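(* Let $\Gamma\subset\mathrm{PSL}(2,\mathbb R)$ be a discrete cocompact subgroup. Let $\phi\in\widetilde M_2(\Gamma;\{i\})$ with $\delta(\phi)=1$, $\omega=\phi'-\phi^2$, let $f_1,\dots,f_d$ be homogeneous modular forms whose classes form a basis of $I/I^2$, and let $N\in\mathbb N^*$ be such that the ring $R$ generated over $\mathbb C$ by $\{D_\phi^j(f_m)\ (0\le j\le N,\ 1\le m\le d)\ ;\ D_\phi^l(\omega)\ (0\le l\le N)\}$ is closed under $D_\phi$. Let $\widetilde R=R[\phi]$, graded by weight. Then in each weight $k$ the $\mathbb C$-vector space $\widetilde R_k$ is finite dimensional, and $\dim\widetilde R_k=O(k^2)$, i.e. the finitely generated ring $\widetilde R$ has the same order of growth as its non-finitely generated subring $\widetilde M_*(\Gamma)$.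
   Context: $\mathcal H$ is the upper half plane and $i=\sqrt{-1}\in\mathcal H$. $M_k(\Gamma)$ is the space of holomorphic modular forms of weight $k$: holomorphic $f$ on $\mathcal H$ with $f(\frac{az+b}{cz+d})=(cz+d)^kf(z)$ for all $\begin{pmatrix}a&b\\c&d\end{pmatrix}\in\Gamma$; $I=\bigoplus_{k>0}M_k(\Gamma)$. A quasimodular form of weight $k$ and depth $\le p$ over $\Gamma$ is a holomorphic $f:\mathcal H\to\mathbb C$ of moderate growth ($|f(z)|=O(((1+|z|^2)/\operatorname{Im} z)^N)$ for some $N$) for which there are functions $f_0,\dots,f_p:\mathcal H\to\mathbb C$ with $(cz+d)^{-k}f(\frac{az+b}{cz+d})=\sum_{j=0}^p f_j(z)\left(\frac{c}{cz+d}\right)^j$ for all $z$ and all $\begin{pmatrix}a&b\\c&d\end{pmatrix}\in\Gamma$; $\widetilde M_*(\Gamma)=\bigoplus_{k\ge0}\widetilde M_k(\Gamma)$ is the graded ring of these. $M_k(\Gamma;\{i\})$ is the space of meromorphic modular forms of weight $k$ over $\Gamma$ without poles outside the $\Gamma$-orbit of $i$. $\phi\in\widetilde M_2(\Gamma;\{i\})$ with $\delta(\phi)=1$ means: $\phi$ is meromorphic on $\mathcal H$ with all poles in the $\Gamma$-orbit of $i$ and $\phi(\frac{az+b}{cz+d})=(cz+d)^2\phi(z)+c(cz+d)$ for all $\begin{pmatrix}a&b\\c&d\end{pmatrix}\in\Gamma$. Then $\omega\in M_4(\Gamma;\{i\})$. $D_\phi:M_k(\Gamma;\{i\})\to M_{k+2}(\Gamma;\{i\})$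 is $D_\phi(f)=f'-k\phi f$, extended additively. In $\widetilde R$, $\phi$ has weight $2$, $D_\phi^j(f_m)$ has weight $k(f_m)+2j$ where $k(f_m)$ is the weight of $f_m$, and $D_\phi^l(\omega)$ has weight $4+2l$. *)

theory Defs
  imports
    "HOL-Complex_Analysis.Complex_Analysis"
    "HOL-Algebra.Coset"
    "HOL-Algebra.Generated_Rings"
    "HOL-Algebra.Ideal_Product"
    "HOL-Library.Function_Algebras"
    "HOL-Library.Landau_Symbols"
begin

section \<open>Discrete cocompact subgroups of PSL(2,R)\<close>

definition uhp :: "complex set" where
  "uhp = {z. Im z > 0}"

definition SL2R :: "(real^2^2) monoid" where
  "SL2R = \<lparr>carrier = {A. det A = 1}, mult = (**), one = mat 1\<rparr>"

definition PSL2R :: "(real^2^2) set monoid" where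
  "PSL2R = SL2R Mod {mat 1, - mat 1}"

text \<open>An element of \<open>PSL2R\<close> is a coset \<open>{A, - A}\<close>, so for a subgroup \<open>\<Gamma>\<close> of \<open>PSL2R\<close> the
  matrices representing its elements are the members of \<open>\<Union>\<Gamma>\<close>.\<close>

definition autj :: "real^2^2 \<Rightarrow> complex \<Rightarrow> complex" where
  "autj A z = of_real (A$2$1) * z + of_real (A$2$2)"

definition moeb :: "real^2^2 \<Rightarrow> complex \<Rightarrow> complex" where
  "moeb A z = (of_real (A$1$1) * z + of_real (A$1$2)) / autj A z"

definition orbit_of :: "(real^2^2) set set \<Rightarrow> complex \<Rightarrow> complex set" where
  "orbit_of \<Gamma> z = (\<lambda>A. moeb A z) ` \<Union>\<Gamma>"

definition quotient_top :: "'a topology \<Rightarrow> ('a \<Rightarrow> 'b) \<Rightarrow> 'b topology" where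
  "quotient_top X q =
     topology (\<lambda>U. U \<subseteq> q ` topspace X \<and> openin X {x \<in> topspace X. q x \<in> U})"

lemma istopology_quotient_top:
  "istopology (\<lambda>U. U \<subseteq> q ` topspace X \<and> openin X {x \<in> topspace X. q x \<in> U})"
proof -
  have "{x \<in> topspace X. q x \<in> S \<inter> T}
      = {x \<in> topspace X. q x \<in> S} \<inter> {x \<in> topspace X. q x \<in> T}" for S T
    by auto
  moreover have "{x \<in> topspace X. q x \<in> \<Union>K} = (\<Union>U\<in>K. {x \<in> topspace X. q x \<in> U})" for K
    by auto
  ultimately show ?thesis
    unfolding istopology_def by (auto intro!: openin_Union)
qed

lemma openin_quotient_top:
  "openin (quotient_top X q) U \<longleftrightarrow>
     U \<subseteq> q ` topspace X \<and> openin X {x \<in> topspace X. q x \<in> U}"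
  unfolding quotient_top_def by (simp add: topology_inverse'[OF istopology_quotient_top])

definition PSL2R_top :: "(real^2^2) set topology" where
  "PSL2R_top = quotient_top (top_of_set (carrier SL2R)) (\<lambda>A. {mat 1, - mat 1} #>\<^bsub>SL2R\<^esub> A)"

definition discrete_cocompact :: "(real^2^2) set set \<Rightarrow> bool" where
  "discrete_cocompact \<Gamma> \<longleftrightarrow>
     subgroup \<Gamma> PSL2R \<and>
     subtopology PSL2R_top \<Gamma> = discrete_topology \<Gamma> \<and>
     compact_space (quotient_top (top_of_set uhp) (orbit_of \<Gamma>))"

section \<open>Algebras of functions\<close>

text \<open>A function on a set \<open>\<Omega>\<close> is represented by its extension by zero to all of \<open>\<complex>\<close>; a
  meromorphic function on \<open>uhp\<close> with poles in a discrete closed set \<open>P\<close> is represented by its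
  restriction to \<open>uhp - P\<close>. With these conventions equality in the rings below is equality
  of functions.\<close>

definition fun_ring :: "complex set \<Rightarrow> (complex \<Rightarrow> complex) ring" where
  "fun_ring \<Omega> =
     \<lparr>carrier = {f. \<forall>z. z \<notin> \<Omega> \<longrightarrow> f z = 0}, mult = (*), one = (\<lambda>z. if z \<in> \<Omega> then 1 else 0),
      zero = 0, add = (+)\<rparr>"

definition restr :: "complex set \<Rightarrow> (complex \<Rightarrow> complex) \<Rightarrow> complex \<Rightarrow> complex" where
  "restr \<Omega> f = (\<lambda>z. if z \<in> \<Omega> then f z else 0)"

lemma cring_fun_ring: "cring (fun_ring \<Omega>)"
proof (rule cringI)
  show "abelian_group (fun_ring \<Omega>)"
  proof (rule abelian_groupI)
    fix f assume "f \<in> carrier (fun_ring \<Omega>)"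
    then show "\<exists>g\<in>carrier (fun_ring \<Omega>). g \<oplus>\<^bsub>fun_ring \<Omega>\<^esub> f = \<zero>\<^bsub>fun_ring \<Omega>\<^esub>"
      by (intro bexI[of _ "- f"]) (auto simp: fun_ring_def)
  qed (auto simp: fun_ring_def fun_eq_iff)
  show "comm_monoid (fun_ring \<Omega>)"
    by (rule comm_monoidI) (auto simp: fun_ring_def fun_eq_iff)
qed (auto simp: fun_ring_def fun_eq_iff algebra_simps)

definition fscale :: "complex \<Rightarrow> (complex \<Rightarrow> complex) \<Rightarrow> complex \<Rightarrow> complex" where
  "fscale c f = (\<lambda>z. c * f z)"

interpretation fvs: vector_space fscale
  by unfold_locales (auto simp: fscale_def fun_eq_iff algebra_simps)

definition fin_dim :: "(complex \<Rightarrow> complex) set \<Rightarrow> bool" where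
  "fin_dim V \<longleftrightarrow> (\<exists>B. finite B \<and> fvs.span B = V)"

definition gen_alg :: "complex set \<Rightarrow> (complex \<Rightarrow> complex) set \<Rightarrow> (complex \<Rightarrow> complex) set" where
  "gen_alg \<Omega> S = generate_ring (fun_ring \<Omega>) (range (\<lambda>c. restr \<Omega> (\<lambda>_. c)) \<union> S)"

definition fin_gen_alg :: "complex set \<Rightarrow> (complex \<Rightarrow> complex) set \<Rightarrow> bool" where
  "fin_gen_alg \<Omega> A \<longleftrightarrow> (\<exists>S. finite S \<and> S \<subseteq> carrier (fun_ring \<Omega>) \<and> A = gen_alg \<Omega> S)"

text \<open>Monomials in a set \<open>G\<close> of weighted generators \<open>(weight, function)\<close>, with their weights.\<close>

inductive_set wt_monom ::
    "complex set \<Rightarrow> (nat \<times> (complex \<Rightarrow> complex)) set \<Rightarrow> (nat \<times> (complex \<Rightarrow> complex)) set"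
  for \<Omega> G where
  one: "(0, \<one>\<^bsub>fun_ring \<Omega>\<^esub>) \<in> wt_monom \<Omega> G"
| mult: "(w, g) \<in> G \<Longrightarrow> (k, m) \<in> wt_monom \<Omega> G \<Longrightarrow> (w + k, g \<otimes>\<^bsub>fun_ring \<Omega>\<^esub> m) \<in> wt_monom \<Omega> G"

section \<open>Modular and quasimodular forms\<close>

definition mod_forms :: "(real^2^2) set set \<Rightarrow> nat \<Rightarrow> (complex \<Rightarrow> complex) set" where
  "mod_forms \<Gamma> k =
     {f \<in> carrier (fun_ring uhp). f holomorphic_on uhp \<and>
        (\<forall>A\<in>\<Union>\<Gamma>. \<forall>z\<in>uhp. f (moeb A z) = autj A z ^ k * f z)}"

definition pos_ideal :: "(real^2^2) set set \<Rightarrow> (complex \<Rightarrow> complex) set" where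
  "pos_ideal \<Gamma> = fvs.span (\<Union>k\<in>{1..}. mod_forms \<Gamma> k)"

definition moderate_growth :: "(complex \<Rightarrow> complex) \<Rightarrow> bool" where
  "moderate_growth f \<longleftrightarrow>
     (\<exists>(N::nat) C. \<forall>z\<in>uhp. norm (f z) \<le> C * ((1 + (norm z)\<^sup>2) / Im z) ^ N)"

definition quasi_forms_depth ::
    "(real^2^2) set set \<Rightarrow> nat \<Rightarrow> nat \<Rightarrow> (complex \<Rightarrow> complex) set" where
  "quasi_forms_depth \<Gamma> k p =
     {f \<in> carrier (fun_ring uhp). f holomorphic_on uhp \<and> moderate_growth f \<and>
        (\<exists>F :: nat \<Rightarrow> complex \<Rightarrow> complex. \<forall>A\<in>\<Union>\<Gamma>. \<forall>z\<in>uhp.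
           f (moeb A z) / autj A z ^ k = (\<Sum>j\<le>p. F j z * (of_real (A$2$1) / autj A z) ^ j))}"

definition quasi_forms :: "(real^2^2) set set \<Rightarrow> nat \<Rightarrow> (complex \<Rightarrow> complex) set" where
  "quasi_forms \<Gamma> k = (\<Union>p. quasi_forms_depth \<Gamma> k p)"

definition quasi_ring :: "(real^2^2) set set \<Rightarrow> (complex \<Rightarrow> complex) set" where
  "quasi_ring \<Gamma> = fvs.span (\<Union>k. quasi_forms \<Gamma> k)"

definition Om :: "(real^2^2) set set \<Rightarrow> complex set" where
  "Om \<Gamma> = uhp - orbit_of \<Gamma> \<i>"

text \<open>\<open>meromorphic_on\<close> does not depend on the values at the points of the orbit of \<open>\<i>\<close>,
  where the representatives below are set to zero.\<close>

definition mero_i :: "(real^2^2) set set \<Rightarrow> (complex \<Rightarrow> complex) set" where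
  "mero_i \<Gamma> =
     {f \<in> carrier (fun_ring (Om \<Gamma>)). f meromorphic_on uhp \<and> f holomorphic_on Om \<Gamma>}"

definition mod_forms_i :: "(real^2^2) set set \<Rightarrow> int \<Rightarrow> (complex \<Rightarrow> complex) set" where
  "mod_forms_i \<Gamma> k =
     {f \<in> mero_i \<Gamma>. \<forall>A\<in>\<Union>\<Gamma>. \<forall>z\<in>Om \<Gamma>. f (moeb A z) = autj A z powi k * f z}"

text \<open>The elements \<open>\<phi>\<close> of weight 2 with \<open>\<delta>(\<phi>) = 1\<close>.\<close>

definition quasi_forms2_i_delta1 :: "(real^2^2) set set \<Rightarrow> (complex \<Rightarrow> complex) set" where
  "quasi_forms2_i_delta1 \<Gamma> =
     {\<phi> \<in> mero_i \<Gamma>. \<forall>A\<in>\<Union>\<Gamma>. \<forall>z\<in>Om \<Gamma>.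
        \<phi> (moeb A z) = autj A z ^ 2 * \<phi> z + of_real (A$2$1) * autj A z}"

section \<open>The rings \<open>R\<close> and \<open>R[\<phi>]\<close>\<close>

definition omega :: "(real^2^2) set set \<Rightarrow> (complex \<Rightarrow> complex) \<Rightarrow> complex \<Rightarrow> complex" where
  "omega \<Gamma> \<phi> = restr (Om \<Gamma>) (\<lambda>z. deriv \<phi> z - (\<phi> z)\<^sup>2)"

definition Dphi ::
    "(real^2^2) set set \<Rightarrow> (complex \<Rightarrow> complex) \<Rightarrow> int \<Rightarrow> (complex \<Rightarrow> complex) \<Rightarrow> complex \<Rightarrow> complex"
  where "Dphi \<Gamma> \<phi> k f = restr (Om \<Gamma>) (\<lambda>z. deriv f z - of_int k * \<phi> z * f z)"

text \<open>\<open>Dphi_iter \<Gamma> \<phi> k j f\<close> is the \<open>j\<close>-th iterate of \<open>D\<^sub>\<phi>\<close> on \<open>f\<close> of weight \<open>k\<close>.\<close>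

fun Dphi_iter ::
    "(real^2^2) set set \<Rightarrow> (complex \<Rightarrow> complex) \<Rightarrow> nat \<Rightarrow> nat \<Rightarrow> (complex \<Rightarrow> complex) \<Rightarrow> complex \<Rightarrow> complex"
  where
  "Dphi_iter \<Gamma> \<phi> k 0 f = f"
| "Dphi_iter \<Gamma> \<phi> k (Suc j) f = Dphi \<Gamma> \<phi> (int (k + 2 * j)) (Dphi_iter \<Gamma> \<phi> k j f)"

text \<open>Closure under the additive extension of \<open>D\<^sub>\<phi>\<close> to sums of forms of various weights.\<close>

definition closed_Dphi ::
    "(real^2^2) set set \<Rightarrow> (complex \<Rightarrow> complex) \<Rightarrow> (complex \<Rightarrow> complex) set \<Rightarrow> bool" where
  "closed_Dphi \<Gamma> \<phi> A \<longleftrightarrow>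
     (\<forall>(K :: int set) g. finite K \<longrightarrow> (\<forall>k\<in>K. g k \<in> mod_forms_i \<Gamma> k) \<longrightarrow>
        (\<Sum>k\<in>K. g k) \<in> A \<longrightarrow> (\<Sum>k\<in>K. Dphi \<Gamma> \<phi> k (g k)) \<in> A)"

definition R_gens ::
    "(real^2^2) set set \<Rightarrow> (complex \<Rightarrow> complex) \<Rightarrow> nat \<Rightarrow> nat \<Rightarrow> (nat \<Rightarrow> nat) \<Rightarrow>
      (nat \<Rightarrow> complex \<Rightarrow> complex) \<Rightarrow> (nat \<times> (complex \<Rightarrow> complex)) set" where
  "R_gens \<Gamma> \<phi> N d wt f =
     {(wt m + 2 * j, Dphi_iter \<Gamma> \<phi> (wt m) j (restr (Om \<Gamma>) (f m))) | j m. j \<le> N \<and> m \<in> {1..d}} \<union>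
     {(4 + 2 * l, Dphi_iter \<Gamma> \<phi> 4 l (omega \<Gamma> \<phi>)) | l. l \<le> N}"

definition R_ring ::
    "(real^2^2) set set \<Rightarrow> (complex \<Rightarrow> complex) \<Rightarrow> nat \<Rightarrow> nat \<Rightarrow> (nat \<Rightarrow> nat) \<Rightarrow>
      (nat \<Rightarrow> complex \<Rightarrow> complex) \<Rightarrow> (complex \<Rightarrow> complex) set" where
  "R_ring \<Gamma> \<phi> N d wt f = gen_alg (Om \<Gamma>) (snd ` R_gens \<Gamma> \<phi> N d wt f)"

definition Rt_ring ::
    "(real^2^2) set set \<Rightarrow> (complex \<Rightarrow> complex) \<Rightarrow> nat \<Rightarrow> nat \<Rightarrow> (nat \<Rightarrow> nat) \<Rightarrow>
      (nat \<Rightarrow> complex \<Rightarrow> complex) \<Rightarrow> (complex \<Rightarrow> complex) set" where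
  "Rt_ring \<Gamma> \<phi> N d wt f = generate_ring (fun_ring (Om \<Gamma>)) (R_ring \<Gamma> \<phi> N d wt f \<union> {\<phi>})"

definition Rt_wt ::
    "(real^2^2) set set \<Rightarrow> (complex \<Rightarrow> complex) \<Rightarrow> nat \<Rightarrow> nat \<Rightarrow> (nat \<Rightarrow> nat) \<Rightarrow>
      (nat \<Rightarrow> complex \<Rightarrow> complex) \<Rightarrow> nat \<Rightarrow> (complex \<Rightarrow> complex) set" where
  "Rt_wt \<Gamma> \<phi> N d wt f k =
     fvs.span {g. (k, g) \<in> wt_monom (Om \<Gamma>) (insert (2, \<phi>) (R_gens \<Gamma> \<phi> N d wt f))}"

text \<open>The classes of \<open>f 1, \<dots>, f d\<close> form a basis of \<open>I/J\<close>.\<close>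

definition quotient_basis ::
    "(complex \<Rightarrow> complex) set \<Rightarrow> (complex \<Rightarrow> complex) set \<Rightarrow> nat \<Rightarrow>
      (nat \<Rightarrow> complex \<Rightarrow> complex) \<Rightarrow> bool" where
  "quotient_basis I J d f \<longleftrightarrow>
     (\<forall>m\<in>{1..d}. f m \<in> I) \<and>
     (\<forall>c. (\<Sum>m=1..d. fscale (c m) (f m)) \<in> J \<longrightarrow> (\<forall>m\<in>{1..d}. c m = 0)) \<and>
     (\<forall>g\<in>I. \<exists>c. g - (\<Sum>m=1..d. fscale (c m) (f m)) \<in> J)"

end

theory Submission
  imports Defs
begin

text \<open>The argument rests on a few facts about \<open>\<Gamma>\<close>.  The automorphy factors are independent
  (\<open>automorphy_unique\<close>): a finite sum of functions \<open>(c z + d)\<^sup>k Q\<^sub>k(c / (c z + d))\<close> on the group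
  determines the polynomials \<open>Q\<^sub>k\<close>, since the bottom rows \<open>(c, d)\<close> are unbounded in infinitely many
  directions.  There is no holomorphic form of weight 2 with \<open>\<delta> = 1\<close> (\<open>no_holomorphic_weight2\<close>), because a
  \<open>\<Gamma>\<close>-invariant mean over \<open>SL(2, \<real>)\<close>, which exists by cocompactness, would average it to a holomorphic function with
  the same transformation law under all of \<open>SL(2, \<real>)\<close>.  Schwarz's lemma on a compact fundamental set bounds the vanishing order of a form of weight \<open>k\<close> by a
  multiple of \<open>k\<close> (\<open>vanishing_order_bound\<close>), and Poincare series give a nonzero form of positive weight
  (\<open>exists_mod_form\<close>).

  From these one gets the structure of quasimodular forms.  The coefficients of a quasimodular form transform
  among themselves; the leading one is a modular form of weight \<open>k - 2 p\<close>, whence \<open>2 p < k\<close> for depth \<open>p > 0\<close>, the case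
  \<open>2 p = k\<close> being excluded by the absence of a holomorphic \<open>\<phi>\<close>.  Subtracting derivatives of modular forms
  shows that quasimodular forms are sums of derivatives of modular forms (\<open>quasi_form_decomposition\<close>).

  The ring \<open>R[\<phi>]\<close> contains the modular forms, since the \<open>f m\<close> generate \<open>I\<close> modulo \<open>I\<^sup>2\<close>, and is closed under
  differentiation, since \<open>f' = D\<^sub>\<phi> f + k \<phi> f\<close> and \<open>\<phi>' = \<omega> + \<phi>\<^sup>2\<close>; so it contains all quasimodular
  forms (\<open>quasi_forms_Rt\<close>).  Its part of weight \<open>k\<close> is spanned by products \<open>\<phi>\<^sup>j g\<close> with \<open>g\<close> a
  meromorphic modular form of weight \<open>k - 2 j\<close> whose pole at \<open>\<i>\<close> has order \<open>O(k)\<close>; such \<open>g\<close> form a space of dimension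
  \<open>O(k)\<close>, so the dimension is \<open>O(k\<^sup>2)\<close> (\<open>Rt_bound\<close>).  In even weights the quasimodular forms already
  reach this order (\<open>quasi_dim_lower\<close>): two independent forms \<open>P\<close>, \<open>Q\<close> of equal weight and \<open>P'\<close> are algebraically
  independent.  In odd weights everything vanishes because \<open>-1\<close> acts by \<open>-1\<close>.  Finally the ring of quasimodular
  forms cannot be generated by finitely many elements (\<open>quasi_ring_not_fin_gen\<close>): generators satisfy \<open>2 p < k\<close> with a uniform
  gap, but derivatives of high order close the gap.\<close>


no_notation fps_nth (infixl "$" 75)
hide_const (open) up_ring.coeff up_ring.monom module.smult

section \<open>Matrices acting on the upper half plane\<close>

lemma matrix_mult_entries:
  fixes A B :: "real^2^2"
  shows "(A ** B)$1$1 = A$1$1 * B$1$1 + A$1$2 * B$2$1"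
    "(A ** B)$1$2 = A$1$1 * B$1$2 + A$1$2 * B$2$2"
    "(A ** B)$2$1 = A$2$1 * B$1$1 + A$2$2 * B$2$1"
    "(A ** B)$2$2 = A$2$1 * B$1$2 + A$2$2 * B$2$2"
  by (simp_all add: matrix_matrix_mult_def sum_2)

lemma matrix_eq_entries:
  fixes A B :: "real^2^2"
  shows "A = B \<longleftrightarrow> A$1$1 = B$1$1 \<and> A$1$2 = B$1$2 \<and> A$2$1 = B$2$1 \<and> A$2$2 = B$2$2"
proof -
  have 1: "A = B \<longleftrightarrow> A $ 1 = B $ 1 \<and> A $ 2 = B $ 2"
    by (subst vec_eq_iff) (rule forall_2)
  have 2: "v = w \<longleftrightarrow> v $ 1 = w $ 1 \<and> v $ 2 = w $ 2" for v w :: "real^2"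
    by (subst vec_eq_iff) (rule forall_2)
  show ?thesis unfolding 1 2 by (rule conj_assoc)
qed

lemma mat_1_entries:
  "(mat 1 :: real^2^2)$1$1 = 1" "(mat 1 :: real^2^2)$1$2 = 0"
  "(mat 1 :: real^2^2)$2$1 = 0" "(mat 1 :: real^2^2)$2$2 = 1"
  by (simp_all add: mat_def)

definition frob :: "real^2^2 \<Rightarrow> real" where
  "frob A = (A$1$1)\<^sup>2 + (A$1$2)\<^sup>2 + (A$2$1)\<^sup>2 + (A$2$2)\<^sup>2"

lemma uhp_iff [simp]: "z \<in> uhp \<longleftrightarrow> Im z > 0"
  by (simp add: uhp_def)

lemma open_uhp [simp]: "open uhp"
  unfolding uhp_def by (rule open_halfspace_Im_gt)

lemma connected_uhp [simp]: "connected uhp"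
  unfolding uhp_def by (intro convex_connected convex_halfspace_Im_gt)

lemma autj_nonzero:
  assumes "det A = 1" "Im z > 0"
  shows "autj A z \<noteq> 0"
proof
  assume *: "autj A z = 0"
  then have "Im (autj A z) = 0" by simp
  then have "A$2$1 = 0" using assms by (auto simp: autj_def)
  with * assms show False by (auto simp: autj_def det_2)
qed

lemma autj_mult:
  assumes "det B = 1" "Im z > 0"
  shows "autj (A ** B) z = autj A (moeb B z) * autj B z"
  using autj_nonzero[OF assms]
  by (simp add: autj_def moeb_def matrix_mult_entries field_simps)

lemma moeb_mult:
  assumes "det A = 1" "det B = 1" "Im z > 0" "Im (moeb B z) > 0"
  shows "moeb (A ** B) z = moeb A (moeb B z)"
proof -
  have 1: "autj B z \<noteq> 0" "autj A (moeb B z) \<noteq> 0" using autj_nonzero assms by auto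
  have "moeb (A ** B) z = (of_real ((A ** B)$1$1) * z + of_real ((A ** B)$1$2)) / (autj A (moeb B z) * autj B z)"
    using autj_mult assms by (simp add: moeb_def)
  also have "of_real ((A ** B)$1$1) * z + of_real ((A ** B)$1$2)
      = (of_real (A$1$1) * moeb B z + of_real (A$1$2)) * autj B z"
    using 1(1) by (simp add: moeb_def[of B] matrix_mult_entries field_simps) (simp add: autj_def algebra_simps)
  finally show ?thesis using 1 by (simp add: moeb_def[of A])
qed

lemma Im_moeb:
  assumes "det A = 1"
  shows "Im (moeb A z) = Im z / (norm (autj A z))\<^sup>2"
proof -
  have "Im (moeb A z) = Im ((of_real (A$1$1) * z + of_real (A$1$2)) * cnj (autj A z)) / (norm (autj A z))\<^sup>2"
    unfolding moeb_def complex_div_cnj[of _ "autj A z"] by (simp only: Im_divide_of_real)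
  also have "Im ((of_real (A$1$1) * z + of_real (A$1$2)) * cnj (autj A z)) = Im z * (A$1$1 * A$2$2 - A$1$2 * A$2$1)"
    by (simp add: autj_def algebra_simps)
  finally show ?thesis using assms by (simp add: det_2)
qed

lemma Im_moeb_pos:
  assumes "det A = 1" "Im z > 0"
  shows "Im (moeb A z) > 0"
  using Im_moeb[OF assms(1)] autj_nonzero[OF assms] assms by simp

text \<open>The quantity \<open>c / (c z + d)\<close> is a cocycle for the weight 2 action; it governs everything
  quasimodular.\<close>

lemma autj_cocycle:
  assumes "det A = 1" "det B = 1" "Im z > 0"
  shows "of_real ((A ** B)$2$1) / autj (A ** B) z
    = of_real (A$2$1) / autj A (moeb B z) / (autj B z)\<^sup>2 + of_real (B$2$1) / autj B z"
proof -
  have 1: "autj B z \<noteq> 0" "autj A (moeb B z) \<noteq> 0" using autj_nonzero Im_moeb_pos assms by auto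
  have 2: "autj A (moeb B z) * autj B z =
      of_real (A$2$1) * (of_real (B$1$1) * z + of_real (B$1$2)) + of_real (A$2$2) * autj B z"
    using 1 by (simp add: autj_def[of A] moeb_def field_simps)
  have 3: "of_real (B$1$1) * autj B z - of_real (B$2$1) * (of_real (B$1$1) * z + of_real (B$1$2)) = 1"
  proof -
    have "of_real (B$1$1) * autj B z - of_real (B$2$1) * (of_real (B$1$1) * z + of_real (B$1$2)) = of_real (det B)"
      by (simp add: autj_def det_2 algebra_simps)
    then show ?thesis using assms by simp
  qed
  have "of_real ((A ** B)$2$1) * autj B z
      = of_real (A$2$1) * (1 + of_real (B$2$1) * (of_real (B$1$1) * z + of_real (B$1$2)))
        + of_real (A$2$2) * of_real (B$2$1) * autj B z"
  proof -
    have "of_real (B$1$1) * autj B z = 1 + of_real (B$2$1) * (of_real (B$1$1) * z + of_real (B$1$2))"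
      using 3 by (simp add: algebra_simps)
    moreover have "of_real ((A ** B)$2$1) * autj B z
        = of_real (A$2$1) * (of_real (B$1$1) * autj B z) + of_real (A$2$2) * of_real (B$2$1) * autj B z"
      by (simp add: matrix_mult_entries algebra_simps)
    ultimately show ?thesis by simp
  qed
  also have "\<dots> = of_real (A$2$1) + of_real (B$2$1) * (autj A (moeb B z) * autj B z)"
    unfolding 2 by (simp add: algebra_simps)
  finally have 4: "of_real ((A ** B)$2$1) * autj B z
      = of_real (A$2$1) + of_real (B$2$1) * (autj A (moeb B z) * autj B z)" .
  show ?thesis unfolding autj_mult[OF assms(2,3)]
    using 1 4 by (simp add: field_simps power2_eq_square)
qed

lemma moeb_1 [simp]: "moeb (mat 1) z = z" and autj_1 [simp]: "autj (mat 1) z = 1"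
  by (simp_all add: moeb_def autj_def mat_1_entries)

lemma autj_neg1: "autj (- mat 1) z = -1" and moeb_neg1: "moeb (- mat 1) z = z"
  by (simp_all add: moeb_def autj_def mat_1_entries)

lemma autj_has_deriv: "(autj A has_field_derivative of_real (A$2$1)) (at z within S)"
  unfolding autj_def[abs_def] by (auto intro!: derivative_eq_intros)

lemma moeb_has_deriv:
  assumes "det A = 1" "Im z > 0"
  shows "(moeb A has_field_derivative 1 / (autj A z)\<^sup>2) (at z within S)"
proof -
  have nz: "autj A z \<noteq> 0" by (rule autj_nonzero[OF assms])
  have e: "(of_real (A$1$1) * autj A z - (of_real (A$1$1) * z + of_real (A$1$2)) * of_real (A$2$1)) = (1::complex)"
  proof -
    have "(of_real (A$1$1) * autj A z - (of_real (A$1$1) * z + of_real (A$1$2)) * of_real (A$2$1)) = complex_of_real (det A)"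
      by (simp add: autj_def det_2 algebra_simps)
    then show ?thesis using assms by simp
  qed
  show ?thesis unfolding moeb_def[abs_def]
    by (rule derivative_eq_intros autj_has_deriv refl nz | simp add: e power2_eq_square del: of_real_mult)+
qed

lemma holomorphic_autj [holomorphic_intros]: "autj A holomorphic_on S"
  unfolding autj_def[abs_def] by (intro holomorphic_intros)

lemma holomorphic_moeb:
  assumes "det A = 1" "S \<subseteq> uhp"
  shows "moeb A holomorphic_on S"
  using moeb_has_deriv[OF assms(1)] assms(2) unfolding holomorphic_on_def field_differentiable_def
  by (meson subsetD uhp_iff)

section \<open>Discreteness and cocompactness\<close>

lemma group_SL2R: "group SL2R"
proof (rule groupI)
  fix A :: "real^2^2" assume "A \<in> carrier SL2R"
  then have d: "det A = 1" by (simp add: SL2R_def)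
  then have "invertible A" by (simp add: invertible_det_nz)
  then obtain B where "B ** A = mat 1" by (auto simp: invertible_def)
  then show "\<exists>B\<in>carrier SL2R. B \<otimes>\<^bsub>SL2R\<^esub> A = \<one>\<^bsub>SL2R\<^esub>"
    using d det_mul[of B A] by (intro bexI[of _ B]) (auto simp: SL2R_def)
qed (auto simp: SL2R_def det_mul matrix_mul_assoc)

lemma det_minus_mat_1: "det (- mat 1 :: real^2^2) = 1"
  by (simp add: det_2 mat_1_entries)

lemma neg1_mult: "(- mat 1 :: real^2^2) ** A = - A" "A ** (- mat 1 :: real^2^2) = - A"
  by (auto simp: matrix_eq_entries matrix_mult_entries mat_1_entries)

lemma normal_pm1: "{mat 1, - mat 1} \<lhd> SL2R"
proof -
  interpret group SL2R by (rule group_SL2R)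
  have inv1: "inv\<^bsub>SL2R\<^esub> (mat 1) = mat 1" using inv_one by (simp add: SL2R_def)
  have inv2: "inv\<^bsub>SL2R\<^esub> (- mat 1) = - mat 1"
    by (rule inv_equality) (auto simp: SL2R_def neg1_mult det_minus_mat_1)
  have "subgroup {mat 1, - mat 1} SL2R"
  proof (rule subgroupI)
    show "{mat 1, - mat 1} \<subseteq> carrier SL2R" using det_minus_mat_1 by (auto simp: SL2R_def)
  next
    fix a :: "real^2^2" assume "a \<in> {mat 1, - mat 1}"
    then show "inv\<^bsub>SL2R\<^esub> a \<in> {mat 1, - mat 1}" using inv1 inv2 by auto
  next
    fix a b :: "real^2^2" assume "a \<in> {mat 1, - mat 1}" "b \<in> {mat 1, - mat 1}"
    then show "a \<otimes>\<^bsub>SL2R\<^esub> b \<in> {mat 1, - mat 1}" by (auto simp: SL2R_def neg1_mult)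
  qed auto
  then show ?thesis
    by (rule normalI) (auto simp: r_coset_def l_coset_def SL2R_def neg1_mult)
qed

lemma coset_pm1: "{mat 1, - mat 1} #>\<^bsub>SL2R\<^esub> A = {A, - A}"
  by (auto simp: r_coset_def SL2R_def neg1_mult)

lemma group_PSL2R: "group PSL2R"
  unfolding PSL2R_def by (rule normal.factorgroup_is_group[OF normal_pm1])

locale cocompact_group =
  fixes \<Gamma> :: "(real^2^2) set set"
  assumes dc: "discrete_cocompact \<Gamma>"
begin

definition G where "G = \<Union>\<Gamma>"

lemma subgroup: "subgroup \<Gamma> PSL2R"
  using dc by (simp add: discrete_cocompact_def)

lemma orbit_of_eq: "orbit_of \<Gamma> z = (\<lambda>A. moeb A z) ` G"
  by (simp add: orbit_of_def G_def)

lemma memE: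
  assumes "S \<in> \<Gamma>" obtains A where "S = {A, - A}" "det A = 1"
proof -
  have "S \<in> carrier PSL2R" using assms subgroup.subset[OF subgroup] by auto
  then obtain A where "A \<in> carrier SL2R" "S = {A, - A}"
    by (auto simp: PSL2R_def FactGroup_def RCOSETS_def coset_pm1)
  then show thesis using that by (auto simp: SL2R_def)
qed

lemma det_neg: "det (- A :: real^2^2) = det A"
  by (simp add: det_2)

lemma G_det: "A \<in> G \<Longrightarrow> det A = 1"
  unfolding G_def by (auto elim!: memE simp: det_neg)

lemma coset_in: "A \<in> G \<Longrightarrow> {A, - A} \<in> \<Gamma>"
proof -
  assume "A \<in> G"
  then obtain S where S: "S \<in> \<Gamma>" "A \<in> S" by (auto simp: G_def)
  then obtain B where "S = {B, - B}" by (elim memE)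
  then have "S = {A, - A}" using S by auto
  then show ?thesis using S by simp
qed

lemma G_neg: "A \<in> G \<Longrightarrow> - A \<in> G"
  using coset_in by (auto simp: G_def)

lemma G_one: "mat 1 \<in> G"
  using subgroup.one_closed[OF subgroup] by (auto simp: PSL2R_def FactGroup_def G_def)

lemma G_neg1: "- mat 1 \<in> G"
  using G_neg[OF G_one] .

lemma G_mult: "A \<in> G \<Longrightarrow> B \<in> G \<Longrightarrow> A ** B \<in> G"
proof -
  assume "A \<in> G" "B \<in> G"
  then obtain S T where ST: "S \<in> \<Gamma>" "A \<in> S" "T \<in> \<Gamma>" "B \<in> T" by (auto simp: G_def)
  then have "S \<otimes>\<^bsub>PSL2R\<^esub> T \<in> \<Gamma>" using subgroup.m_closed[OF subgroup] by auto
  moreover have "A ** B \<in> S \<otimes>\<^bsub>PSL2R\<^esub> T" using ST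
    by (auto simp: PSL2R_def FactGroup_def set_mult_def SL2R_def)
  ultimately show ?thesis unfolding G_def by blast
qed

lemma G_inv:
  assumes "A \<in> G" obtains B where "B \<in> G" "A ** B = mat 1" "B ** A = mat 1"
proof -
  from assms obtain S where S: "S \<in> \<Gamma>" "A \<in> S" by (auto simp: G_def)
  have Si: "inv\<^bsub>PSL2R\<^esub> S \<in> \<Gamma>" using subgroup.m_inv_closed[OF subgroup S(1)] .
  then obtain B where B: "B \<in> inv\<^bsub>PSL2R\<^esub> S" by (elim memE) auto
  have "S \<otimes>\<^bsub>PSL2R\<^esub> inv\<^bsub>PSL2R\<^esub> S = \<one>\<^bsub>PSL2R\<^esub>"
    using group.r_inv[OF group_PSL2R] subgroup.subset[OF subgroup] S by auto
  then have "A ** B \<in> {mat 1, - mat 1}" using S B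
    by (auto simp: PSL2R_def FactGroup_def set_mult_def SL2R_def)
  moreover have "- B \<in> G" "B \<in> G" using Si B G_neg by (auto simp: G_def)
  moreover have "A ** (- B) = - (A ** B)"
    by (auto simp: matrix_eq_entries matrix_mult_entries)
  ultimately obtain C where C: "C \<in> G" "A ** C = mat 1" by (metis add.inverse_inverse insertE singletonD)
  moreover from C have "C ** A = mat 1" by (simp add: matrix_left_right_inverse)
  ultimately show thesis using that by blast
qed

lemma right_mult_bij: assumes "B \<in> G" shows "bij_betw (\<lambda>A. A ** B) G G"
proof -
  obtain C where C: "C \<in> G" "B ** C = mat 1" "C ** B = mat 1" using G_inv assms by blast
  show ?thesis
    by (rule bij_betwI[of _ _ _ "\<lambda>A. A ** C"]) (use C assms G_mult in \<open>auto simp: matrix_mul_assoc[symmetric]\<close>)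
qed

lemma discrete:
  obtains e where "e > 0"
    "\<And>A. A \<in> G \<Longrightarrow> \<bar>A$1$1 - 1\<bar> < e \<Longrightarrow> \<bar>A$1$2\<bar> < e \<Longrightarrow> \<bar>A$2$1\<bar> < e \<Longrightarrow> \<bar>A$2$2 - 1\<bar> < e \<Longrightarrow> A = mat 1"
proof -
  let ?N = "{mat 1, - mat 1} :: (real^2^2) set"
  have N: "?N \<in> \<Gamma>" using coset_in[OF G_one] by simp
  have "openin (subtopology PSL2R_top \<Gamma>) {?N}"
    using dc N by (simp add: discrete_cocompact_def)
  then obtain U where U: "openin PSL2R_top U" "{?N} = U \<inter> \<Gamma>"
    unfolding openin_subtopology by blast
  from U(1) have "openin (top_of_set (carrier SL2R)) {A \<in> carrier SL2R. {A, - A} \<in> U}"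
    by (simp add: PSL2R_top_def openin_quotient_top coset_pm1)
  then obtain T where T: "open T" "{A \<in> carrier SL2R. {A, - A} \<in> U} = carrier SL2R \<inter> T"
    unfolding openin_open by blast
  have "mat 1 \<in> carrier SL2R" by (simp add: SL2R_def)
  moreover have "?N \<in> U" using U(2) by blast
  ultimately have "mat 1 \<in> T" using T(2) by blast
  then obtain e where e: "e > 0" "ball (mat 1) e \<subseteq> T" using T(1) open_contains_ball by blast
  show thesis
  proof (rule that[of "min 1 (e/4)"])
    show "min 1 (e/4) > 0" using e by simp
    fix A assume A: "A \<in> G" and l: "\<bar>A$1$1 - 1\<bar> < min 1 (e/4)" "\<bar>A$1$2\<bar> < min 1 (e/4)" "\<bar>A$2$1\<bar> < min 1 (e/4)" "\<bar>A$2$2 - 1\<bar> < min 1 (e/4)"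
    have "norm (A - mat 1) \<le> (\<Sum>i\<in>UNIV. norm ((A - mat 1)$i))" unfolding norm_vec_def by (rule L2_set_le_sum) simp
    also have "\<dots> \<le> (\<Sum>i\<in>UNIV. \<Sum>j\<in>UNIV. \<bar>(A - mat 1)$i$j\<bar>)"
      by (intro sum_mono norm_le_l1_cart)
    also have "\<dots> = \<bar>A$1$1 - 1\<bar> + \<bar>A$1$2\<bar> + (\<bar>A$2$1\<bar> + \<bar>A$2$2 - 1\<bar>)"
      by (simp add: sum_2 mat_1_entries)
    also have "\<dots> < e" using l by linarith
    finally have "A \<in> T" using e(2) by (simp add: subset_iff dist_norm norm_minus_commute)
    moreover have "A \<in> carrier SL2R" using G_det[OF A] by (simp add: SL2R_def)
    ultimately have "{A, - A} \<in> U" using T(2) by blast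
    then have "{A, - A} \<in> {?N}" unfolding U(2) using coset_in[OF A] by (rule IntI)
    then have "{A, - A} = ?N" by (simp only: singleton_iff)
    then have "A = mat 1 \<or> A = - mat 1" unfolding doubleton_eq_iff by blast
    moreover have "A \<noteq> - mat 1"
    proof
      assume "A = - mat 1"
      then have "A$1$1 = -1" by (simp add: mat_1_entries)
      with l(1) show False by simp
    qed
    ultimately show "A = mat 1" by blast
  qed
qed

end

lemma inverse_entries:
  fixes A C :: "real^2^2"
  assumes "C ** A = mat 1" "det A = 1"
  shows "C$1$1 = A$2$2" "C$1$2 = - A$1$2" "C$2$1 = - A$2$1" "C$2$2 = A$1$1"
proof -
  have e: "C$1$1 * A$1$1 + C$1$2 * A$2$1 = 1" "C$1$1 * A$1$2 + C$1$2 * A$2$2 = 0"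
    "C$2$1 * A$1$1 + C$2$2 * A$2$1 = 0" "C$2$1 * A$1$2 + C$2$2 * A$2$2 = 1"
    using assms(1) by (simp_all add: matrix_eq_entries matrix_mult_entries mat_1_entries)
  have d: "A$1$1 * A$2$2 - A$1$2 * A$2$1 = 1" using assms(2) by (simp add: det_2)
  have adj: "p = u * A$2$2 - v * A$2$1 \<and> q = v * A$1$1 - u * A$1$2"
    if "p * A$1$1 + q * A$2$1 = u" "p * A$1$2 + q * A$2$2 = v" for p q u v
  proof -
    have "p = p * (A$1$1 * A$2$2 - A$1$2 * A$2$1)" "q = q * (A$1$1 * A$2$2 - A$1$2 * A$2$1)" using d by simp_all
    then show ?thesis unfolding that[symmetric] by (simp add: algebra_simps)
  qed
  show "C$1$1 = A$2$2" "C$1$2 = - A$1$2" "C$2$1 = - A$2$1" "C$2$2 = A$1$1"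
    using adj[OF e(1,2)] adj[OF e(3,4)] by simp_all
qed

lemma frob_entries:
  assumes "frob A \<le> T\<^sup>2" "T \<ge> 0"
  shows "\<bar>A$1$1\<bar> \<le> T" "\<bar>A$1$2\<bar> \<le> T" "\<bar>A$2$1\<bar> \<le> T" "\<bar>A$2$2\<bar> \<le> T"
proof -
  have "(A$1$1)\<^sup>2 \<le> T\<^sup>2" "(A$1$2)\<^sup>2 \<le> T\<^sup>2" "(A$2$1)\<^sup>2 \<le> T\<^sup>2" "(A$2$2)\<^sup>2 \<le> T\<^sup>2"
    using assms(1) unfolding frob_def by (smt (verit) zero_le_power2)+
  then show "\<bar>A$1$1\<bar> \<le> T" "\<bar>A$1$2\<bar> \<le> T" "\<bar>A$2$1\<bar> \<le> T" "\<bar>A$2$2\<bar> \<le> T"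
    using assms(2) by (simp_all add: abs_le_square_iff[symmetric])
qed

lemma frob_ge_2: "det A = 1 \<Longrightarrow> frob A \<ge> 2"
proof -
  assume "det A = 1"
  then have "frob A - 2 = (A$1$1 - A$2$2)\<^sup>2 + (A$1$2 + A$2$1)\<^sup>2"
    by (simp add: frob_def det_2 power2_eq_square algebra_simps)
  then show ?thesis by (smt (verit) zero_le_power2)
qed

lemma card_int_box:
  fixes g :: "'a \<Rightarrow> int \<times> int \<times> int \<times> int"
  assumes "inj_on g S" "g ` S \<subseteq> {-M..M} \<times> {-M..M} \<times> {-M..M} \<times> {-M..M}" "M \<ge> 0"
  shows "finite S \<and> real (card S) \<le> (2 * of_int M + 1) ^ 4"
proof -
  let ?B = "{-M..M} \<times> {-M..M} \<times> {-M..M} \<times> {-M..M}"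
  have f: "finite ?B" by simp
  have "card S \<le> card ?B" using card_inj_on_le[OF assms(1,2) f] .
  also have "card ?B = nat (2 * M + 1) ^ 4"
    using assms(3) by (simp add: card_cartesian_product power4_eq_xxxx algebra_simps)
  finally have "real (card S) \<le> real (nat (2 * M + 1) ^ 4)" by (rule of_nat_mono)
  also have "\<dots> = (2 * of_int M + 1) ^ 4" using assms(3) by simp
  finally show ?thesis using finite_imageD[OF finite_subset[OF assms(2) f] assms(1)] by simp
qed

context cocompact_group
begin

text \<open>Distinct \<open>A, B \<in> G\<close> satisfy \<open>A\<inverse> B \<noteq> 1\<close>, so for entries bounded by \<open>T\<close> they are separated by a multiple
  of \<open>1 / T\<close>; hence the cells of a grid of mesh proportional to \<open>1 / T\<close> contain at most one element each.\<close>

lemma card_frob_le: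
  obtains C where "\<And>T. T \<ge> 1 \<Longrightarrow> finite {A \<in> G. frob A \<le> T\<^sup>2} \<and> real (card {A \<in> G. frob A \<le> T\<^sup>2}) \<le> C * T ^ 8"
proof -
  obtain e where e: "e > 0"
    "\<And>A. A \<in> G \<Longrightarrow> \<bar>A$1$1 - 1\<bar> < e \<Longrightarrow> \<bar>A$1$2\<bar> < e \<Longrightarrow> \<bar>A$2$1\<bar> < e \<Longrightarrow> \<bar>A$2$2 - 1\<bar> < e \<Longrightarrow> A = mat 1"
    using discrete by metis
  show thesis
  proof (rule that[of "(8 / e + 3) ^ 4"])
    fix T :: real assume T: "T \<ge> 1"
    let ?S = "{A \<in> G. frob A \<le> T\<^sup>2}"
    define s where "s = 4 * T / e"
    have s: "s > 0" using e T by (simp add: s_def)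
    define g :: "real^2^2 \<Rightarrow> int \<times> int \<times> int \<times> int"
      where "g A = (\<lfloor>A$1$1 * s\<rfloor>, \<lfloor>A$1$2 * s\<rfloor>, \<lfloor>A$2$1 * s\<rfloor>, \<lfloor>A$2$2 * s\<rfloor>)" for A
    define M where "M = \<lceil>T * s\<rceil>"
    have "T * s > 0" using s T by simp
    then have M: "M \<ge> 0" unfolding M_def by simp
    have fl: "\<bar>x - y\<bar> * s < 1" if "\<lfloor>x * s\<rfloor> = \<lfloor>y * s\<rfloor>" for x y
    proof -
      have "\<bar>x * s - y * s\<bar> < 1" using that by linarith
      then show ?thesis using s by (simp add: left_diff_distrib[symmetric] abs_mult)
    qed
    have small: "\<bar>p * u + q * v\<bar> < e" if "\<bar>p\<bar> \<le> T" "\<bar>q\<bar> \<le> T" "\<bar>u\<bar> * s < 1" "\<bar>v\<bar> * s < 1" for p q u v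
    proof -
      have uv: "4 * T * \<bar>u\<bar> < e" "4 * T * \<bar>v\<bar> < e" using that(3,4) e(1) by (simp_all add: s_def field_simps)
      have "\<bar>p * u + q * v\<bar> \<le> \<bar>p\<bar> * \<bar>u\<bar> + \<bar>q\<bar> * \<bar>v\<bar>" by (simp add: abs_mult[symmetric])
      also have "\<dots> \<le> T * \<bar>u\<bar> + T * \<bar>v\<bar>" using that(1,2) by (intro add_mono mult_right_mono) auto
      finally show ?thesis using uv e(1) by linarith
    qed
    have inj: "inj_on g ?S"
    proof (rule inj_onI)
      fix A B assume A: "A \<in> ?S" and B: "B \<in> ?S" and gg: "g A = g B"
      obtain C where C: "C \<in> G" "A ** C = mat 1" "C ** A = mat 1" using G_inv A by blast
      have dA: "det A = 1" using A G_det by blast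
      note ce = inverse_entries[OF C(3) dA]
      have c: "\<bar>C$1$1\<bar> \<le> T" "\<bar>C$1$2\<bar> \<le> T" "\<bar>C$2$1\<bar> \<le> T" "\<bar>C$2$2\<bar> \<le> T"
        using frob_entries[of A T] A T by (simp_all add: ce)
      have d: "\<bar>B$1$1 - A$1$1\<bar> * s < 1" "\<bar>B$1$2 - A$1$2\<bar> * s < 1" "\<bar>B$2$1 - A$2$1\<bar> * s < 1" "\<bar>B$2$2 - A$2$2\<bar> * s < 1"
        using gg by (auto simp: g_def intro!: fl)
      have ca: "C$1$1 * A$1$1 + C$1$2 * A$2$1 = 1" "C$1$1 * A$1$2 + C$1$2 * A$2$2 = 0"
        "C$2$1 * A$1$1 + C$2$2 * A$2$1 = 0" "C$2$1 * A$1$2 + C$2$2 * A$2$2 = 1"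
        using C(3) by (simp_all add: matrix_eq_entries matrix_mult_entries mat_1_entries)
      have "C ** B = mat 1"
      proof (rule e(2))
        show "C ** B \<in> G" using G_mult C A B by blast
        have "(C ** B)$1$1 - 1 = C$1$1 * (B$1$1 - A$1$1) + C$1$2 * (B$2$1 - A$2$1)"
          using ca by (simp add: matrix_mult_entries algebra_simps)
        then show "\<bar>(C ** B)$1$1 - 1\<bar> < e" using small[OF c(1,2) d(1,3)] by simp
        have "(C ** B)$1$2 = C$1$1 * (B$1$2 - A$1$2) + C$1$2 * (B$2$2 - A$2$2)"
          using ca by (simp add: matrix_mult_entries algebra_simps)
        then show "\<bar>(C ** B)$1$2\<bar> < e" using small[OF c(1,2) d(2,4)] by simp
        have "(C ** B)$2$1 = C$2$1 * (B$1$1 - A$1$1) + C$2$2 * (B$2$1 - A$2$1)"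
          using ca by (simp add: matrix_mult_entries algebra_simps)
        then show "\<bar>(C ** B)$2$1\<bar> < e" using small[OF c(3,4) d(1,3)] by simp
        have "(C ** B)$2$2 - 1 = C$2$1 * (B$1$2 - A$1$2) + C$2$2 * (B$2$2 - A$2$2)"
          using ca by (simp add: matrix_mult_entries algebra_simps)
        then show "\<bar>(C ** B)$2$2 - 1\<bar> < e" using small[OF c(3,4) d(2,4)] by simp
      qed
      then have "A ** (C ** B) = A" by simp
      then show "A = B" using C(2) by (simp add: matrix_mul_assoc)
    qed
    have box: "g ` ?S \<subseteq> {-M..M} \<times> {-M..M} \<times> {-M..M} \<times> {-M..M}"
    proof -
      have "\<lfloor>x * s\<rfloor> \<in> {-M..M}" if "\<bar>x\<bar> \<le> T" for x
      proof -
        have "\<bar>x * s\<bar> \<le> T * s" using that s by (simp add: abs_mult)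
        then show ?thesis unfolding M_def by (simp, linarith)
      qed
      then show ?thesis using frob_entries[of _ T] T by (auto simp: g_def)
    qed
    have "2 * real_of_int M + 1 \<le> 2 * (T * s + 1) + 1" unfolding M_def by (intro add_right_mono mult_left_mono of_int_ceiling_le_add_one) simp
    also have "\<dots> = 8 * T\<^sup>2 / e + 3 * 1" by (simp add: s_def power2_eq_square)
    also have "\<dots> \<le> 8 * T\<^sup>2 / e + 3 * T\<^sup>2" using T by (intro add_mono mult_left_mono) auto
    also have "\<dots> = (8 / e + 3) * T\<^sup>2" by (simp add: algebra_simps)
    finally have "(2 * real_of_int M + 1) ^ 4 \<le> ((8 / e + 3) * T\<^sup>2) ^ 4"
      using M by (intro power_mono) auto
    also have "\<dots> = (8 / e + 3) ^ 4 * T ^ 8" by (simp add: power_mult_distrib flip: power_mult)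
    finally show "finite ?S \<and> real (card ?S) \<le> (8 / e + 3) ^ 4 * T ^ 8"
      using card_int_box[OF inj box M] by linarith
  qed
qed

lemma finite_frob_le: "finite {A \<in> G. frob A \<le> r}"
proof -
  obtain C where C: "\<And>T. T \<ge> 1 \<Longrightarrow> finite {A \<in> G. frob A \<le> T\<^sup>2} \<and> real (card {A \<in> G. frob A \<le> T\<^sup>2}) \<le> C * T ^ 8"
    using card_frob_le by blast
  have "r \<le> (\<bar>r\<bar> + 1) * 1" by simp
  also have "\<dots> \<le> (\<bar>r\<bar> + 1) * (\<bar>r\<bar> + 1)" by (intro mult_left_mono) auto
  finally have "r \<le> (\<bar>r\<bar> + 1)\<^sup>2" by (simp add: power2_eq_square)
  then have "{A \<in> G. frob A \<le> r} \<subseteq> {A \<in> G. frob A \<le> (\<bar>r\<bar> + 1)\<^sup>2}" by auto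
  then show ?thesis using C[of "\<bar>r\<bar> + 1"] finite_subset by auto
qed

lemma countable_G: "countable G"
proof -
  have "G \<subseteq> (\<Union>n::nat. {A \<in> G. frob A \<le> real n})"
  proof
    fix A assume "A \<in> G"
    moreover obtain n where "frob A \<le> real n" using real_arch_simple by blast
    ultimately have "A \<in> {A \<in> G. frob A \<le> real n}" by simp
    then show "A \<in> (\<Union>n::nat. {A \<in> G. frob A \<le> real n})" by (rule UN_I[OF UNIV_I])
  qed
  moreover have "countable (\<Union>n::nat. {A \<in> G. frob A \<le> real n})"
    by (intro countable_UN countable_finite finite_frob_le countableI_type)
  ultimately show ?thesis by (rule countable_subset)
qed

lemma summable_frob: "(\<lambda>A. 1 / frob A ^ 5) summable_on G"
proof (rule nonneg_bdd_above_summable_on)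
  obtain C where C: "\<And>T. T \<ge> 1 \<Longrightarrow> finite {A \<in> G. frob A \<le> T\<^sup>2} \<and> real (card {A \<in> G. frob A \<le> T\<^sup>2}) \<le> C * T ^ 8"
    using card_frob_le by blast
  have C0: "C \<ge> 0" using C[of 1] by (smt (verit) of_nat_0_le_iff power_one mult_cancel_left2)
  define h where "h m = 256 * C * inverse (real m ^ 2)" for m :: nat
  have sh: "summable h" unfolding h_def by (intro summable_mult inverse_power_summable) auto
  show "bdd_above (sum (\<lambda>A. 1 / frob A ^ 5) ` {F. F \<subseteq> G \<and> finite F})"
  proof (intro bdd_aboveI2)
    fix F assume "F \<in> {F. F \<subseteq> G \<and> finite F}"
    then have F: "F \<subseteq> G" "finite F" by auto
    define n where "n A = nat \<lfloor>sqrt (frob A)\<rfloor>" for A :: "real^2^2"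
    have n: "n A \<ge> 1 \<and> real (n A) ^ 2 \<le> frob A \<and> frob A \<le> (real (n A) + 1)\<^sup>2" if "A \<in> F" for A
    proof -
      have 2: "frob A \<ge> 2" using frob_ge_2 G_det that F by blast
      then have "sqrt (frob A) \<ge> 1" by simp
      then have l: "real (n A) \<le> sqrt (frob A)" "sqrt (frob A) \<le> real (n A) + 1" "n A \<ge> 1"
        unfolding n_def by linarith+
      have "real (n A) ^ 2 \<le> (sqrt (frob A))\<^sup>2" "(sqrt (frob A))\<^sup>2 \<le> (real (n A) + 1)\<^sup>2"
        using l 2 by (intro power_mono; simp)+
      then show ?thesis using l 2 by simp
    qed
    have "(\<Sum>A\<in>F. 1 / frob A ^ 5) \<le> (\<Sum>A\<in>F. 1 / real (n A) ^ 10)"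
    proof (rule sum_mono)
      fix A assume A: "A \<in> F"
      have "(real (n A) ^ 2) ^ 5 \<le> frob A ^ 5" using n[OF A] by (intro power_mono) auto
      moreover have "(real (n A) ^ 2) ^ 5 > 0" using n[OF A] by simp
      ultimately have "1 / frob A ^ 5 \<le> 1 / (real (n A) ^ 2) ^ 5" by (rule frac_le[OF zero_le_one order_refl, rotated])
      then show "1 / frob A ^ 5 \<le> 1 / real (n A) ^ 10" by (simp flip: power_mult)
    qed
    also have "\<dots> = (\<Sum>m\<in>n ` F. \<Sum>A\<in>{A \<in> F. n A = m}. 1 / real (n A) ^ 10)"
      by (rule sum.image_gen[OF F(2)])
    also have "\<dots> \<le> (\<Sum>m\<in>n ` F. h m)"
    proof (rule sum_mono)
      fix m assume m: "m \<in> n ` F"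
      then have m1: "m \<ge> 1" using n by auto
      have sub: "{A \<in> F. n A = m} \<subseteq> {A \<in> G. frob A \<le> (real m + 1)\<^sup>2}" using F n by auto
      have "real (card {A \<in> F. n A = m}) \<le> real (card {A \<in> G. frob A \<le> (real m + 1)\<^sup>2})"
        using C[of "real m + 1"] sub by (intro of_nat_mono card_mono) auto
      also have "\<dots> \<le> C * (real m + 1) ^ 8" using C[of "real m + 1"] by simp
      also have "\<dots> \<le> C * (2 * real m) ^ 8" using m1 C0 by (intro mult_left_mono power_mono) auto
      finally have "real (card {A \<in> F. n A = m}) \<le> 256 * C * real m ^ 8" by (simp add: power_mult_distrib)
      then have "real (card {A \<in> F. n A = m}) / real m ^ 10 \<le> 256 * C * real m ^ 8 / real m ^ 10"
        by (intro divide_right_mono) auto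
      also have "\<dots> = h m" using m1 by (simp add: h_def field_simps flip: power_add)
      finally show "(\<Sum>A\<in>{A \<in> F. n A = m}. 1 / real (n A) ^ 10) \<le> h m"
        by simp
    qed
    also have "\<dots> \<le> suminf h" by (intro sum_le_suminf sh finite_imageI F(2)) (simp add: h_def C0)
    finally show "(\<Sum>A\<in>F. 1 / frob A ^ 5) \<le> suminf h" .
  qed
qed (simp add: frob_def)

lemma moeb_uhp: "A \<in> G \<Longrightarrow> Im z > 0 \<Longrightarrow> Im (moeb A z) > 0"
  using Im_moeb_pos G_det by blast

lemma orbit_of_moeb: assumes "A \<in> G" "Im z > 0" shows "orbit_of \<Gamma> (moeb A z) = orbit_of \<Gamma> z"
proof -
  have m: "moeb (B ** A) z = moeb B (moeb A z)" if "B \<in> G" for B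
    using moeb_mult that assms G_det moeb_uhp by blast
  have "orbit_of \<Gamma> z = (\<lambda>B. moeb (B ** A) z) ` G"
  proof -
    have "(\<lambda>B. moeb (B ** A) z) ` G = (\<lambda>B. moeb B z) ` ((\<lambda>B. B ** A) ` G)" by (simp only: image_image)
    then show ?thesis
      unfolding orbit_of_eq bij_betw_imp_surj_on[OF right_mult_bij[OF assms(1)]] by (rule sym)
  qed
  also have "\<dots> = orbit_of \<Gamma> (moeb A z)" unfolding orbit_of_eq using m by (intro image_cong) auto
  finally show ?thesis by simp
qed

lemma orbit_self: "z \<in> orbit_of \<Gamma> z"
  unfolding orbit_of_eq by (rule image_eqI[of _ _ "mat 1"]) (use G_one in auto)

lemma cocompact:
  obtains R where "R \<ge> 1" "\<And>z. Im z > 0 \<Longrightarrow> \<exists>A\<in>G. Im (moeb A z) \<ge> 1 / R \<and> norm (moeb A z) \<le> R"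
proof -
  let ?X = "quotient_top (top_of_set uhp) (orbit_of \<Gamma>)"
  define U where "U n = {z. norm z < real n + 1 \<and> Im z > 1 / (real n + 1)}" for n
  have Upos: "Im z > 0" if "z \<in> U n" for z n
    using that unfolding U_def by (smt (verit) divide_pos_pos mem_Collect_eq of_nat_0_le_iff)
  have Uopen: "open (U n)" for n
    unfolding U_def by (intro open_Collect_conj open_Collect_less continuous_intros)
  have pre: "{x \<in> uhp. orbit_of \<Gamma> x \<in> orbit_of \<Gamma> ` U n} = (\<Union>A\<in>G. uhp \<inter> moeb A -` U n)" for n
  proof (intro equalityI subsetI)
    fix x assume "x \<in> {x \<in> uhp. orbit_of \<Gamma> x \<in> orbit_of \<Gamma> ` U n}"
    then obtain y where y: "Im x > 0" "y \<in> U n" "orbit_of \<Gamma> x = orbit_of \<Gamma> y" by auto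
    then have "y \<in> orbit_of \<Gamma> x" using orbit_self by simp
    then obtain A where "A \<in> G" "y = moeb A x" unfolding orbit_of_eq by (rule imageE)
    then show "x \<in> (\<Union>A\<in>G. uhp \<inter> moeb A -` U n)" using y by (intro UN_I[of A]) auto
  next
    fix x assume "x \<in> (\<Union>A\<in>G. uhp \<inter> moeb A -` U n)"
    then obtain A where "A \<in> G" "Im x > 0" "moeb A x \<in> U n" by auto
    then show "x \<in> {x \<in> uhp. orbit_of \<Gamma> x \<in> orbit_of \<Gamma> ` U n}" using orbit_of_moeb by (auto intro!: rev_image_eqI)
  qed
  have op: "openin ?X (orbit_of \<Gamma> ` U n)" for n
  proof -
    have "open (uhp \<inter> moeb A -` U n)" if "A \<in> G" for A
      using holomorphic_moeb[of A uhp] G_det[OF that] Uopen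
      by (intro continuous_open_preimage holomorphic_on_imp_continuous_on) auto
    then have "open {x \<in> uhp. orbit_of \<Gamma> x \<in> orbit_of \<Gamma> ` U n}" unfolding pre by (intro open_UN ballI)
    then have "openin (top_of_set uhp) {x \<in> uhp. orbit_of \<Gamma> x \<in> orbit_of \<Gamma> ` U n}"
      by (intro open_subset) blast
    moreover have "U n \<subseteq> uhp" using Upos by auto
    ultimately show ?thesis unfolding openin_quotient_top by (simp add: image_mono)
  qed
  have topsp: "topspace ?X \<subseteq> orbit_of \<Gamma> ` uhp"
    using openin_topspace[of ?X] unfolding openin_quotient_top by simp
  have cov: "uhp \<subseteq> (\<Union>n. U n)"
  proof
    fix z assume "z \<in> uhp"
    then have z: "Im z > 0" by simp
    obtain n where n: "max (norm z) (1 / Im z) < real n" using reals_Archimedean2[of "max (norm z) (1 / Im z)"] by auto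
    have n1: "1 / Im z < real n + 1" "norm z < real n + 1" using n by simp_all
    from n1(1) have "1 / (real n + 1) < Im z" using z by (simp add: field_simps)
    with n1(2) have "z \<in> U n" by (simp add: U_def)
    then show "z \<in> (\<Union>n. U n)" by (rule UN_I[OF UNIV_I])
  qed
  define \<U> where "\<U> = range (\<lambda>n. orbit_of \<Gamma> ` U n)"
  have "compact_space ?X" using dc by (simp add: discrete_cocompact_def)
  moreover have "\<forall>V\<in>\<U>. openin ?X V" using op by (simp add: \<U>_def)
  moreover have "topspace ?X \<subseteq> \<Union>\<U>"
    using order_trans[OF topsp image_mono[OF cov]] unfolding \<U>_def by (simp only: image_UN)
  ultimately obtain \<F> where F: "finite \<F>" "\<F> \<subseteq> \<U>" "topspace ?X \<subseteq> \<Union>\<F>"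
    unfolding compact_space_alt by (drule_tac spec[of _ \<U>]) auto
  then obtain S where S: "finite S" "\<F> = (\<lambda>n. orbit_of \<Gamma> ` U n) ` S"
    unfolding \<U>_def using finite_subset_image by metis
  define m where "m = Max (insert 0 S)"
  have m: "n \<le> m" if "n \<in> S" for n using S that by (simp add: m_def)
  have top2: "orbit_of \<Gamma> ` uhp \<subseteq> topspace ?X"
  proof -
    have "{x \<in> uhp. orbit_of \<Gamma> x \<in> orbit_of \<Gamma> ` uhp} = uhp" by blast
    then have "openin ?X (orbit_of \<Gamma> ` uhp)" unfolding openin_quotient_top by simp
    then show ?thesis by (rule openin_subset)
  qed
  show thesis
  proof (rule that[of "real m + 1"])
    fix z assume z: "Im z > 0"
    then have "orbit_of \<Gamma> z \<in> \<Union>\<F>" using order_trans[OF top2 F(3)] by (simp add: subset_iff)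
    then obtain n y where y: "n \<in> S" "y \<in> U n" "orbit_of \<Gamma> z = orbit_of \<Gamma> y" using S by auto
    then obtain A where A: "A \<in> G" "y = moeb A z" using orbit_self[of y] unfolding orbit_of_eq by auto
    have nm: "real n \<le> real m" using m y by simp
    have "1 / (real m + 1) \<le> 1 / (real n + 1)" using nm by (simp add: field_simps)
    then show "\<exists>A\<in>G. Im (moeb A z) \<ge> 1 / (real m + 1) \<and> norm (moeb A z) \<le> real m + 1"
      using A y nm by (intro bexI[of _ A]) (auto simp: U_def)
  qed simp
qed

lemma unbounded_rows: obtains A where "A \<in> G" "(A$2$1)\<^sup>2 + (A$2$2)\<^sup>2 > M"
proof -
  obtain R where R: "R \<ge> 1" "\<And>z. Im z > 0 \<Longrightarrow> \<exists>A\<in>G. Im (moeb A z) \<ge> 1 / R \<and> norm (moeb A z) \<le> R"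
    using cocompact by blast
  define e where "e = 1 / ((\<bar>M\<bar> + 1) * (2 * (R\<^sup>2 + 1) * R))"
  have e: "e > 0" unfolding e_def using R(1)
    by (intro divide_pos_pos mult_pos_pos add_nonneg_pos) simp_all
  obtain A where A: "A \<in> G" "Im (moeb A (\<i> * of_real e)) \<ge> 1 / R" "norm (moeb A (\<i> * of_real e)) \<le> R"
    using R(2)[of "\<i> * of_real e"] e by auto
  define w where "w = moeb A (\<i> * of_real e)"
  obtain B where B: "B \<in> G" "A ** B = mat 1" "B ** A = mat 1" using G_inv A by blast
  have d: "det A = 1" "det B = 1" using G_det A B by auto
  have "moeb B w = \<i> * of_real e" unfolding w_def
    using moeb_mult[of B A "\<i> * of_real e"] moeb_uhp[OF A(1)] d B(3) e by simp
  then have "Im w / (norm (autj B w))\<^sup>2 = e" using Im_moeb[of B w] d by simp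
  moreover have w: "Im w \<ge> 1 / R" "norm w \<le> R" using A by (auto simp: w_def)
  moreover have "norm (autj B w) \<noteq> 0" using autj_nonzero[of B w] d w R(1) by (smt (verit) divide_pos_pos norm_eq_zero)
  ultimately have 1: "1 / R \<le> e * (norm (autj B w))\<^sup>2" by (simp add: field_simps)
  have "norm (autj B w) \<le> \<bar>B$2$1\<bar> * R + \<bar>B$2$2\<bar>"
    unfolding autj_def by (rule order_trans[OF norm_triangle_ineq]) (use w in \<open>simp add: norm_mult mult_left_mono\<close>)
  then have "(norm (autj B w))\<^sup>2 \<le> (\<bar>B$2$1\<bar> * R + \<bar>B$2$2\<bar>)\<^sup>2" by (intro power_mono) auto
  also have "\<dots> \<le> 2 * (R\<^sup>2 + 1) * ((B$2$1)\<^sup>2 + (B$2$2)\<^sup>2)"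
  proof -
    have "0 \<le> (\<bar>B$2$1\<bar> * R - \<bar>B$2$2\<bar>)\<^sup>2 + 2 * (B$2$1)\<^sup>2 + 2 * R\<^sup>2 * (B$2$2)\<^sup>2" by simp
    also have "\<dots> = 2 * (R\<^sup>2 + 1) * ((B$2$1)\<^sup>2 + (B$2$2)\<^sup>2) - (\<bar>B$2$1\<bar> * R + \<bar>B$2$2\<bar>)\<^sup>2"
      by (simp add: power2_sum power2_diff power_mult_distrib algebra_simps)
    finally show ?thesis by simp
  qed
  finally have "1 / R \<le> e * (2 * (R\<^sup>2 + 1) * ((B$2$1)\<^sup>2 + (B$2$2)\<^sup>2))" using 1 e by (meson mult_left_mono less_imp_le order_trans)
  also have "\<dots> = ((B$2$1)\<^sup>2 + (B$2$2)\<^sup>2) / ((\<bar>M\<bar> + 1) * R)" using R(1)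
    by (simp add: e_def add_nonneg_eq_0_iff)
  finally have "1 / R \<le> ((B$2$1)\<^sup>2 + (B$2$2)\<^sup>2) / ((\<bar>M\<bar> + 1) * R)" .
  moreover have "(\<bar>M\<bar> + 1) * R > 0" using R(1) by (intro mult_pos_pos) simp_all
  ultimately have "1 / R * ((\<bar>M\<bar> + 1) * R) \<le> (B$2$1)\<^sup>2 + (B$2$2)\<^sup>2" by (simp only: pos_le_divide_eq)
  then have "\<bar>M\<bar> + 1 \<le> (B$2$1)\<^sup>2 + (B$2$2)\<^sup>2" using R(1) by simp
  then show thesis using B that by force
qed

lemma finite_orbit_bounded:
  assumes "r > 0"
  shows "finite {A \<in> G. norm (moeb A \<i>) \<le> r \<and> Im (moeb A \<i>) \<ge> 1 / r}"
proof (rule finite_subset[OF _ finite_frob_le[of "r + r\<^sup>2 * r"]], rule subsetI)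
  fix A assume "A \<in> {A \<in> G. norm (moeb A \<i>) \<le> r \<and> Im (moeb A \<i>) \<ge> 1 / r}"
  then have AG: "A \<in> G" and l: "norm (moeb A \<i>) \<le> r" "1 / r \<le> Im (moeb A \<i>)" by auto
  then have d: "det A = 1" using G_det by blast
  have n: "(norm (autj A \<i>))\<^sup>2 = (A$2$1)\<^sup>2 + (A$2$2)\<^sup>2" by (simp add: autj_def cmod_power2 add.commute)
  have pos: "(norm (autj A \<i>))\<^sup>2 > 0" using autj_nonzero[of A \<i>] d by simp
  have "1 / r \<le> 1 / (norm (autj A \<i>))\<^sup>2" using l(2) Im_moeb[OF d, of \<i>] by simp
  then have 1: "(norm (autj A \<i>))\<^sup>2 \<le> r" using pos assms by (simp add: field_simps)
  have "moeb A \<i> * autj A \<i> = of_real (A$1$1) * \<i> + of_real (A$1$2)"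
    using pos by (simp add: moeb_def)
  then have "(norm (moeb A \<i>))\<^sup>2 * (norm (autj A \<i>))\<^sup>2 = (A$1$1)\<^sup>2 + (A$1$2)\<^sup>2"
  proof -
    have "(norm (moeb A \<i>))\<^sup>2 * (norm (autj A \<i>))\<^sup>2 = (norm (moeb A \<i> * autj A \<i>))\<^sup>2"
      by (simp add: norm_mult power_mult_distrib)
    then show ?thesis unfolding \<open>moeb A \<i> * autj A \<i> = _\<close> by (simp add: cmod_power2)
  qed
  moreover have "(norm (moeb A \<i>))\<^sup>2 * (norm (autj A \<i>))\<^sup>2 \<le> r\<^sup>2 * r"
    using l 1 by (intro mult_mono power_mono) auto
  ultimately show "A \<in> {A \<in> G. frob A \<le> r + r\<^sup>2 * r}" using 1 n AG by (simp add: frob_def)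
qed

lemma orbit_locally_finite:
  assumes "Im z > 0"
  obtains W where "open W" "z \<in> W" "W \<subseteq> uhp" "finite (W \<inter> orbit_of \<Gamma> \<i>)"
proof -
  define r where "r = norm z + 1 / Im z + 1"
  have r: "r > 0" "norm z < r" "1 / Im z < r" using assms by (auto simp: r_def add_nonneg_pos add_pos_nonneg)
  define W where "W = {w. norm w < r \<and> Im w > 1 / r}"
  have "open W" unfolding W_def by (intro open_Collect_conj open_Collect_less continuous_intros)
  moreover have "1 / r < Im z" using r assms by (simp add: field_simps)
  then have "z \<in> W" using r by (simp add: W_def)
  moreover have "1 / r > 0" using r(1) by simp
  then have "W \<subseteq> uhp" unfolding W_def uhp_def using less_trans by blast
  moreover have "W \<inter> orbit_of \<Gamma> \<i> \<subseteq> (\<lambda>A. moeb A \<i>) ` {A \<in> G. norm (moeb A \<i>) \<le> r \<and> Im (moeb A \<i>) \<ge> 1 / r}"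
    by (auto simp: W_def orbit_of_eq)
  then have "finite (W \<inter> orbit_of \<Gamma> \<i>)" 
    by (rule finite_subset[OF _ finite_imageI[OF finite_orbit_bounded[OF r(1)]]])
  ultimately show thesis by (rule that)
qed

lemma punctured_nbhd:
  assumes "Im z > 0"
  obtains e where "e > 0" "ball z e - {z} \<subseteq> Om \<Gamma>" "ball z e \<subseteq> uhp"
proof -
  obtain W where W: "open W" "z \<in> W" "W \<subseteq> uhp" "finite (W \<inter> orbit_of \<Gamma> \<i>)"
    using orbit_locally_finite assms by blast
  have "open (W - (W \<inter> orbit_of \<Gamma> \<i> - {z}))" using W by (intro open_Diff finite_imp_closed) auto
  moreover have "z \<in> W - (W \<inter> orbit_of \<Gamma> \<i> - {z})" using W by auto
  ultimately obtain e where e: "e > 0" "ball z e \<subseteq> W - (W \<inter> orbit_of \<Gamma> \<i> - {z})"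
    by (rule openE)
  show thesis
  proof (rule that[OF e(1)])
    show 1: "ball z e \<subseteq> uhp" using order_trans[OF e(2)] W(3) by blast
    show "ball z e - {z} \<subseteq> Om \<Gamma>"
    proof
      fix w assume w: "w \<in> ball z e - {z}"
      then have "w \<in> W - (W \<inter> orbit_of \<Gamma> \<i> - {z})" by (intro subsetD[OF e(2)]) simp
      then show "w \<in> Om \<Gamma>" using w subsetD[OF W(3), of w] by (auto simp: Om_def)
    qed
  qed
qed

lemma open_Om: "open (Om \<Gamma>)"
  unfolding open_contains_ball
proof
  fix z assume z: "z \<in> Om \<Gamma>"
  then have "Im z > 0" by (simp add: Om_def)
  then obtain e where e: "e > 0" "ball z e - {z} \<subseteq> Om \<Gamma>" by (rule punctured_nbhd)
  have "ball z e \<subseteq> insert z (ball z e - {z})" by auto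
  also have "\<dots> \<subseteq> Om \<Gamma>" by (rule insert_subsetI[OF z e(2)])
  finally show "\<exists>e>0. ball z e \<subseteq> Om \<Gamma>" using e(1) by auto
qed

lemma Om_subset: "Om \<Gamma> \<subseteq> uhp"
  by (auto simp: Om_def)

lemma moeb_Om: assumes "A \<in> G" "z \<in> Om \<Gamma>" shows "moeb A z \<in> Om \<Gamma>"
proof -
  have z: "Im z > 0" "z \<notin> orbit_of \<Gamma> \<i>" using assms by (auto simp: Om_def)
  have "moeb A z \<notin> orbit_of \<Gamma> \<i>"
  proof
    assume "moeb A z \<in> orbit_of \<Gamma> \<i>"
    then obtain B where B: "B \<in> G" "moeb A z = moeb B \<i>" by (auto simp: orbit_of_eq)
    have "orbit_of \<Gamma> z = orbit_of \<Gamma> \<i>"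
      using orbit_of_moeb[OF assms(1) z(1)] orbit_of_moeb[OF B(1), of \<i>] B(2) by simp
    then show False using orbit_self[of z] z by simp
  qed
  then show ?thesis using moeb_uhp[OF assms(1) z(1)] by (simp add: Om_def)
qed

end

section \<open>An invariant mean\<close>

definition mpres :: "('a::euclidean_space \<Rightarrow> 'a) \<Rightarrow> bool" where
  "mpres T \<longleftrightarrow> T \<in> borel_measurable borel \<and>
    (\<forall>f\<in>borel_measurable borel. (\<integral>\<^sup>+x. f (T x) \<partial>lborel) = (\<integral>\<^sup>+x. f x \<partial>lborel))"

lemma mpresD:
  assumes "mpres T" shows "T \<in> borel_measurable borel"
    "f \<in> borel_measurable borel \<Longrightarrow> (\<integral>\<^sup>+x. f (T x) \<partial>lborel) = (\<integral>\<^sup>+x. f x \<partial>lborel)"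
  using assms by (auto simp: mpres_def)

lemma mpres_comp:
  assumes "mpres S" "mpres T" shows "mpres (\<lambda>x. S (T x))"
proof -
  have m: "S \<in> borel_measurable borel" "T \<in> borel_measurable borel" using assms by (auto simp: mpres_def)
  have "(\<integral>\<^sup>+x. f (S (T x)) \<partial>lborel) = (\<integral>\<^sup>+x. f x \<partial>lborel)" if f: "f \<in> borel_measurable borel" for f
  proof -
    have "(\<lambda>x. f (S x)) \<in> borel_measurable borel" using m(1) f by (rule measurable_compose)
    from mpresD(2)[OF assms(2) this] show ?thesis using mpresD(2)[OF assms(1) f] by (rule trans)
  qed
  moreover have "(\<lambda>x. S (T x)) \<in> borel_measurable borel" using m(2,1) by (rule measurable_compose)
  ultimately show ?thesis by (simp add: mpres_def)
qed

lemma nn_integral_lborel_translate: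
  fixes g :: "'a::euclidean_space \<Rightarrow> ennreal"
  assumes "g \<in> borel_measurable borel"
  shows "(\<integral>\<^sup>+y. g (c + y) \<partial>lborel) = (\<integral>\<^sup>+y. g y \<partial>lborel)"
proof -
  have "(\<integral>\<^sup>+y. g y \<partial>lborel) = (\<integral>\<^sup>+y. g y \<partial>(distr lborel borel ((+) c)))"
    by (simp add: lborel_distr_plus)
  also have "\<dots> = (\<integral>\<^sup>+y. g (c + y) \<partial>lborel)"
    using assms by (subst nn_integral_distr) auto
  finally show ?thesis by simp
qed

lemma borel_prod_lborel:
  fixes f :: "'a::euclidean_space \<times> 'b::euclidean_space \<Rightarrow> ennreal"
  assumes "f \<in> borel_measurable borel"
  shows "(\<integral>\<^sup>+p. f p \<partial>lborel) = (\<integral>\<^sup>+x. (\<integral>\<^sup>+y. f (x, y) \<partial>lborel) \<partial>lborel)"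
    "(\<integral>\<^sup>+p. f p \<partial>lborel) = (\<integral>\<^sup>+y. (\<integral>\<^sup>+x. f (x, y) \<partial>lborel) \<partial>lborel)"
proof -
  have f: "f \<in> borel_measurable (lborel \<Otimes>\<^sub>M lborel)"
    using assms by (simp add: lborel_prod)
  show "(\<integral>\<^sup>+p. f p \<partial>lborel) = (\<integral>\<^sup>+x. (\<integral>\<^sup>+y. f (x, y) \<partial>lborel) \<partial>lborel)"
    using lborel.nn_integral_fst[OF f] by (simp add: lborel_prod)
  show "(\<integral>\<^sup>+p. f p \<partial>lborel) = (\<integral>\<^sup>+y. (\<integral>\<^sup>+x. f (x, y) \<partial>lborel) \<partial>lborel)"
    using lborel_pair.nn_integral_snd[OF f] by (simp add: lborel_prod)
qed

lemma borel_section: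
  fixes f :: "'a::euclidean_space \<times> 'b::euclidean_space \<Rightarrow> ennreal"
  assumes "f \<in> borel_measurable borel"
  shows "(\<lambda>y. f (x, y)) \<in> borel_measurable borel" "(\<lambda>x. f (x, y)) \<in> borel_measurable borel"
proof -
  have "f \<in> borel_measurable (borel \<Otimes>\<^sub>M borel)" using assms by (simp add: borel_prod)
  then show "(\<lambda>y. f (x, y)) \<in> borel_measurable borel" "(\<lambda>x. f (x, y)) \<in> borel_measurable borel"
    by measurable
qed

lemma mpres_shear_snd:
  fixes h :: "'a::euclidean_space \<Rightarrow> 'b::euclidean_space"
  assumes h: "continuous_on UNIV h"
  shows "mpres (\<lambda>(x, y). (x, h x + y))"
proof -
  have m: "(\<lambda>(x, y). (x, h x + y)) \<in> borel_measurable borel"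
    unfolding case_prod_unfold by (intro borel_measurable_continuous_onI continuous_intros continuous_on_compose2[OF h]) auto
  have "(\<integral>\<^sup>+p. f (case p of (x, y) \<Rightarrow> (x, h x + y)) \<partial>lborel) = (\<integral>\<^sup>+p. f p \<partial>lborel)"
    if f: "f \<in> borel_measurable borel" for f
  proof -
    have "(\<integral>\<^sup>+p. f (case p of (x, y) \<Rightarrow> (x, h x + y)) \<partial>lborel) = (\<integral>\<^sup>+x. (\<integral>\<^sup>+y. f (x, h x + y) \<partial>lborel) \<partial>lborel)"
      using borel_prod_lborel(1)[OF measurable_compose[OF m f]] by simp
    also have "\<dots> = (\<integral>\<^sup>+x. (\<integral>\<^sup>+y. f (x, y) \<partial>lborel) \<partial>lborel)"
      by (intro nn_integral_cong nn_integral_lborel_translate borel_section f)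
    finally show ?thesis using borel_prod_lborel(1)[OF f] by simp
  qed
  then show ?thesis using m by (simp add: mpres_def)
qed

lemma mpres_shear_fst:
  fixes h :: "'b::euclidean_space \<Rightarrow> 'a::euclidean_space"
  assumes h: "continuous_on UNIV h"
  shows "mpres (\<lambda>(x, y). (h y + x, y))"
proof -
  have m: "(\<lambda>(x, y). (h y + x, y)) \<in> borel_measurable borel"
    unfolding case_prod_unfold by (intro borel_measurable_continuous_onI continuous_intros continuous_on_compose2[OF h]) auto
  have "(\<integral>\<^sup>+p. f (case p of (x, y) \<Rightarrow> (h y + x, y)) \<partial>lborel) = (\<integral>\<^sup>+p. f p \<partial>lborel)"
    if f: "f \<in> borel_measurable borel" for f
  proof -
    have "(\<integral>\<^sup>+p. f (case p of (x, y) \<Rightarrow> (h y + x, y)) \<partial>lborel) = (\<integral>\<^sup>+y. (\<integral>\<^sup>+x. f (h y + x, y) \<partial>lborel) \<partial>lborel)"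
      using borel_prod_lborel(2)[OF measurable_compose[OF m f]] by simp
    also have "\<dots> = (\<integral>\<^sup>+y. (\<integral>\<^sup>+x. f (x, y) \<partial>lborel) \<partial>lborel)"
    proof (rule nn_integral_cong)
      fix y show "(\<integral>\<^sup>+x. f (h y + x, y) \<partial>lborel) = (\<integral>\<^sup>+x. f (x, y) \<partial>lborel)"
        using nn_integral_lborel_translate[OF borel_section(2)[OF f]] .
    qed
    finally show ?thesis using borel_prod_lborel(2)[OF f] by simp
  qed
  then show ?thesis using m by (simp add: mpres_def)
qed

lemma mpres_prod:
  fixes S :: "'a::euclidean_space \<Rightarrow> 'a" and T :: "'b::euclidean_space \<Rightarrow> 'b"
  assumes S: "mpres S" "continuous_on UNIV S" and T: "mpres T" "continuous_on UNIV T"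
  shows "mpres (\<lambda>(x, y). (S x, T y))"
proof -
  have m: "(\<lambda>(x, y). (S x, T y)) \<in> borel_measurable borel"
    unfolding case_prod_unfold
    by (intro borel_measurable_continuous_onI continuous_intros continuous_on_compose2[OF S(2)] continuous_on_compose2[OF T(2)]) auto
  have m1: "(\<lambda>(x, y). (S x, y)) \<in> borel_measurable (borel :: ('a \<times> 'b) measure)"
    unfolding case_prod_unfold
    by (intro borel_measurable_continuous_onI continuous_intros continuous_on_compose2[OF S(2)]) auto
  have "(\<integral>\<^sup>+p. f (case p of (x, y) \<Rightarrow> (S x, T y)) \<partial>lborel) = (\<integral>\<^sup>+p. f p \<partial>lborel)"
    if f: "f \<in> borel_measurable borel" for f
  proof -
    have "(\<integral>\<^sup>+p. f (case p of (x, y) \<Rightarrow> (S x, T y)) \<partial>lborel) = (\<integral>\<^sup>+x. (\<integral>\<^sup>+y. f (S x, T y) \<partial>lborel) \<partial>lborel)"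
      using borel_prod_lborel(1)[OF measurable_compose[OF m f]] by simp
    also have "\<dots> = (\<integral>\<^sup>+x. (\<integral>\<^sup>+y. f (S x, y) \<partial>lborel) \<partial>lborel)"
    proof (rule nn_integral_cong)
      fix x show "(\<integral>\<^sup>+y. f (S x, T y) \<partial>lborel) = (\<integral>\<^sup>+y. f (S x, y) \<partial>lborel)"
        using mpresD(2)[OF T(1) borel_section(1)[OF f]] .
    qed
    also have "\<dots> = (\<integral>\<^sup>+y. (\<integral>\<^sup>+x. f (S x, y) \<partial>lborel) \<partial>lborel)"
      using borel_prod_lborel[OF measurable_compose[OF m1 f]] by simp
    also have "\<dots> = (\<integral>\<^sup>+y. (\<integral>\<^sup>+x. f (x, y) \<partial>lborel) \<partial>lborel)"
    proof (rule nn_integral_cong)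
      fix y show "(\<integral>\<^sup>+x. f (S x, y) \<partial>lborel) = (\<integral>\<^sup>+x. f (x, y) \<partial>lborel)"
        using mpresD(2)[OF S(1) borel_section(2)[OF f]] .
    qed
    finally show ?thesis using borel_prod_lborel(2)[OF f] by simp
  qed
  then show ?thesis using m by (simp add: mpres_def)
qed

text \<open>Real \<open>2 \<times> 2\<close> matrices, given by their two rows.\<close>

type_synonym quad = "(real \<times> real) \<times> (real \<times> real)"

definition lact :: "real^2^2 \<Rightarrow> quad \<Rightarrow> quad" where
  "lact A = (\<lambda>(r, s). (A$1$1 *\<^sub>R r + A$1$2 *\<^sub>R s, A$2$1 *\<^sub>R r + A$2$2 *\<^sub>R s))"

lemma lact_mult: "lact (A ** B) X = lact A (lact B X)"
  by (cases X) (simp add: lact_def matrix_mult_entries algebra_simps scaleR_add_left)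

lemma lact_1 [simp]: "lact (mat 1) X = X"
  by (cases X) (simp add: lact_def mat_1_entries)

text \<open>Both row operations are shears, so they preserve Lebesgue measure, and the matrices of
  determinant 1 are products of row operations.\<close>

lemma mpres_lact:
  assumes "det A = 1" shows "mpres (lact A)"
proof -
  define U where "U t = (\<lambda>(r::real\<times>real, s::real\<times>real). (t *\<^sub>R s + r, s))" for t :: real
  define L where "L t = (\<lambda>(r::real\<times>real, s::real\<times>real). (r, t *\<^sub>R r + s))" for t :: real
  have U: "mpres (U t)" for t unfolding U_def by (rule mpres_shear_fst) (intro continuous_intros)
  have L: "mpres (L t)" for t unfolding L_def by (rule mpres_shear_snd) (intro continuous_intros)
  have d: "A$1$1 * A$2$2 - A$1$2 * A$2$1 = 1" using assms by (simp add: det_2)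
  show ?thesis
  proof (cases "A$2$1 = 0")
    case False
    let ?c = "A$2$1"
    have "lact A X = U ((A$1$1 - 1) / ?c) (L ?c (U ((A$2$2 - 1) / ?c) X))" for X
    proof -
      obtain x1 x2 y1 y2 where X: "X = ((x1, x2), (y1, y2))" by (cases X) auto
      have b: "A$1$2 = (A$1$1 * A$2$2 - 1) / ?c" using d False by (simp add: field_simps)
      show ?thesis using False unfolding X lact_def U_def L_def b
        by (simp add: field_simps)
    qed
    then have "lact A = (\<lambda>X. U ((A$1$1 - 1) / ?c) (L ?c (U ((A$2$2 - 1) / ?c) X)))" by (rule ext)
    then show ?thesis using mpres_comp[OF U mpres_comp[OF L U]] by simp
  next
    case True
    let ?d = "A$2$2"
    have d0': "?d \<noteq> 0" using d True by auto
    moreover have "A$1$1 = 1 / ?d" using d True d0' by (simp add: nonzero_eq_divide_eq)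
    ultimately have d0: "?d \<noteq> 0" "A$1$1 = 1 / ?d" by simp_all
    have "lact A X = U ((A$1$1 + A$1$2 - 1) / ?d) (L ?d (U ((?d - 1) / ?d) (L (-1) X)))" for X
    proof -
      obtain x1 x2 y1 y2 where X: "X = ((x1, x2), (y1, y2))" by (cases X) auto
      show ?thesis using d0(1) unfolding X lact_def U_def L_def d0(2)
        by (simp add: field_simps True)
    qed
    then have "lact A = (\<lambda>X. U ((A$1$1 + A$1$2 - 1) / ?d) (L ?d (U ((?d - 1) / ?d) (L (-1) X))))" by (rule ext)
    then show ?thesis using mpres_comp[OF U mpres_comp[OF L mpres_comp[OF U L]]] by simp
  qed
qed

definition rU :: "real \<Rightarrow> quad \<Rightarrow> quad" where
  "rU t = (\<lambda>(r, s). ((\<lambda>(x, y). (x, t * x + y)) r, (\<lambda>(x, y). (x, t * x + y)) s))"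

definition rL :: "real \<Rightarrow> quad \<Rightarrow> quad" where
  "rL t = (\<lambda>(r, s). ((\<lambda>(x, y). (t * y + x, y)) r, (\<lambda>(x, y). (t * y + x, y)) s))"

lemma mpres_rU: "mpres (rU t)"
  unfolding rU_def by (intro mpres_prod mpres_shear_snd) (auto simp: case_prod_unfold intro!: continuous_intros)

lemma mpres_rL: "mpres (rL t)"
  unfolding rL_def by (intro mpres_prod mpres_shear_fst) (auto simp: case_prod_unfold intro!: continuous_intros)

definition qdet :: "quad \<Rightarrow> real" where
  "qdet X = fst (fst X) * snd (snd X) - snd (fst X) * fst (snd X)"

definition qsq :: "quad \<Rightarrow> real" where
  "qsq X = (fst (fst X))\<^sup>2 + (snd (fst X))\<^sup>2 + (fst (snd X))\<^sup>2 + (snd (snd X))\<^sup>2"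

definition qj :: "quad \<Rightarrow> complex \<Rightarrow> complex" where
  "qj X z = of_real (fst (snd X)) * z + of_real (snd (snd X))"

definition qm :: "quad \<Rightarrow> complex \<Rightarrow> complex" where
  "qm X z = (of_real (fst (fst X)) * z + of_real (snd (fst X))) / qj X z"

lemma qdet_lact: "qdet (lact A X) = det A * qdet X"
  by (cases X) (simp add: qdet_def lact_def det_2 algebra_simps)

lemma qdet_rU [simp]: "qdet (rU t X) = qdet X" and qdet_rL [simp]: "qdet (rL t X) = qdet X"
  by (auto simp: qdet_def rU_def rL_def algebra_simps split: prod.splits)

lemma lact_rU: "lact A (rU t X) = rU t (lact A X)" and lact_rL: "lact A (rL t X) = rL t (lact A X)"
  by (auto simp: lact_def rU_def rL_def algebra_simps split: prod.splits)

lemma rU_inv [simp]: "rU t (rU (-t) X) = X" and rL_inv [simp]: "rL t (rL (-t) X) = X"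
  by (auto simp: rU_def rL_def algebra_simps split: prod.splits)

lemma qj_nonzero:
  assumes "qdet X > 0" "Im z > 0" shows "qj X z \<noteq> 0"
proof
  assume *: "qj X z = 0"
  then have "Im (qj X z) = 0" by simp
  then have "fst (snd X) = 0" using assms by (simp add: qj_def)
  with * have "snd (snd X) = 0" by (simp add: qj_def)
  with \<open>fst (snd X) = 0\<close> assms(1) show False by (simp add: qdet_def)
qed

lemma Im_qm: "Im (qm X z) = qdet X * Im z / (norm (qj X z))\<^sup>2"
proof -
  have "Im (qm X z) = Im ((of_real (fst (fst X)) * z + of_real (snd (fst X))) * cnj (qj X z)) / (norm (qj X z))\<^sup>2"
    unfolding qm_def complex_div_cnj[of _ "qj X z"] by (simp only: Im_divide_of_real)
  also have "Im ((of_real (fst (fst X)) * z + of_real (snd (fst X))) * cnj (qj X z)) = qdet X * Im z"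
    by (simp add: qj_def qdet_def algebra_simps)
  finally show ?thesis .
qed

lemma Im_qm_pos: "qdet X > 0 \<Longrightarrow> Im z > 0 \<Longrightarrow> Im (qm X z) > 0"
  using Im_qm[of X z] qj_nonzero[of X z] by simp

lemma qj_lact:
  assumes "qdet X > 0" "Im z > 0"
  shows "qj (lact A X) z = autj A (qm X z) * qj X z"
  using qj_nonzero[OF assms]
  by (cases X) (simp add: autj_def qm_def field_simps, simp add: qj_def lact_def algebra_simps)

lemma qm_lact:
  assumes "qdet X > 0" "Im z > 0"
  shows "qm (lact A X) z = moeb A (qm X z)"
proof -
  have nz: "qj X z \<noteq> 0" using qj_nonzero assms by blast
  have 1: "of_real (fst (fst X)) * z + of_real (snd (fst X)) = qm X z * qj X z" using nz by (simp add: qm_def)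
  have "of_real (fst (fst (lact A X))) * z + of_real (snd (fst (lact A X)))
      = of_real (A$1$1) * (of_real (fst (fst X)) * z + of_real (snd (fst X))) + of_real (A$1$2) * qj X z"
    by (cases X) (simp add: lact_def qj_def algebra_simps)
  also have "\<dots> = (of_real (A$1$1) * qm X z + of_real (A$1$2)) * qj X z"
    unfolding 1 by (simp add: algebra_simps)
  finally have "qm (lact A X) z = ((of_real (A$1$1) * qm X z + of_real (A$1$2)) * qj X z) / (autj A (qm X z) * qj X z)"
    unfolding qm_def[of "lact A X"] qj_lact[OF assms] by simp
  then show ?thesis using nz by (simp add: moeb_def)
qed

definition Phi :: "(complex \<Rightarrow> complex) \<Rightarrow> complex \<Rightarrow> quad \<Rightarrow> complex" where
  "Phi \<phi> z X = (if X \<in> {X. qdet X > 0}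
     then of_real (qdet X) * \<phi> (qm X z) / (qj X z)\<^sup>2 - of_real (fst (snd X)) / qj X z else 0)"

lemma Phi_rU: "Phi \<phi> z (rU t X) = Phi \<phi> (z + of_real t) X"
proof -
  have "qj (rU t X) z = qj X (z + of_real t)"
    "of_real (fst (fst (rU t X))) * z + of_real (snd (fst (rU t X)))
      = of_real (fst (fst X)) * (z + of_real t) + complex_of_real (snd (fst X))"
    "fst (snd (rU t X)) = fst (snd X)"
    by (auto simp: qj_def rU_def algebra_simps split: prod.splits)
  then show ?thesis by (simp add: Phi_def qm_def)
qed

lemma Phi_rL:
  assumes z: "Im z > 0" and X: "qdet X > 0"
  shows "Phi \<phi> z (rL 1 X) = Phi \<phi> (z / (z + 1)) X / (z + 1)\<^sup>2 - 1 / (z + 1)"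
proof -
  let ?w = "z / (z + 1)"
  have z1: "z + 1 \<noteq> 0" using z by (auto simp: complex_eq_iff)
  have j: "qj (rL 1 X) z = (z + 1) * qj X ?w"
    using z1 by (auto simp: qj_def rL_def field_simps split: prod.splits)
  have qm: "qm (rL 1 X) z = qm X ?w"
    unfolding qm_def j using z1
    by (cases "qj X ?w = 0") (auto simp: rL_def field_simps split: prod.splits)
  have c: "fst (snd (rL 1 X)) = fst (snd X) + snd (snd X)" by (auto simp: rL_def split: prod.splits)
  have "qj (rL 1 X) z \<noteq> 0" using qj_nonzero[of "rL 1 X" z] z X by simp
  then have nz: "qj X ?w \<noteq> 0" using j by auto
  have e: "complex_of_real (fst (snd X) + snd (snd X)) * (z + 1) = of_real (fst (snd X)) + (z + 1) * qj X ?w"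
    using z1 by (simp add: qj_def field_simps)
  have "complex_of_real (fst (snd X) + snd (snd X)) / ((z + 1) * qj X ?w)
      = complex_of_real (fst (snd X) + snd (snd X)) * (z + 1) / ((z + 1) * qj X ?w * (z + 1))"
    using z1 nz by simp
  also have "\<dots> = of_real (fst (snd X)) / qj X ?w / (z + 1)\<^sup>2 + 1 / (z + 1)"
    unfolding e using z1 nz by (simp add: divide_simps power2_eq_square)
  finally have "complex_of_real (fst (snd X) + snd (snd X)) / ((z + 1) * qj X ?w)
      = of_real (fst (snd X)) / qj X ?w / (z + 1)\<^sup>2 + 1 / (z + 1)" .
  then show ?thesis using X unfolding Phi_def qm j c
    by (simp add: power_mult_distrib diff_divide_distrib mult.commute)
qed

lemma qsq_norm: "qsq X = (norm X)\<^sup>2"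
  by (cases X) (auto simp: qsq_def norm_Pair)

definition cset :: "real \<Rightarrow> quad set" where
  "cset T = {X. 1 \<le> qdet X \<and> qdet X \<le> 2 \<and> qsq X \<le> T}"

lemma continuous_qdet [continuous_intros]: "continuous_on S qdet"
  and continuous_qsq [continuous_intros]: "continuous_on S qsq"
  unfolding qdet_def[abs_def] qsq_def[abs_def] by (intro continuous_intros)+

lemma compact_cset: "compact (cset T)"
proof -
  have "closed (cset T)" unfolding cset_def
    by (intro closed_Collect_conj closed_Collect_le continuous_intros)
  moreover have "bounded (cset T)"
    unfolding bounded_iff
  proof (intro exI[of _ "sqrt T"] ballI)
    fix X assume "X \<in> cset T"
    then have "(norm X)\<^sup>2 \<le> T" by (simp add: cset_def qsq_norm)
    then show "norm X \<le> sqrt T" by (rule real_le_rsqrt)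
  qed
  ultimately show ?thesis by (simp add: compact_eq_bounded_closed)
qed

lemma cset_not_null:
  assumes "T \<ge> 4" shows "cset T \<notin> null_sets lborel"
proof
  assume n: "cset T \<in> null_sets lborel"
  define W where "W = {X. 1 < qdet X \<and> qdet X < 2 \<and> qsq X < T}"
  have "open W" unfolding W_def by (intro open_Collect_conj open_Collect_less continuous_intros)
  moreover have "((sqrt (3/2), 0), (0, sqrt (3/2))) \<in> W"
    using assms by (simp add: W_def qdet_def qsq_def)
  ultimately have "\<not> negligible W" using open_not_negligible by blast
  moreover have "W \<subseteq> cset T" by (auto simp: W_def cset_def)
  moreover have "negligible (cset T)"
    using n null_sets_completionI unfolding negligible_iff_null_sets by blast
  ultimately show False using negligible_subset by blast
qed

lemma Phi_measurable:
  assumes "\<phi> holomorphic_on uhp" "Im z > 0"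
  shows "Phi \<phi> z \<in> borel_measurable borel"
  unfolding Phi_def[abs_def]
proof (rule borel_measurable_continuous_on_if)
  show "{X. 0 < qdet X} \<in> sets borel"
    by (intro borel_open open_Collect_less continuous_intros)
  show "continuous_on {X. 0 < qdet X} (\<lambda>X. of_real (qdet X) * \<phi> (qm X z) / (qj X z)\<^sup>2 - of_real (fst (snd X)) / qj X z)"
  proof -
    have nz: "\<forall>X\<in>{X. 0 < qdet X}. qj X z \<noteq> 0" using qj_nonzero assms(2) by simp
    have j: "continuous_on {X. 0 < qdet X} (\<lambda>X. qj X z)" unfolding qj_def by (intro continuous_intros)
    have m: "continuous_on {X. 0 < qdet X} (\<lambda>X. qm X z)" unfolding qm_def by (intro continuous_intros j nz)
    have "continuous_on {X. 0 < qdet X} (\<lambda>X. \<phi> (qm X z))"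
      by (rule continuous_on_compose2[OF holomorphic_on_imp_continuous_on[OF assms(1)] m])
        (use Im_qm_pos assms(2) in auto)
    then show ?thesis using nz by (intro continuous_intros j) auto
  qed
qed simp

lemma Phi_bounded:
  assumes "\<phi> holomorphic_on uhp" "compact K" "K \<subseteq> uhp"
  obtains B where "\<And>z X. z \<in> K \<Longrightarrow> X \<in> cset T \<Longrightarrow> norm (Phi \<phi> z X) \<le> B"
proof -
  let ?P = "K \<times> cset T"
  have pos: "0 < qdet (snd p)" "Im (fst p) > 0" if "p \<in> ?P" for p
    using that assms(3) by (auto simp: cset_def)
  have nz: "\<forall>p\<in>?P. qj (snd p) (fst p) \<noteq> 0" using qj_nonzero pos by simp
  have j: "continuous_on ?P (\<lambda>p. qj (snd p) (fst p))" unfolding qj_def by (intro continuous_intros)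
  have m: "continuous_on ?P (\<lambda>p. qm (snd p) (fst p))" unfolding qm_def by (intro continuous_intros j nz)
  have d: "continuous_on ?P (\<lambda>p. qdet (snd p))" unfolding qdet_def by (intro continuous_intros)
  have "continuous_on ?P (\<lambda>p. \<phi> (qm (snd p) (fst p)))"
    by (rule continuous_on_compose2[OF holomorphic_on_imp_continuous_on[OF assms(1)] m])
      (use Im_qm_pos pos in auto)
  then have "continuous_on ?P (\<lambda>p. of_real (qdet (snd p)) * \<phi> (qm (snd p) (fst p)) / (qj (snd p) (fst p))\<^sup>2
      - of_real (fst (snd (snd p))) / qj (snd p) (fst p))"
    using nz by (intro continuous_intros j d) auto
  then have "continuous_on ?P (\<lambda>p. Phi \<phi> (fst p) (snd p))"
    by (rule continuous_on_eq) (use pos in \<open>simp add: Phi_def\<close>)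
  then have "compact ((\<lambda>p. Phi \<phi> (fst p) (snd p)) ` ?P)"
    by (rule compact_continuous_image) (intro compact_Times assms compact_cset)
  then have "bounded ((\<lambda>p. Phi \<phi> (fst p) (snd p)) ` ?P)" by (rule compact_imp_bounded)
  then obtain B where B: "\<forall>y\<in>(\<lambda>p. Phi \<phi> (fst p) (snd p)) ` ?P. norm y \<le> B"
    unfolding bounded_iff by (rule exE)
  show thesis
  proof (rule that[of B])
    fix z X assume "z \<in> K" "X \<in> cset T"
    then have "(z, X) \<in> ?P" by simp
    then have "Phi \<phi> (fst (z, X)) (snd (z, X)) \<in> (\<lambda>p. Phi \<phi> (fst p) (snd p)) ` ?P" by (rule imageI)
    from bspec[OF B this] show "norm (Phi \<phi> z X) \<le> B" by simp
  qed
qed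

lemma Phi_holomorphic:
  assumes "\<phi> holomorphic_on uhp"
  shows "(\<lambda>z. Phi \<phi> z X) holomorphic_on uhp"
proof (cases "qdet X > 0")
  case True
  have nz: "\<And>z. z \<in> uhp \<Longrightarrow> qj X z \<noteq> 0" using qj_nonzero True by simp
  have j: "qj X holomorphic_on uhp" unfolding qj_def[abs_def] by (intro holomorphic_intros)
  have m: "qm X holomorphic_on uhp" unfolding qm_def[abs_def] by (intro holomorphic_intros j nz)
  have "(\<lambda>z. \<phi> (qm X z)) holomorphic_on uhp"
  proof -
    have "qm X ` uhp \<subseteq> uhp" using Im_qm_pos[OF True] by (simp add: image_subset_iff)
    then show ?thesis using holomorphic_on_compose_gen[OF m assms] by (simp add: o_def)
  qed
  then have "(\<lambda>z. of_real (qdet X) * \<phi> (qm X z) / (qj X z)\<^sup>2 - of_real (fst (snd X)) / qj X z) holomorphic_on uhp"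
    using nz by (intro holomorphic_intros j) auto
  then show ?thesis using True by (simp add: Phi_def[abs_def])
next
  case False
  then show ?thesis by (simp add: Phi_def[abs_def])
qed

text \<open>A quantitative form of the Cauchy-Riemann equation, uniform over a bounded family.\<close>

lemma CR_estimate:
  fixes f :: "complex \<Rightarrow> complex"
  assumes hol: "f holomorphic_on S" and S: "open S" "cball z0 (2 * r) \<subseteq> S" and r: "r > 0"
    and B: "\<And>w. w \<in> cball z0 (2 * r) \<Longrightarrow> norm (f w) \<le> B" and h: "\<bar>h\<bar> \<le> r"
  shows "norm (f (z0 + \<i> * of_real h) - f z0 - \<i> * (f (z0 + of_real h) - f z0)) \<le> 4 * (B + 1) / r\<^sup>2 * h\<^sup>2"
proof -
  define C where "C = 2 * (B + 1) / r\<^sup>2"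
  have sub: "cball w r \<subseteq> cball z0 (2 * r)" if "w \<in> cball z0 r" for w
  proof
    fix y assume "y \<in> cball w r"
    then show "y \<in> cball z0 (2 * r)" using that dist_triangle[of z0 y w] by simp
  qed
  have 2: "norm ((deriv ^^ 2) f w) \<le> C" if w: "w \<in> cball z0 r" for w
  proof -
    have s: "cball w r \<subseteq> S" using sub[OF w] S(2) by (rule order_trans)
    have "norm ((deriv ^^ 2) f w) \<le> fact 2 * (B + 1) / r ^ 2"
    proof (rule Cauchy_higher_deriv_bound[where y = 0])
      show "f holomorphic_on ball w r" by (rule holomorphic_on_subset[OF hol order_trans[OF ball_subset_cball s]])
      show "continuous_on (cball w r) f"
        by (rule holomorphic_on_imp_continuous_on[OF holomorphic_on_subset[OF hol s]])
      show "f y \<in> ball 0 (B + 1)" if "y \<in> ball w r" for y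
      proof -
        have "y \<in> cball z0 (2 * r)" using that by (intro subsetD[OF sub[OF w]]) simp
        then show ?thesis using B[of y] by simp
      qed
    qed (use r in auto)
    then show ?thesis by (simp add: C_def)
  qed
  have T: "norm (f z - f z0 - deriv f z0 * (z - z0)) \<le> C * norm (z - z0) ^ 2" if z: "z \<in> cball z0 r" for z
  proof -
    have "norm ((deriv ^^ 0) f z - (\<Sum>i\<le>1. (deriv ^^ i) f z0 * (z - z0) ^ i / fact i)) \<le> C * norm (z - z0) ^ Suc 1 / fact 1"
    proof (rule complex_Taylor[of "cball z0 r"])
      fix i x assume x: "x \<in> cball z0 r" "i \<le> (1::nat)"
      have "x \<in> cball z0 (2 * r)" using x(1) r by simp
      then have "x \<in> S" using S(2) by (rule subsetD[rotated])
      then have "((deriv ^^ i) f has_field_derivative deriv ((deriv ^^ i) f) x) (at x)"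
        using holomorphic_higher_deriv[OF hol S(1)] S(1) by (intro holomorphic_derivI) auto
      then show "((deriv ^^ i) f has_field_derivative (deriv ^^ Suc i) f x) (at x within cball z0 r)"
        by (simp add: has_field_derivative_at_within)
    next
      fix x assume "x \<in> cball z0 r"
      then show "norm ((deriv ^^ Suc 1) f x) \<le> C" using 2 by (simp add: numeral_2_eq_2)
    qed (use z r in auto)
    then show ?thesis by (simp add: numeral_2_eq_2 algebra_simps)
  qed
  have t1: "norm (f (z0 + \<i> * of_real h) - f z0 - deriv f z0 * (\<i> * of_real h)) \<le> C * h\<^sup>2"
    using T[of "z0 + \<i> * of_real h"] h by (simp add: dist_norm norm_mult)
  have t2: "norm (f (z0 + of_real h) - f z0 - deriv f z0 * of_real h) \<le> C * h\<^sup>2"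
    using T[of "z0 + of_real h"] h by (simp add: dist_norm)
  have "f (z0 + \<i> * of_real h) - f z0 - \<i> * (f (z0 + of_real h) - f z0)
     = (f (z0 + \<i> * of_real h) - f z0 - deriv f z0 * (\<i> * of_real h)) - \<i> * (f (z0 + of_real h) - f z0 - deriv f z0 * of_real h)"
    by (simp add: algebra_simps)
  then have "norm (f (z0 + \<i> * of_real h) - f z0 - \<i> * (f (z0 + of_real h) - f z0))
     \<le> norm (f (z0 + \<i> * of_real h) - f z0 - deriv f z0 * (\<i> * of_real h)) + norm (\<i> * (f (z0 + of_real h) - f z0 - deriv f z0 * of_real h))"
    by (simp only: norm_triangle_ineq4)
  also have "norm (\<i> * (f (z0 + of_real h) - f z0 - deriv f z0 * of_real h)) = norm (f (z0 + of_real h) - f z0 - deriv f z0 * of_real h)"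
    by (simp add: norm_mult)
  finally have "norm (f (z0 + \<i> * of_real h) - f z0 - \<i> * (f (z0 + of_real h) - f z0)) \<le> C * h\<^sup>2 + C * h\<^sup>2"
    using t1 t2 by linarith
  moreover have "4 * (B + 1) / r\<^sup>2 = 2 * C" by (simp add: C_def)
  ultimately show ?thesis by simp
qed

context cocompact_group
begin

lemma cset_reach:
  obtains T where "T \<ge> 4" "\<And>X. 1 \<le> qdet X \<Longrightarrow> qdet X \<le> 2 \<Longrightarrow> \<exists>A\<in>G. lact A X \<in> cset T"
proof -
  obtain R where R: "R \<ge> 1" "\<And>z. Im z > 0 \<Longrightarrow> \<exists>A\<in>G. Im (moeb A z) \<ge> 1 / R \<and> norm (moeb A z) \<le> R"
    using cocompact by blast
  define T where "T = 2 * R + R\<^sup>2 * (2 * R)"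
  show thesis
  proof (rule that[of T])
    have "R\<^sup>2 \<ge> 1" using R(1) by simp
    then have "R\<^sup>2 * (2 * R) \<ge> 1 * (2 * 1)" using R(1) by (intro mult_mono) auto
    then show "T \<ge> 4" using R(1) by (simp add: T_def)
  next
    fix X assume X: "1 \<le> qdet X" "qdet X \<le> 2"
    then have pos: "qdet X > 0" by simp
    have "Im (qm X \<i>) > 0" using Im_qm_pos[OF pos, of \<i>] by simp
    then obtain A where A: "A \<in> G" "Im (moeb A (qm X \<i>)) \<ge> 1 / R" "norm (moeb A (qm X \<i>)) \<le> R"
      using R(2) by blast
    define Y where "Y = lact A X"
    have dY: "qdet Y = qdet X" using G_det[OF A(1)] by (simp add: Y_def qdet_lact)
    have w: "qm Y \<i> = moeb A (qm X \<i>)" unfolding Y_def by (rule qm_lact) (use pos in auto)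
    have n: "(norm (qj Y \<i>))\<^sup>2 = (fst (snd Y))\<^sup>2 + (snd (snd Y))\<^sup>2" by (simp add: qj_def cmod_power2)
    have nz: "qj Y \<i> \<noteq> 0" using qj_nonzero[of Y \<i>] dY pos by simp
    have "1 / R \<le> qdet X / (norm (qj Y \<i>))\<^sup>2" using A(2) Im_qm[of Y \<i>] dY w by simp
    then have "(norm (qj Y \<i>))\<^sup>2 \<le> qdet X * R" using R(1) nz by (simp add: field_simps)
    also have "\<dots> \<le> 2 * R" using X R(1) by (intro mult_right_mono) auto
    finally have 1: "(norm (qj Y \<i>))\<^sup>2 \<le> 2 * R" .
    have "of_real (fst (fst Y)) * \<i> + of_real (snd (fst Y)) = qm Y \<i> * qj Y \<i>" using nz by (simp add: qm_def)
    then have "(norm (qm Y \<i>))\<^sup>2 * (norm (qj Y \<i>))\<^sup>2 = (norm (of_real (fst (fst Y)) * \<i> + complex_of_real (snd (fst Y))))\<^sup>2"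
      by (simp add: norm_mult power_mult_distrib)
    also have "\<dots> = (fst (fst Y))\<^sup>2 + (snd (fst Y))\<^sup>2" by (simp add: cmod_power2)
    finally have 2: "(norm (qm Y \<i>))\<^sup>2 * (norm (qj Y \<i>))\<^sup>2 = (fst (fst Y))\<^sup>2 + (snd (fst Y))\<^sup>2" .
    have "(norm (qm Y \<i>))\<^sup>2 * (norm (qj Y \<i>))\<^sup>2 \<le> R\<^sup>2 * (2 * R)"
      using A(3) 1 w R(1) by (intro mult_mono power_mono) auto
    then have "qsq Y \<le> T" using 1 2 n by (simp add: qsq_def T_def)
    then show "\<exists>A\<in>G. lact A X \<in> cset T" using A(1) X dY by (intro bexI[of _ A]) (auto simp: cset_def Y_def)
  qed
qed

lemma finite_lact_cset:
  assumes "qdet X \<ge> 1" shows "finite {A \<in> G. lact A X \<in> cset T}"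
proof (rule finite_subset[OF _ finite_frob_le[of "4 * (T * qsq X)"]], rule subsetI)
  fix A assume "A \<in> {A \<in> G. lact A X \<in> cset T}"
  then have A: "A \<in> G" "qsq (lact A X) \<le> T" by (auto simp: cset_def)
  define a b c d where "a = fst (fst X)" "b = snd (fst X)" "c = fst (snd X)" "d = snd (snd X)"
  define a' b' c' d' where "a' = fst (fst (lact A X))" "b' = snd (fst (lact A X))" "c' = fst (snd (lact A X))" "d' = snd (snd (lact A X))"
  have D: "qdet X = a * d - b * c" by (simp add: qdet_def a_b_c_d_def)
  have q: "qsq X = a\<^sup>2 + b\<^sup>2 + c\<^sup>2 + d\<^sup>2" by (simp add: qsq_def a_b_c_d_def)
  have q': "a'\<^sup>2 + b'\<^sup>2 + c'\<^sup>2 + d'\<^sup>2 \<le> T" using A(2) by (simp add: qsq_def a'_b'_c'_d'_def)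
  have l: "a' = A$1$1 * a + A$1$2 * c" "b' = A$1$1 * b + A$1$2 * d" "c' = A$2$1 * a + A$2$2 * c" "d' = A$2$1 * b + A$2$2 * d"
    unfolding a'_b'_c'_d'_def a_b_c_d_def by (cases X; simp add: lact_def)+
  have bd: "x\<^sup>2 \<le> T * qsq X" if e: "x * qdet X = p * u - r * v" and pr: "p\<^sup>2 + r\<^sup>2 \<le> T" and uv: "u\<^sup>2 + v\<^sup>2 \<le> qsq X" for x p u r v
  proof -
    have "x\<^sup>2 * 1 \<le> x\<^sup>2 * (qdet X)\<^sup>2" using assms by (intro mult_left_mono) auto
    also have "\<dots> = (p * u - r * v)\<^sup>2" using e by (metis power_mult_distrib)
    also have "\<dots> \<le> (p\<^sup>2 + r\<^sup>2) * (u\<^sup>2 + v\<^sup>2)"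
    proof -
      have "(p\<^sup>2 + r\<^sup>2) * (u\<^sup>2 + v\<^sup>2) = (p * u - r * v)\<^sup>2 + (p * v + r * u)\<^sup>2"
        by (simp add: power2_eq_square algebra_simps)
      then show ?thesis by simp
    qed
    also have "\<dots> \<le> T * qsq X" using pr uv by (intro mult_mono) (auto intro: order_trans[OF _ pr])
    finally show ?thesis by simp
  qed
  have ss: "a'\<^sup>2 + b'\<^sup>2 \<le> T" "b'\<^sup>2 + a'\<^sup>2 \<le> T" "c'\<^sup>2 + d'\<^sup>2 \<le> T" "d'\<^sup>2 + c'\<^sup>2 \<le> T"
    "d\<^sup>2 + c\<^sup>2 \<le> qsq X" "a\<^sup>2 + b\<^sup>2 \<le> qsq X"
    using q' zero_le_power2[of a'] zero_le_power2[of b'] zero_le_power2[of c'] zero_le_power2[of d']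
      zero_le_power2[of a] zero_le_power2[of b] zero_le_power2[of c] zero_le_power2[of d] unfolding q by linarith+
  have "(A$1$1)\<^sup>2 \<le> T * qsq X" by (rule bd[of _ a' d b' c]) (use ss in \<open>simp_all add: l D algebra_simps\<close>)
  moreover have "(A$1$2)\<^sup>2 \<le> T * qsq X" by (rule bd[of _ b' a a' b]) (use ss in \<open>simp_all add: l D algebra_simps\<close>)
  moreover have "(A$2$1)\<^sup>2 \<le> T * qsq X" by (rule bd[of _ c' d d' c]) (use ss in \<open>simp_all add: l D algebra_simps\<close>)
  moreover have "(A$2$2)\<^sup>2 \<le> T * qsq X" by (rule bd[of _ d' a c' b]) (use ss in \<open>simp_all add: l D algebra_simps\<close>)
  ultimately show "A \<in> {A \<in> G. frob A \<le> 4 * (T * qsq X)}" using A(1) by (simp add: frob_def)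
qed

lemma infinite_G: "infinite G"
proof
  assume "finite G"
  then have f: "finite ((\<lambda>A. (A$2$1)\<^sup>2 + (A$2$2)\<^sup>2) ` G)" by simp
  obtain A where A: "A \<in> G" "(A$2$1)\<^sup>2 + (A$2$2)\<^sup>2 > Max ((\<lambda>A. (A$2$1)\<^sup>2 + (A$2$2)\<^sup>2) ` G)"
    by (rule unbounded_rows)
  then show False using Max_ge[OF f, of "(A$2$1)\<^sup>2 + (A$2$2)\<^sup>2"] by auto
qed

definition ginv :: "real^2^2 \<Rightarrow> real^2^2" where
  "ginv A = (SOME B. B \<in> G \<and> A ** B = mat 1 \<and> B ** A = mat 1)"

lemma ginv: assumes "A \<in> G" shows "ginv A \<in> G" "A ** ginv A = mat 1" "ginv A ** A = mat 1"
proof -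
  have "\<exists>B. B \<in> G \<and> A ** B = mat 1 \<and> B ** A = mat 1" using G_inv[OF assms] by metis
  from someI_ex[OF this] show "ginv A \<in> G" "A ** ginv A = mat 1" "ginv A ** A = mat 1"
    by (auto simp: ginv_def)
qed

lemma ginv_ginv: assumes "A \<in> G" shows "ginv (ginv A) = A"
proof -
  have "ginv (ginv A) = (A ** ginv A) ** ginv (ginv A)" using ginv[OF assms] by simp
  also have "\<dots> = A" using ginv(2)[OF ginv(1)[OF assms]] by (simp add: matrix_mul_assoc[symmetric])
  finally show ?thesis .
qed

lemma bij_ginv: "bij_betw ginv G G"
  by (rule bij_betwI[of _ _ _ ginv]) (auto simp: ginv ginv_ginv)

definition right_invariant :: "quad measure \<Rightarrow> bool" where
  "right_invariant m \<longleftrightarrow> (\<forall>S S' f. mpres S' \<and> S \<in> borel_measurable borel \<and> (\<forall>X. S (S' X) = X) \<and>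
      (\<forall>A X. lact A (S' X) = S' (lact A X)) \<and> (\<forall>X. qdet (S' X) = qdet X) \<and>
      f \<in> borel_measurable borel \<and> (\<forall>A\<in>G. \<forall>X. f (lact A X) = f X) \<longrightarrow>
      (\<integral>\<^sup>+X. f (S X) \<partial>m) = (\<integral>\<^sup>+X. f X \<partial>m))"

text \<open>Weighting each matrix of determinant in \<open>[1, 2]\<close> by the inverse of the number of its translates
  in a compact set meeting all orbits unfolds integrals over the quotient to integrals over \<open>\<real>\<^sup>4\<close>.
  Lebesgue measure is invariant on both sides, so the right translations still preserve the mean
  of every left invariant function.\<close>

lemma invariant_mean:
  obtains m :: "quad measure" and T where
    "T \<ge> 4" "sets m = sets borel" "finite_measure m" "measure m (space m) > 0" "AE X in m. X \<in> cset T"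
    "right_invariant m"
proof -
  obtain T where T: "T \<ge> 4" "\<And>X. 1 \<le> qdet X \<Longrightarrow> qdet X \<le> 2 \<Longrightarrow> \<exists>A\<in>G. lact A X \<in> cset T"
    using cset_reach by blast
  define c :: "quad \<Rightarrow> ennreal" where "c = indicator (cset T)"
  define N where "N X = (\<integral>\<^sup>+A. c (lact A X) \<partial>count_space G)" for X
  define \<rho> where "\<rho> X = c X / N X" for X
  have lm: "lact A \<in> borel_measurable borel" if "A \<in> G" for A
    using mpresD(1)[OF mpres_lact[OF G_det[OF that]]] .
  have cs: "cset T \<in> sets borel" by (intro borel_closed compact_imp_closed compact_cset)
  have cm: "c \<in> borel_measurable borel" unfolding c_def using cs by (rule borel_measurable_indicator)
  have Nm: "N \<in> borel_measurable borel"
  proof -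
    have bij: "bij_betw (from_nat_into G) UNIV G"
      by (rule bij_betw_from_nat_into[OF countable_G infinite_G])
    have "N X = (\<Sum>i. c (lact (from_nat_into G i) X))" for X
      unfolding N_def nn_integral_bij_count_space[OF bij, symmetric] by (simp add: nn_integral_count_space_nat)
    then have N: "N = (\<lambda>X. \<Sum>i. c (lact (from_nat_into G i) X))" by (rule ext)
    have "from_nat_into G i \<in> G" for i using bij by (auto simp: bij_betw_def)
    then show ?thesis unfolding N
      by (intro borel_measurable_suminf_order measurable_compose[OF lm cm])
  qed
  have rm: "\<rho> \<in> borel_measurable borel" unfolding \<rho>_def by (intro borel_measurable_divide_ennreal cm Nm)
  have Ninv: "N (lact B X) = N X" if "B \<in> G" for B X
    unfolding N_def using nn_integral_bij_count_space[OF right_mult_bij[OF that], of "\<lambda>A. c (lact A X)"]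
    by (simp add: lact_mult)
  have N1: "N X \<ge> 1" "N X \<noteq> \<infinity>" if X: "1 \<le> qdet X" "qdet X \<le> 2" for X
  proof -
    obtain A where A: "A \<in> G" "lact A X \<in> cset T" using T(2)[OF X] by blast
    have "c (lact A X) \<le> N X" unfolding N_def by (rule nn_integral_ge_point[OF A(1)])
    then show "N X \<ge> 1" using A(2) by (simp add: c_def)
    have "N X = (\<integral>\<^sup>+A. indicator {A \<in> G. lact A X \<in> cset T} A \<partial>count_space G)"
      unfolding N_def by (intro nn_integral_cong) (auto simp: c_def indicator_def)
    also have "\<dots> = emeasure (count_space G) {A \<in> G. lact A X \<in> cset T}"
      by (rule nn_integral_indicator) simp
    also have "\<dots> = of_nat (card {A \<in> G. lact A X \<in> cset T})"
      using finite_lact_cset[OF X(1)] by (subst emeasure_count_space_finite) auto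
    finally show "N X \<noteq> \<infinity>" by simp
  qed
  have sum1: "(\<integral>\<^sup>+A. \<rho> (lact A X) \<partial>count_space G) = 1" if X: "1 \<le> qdet X" "qdet X \<le> 2" for X
  proof -
    have "(\<integral>\<^sup>+A. \<rho> (lact A X) \<partial>count_space G) = (\<integral>\<^sup>+A. c (lact A X) / N X \<partial>count_space G)"
      by (intro nn_integral_cong) (simp add: \<rho>_def Ninv)
    also have "\<dots> = N X / N X" unfolding N_def by (rule nn_integral_divide) simp
    also have "\<dots> = 1" using N1[OF X] by (intro ennreal_divide_self) (auto simp: less_top)
    finally show ?thesis .
  qed
  have supp: "1 \<le> qdet X \<and> qdet X \<le> 2" if "\<rho> X \<noteq> 0" for X
    using that by (auto simp: \<rho>_def c_def cset_def indicator_def split: if_splits)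
  define m where "m = density lborel \<rho>"
  have inv: "(\<integral>\<^sup>+X. f (S X) \<partial>m) = (\<integral>\<^sup>+X. f X \<partial>m)"
    if S': "mpres S'" and Sm: "S \<in> borel_measurable borel" and SS: "\<And>X. S (S' X) = X"
      and comm: "\<And>A X. lact A (S' X) = S' (lact A X)" and det: "\<And>X. qdet (S' X) = qdet X"
      and f: "f \<in> borel_measurable borel" and finv: "\<And>A X. A \<in> G \<Longrightarrow> f (lact A X) = f X"
    for S S' f
  proof -
    have S'm: "S' \<in> borel_measurable borel" using mpresD(1)[OF S'] .
    have fS: "(\<lambda>X. f (S X)) \<in> borel_measurable borel" using Sm f by (rule measurable_compose)
    have rS: "(\<lambda>X. \<rho> (S' X)) \<in> borel_measurable borel" using S'm rm by (rule measurable_compose)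
    have rl: "(\<lambda>X. \<rho> (lact A X)) \<in> borel_measurable borel" if "A \<in> G" for A
      using lm[OF that] rm by (rule measurable_compose)
    have rlS: "(\<lambda>X. \<rho> (lact A (S' X))) \<in> borel_measurable borel" if "A \<in> G" for A
      using S'm rl[OF that] by (rule measurable_compose)
    have "(\<integral>\<^sup>+X. f (S X) \<partial>m) = (\<integral>\<^sup>+X. \<rho> X * f (S X) \<partial>lborel)"
      unfolding m_def using rm fS by (subst nn_integral_density) auto
    also have "\<dots> = (\<integral>\<^sup>+X. \<rho> (S' X) * f X \<partial>lborel)"
      using mpresD(2)[OF S', of "\<lambda>X. \<rho> X * f (S X)"] rm fS by (simp add: SS)
    also have "\<dots> = (\<integral>\<^sup>+X. (\<integral>\<^sup>+A. \<rho> (S' X) * f X * \<rho> (lact A X) \<partial>count_space G) \<partial>lborel)"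
    proof (rule nn_integral_cong)
      fix X
      have "(\<integral>\<^sup>+A. \<rho> (S' X) * f X * \<rho> (lact A X) \<partial>count_space G)
          = \<rho> (S' X) * f X * (\<integral>\<^sup>+A. \<rho> (lact A X) \<partial>count_space G)"
        by (rule nn_integral_cmult) simp
      then show "\<rho> (S' X) * f X = (\<integral>\<^sup>+A. \<rho> (S' X) * f X * \<rho> (lact A X) \<partial>count_space G)"
        using sum1[of X] supp[of "S' X"] det[of X] by (cases "\<rho> (S' X) = 0") auto
    qed
    also have "\<dots> = (\<integral>\<^sup>+A. (\<integral>\<^sup>+X. \<rho> (S' X) * f X * \<rho> (lact A X) \<partial>lborel) \<partial>count_space G)"
      by (rule nn_integral_count_space_nn_integral[OF countable_G])
        (use rS f rl in \<open>simp add: borel_measurable_times_ennreal\<close>)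
    also have "\<dots> = (\<integral>\<^sup>+A. (\<integral>\<^sup>+X. \<rho> (lact (ginv A) (S' X)) * f X * \<rho> X \<partial>lborel) \<partial>count_space G)"
    proof (rule nn_integral_cong)
      fix A assume "A \<in> space (count_space G)"
      then have A: "A \<in> G" by simp
      have B: "ginv A \<in> G" using ginv(1)[OF A] .
      have "(\<lambda>X. \<rho> (S' X) * f X * \<rho> (lact A X)) \<in> borel_measurable borel"
        using rS f rl[OF A] by (simp add: borel_measurable_times_ennreal)
      from mpresD(2)[OF mpres_lact[OF G_det[OF B]] this]
      have "(\<integral>\<^sup>+X. \<rho> (S' X) * f X * \<rho> (lact A X) \<partial>lborel)
          = (\<integral>\<^sup>+X. \<rho> (S' (lact (ginv A) X)) * f (lact (ginv A) X) * \<rho> (lact A (lact (ginv A) X)) \<partial>lborel)"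
        by simp
      also have "\<dots> = (\<integral>\<^sup>+X. \<rho> (lact (ginv A) (S' X)) * f X * \<rho> X \<partial>lborel)"
        by (simp add: comm finv[OF B] ginv(2)[OF A] flip: lact_mult)
      finally show "(\<integral>\<^sup>+X. \<rho> (S' X) * f X * \<rho> (lact A X) \<partial>lborel)
          = (\<integral>\<^sup>+X. \<rho> (lact (ginv A) (S' X)) * f X * \<rho> X \<partial>lborel)" .
    qed
    also have "\<dots> = (\<integral>\<^sup>+A. (\<integral>\<^sup>+X. \<rho> (lact A (S' X)) * f X * \<rho> X \<partial>lborel) \<partial>count_space G)"
      by (rule nn_integral_bij_count_space[OF bij_ginv])
    also have "\<dots> = (\<integral>\<^sup>+X. (\<integral>\<^sup>+A. \<rho> (lact A (S' X)) * f X * \<rho> X \<partial>count_space G) \<partial>lborel)"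
      by (rule nn_integral_count_space_nn_integral[OF countable_G, symmetric])
        (use rlS f rm in \<open>simp add: borel_measurable_times_ennreal\<close>)
    also have "\<dots> = (\<integral>\<^sup>+X. \<rho> X * f X \<partial>lborel)"
    proof (rule nn_integral_cong)
      fix X
      have "(\<integral>\<^sup>+A. \<rho> (lact A (S' X)) * f X * \<rho> X \<partial>count_space G)
          = (\<integral>\<^sup>+A. \<rho> (lact A (S' X)) * (f X * \<rho> X) \<partial>count_space G)"
        by (simp add: mult.assoc)
      also have "\<dots> = (\<integral>\<^sup>+A. \<rho> (lact A (S' X)) \<partial>count_space G) * (f X * \<rho> X)"
        by (rule nn_integral_multc) simp
      finally show "(\<integral>\<^sup>+A. \<rho> (lact A (S' X)) * f X * \<rho> X \<partial>count_space G) = \<rho> X * f X"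
        using sum1[of "S' X"] supp[of X] det[of X] by (cases "\<rho> X = 0") (auto simp: mult.commute)
    qed
    also have "\<dots> = (\<integral>\<^sup>+X. f X \<partial>m)"
      unfolding m_def using rm f by (subst nn_integral_density) auto
    finally show ?thesis .
  qed
  have mass: "emeasure m (space m) = (\<integral>\<^sup>+X. \<rho> X \<partial>lborel)"
    unfolding m_def using rm by (subst emeasure_density) auto
  have "(\<integral>\<^sup>+X. \<rho> X \<partial>lborel) \<le> (\<integral>\<^sup>+X. c X \<partial>lborel)"
  proof (rule nn_integral_mono)
    fix X show "\<rho> X \<le> c X"
    proof (cases "X \<in> cset T")
      case True
      then have "N X \<ge> 1" using N1 by (simp add: cset_def)
      then show ?thesis using True unfolding \<rho>_def c_def
        by (intro divide_le_posI_ennreal) (auto intro: less_le_trans[of 0 1])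
    qed (simp add: \<rho>_def c_def)
  qed
  also have "\<dots> = emeasure lborel (cset T)" unfolding c_def using cs by (subst nn_integral_indicator) auto
  also have "\<dots> < \<infinity>" by (rule emeasure_bounded_finite[OF compact_imp_bounded[OF compact_cset]])
  finally have fin: "emeasure m (space m) \<noteq> \<infinity>" using mass by simp
  have fm: "finite_measure m" by (rule finite_measureI) (use fin in simp)
  have pos: "emeasure m (space m) \<noteq> 0"
  proof
    assume "emeasure m (space m) = 0"
    then have "AE X in lborel. \<rho> X = 0" using mass rm by (simp add: nn_integral_0_iff_AE)
    then have "AE X in lborel. X \<notin> cset T"
    proof (rule AE_mp, intro AE_I2 impI notI)
      fix X assume z: "\<rho> X = 0" and X: "X \<in> cset T"
      then have "N X \<noteq> \<infinity>" using N1 by (simp add: cset_def)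
      then show False using z X by (simp add: \<rho>_def c_def ennreal_divide_eq_0_iff)
    qed
    then have "cset T \<in> null_sets lborel" using cs by (subst (asm) AE_iff_null_sets[symmetric]) auto
    then show False using cset_not_null[OF T(1)] by simp
  qed
  show thesis
  proof (rule that[OF T(1) _ fm])
    show "sets m = sets borel" by (simp add: m_def)
    show "measure m (space m) > 0" using fin pos by (simp add: measure_def enn2real_positive_iff less_top zero_less_iff_neq_zero)
    have "AE X in lborel. 0 < \<rho> X \<longrightarrow> X \<in> cset T"
      by (rule AE_I2) (auto simp: \<rho>_def c_def indicator_def split: if_splits)
    then show "AE X in m. X \<in> cset T" unfolding m_def using rm by (subst AE_density) auto
    show "right_invariant m" unfolding right_invariant_def
    proof (intro allI impI, elim conjE)
      fix S S' and f :: "quad \<Rightarrow> ennreal"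
      assume a: "mpres S'" "S \<in> borel_measurable borel" "\<forall>X. S (S' X) = X" "\<forall>A X. lact A (S' X) = S' (lact A X)"
        "\<forall>X. qdet (S' X) = qdet X" "f \<in> borel_measurable borel" "\<forall>A\<in>G. \<forall>X. f (lact A X) = f X"
      show "(\<integral>\<^sup>+X. f (S X) \<partial>m) = (\<integral>\<^sup>+X. f X \<partial>m)"
        by (rule inv[OF a(1,2) a(3)[rule_format] a(4)[rule_format] a(5)[rule_format] a(6) a(7)[rule_format]])
    qed
  qed
qed

end

context cocompact_group
begin

lemma Phi_lact:
  assumes tr: "\<And>A z. A \<in> G \<Longrightarrow> Im z > 0 \<Longrightarrow> \<phi> (moeb A z) = autj A z ^ 2 * \<phi> z + of_real (A$2$1) * autj A z"
    and A: "A \<in> G" and z: "Im z > 0"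
  shows "Phi \<phi> z (lact A X) = Phi \<phi> z X"
proof (cases "qdet X > 0")
  case True
  have d: "det A = 1" using G_det[OF A] .
  let ?w = "qm X z"
  have w: "Im ?w > 0" using Im_qm_pos[OF True z] .
  have nz: "autj A ?w \<noteq> 0" "qj X z \<noteq> 0" using autj_nonzero[OF d w] qj_nonzero[OF True z] by auto
  have c: "of_real (fst (snd (lact A X))) * qj X z = of_real (A$2$1) * of_real (qdet X) + of_real (fst (snd X)) * (autj A ?w * qj X z)"
    unfolding qj_lact[OF True z, symmetric]
    by (cases X) (simp add: lact_def qj_def qdet_def algebra_simps)
  have c': "of_real (fst (snd (lact A X))) / (autj A ?w * qj X z)
      = of_real (A$2$1) * of_real (qdet X) / (autj A ?w * (qj X z)\<^sup>2) + of_real (fst (snd X)) / qj X z"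
  proof -
    have "of_real (fst (snd (lact A X))) / (autj A ?w * qj X z) = of_real (fst (snd (lact A X))) * qj X z / (autj A ?w * (qj X z)\<^sup>2)"
      using nz by (simp add: power2_eq_square)
    also have "\<dots> = of_real (A$2$1) * of_real (qdet X) / (autj A ?w * (qj X z)\<^sup>2) + of_real (fst (snd X)) / qj X z"
      unfolding c using nz by (simp add: add_divide_distrib power2_eq_square)
    finally show ?thesis .
  qed
  have "of_real (qdet X) * \<phi> (moeb A ?w) / (autj A ?w * qj X z)\<^sup>2
      = of_real (qdet X) * \<phi> ?w / (qj X z)\<^sup>2 + of_real (A$2$1) * of_real (qdet X) / (autj A ?w * (qj X z)\<^sup>2)"
    unfolding tr[OF A w] using nz by (simp add: field_simps power2_eq_square)
  note main = this
  have dl: "qdet (lact A X) = qdet X" using d by (simp add: qdet_lact)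
  have "Phi \<phi> z (lact A X) = of_real (qdet X) * \<phi> (moeb A ?w) / (autj A ?w * qj X z)\<^sup>2
      - of_real (fst (snd (lact A X))) / (autj A ?w * qj X z)"
    using True unfolding Phi_def dl qm_lact[OF True z] qj_lact[OF True z] mem_Collect_eq by (simp only: if_True)
  also have "\<dots> = of_real (qdet X) * \<phi> ?w / (qj X z)\<^sup>2 - of_real (fst (snd X)) / qj X z"
  proof -
    have "(p + q) - (q + r) = p - r" for p q r :: complex by simp
    then show ?thesis unfolding main c' .
  qed
  also have "\<dots> = Phi \<phi> z X" using True unfolding Phi_def mem_Collect_eq by (simp only: if_True)
  finally show ?thesis .
next
  case False
  then show ?thesis using G_det[OF A] by (simp add: Phi_def qdet_lact)
qed

text \<open>There is no holomorphic quasimodular form \<open>\<phi>\<close> of weight 2 with \<open>\<delta> \<phi> = 1\<close>.  Averaging the translates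
  \<open>\<phi> | X\<close> with the invariant mean would give a holomorphic function that transforms like \<open>\<phi>\<close> under all
  of \<open>SL(2,\<real>)\<close>; invariance under translations makes it constant, and a constant does not have
  the required behaviour under the lower triangular matrices.\<close>

theorem no_holomorphic_weight2:
  assumes hol: "\<phi> holomorphic_on uhp"
    and tr: "\<And>A z. A \<in> G \<Longrightarrow> Im z > 0 \<Longrightarrow> \<phi> (moeb A z) = autj A z ^ 2 * \<phi> z + of_real (A$2$1) * autj A z"
  shows False
proof -
  obtain m :: "quad measure" and T where
    T: "T \<ge> 4" and sets: "sets m = sets borel" and fin: "finite_measure m" and pos: "measure m (space m) > 0"
    and supp: "AE X in m. X \<in> cset T"
    and ri: "right_invariant m"
    by (rule invariant_mean)
  have inv: "(\<integral>\<^sup>+X. f (S X) \<partial>m) = (\<integral>\<^sup>+X. f X \<partial>m)"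
    if "mpres S'" "S \<in> borel_measurable borel" "\<And>X. S (S' X) = X"
      "\<And>A X. lact A (S' X) = S' (lact A X)" "\<And>X. qdet (S' X) = qdet X"
      "f \<in> borel_measurable borel" "\<And>A X. A \<in> G \<Longrightarrow> f (lact A X) = f X" for S S' f
    by (rule ri[unfolded right_invariant_def, rule_format, of S' S f]) (intro conjI allI ballI that)
  interpret finite_measure m by (rule fin)
  define M where "M = measure m (space m)"
  define e where "e z = (\<integral>X. Phi \<phi> z X \<partial>m)" for z
  have bm: "f \<in> borel_measurable m \<longleftrightarrow> f \<in> borel_measurable borel" for f :: "quad \<Rightarrow> complex"
    unfolding measurable_cong_sets[OF sets refl] ..
  have bmr: "f \<in> borel_measurable m \<longleftrightarrow> f \<in> borel_measurable borel" for f :: "quad \<Rightarrow> real"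
    unfolding measurable_cong_sets[OF sets refl] ..
  have meas: "Phi \<phi> z \<in> borel_measurable m" if "Im z > 0" for z
    using Phi_measurable[OF hol that] by (simp only: bm)
  have int: "integrable m (Phi \<phi> z)" if z: "Im z > 0" for z
  proof -
    have "compact {z}" "{z} \<subseteq> uhp" using z by auto
    then obtain B where B: "\<And>w X. w \<in> {z} \<Longrightarrow> X \<in> cset T \<Longrightarrow> norm (Phi \<phi> w X) \<le> B"
      using Phi_bounded[OF hol \<open>compact {z}\<close> \<open>{z} \<subseteq> uhp\<close>, of T] by metis
    show ?thesis
    proof (rule integrable_const_bound[of _ B])
      show "AE X in m. norm (Phi \<phi> z X) \<le> B" using supp by eventually_elim (use B in auto)
    qed (rule meas[OF z])
  qed
  have real_inv: "(\<integral>X. g (S X) \<partial>m) = (\<integral>X. g X \<partial>m)"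
    if S: "mpres S'" "S \<in> borel_measurable borel" "\<And>X. S (S' X) = X" "\<And>A X. lact A (S' X) = S' (lact A X)"
      "\<And>X. qdet (S' X) = qdet X"
      and g: "g \<in> borel_measurable borel" "\<And>A X. A \<in> G \<Longrightarrow> g (lact A X) = g X" "integrable m g" "integrable m (\<lambda>X. g (S X))"
    for S S' and g :: "quad \<Rightarrow> real"
  proof -
    have "(\<integral>\<^sup>+X. ennreal (g (S X)) \<partial>m) = (\<integral>\<^sup>+X. ennreal (g X) \<partial>m)"
      by (rule inv[OF S]) (use g in auto)
    moreover have "(\<integral>\<^sup>+X. ennreal (- g (S X)) \<partial>m) = (\<integral>\<^sup>+X. ennreal (- g X) \<partial>m)"
      by (rule inv[OF S]) (use g in auto)
    ultimately show ?thesis using g(3,4) by (simp add: real_lebesgue_integral_def)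
  qed
  have cinv: "(\<integral>X. Phi \<phi> z (S X) \<partial>m) = e z"
    if S: "mpres S'" "S \<in> borel_measurable borel" "\<And>X. S (S' X) = X" "\<And>A X. lact A (S' X) = S' (lact A X)"
      "\<And>X. qdet (S' X) = qdet X" and z: "Im z > 0" and iS: "integrable m (\<lambda>X. Phi \<phi> z (S X))" for S S' z
  proof (rule complex_eqI)
    have Pm: "Phi \<phi> z \<in> borel_measurable borel" by (rule Phi_measurable[OF hol z])
    have "(\<integral>X. Re (Phi \<phi> z (S X)) \<partial>m) = (\<integral>X. Re (Phi \<phi> z X) \<partial>m)"
      by (rule real_inv[OF S]) (use Pm int[OF z] iS Phi_lact[OF tr _ z] in auto)
    then show "Re (\<integral>X. Phi \<phi> z (S X) \<partial>m) = Re (e z)" using int[OF z] iS by (simp add: e_def)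
    have "(\<integral>X. Im (Phi \<phi> z (S X)) \<partial>m) = (\<integral>X. Im (Phi \<phi> z X) \<partial>m)"
      by (rule real_inv[OF S]) (use Pm int[OF z] iS Phi_lact[OF tr _ z] in auto)
    then show "Im (\<integral>X. Phi \<phi> z (S X) \<partial>m) = Im (e z)" using int[OF z] iS by (simp add: e_def)
  qed
  have hor: "e (z + of_real t) = e z" if z: "Im z > 0" for z t
  proof -
    have "(\<integral>X. Phi \<phi> z (rU t X) \<partial>m) = e z"
    proof (rule cinv[of "rU (- t)"])
      show "integrable m (\<lambda>X. Phi \<phi> z (rU t X))" unfolding Phi_rU by (rule int) (use z in simp)
    qed (use z mpresD(1)[OF mpres_rU] in \<open>simp_all add: mpres_rU lact_rU\<close>)
    then show ?thesis unfolding Phi_rU by (simp add: e_def)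
  qed
  have low: "e z = e (z / (z + 1)) / (z + 1)\<^sup>2 - of_real M / (z + 1)" if z: "Im z > 0" for z
  proof -
    have w: "Im (z / (z + 1)) > 0"
    proof -
      have "(Re z + 1)\<^sup>2 + (Im z)\<^sup>2 > 0" using z by (simp add: add_nonneg_pos)
      then show ?thesis using z by (simp add: Im_divide algebra_simps)
    qed
    let ?g = "\<lambda>X. Phi \<phi> (z / (z + 1)) X / (z + 1)\<^sup>2 - 1 / (z + 1)"
    have ae: "AE X in m. Phi \<phi> z (rL 1 X) = ?g X" using supp
    proof eventually_elim
      case (elim X)
      then have "qdet X > 0" by (simp add: cset_def)
      then show ?case by (rule Phi_rL[OF z])
    qed
    have ig: "integrable m ?g" using int[OF w] by auto
    have mL: "(\<lambda>X. Phi \<phi> z (rL 1 X)) \<in> borel_measurable m"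
      unfolding bm by (rule measurable_compose[OF mpresD(1)[OF mpres_rL] Phi_measurable[OF hol z]])
    have iL: "integrable m (\<lambda>X. Phi \<phi> z (rL 1 X))"
      using ig ae mL borel_measurable_integrable[OF ig] by (subst integrable_cong_AE[of _ _ ?g]) auto
    have "e z = (\<integral>X. Phi \<phi> z (rL 1 X) \<partial>m)"
      by (rule cinv[of "rL (-1)", symmetric]) (use z iL mpresD(1)[OF mpres_rL] rL_inv[of 1] in \<open>simp_all add: mpres_rL lact_rL\<close>)
    also have "\<dots> = (\<integral>X. ?g X \<partial>m)"
      by (rule integral_cong_AE[OF mL borel_measurable_integrable[OF ig] ae])
    also have "\<dots> = e (z / (z + 1)) / (z + 1)\<^sup>2 - of_real M / (z + 1)"
      using int[OF w] by (simp add: e_def M_def scaleR_conv_of_real)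
    finally show ?thesis .
  qed
  have vert: "\<exists>C. \<forall>h. \<bar>h\<bar> \<le> Im z / 3 \<longrightarrow> norm (e (z + \<i> * of_real h) - e z) \<le> C * h\<^sup>2" if z: "Im z > 0" for z
  proof -
    define r where "r = Im z / 3"
    have r: "r > 0" using z by (simp add: r_def)
    have sub: "cball z (2 * r) \<subseteq> uhp"
    proof
      fix w assume "w \<in> cball z (2 * r)"
      then have "\<bar>Im z - Im w\<bar> \<le> 2 * r" using abs_Im_le_cmod[of "z - w"] by (simp add: dist_norm)
      moreover have "Im z = 3 * r" by (simp add: r_def)
      ultimately have "Im w > 0" using r by linarith
      then show "w \<in> uhp" by simp
    qed
    obtain B where B: "\<And>w X. w \<in> cball z (2 * r) \<Longrightarrow> X \<in> cset T \<Longrightarrow> norm (Phi \<phi> w X) \<le> B"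
      using Phi_bounded[OF hol compact_cball sub, of T] by metis
    let ?C = "4 * (B + 1) / r\<^sup>2"
    have "norm (e (z + \<i> * of_real h) - e z) \<le> ?C * M * h\<^sup>2" if h: "\<bar>h\<bar> \<le> r" for h
    proof -
      have p: "Im (z + \<i> * of_real h) > 0" "Im (z + of_real h) > 0" using h z by (auto simp: r_def)
      let ?F = "\<lambda>X. Phi \<phi> (z + \<i> * of_real h) X - Phi \<phi> z X - \<i> * (Phi \<phi> (z + of_real h) X - Phi \<phi> z X)"
      have iF: "integrable m ?F" using int[OF p(1)] int[OF p(2)] int[OF z] by auto
      have "(\<integral>X. ?F X \<partial>m) = e (z + \<i> * of_real h) - e z - \<i> * (e (z + of_real h) - e z)"
        using int[OF p(1)] int[OF p(2)] int[OF z] by (simp add: e_def)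
      then have "e (z + \<i> * of_real h) - e z = (\<integral>X. ?F X \<partial>m)" using hor[OF z] by simp
      then have "norm (e (z + \<i> * of_real h) - e z) \<le> (\<integral>X. norm (?F X) \<partial>m)"
        using integral_norm_bound[of m ?F] by simp
      also have "\<dots> \<le> (\<integral>X. ?C * h\<^sup>2 \<partial>m)"
      proof (rule integral_mono_AE)
        show "AE X in m. norm (?F X) \<le> ?C * h\<^sup>2" using supp
        proof eventually_elim
          case (elim X)
          show ?case
            by (rule CR_estimate[OF Phi_holomorphic[OF hol] open_uhp sub r B[OF _ elim] h])
        qed
      qed (use iF in auto)
      also have "\<dots> = ?C * M * h\<^sup>2" by (simp add: M_def)
      finally show ?thesis .
    qed
    then show ?thesis unfolding r_def by blast
  qed
  have "\<exists>c. \<forall>y\<in>{0<..}. e (\<i> * of_real y) = c"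
  proof (rule has_derivative_zero_constant)
    fix y :: real assume "y \<in> {0<..}"
    then have y: "y > 0" by simp
    then obtain C where C: "\<forall>h. \<bar>h\<bar> \<le> y / 3 \<longrightarrow> norm (e (\<i> * of_real y + \<i> * of_real h) - e (\<i> * of_real y)) \<le> C * h\<^sup>2"
      using vert[of "\<i> * of_real y"] by auto
    show "((\<lambda>y. e (\<i> * of_real y)) has_derivative (\<lambda>h. 0)) (at y within {0<..})"
    proof (rule has_derivativeI_sandwich[of "y / 3" _ _ _ _ "\<lambda>x. C * \<bar>x - y\<bar>"])
      fix x :: real assume x: "x \<noteq> y" "dist x y < y / 3"
      have "norm (e (\<i> * of_real y + \<i> * of_real (x - y)) - e (\<i> * of_real y)) \<le> C * (x - y)\<^sup>2"
        by (rule C[rule_format]) (use x in \<open>simp add: dist_norm\<close>)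
      moreover have "\<i> * of_real y + \<i> * of_real (x - y) = \<i> * complex_of_real x" by (simp add: algebra_simps)
      ultimately have "norm (e (\<i> * of_real x) - e (\<i> * of_real y)) \<le> C * \<bar>x - y\<bar> * \<bar>x - y\<bar>"
        by (simp add: power2_eq_square)
      then show "norm (e (\<i> * of_real x) - e (\<i> * of_real y) - 0) / norm (x - y) \<le> C * \<bar>x - y\<bar>"
        using x(1) by (simp add: pos_divide_le_eq)
    next
      have "((\<lambda>x. C * \<bar>x - y\<bar>) \<longlongrightarrow> C * \<bar>y - y\<bar>) (at y within {0<..})" by (intro tendsto_intros)
      then show "((\<lambda>x. C * \<bar>x - y\<bar>) \<longlongrightarrow> 0) (at y within {0<..})" by simp
    qed (use y in auto)
  qed (rule convex_real_interval)
  then obtain c where "\<forall>y\<in>{0<..}. e (\<i> * of_real y) = c" by (rule exE)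
  then have c: "e (\<i> * of_real y) = c" if "y > 0" for y using that by simp
  have const: "e z = c" if z: "Im z > 0" for z
  proof -
    have "\<i> * of_real (Im z) + of_real (Re z) = z" by (simp add: complex_eq_iff)
    then show ?thesis using hor[of "\<i> * of_real (Im z)" "Re z"] c[of "Im z"] z by simp
  qed
  have key: "c * (1 - (z + 1)\<^sup>2) = of_real M * (z + 1)" if z: "Im z > 0" for z
  proof -
    have nz: "z + 1 \<noteq> 0" using z by (auto simp: complex_eq_iff)
    have w: "Im (z / (z + 1)) > 0"
    proof -
      have "(Re z + 1)\<^sup>2 + (Im z)\<^sup>2 > 0" using z by (simp add: add_nonneg_pos)
      then show ?thesis using z by (simp add: Im_divide algebra_simps)
    qed
    have "c = c / (z + 1)\<^sup>2 - of_real M / (z + 1)" using low[OF z] const[OF z] const[OF w] by simp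
    then have "c * (z + 1)\<^sup>2 = (c / (z + 1)\<^sup>2 - of_real M / (z + 1)) * (z + 1)\<^sup>2" by (rule arg_cong)
    also have "\<dots> = c - of_real M * (z + 1)"
    proof -
      have "(p / s\<^sup>2 - q / s) * s\<^sup>2 = p - q * s" if "s \<noteq> 0" for s p q :: complex
        using that by (simp add: left_diff_distrib power2_eq_square)
      then show ?thesis using nz .
    qed
    finally show ?thesis by (simp add: algebra_simps)
  qed
  have k1: "c * (1 - (\<i> + 1)\<^sup>2) = of_real M * (\<i> + 1)" by (rule key) simp
  have k2: "c * (1 - (2 * \<i> + 1)\<^sup>2) = of_real M * (2 * \<i> + 1)" by (rule key) simp
  have s1: "1 - (\<i> + 1)\<^sup>2 = 1 - 2 * \<i>" and s2: "1 - (2 * \<i> + 1)\<^sup>2 = 4 - 4 * \<i>"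
    by (simp_all add: power2_eq_square algebra_simps)
  have "c * (1 - 2 * \<i>) * (2 * \<i> + 1) = c * (4 - 4 * \<i>) * (\<i> + 1)"
    using k1 k2 unfolding s1 s2 by simp
  then have "c = 0" by (simp add: algebra_simps)
  then have "complex_of_real M * (\<i> + 1) = 0" using k1 by simp
  then have "M = 0" by (auto simp: complex_eq_iff)
  then show False using pos by (simp add: M_def)
qed

end

section \<open>Independence of the automorphy factors\<close>

context cocompact_group
begin

text \<open>The bottom rows of \<open>G\<close> are unbounded, so their directions accumulate somewhere along rows of
  increasing length; the limit direction is the bottom row of a rotation.\<close>

lemma limit_row:
  obtains \<A> :: "nat \<Rightarrow> real^2^2" and N :: "nat \<Rightarrow> real" and P :: "real^2^2" where
    "\<forall>m. \<A> m \<in> G" "filterlim N at_top sequentially" "det P = 1"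
    "(\<lambda>m. \<A> m $2$1 / N m) \<longlonglongrightarrow> P$2$1" "(\<lambda>m. \<A> m $2$2 / N m) \<longlonglongrightarrow> P$2$2"
proof -
  have "\<exists>A. A \<in> G \<and> (A$2$1)\<^sup>2 + (A$2$2)\<^sup>2 > (real m)\<^sup>2" for m
    using unbounded_rows by metis
  then obtain A where A: "\<And>m. A m \<in> G" "\<And>m. (A m $2$1)\<^sup>2 + (A m $2$2)\<^sup>2 > (real m)\<^sup>2" by metis
  define n where "n m = sqrt ((A m $2$1)\<^sup>2 + (A m $2$2)\<^sup>2)" for m
  have n: "n m > real m" for m using A(2)[of m] unfolding n_def by (intro real_less_rsqrt)
  have n0: "n m > 0" for m using n[of m] by (meson le_less_trans of_nat_0_le_iff)
  define v where "v m = Complex (A m $2$1 / n m) (A m $2$2 / n m)" for m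
  have v: "v m \<in> sphere 0 1" for m
  proof -
    have sq: "(A m $2$1)\<^sup>2 + (A m $2$2)\<^sup>2 = (n m)\<^sup>2" by (simp add: n_def)
    have "(A m $2$1 / n m)\<^sup>2 + (A m $2$2 / n m)\<^sup>2 = ((A m $2$1)\<^sup>2 + (A m $2$2)\<^sup>2) / (n m)\<^sup>2"
      by (simp only: power_divide add_divide_distrib)
    also have "\<dots> = (n m)\<^sup>2 / (n m)\<^sup>2" by (simp only: sq)
    also have "\<dots> = 1" using n0[of m] by simp
    finally have "(A m $2$1 / n m)\<^sup>2 + (A m $2$2 / n m)\<^sup>2 = 1" .
    then show ?thesis by (simp add: v_def cmod_def)
  qed
  have "seq_compact (sphere (0::complex) 1)" by (rule compact_imp_seq_compact[OF compact_sphere])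
  moreover have "\<forall>m. v m \<in> sphere 0 1" using v by (rule allI)
  ultimately obtain l s where l: "l \<in> sphere 0 1" "strict_mono s" "(v \<circ> s) \<longlonglongrightarrow> l"
    by (rule seq_compactE)
  define P :: "real^2^2" where "P = (\<chi> i j. if i = 1 then (if j = 1 then Im l else - Re l) else (if j = 1 then Re l else Im l))"
  have P: "P$1$1 = Im l" "P$1$2 = - Re l" "P$2$1 = Re l" "P$2$2 = Im l"
    by (simp_all add: P_def)
  show thesis
  proof (rule that[of "\<lambda>m. A (s m)" "\<lambda>m. n (s m)" P])
    show "\<forall>m. A (s m) \<in> G" using A by blast
    show "filterlim (\<lambda>m. n (s m)) at_top sequentially"
    proof (rule filterlim_at_top_mono[OF filterlim_real_sequentially])
      show "eventually (\<lambda>m. real m \<le> n (s m)) sequentially"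
      proof (rule always_eventually, rule allI)
        fix m show "real m \<le> n (s m)" using n[of "s m"] seq_suble[OF l(2), of m] by linarith
      qed
    qed
    have "(Re l)\<^sup>2 + (Im l)\<^sup>2 = 1" using l(1) by (simp add: cmod_def)
    then show "det P = 1" by (simp add: det_2 P power2_eq_square)
    show "(\<lambda>m. A (s m) $2$1 / n (s m)) \<longlonglongrightarrow> P$2$1"
      using tendsto_Re[OF l(3)] by (simp add: v_def P o_def)
    show "(\<lambda>m. A (s m) $2$2 / n (s m)) \<longlonglongrightarrow> P$2$2"
      using tendsto_Im[OF l(3)] by (simp add: v_def P o_def)
  qed
qed

text \<open>If the orbit of a boundary point were finite, the average of the forms \<open>- c / (c z + d)\<close> over the
  orbit would be a holomorphic form of weight 2 with \<open>\<delta> = 1\<close>.\<close>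

lemma infinite_boundary_orbit:
  assumes P: "det P = 1" and z: "Im z > 0"
  shows "infinite ((\<lambda>B. of_real ((P ** B)$2$1) / autj (P ** B) z) ` G)" (is "infinite (?x ` G)")
proof
  assume fin: "finite (?x ` G)"
  let ?U = "?x ` G"
  define n where "n = card ?U"
  have n: "n > 0" using fin G_one unfolding n_def by (subst card_gt_0_iff) auto
  define Y where "Y x w = x / (1 + x * (w - z))" for x w :: complex
  define X where "X B w = of_real ((P ** B)$2$1) / autj (P ** B) w" for B w
  have dP: "det (P ** B) = 1" if "B \<in> G" for B using that P G_det by (simp add: det_mul)
  have nz: "1 + ?x B * (w - z) \<noteq> 0" "X B w = Y (?x B) w" if B: "B \<in> G" and w: "Im w > 0" for B w
  proof -
    have j: "autj (P ** B) z \<noteq> 0" "autj (P ** B) w \<noteq> 0" using autj_nonzero dP[OF B] z w by auto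
    have 1: "1 + ?x B * (w - z) = autj (P ** B) w / autj (P ** B) z"
      using j by (simp add: autj_def field_simps)
    then show "1 + ?x B * (w - z) \<noteq> 0" using j by simp
    show "X B w = Y (?x B) w" unfolding Y_def 1 X_def using j by simp
  qed
  have co: "X B (moeb C w) = (autj C w)\<^sup>2 * X (B ** C) w - of_real (C$2$1) * autj C w"
    if B: "B \<in> G" and C: "C \<in> G" and w: "Im w > 0" for B C w
  proof -
    have j: "autj C w \<noteq> 0" using autj_nonzero G_det C w by blast
    have "X (B ** C) w = X B (moeb C w) / (autj C w)\<^sup>2 + of_real (C$2$1) / autj C w"
      unfolding X_def using autj_cocycle[OF dP[OF B] G_det[OF C] w] by (simp add: matrix_mul_assoc)
    then show ?thesis using j by (simp add: field_simps power2_eq_square)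
  qed
  define \<phi> where "\<phi> w = - (\<Sum>x\<in>?U. Y x w) / of_nat n" for w
  show False
  proof (rule no_holomorphic_weight2)
    show "\<phi> holomorphic_on uhp" unfolding \<phi>_def[abs_def]
    proof (intro holomorphic_intros)
      fix x assume "x \<in> ?U"
      then obtain B where B: "B \<in> G" "x = ?x B" by auto
      show "Y x holomorphic_on uhp" unfolding Y_def[abs_def] B(2)
        using nz(1)[OF B(1)] by (intro holomorphic_intros) auto
    qed (use n in simp)
  next
    fix C w assume C: "C \<in> G" and w: "Im w > 0"
    have w': "Im (moeb C w) > 0" "Im (moeb C z) > 0" using moeb_uhp C w z by auto
    have j: "autj C z \<noteq> 0" using autj_nonzero G_det C z by blast
    define \<tau> where "\<tau> x = (Y x (moeb C z) + of_real (C$2$1) * autj C z) / (autj C z)\<^sup>2" for x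
    have \<tau>: "\<tau> (?x B) = ?x (B ** C)" if B: "B \<in> G" for B
      unfolding \<tau>_def nz(2)[OF B w'(2), symmetric] co[OF B C z] using j by (simp add: X_def)
    have inj: "inj_on \<tau> ?U"
    proof (rule inj_onI)
      fix x y assume xy: "x \<in> ?U" "y \<in> ?U" and e: "\<tau> x = \<tau> y"
      have "1 + x * (moeb C z - z) \<noteq> 0" "1 + y * (moeb C z - z) \<noteq> 0"
        using xy nz(1)[OF _ w'(2)] by auto
      moreover have "Y x (moeb C z) = Y y (moeb C z)" using e j by (simp add: \<tau>_def)
      ultimately have "x * (1 + y * (moeb C z - z)) = y * (1 + x * (moeb C z - z))"
        by (simp add: Y_def frac_eq_eq)
      then show "x = y" by (simp add: algebra_simps)
    qed
    have "\<tau> ` ?U \<subseteq> ?U" using \<tau> G_mult[OF _ C] by auto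
    then have bij: "bij_betw \<tau> ?U ?U" using endo_inj_surj[OF fin _ inj] inj by (simp add: bij_betw_def)
    have Yx: "Y x (moeb C w) = (autj C w)\<^sup>2 * Y (\<tau> x) w - of_real (C$2$1) * autj C w" if "x \<in> ?U" for x
    proof -
      obtain B where B: "B \<in> G" "x = ?x B" using \<open>x \<in> ?U\<close> by auto
      show ?thesis unfolding B(2) \<tau>[OF B(1)] nz(2)[OF B(1) w'(1), symmetric] nz(2)[OF G_mult[OF B(1) C] w, symmetric]
        by (rule co[OF B(1) C w])
    qed
    have "(\<Sum>x\<in>?U. Y x (moeb C w)) = (\<Sum>x\<in>?U. (autj C w)\<^sup>2 * Y (\<tau> x) w - of_real (C$2$1) * autj C w)"
      using Yx by (intro sum.cong) auto
    also have "\<dots> = (autj C w)\<^sup>2 * (\<Sum>x\<in>?U. Y (\<tau> x) w) - of_nat n * (of_real (C$2$1) * autj C w)"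
      by (simp add: sum_subtractf sum_distrib_left n_def)
    also have "(\<Sum>x\<in>?U. Y (\<tau> x) w) = (\<Sum>x\<in>?U. Y x w)"
      by (rule sum.reindex_bij_betw[OF bij])
    finally have s: "(\<Sum>x\<in>?U. Y x (moeb C w)) = (autj C w)\<^sup>2 * (\<Sum>x\<in>?U. Y x w) - of_nat n * (of_real (C$2$1) * autj C w)" .
    show "\<phi> (moeb C w) = autj C w ^ 2 * \<phi> w + of_real (C$2$1) * autj C w"
      unfolding \<phi>_def s using n by (simp add: diff_divide_distrib)
  qed
qed

text \<open>Functions of the form \<open>\<Sum> (c z + d)\<^sup>k Q\<^sub>k(c / (c z + d))\<close> on \<open>G\<close> determine the polynomials \<open>Q\<^sub>k\<close>: along the
  rows of increasing length the highest \<open>k\<close> dominates, so \<open>Q\<^sub>k\<close> vanishes at the points of a boundary orbit.\<close>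

lemma automorphy_unique:
  fixes Q :: "'i \<Rightarrow> complex poly" and k :: "'i \<Rightarrow> nat"
  assumes fin: "finite I" and z: "Im z > 0"
    and eq: "\<And>A. A \<in> G \<Longrightarrow> (\<Sum>i\<in>I. autj A z ^ k i * poly (Q i) (of_real (A$2$1) / autj A z)) = 0"
  shows "(\<Sum>i\<in>{i\<in>I. k i = n}. Q i) = 0"
proof (rule ccontr)
  define S where "S w = (\<Sum>i\<in>{i\<in>I. k i = w}. Q i)" for w
  assume "(\<Sum>i\<in>{i\<in>I. k i = n}. Q i) \<noteq> 0"
  then have n: "S n \<noteq> 0" by (simp add: S_def)
  define W where "W = {w \<in> k ` I. S w \<noteq> 0}"
  have Wf: "finite W" using fin by (simp add: W_def)
  have "n \<in> W"
  proof -
    have "{i\<in>I. k i = n} \<noteq> {}" using n unfolding S_def by (metis sum.empty)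
    then show ?thesis using n by (auto simp: W_def)
  qed
  define p where "p = Max W"
  have p: "p \<in> W" "\<And>w. w \<in> W \<Longrightarrow> w \<le> p" using Wf \<open>n \<in> W\<close> unfolding p_def by (auto intro: Max_in)
  have eqW: "(\<Sum>w\<in>W. autj A z ^ w * poly (S w) (of_real (A$2$1) / autj A z)) = 0" if A: "A \<in> G" for A
  proof -
    let ?u = "of_real (A$2$1) / autj A z"
    have "0 = (\<Sum>i\<in>I. autj A z ^ k i * poly (Q i) ?u)" using eq[OF A] by simp
    also have "\<dots> = (\<Sum>w\<in>k ` I. \<Sum>i\<in>{i\<in>I. k i = w}. autj A z ^ k i * poly (Q i) ?u)"
      by (rule sum.image_gen[OF fin])
    also have "\<dots> = (\<Sum>w\<in>k ` I. autj A z ^ w * poly (S w) ?u)"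
      by (intro sum.cong refl) (simp add: S_def poly_sum sum_distrib_left)
    also have "\<dots> = (\<Sum>w\<in>W. autj A z ^ w * poly (S w) ?u)"
      by (rule sum.mono_neutral_right) (use fin in \<open>auto simp: W_def\<close>)
    finally show ?thesis by simp
  qed
  obtain \<A> :: "nat \<Rightarrow> real^2^2" and N :: "nat \<Rightarrow> real" and P :: "real^2^2" where
    A': "\<forall>m. \<A> m \<in> G" and N: "filterlim N at_top sequentially" and P: "det P = 1"
    and lim: "(\<lambda>m. \<A> m $2$1 / N m) \<longlonglongrightarrow> P$2$1" "(\<lambda>m. \<A> m $2$2 / N m) \<longlonglongrightarrow> P$2$2"
    by (rule limit_row)
  have A: "\<A> m \<in> G" for m using A' by (rule spec)
  have root: "poly (S p) (of_real ((P ** B)$2$1) / autj (P ** B) z) = 0" if B: "B \<in> G" for B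
  proof -
    have d: "det (P ** B) = 1" using P G_det[OF B] by (simp add: det_mul)
    have j: "autj (P ** B) z \<noteq> 0" using autj_nonzero[OF d z] .
    have Npos: "eventually (\<lambda>m. N m > 0) sequentially" using N by (simp add: filterlim_at_top_dense)
    have l1: "(\<lambda>m. (\<A> m ** B)$2$1 / N m) \<longlonglongrightarrow> (P ** B)$2$1"
    proof -
      have "(\<lambda>m. \<A> m $2$1 / N m * B$1$1 + \<A> m $2$2 / N m * B$2$1) \<longlonglongrightarrow> P$2$1 * B$1$1 + P$2$2 * B$2$1"
        by (intro tendsto_intros lim)
      then show ?thesis by (simp add: matrix_mult_entries add_divide_distrib)
    qed
    have l2: "(\<lambda>m. (\<A> m ** B)$2$2 / N m) \<longlonglongrightarrow> (P ** B)$2$2"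
    proof -
      have "(\<lambda>m. \<A> m $2$1 / N m * B$1$2 + \<A> m $2$2 / N m * B$2$2) \<longlonglongrightarrow> P$2$1 * B$1$2 + P$2$2 * B$2$2"
        by (intro tendsto_intros lim)
      then show ?thesis by (simp add: matrix_mult_entries add_divide_distrib)
    qed
    have lj: "(\<lambda>m. autj (\<A> m ** B) z / of_real (N m)) \<longlonglongrightarrow> autj (P ** B) z"
    proof -
      have "(\<lambda>m. of_real ((\<A> m ** B)$2$1 / N m) * z + of_real ((\<A> m ** B)$2$2 / N m)) \<longlonglongrightarrow> autj (P ** B) z"
        unfolding autj_def by (intro tendsto_intros l1 l2)
      then show ?thesis by (simp add: autj_def add_divide_distrib)
    qed
    have lu: "(\<lambda>m. of_real ((\<A> m ** B)$2$1) / autj (\<A> m ** B) z) \<longlonglongrightarrow> of_real ((P ** B)$2$1) / autj (P ** B) z"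
    proof (rule Lim_transform_eventually)
      show "(\<lambda>m. of_real ((\<A> m ** B)$2$1 / N m) / (autj (\<A> m ** B) z / of_real (N m))) \<longlonglongrightarrow> of_real ((P ** B)$2$1) / autj (P ** B) z"
        by (intro tendsto_intros l1 lj j)
      show "\<forall>\<^sub>F m in sequentially. of_real ((\<A> m ** B)$2$1 / N m) / (autj (\<A> m ** B) z / of_real (N m)) = of_real ((\<A> m ** B)$2$1) / autj (\<A> m ** B) z"
        using Npos by eventually_elim simp
    qed
    have lN: "(\<lambda>m. inverse (complex_of_real (N m))) \<longlonglongrightarrow> 0"
    proof -
      have "(\<lambda>m. of_real (inverse (N m))) \<longlonglongrightarrow> complex_of_real 0"
        by (intro tendsto_of_real tendsto_inverse_0_at_top N)
      then show ?thesis by simp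
    qed
    have "(\<lambda>m. \<Sum>w\<in>W. (autj (\<A> m ** B) z / of_real (N m)) ^ w * inverse (of_real (N m)) ^ (p - w)
        * poly (S w) (of_real ((\<A> m ** B)$2$1) / autj (\<A> m ** B) z))
      \<longlonglongrightarrow> (\<Sum>w\<in>W. autj (P ** B) z ^ w * 0 ^ (p - w) * poly (S w) (of_real ((P ** B)$2$1) / autj (P ** B) z))"
      by (intro tendsto_intros lj lN isCont_tendsto_compose[OF poly_isCont lu])
    moreover have "(\<lambda>m. \<Sum>w\<in>W. (autj (\<A> m ** B) z / of_real (N m)) ^ w * inverse (of_real (N m)) ^ (p - w)
        * poly (S w) (of_real ((\<A> m ** B)$2$1) / autj (\<A> m ** B) z)) \<longlonglongrightarrow> 0"
    proof (rule tendsto_eventually)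
      show "\<forall>\<^sub>F m in sequentially. (\<Sum>w\<in>W. (autj (\<A> m ** B) z / of_real (N m)) ^ w * inverse (of_real (N m)) ^ (p - w)
        * poly (S w) (of_real ((\<A> m ** B)$2$1) / autj (\<A> m ** B) z)) = 0"
        using Npos
      proof eventually_elim
        case (elim m)
        have "(\<Sum>w\<in>W. (autj (\<A> m ** B) z / of_real (N m)) ^ w * inverse (of_real (N m)) ^ (p - w)
            * poly (S w) (of_real ((\<A> m ** B)$2$1) / autj (\<A> m ** B) z))
          = inverse (of_real (N m)) ^ p * (\<Sum>w\<in>W. autj (\<A> m ** B) z ^ w * poly (S w) (of_real ((\<A> m ** B)$2$1) / autj (\<A> m ** B) z))"
          unfolding sum_distrib_left
        proof (rule sum.cong[OF refl])
          fix w assume "w \<in> W"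
          then have "w \<le> p" by (rule p(2))
          then have "inverse (complex_of_real (N m)) ^ p = inverse (of_real (N m)) ^ w * inverse (of_real (N m)) ^ (p - w)"
            by (simp flip: power_add)
          then show "(autj (\<A> m ** B) z / of_real (N m)) ^ w * inverse (of_real (N m)) ^ (p - w)
              * poly (S w) (of_real ((\<A> m ** B)$2$1) / autj (\<A> m ** B) z)
            = inverse (of_real (N m)) ^ p * (autj (\<A> m ** B) z ^ w * poly (S w) (of_real ((\<A> m ** B)$2$1) / autj (\<A> m ** B) z))"
            by (simp add: divide_inverse power_mult_distrib)
        qed
        then show ?case using eqW[OF G_mult[OF A B]] by simp
      qed
    qed
    ultimately have "(\<Sum>w\<in>W. autj (P ** B) z ^ w * 0 ^ (p - w) * poly (S w) (of_real ((P ** B)$2$1) / autj (P ** B) z)) = 0"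
      by (rule LIMSEQ_unique)
    moreover have "(\<Sum>w\<in>W. autj (P ** B) z ^ w * 0 ^ (p - w) * poly (S w) (of_real ((P ** B)$2$1) / autj (P ** B) z))
      = (\<Sum>w\<in>W. if w = p then autj (P ** B) z ^ p * poly (S p) (of_real ((P ** B)$2$1) / autj (P ** B) z) else 0)"
      by (intro sum.cong refl) (use p(2) in \<open>force simp: power_0_left\<close>)
    ultimately show ?thesis using Wf p(1) j by (simp add: sum.delta)
  qed
  have "(\<lambda>B. of_real ((P ** B)$2$1) / autj (P ** B) z) ` G \<subseteq> {x. poly (S p) x = 0}"
    using root by auto
  moreover have "finite {x. poly (S p) x = 0}" using p(1) by (intro poly_roots_finite) (simp add: W_def)
  ultimately have "finite ((\<lambda>B. of_real ((P ** B)$2$1) / autj (P ** B) z) ` G)" by (rule finite_subset)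
  then show False using infinite_boundary_orbit[OF P z] by simp
qed

end

section \<open>Bounds from the maximum principle\<close>

context cocompact_group
begin

lemma mod_forms_iff:
  "f \<in> mod_forms \<Gamma> k \<longleftrightarrow> (\<forall>z. \<not> Im z > 0 \<longrightarrow> f z = 0) \<and> f holomorphic_on uhp \<and>
     (\<forall>A\<in>G. \<forall>z. Im z > 0 \<longrightarrow> f (moeb A z) = autj A z ^ k * f z)"
  unfolding mod_forms_def fun_ring_def by (simp add: G_def Ball_def[of uhp])

lemma invariant_attains_sup:
  fixes h :: "complex \<Rightarrow> real"
  assumes cont: "continuous_on uhp h" and inv: "\<And>A z. A \<in> G \<Longrightarrow> Im z > 0 \<Longrightarrow> h (moeb A z) = h z"
    and R: "R \<ge> 1" "\<And>z. Im z > 0 \<Longrightarrow> \<exists>A\<in>G. Im (moeb A z) \<ge> 1 / R \<and> norm (moeb A z) \<le> R"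
  obtains z0 where "Im z0 \<ge> 1 / R" "norm z0 \<le> R" "\<forall>z. Im z > 0 \<longrightarrow> h z \<le> h z0"
proof -
  define K where "K = cball 0 R \<inter> {z. Im z \<ge> 1 / R}"
  have "closed {z. Im z \<ge> 1 / R}" by (intro closed_Collect_le continuous_intros)
  then have "compact K" unfolding K_def by (intro compact_Int_closed compact_cball)
  have pos: "1 / R > 0" using R(1) by simp
  have Ku: "K \<subseteq> uhp"
  proof
    fix z assume "z \<in> K"
    then have "Im z \<ge> 1 / R" by (simp add: K_def)
    then show "z \<in> uhp" using pos by (simp only: uhp_iff)
  qed
  have reach: "\<exists>w\<in>K. h z = h w" if z: "Im z > 0" for z
  proof -
    obtain A where A: "A \<in> G" "Im (moeb A z) \<ge> 1 / R" "norm (moeb A z) \<le> R" using R(2)[OF z] by auto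
    then show ?thesis using inv[OF A(1) z] by (intro bexI[of _ "moeb A z"]) (auto simp: K_def)
  qed
  have "K \<noteq> {}" using reach[of \<i>] by auto
  obtain z0 where z0: "z0 \<in> K" "\<forall>w\<in>K. h w \<le> h z0"
    using continuous_attains_sup[OF \<open>compact K\<close> \<open>K \<noteq> {}\<close> continuous_on_subset[OF cont Ku]] by auto
  show thesis
  proof (rule that[of z0])
    show "\<forall>z. Im z > 0 \<longrightarrow> h z \<le> h z0" using reach z0(2) by fastforce
  qed (use z0 in \<open>auto simp: K_def\<close>)
qed

lemma dist_cnj: "(norm (z - cnj w))\<^sup>2 = (norm (z - w))\<^sup>2 + 4 * Im z * Im w"
  unfolding cmod_power2 by (simp add: power2_eq_square algebra_simps)

text \<open>For a form of weight \<open>-m \<le> 0\<close> the invariant function \<open>\<bar>F\<bar>\<^sup>2 / (Im z)\<^sup>m\<close> has a maximum, at \<open>w\<close> say; then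
  \<open>F(z) / (z - cnj w)\<^sup>m\<close> is a holomorphic function with a maximum at \<open>w\<close>, strict if \<open>m > 0\<close>.\<close>

lemma nonpositive_weight:
  assumes hol: "F holomorphic_on uhp"
    and tr: "\<And>A z. A \<in> G \<Longrightarrow> Im z > 0 \<Longrightarrow> F (moeb A z) * autj A z ^ m = F z"
  shows "\<exists>c. \<forall>z. Im z > 0 \<longrightarrow> F z = c" "m > 0 \<Longrightarrow> Im z > 0 \<Longrightarrow> F z = 0"
proof -
  obtain R where R: "R \<ge> 1" "\<And>z. Im z > 0 \<Longrightarrow> \<exists>A\<in>G. Im (moeb A z) \<ge> 1 / R \<and> norm (moeb A z) \<le> R"
    using cocompact by blast
  define h where "h z = (norm (F z))\<^sup>2 / Im z ^ m" for z
  have "continuous_on uhp h" unfolding h_def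
    by (intro continuous_intros holomorphic_on_imp_continuous_on[OF hol]) auto
  moreover have "h (moeb A z) = h z" if A: "A \<in> G" and z: "Im z > 0" for A z
  proof -
    have j: "norm (autj A z) \<noteq> 0" using autj_nonzero G_det A z by simp
    have "(norm (F z))\<^sup>2 = (norm (F (moeb A z)))\<^sup>2 * ((norm (autj A z))\<^sup>2) ^ m"
      unfolding tr[OF A z, symmetric] by (simp add: norm_mult norm_power power_mult_distrib power_commutes flip: power_mult)
        (simp add: mult.commute)
    then show ?thesis unfolding h_def Im_moeb[OF G_det[OF A]] using j by (simp add: power_divide)
  qed
  ultimately obtain w where w: "Im w \<ge> 1 / R" "\<forall>z. Im z > 0 \<longrightarrow> h z \<le> h w"
    using invariant_attains_sup[OF _ _ R] by metis
  have "1 / R > 0" using R(1) by simp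
  then have wpos: "Im w > 0" using w(1) by linarith
  define f where "f z = F z / (z - cnj w) ^ m" for z
  have nz: "z - cnj w \<noteq> 0" if "Im z > 0" for z
  proof
    assume "z - cnj w = 0"
    then have "Im (z - cnj w) = 0" by simp
    then show False using that wpos by simp
  qed
  have fsq: "(norm (f z))\<^sup>2 = h z * (Im z / (norm (z - cnj w))\<^sup>2) ^ m" if z: "Im z > 0" for z
  proof -
    have "(norm (f z))\<^sup>2 = (norm (F z))\<^sup>2 / ((norm (z - cnj w))\<^sup>2) ^ m"
      by (simp add: f_def norm_divide norm_power power_divide mult.commute flip: power_mult)
    then show ?thesis using z by (simp add: h_def power_divide)
  qed
  have h0: "h w \<ge> 0" unfolding h_def using wpos by simp
  have diagw: "Im w / (norm (w - cnj w))\<^sup>2 = 1 / (4 * Im w)"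
  proof -
    have "(norm (w - cnj w))\<^sup>2 = 4 * Im w * Im w" using dist_cnj[of w w] by simp
    then show ?thesis using wpos by simp
  qed
  have le: "norm (f z) \<le> norm (f w)" if z: "Im z > 0" for z
  proof -
    have "Im z / (norm (z - cnj w))\<^sup>2 \<le> Im z / (4 * Im z * Im w)"
      using z wpos nz[OF z] by (intro divide_left_mono) (auto simp: dist_cnj intro!: mult_pos_pos add_nonneg_pos)
    also have "\<dots> = 1 / (4 * Im w)" using z by simp
    finally have "h z * (Im z / (norm (z - cnj w))\<^sup>2) ^ m \<le> h w * (1 / (4 * Im w)) ^ m"
      using w(2) z h0 by (intro mult_mono power_mono) auto
    then have "(norm (f z))\<^sup>2 \<le> (norm (f w))\<^sup>2" using fsq[OF z] fsq[OF wpos] diagw by simp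
    then show ?thesis by (rule power2_le_imp_le) simp
  qed
  have "f holomorphic_on uhp" unfolding f_def[abs_def] using nz by (intro holomorphic_intros hol) auto
  then have "f constant_on uhp"
    by (rule maximum_modulus_principle[of f uhp uhp w]) (use wpos le in auto)
  then obtain c where c: "\<And>z. Im z > 0 \<Longrightarrow> f z = c" by (auto simp: constant_on_def)
  have zero: "F z = 0" if m: "m > 0" and z: "Im z > 0" for z
  proof -
    define v where "v = w + \<i> * of_real (Im w)"
    have v: "Im v = 2 * Im w" by (simp add: v_def)
    then have vpos: "Im v > 0" using wpos by simp
    have "(norm (v - cnj w))\<^sup>2 = 9 * (Im w)\<^sup>2" unfolding dist_cnj v by (simp add: v_def norm_mult power2_eq_square)
    then have dv: "Im v / (norm (v - cnj w))\<^sup>2 = 2 / (9 * Im w)" using v wpos by (simp add: power2_eq_square)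
    have "h w * (1 / (4 * Im w)) ^ m = h v * (2 / (9 * Im w)) ^ m"
      using fsq[OF vpos] fsq[OF wpos] diagw dv c[OF vpos] c[OF wpos] by simp
    also have "\<dots> \<le> h w * (2 / (9 * Im w)) ^ m" using w(2) vpos wpos by (intro mult_right_mono) auto
    finally have le: "h w * (1 / (4 * Im w)) ^ m \<le> h w * (2 / (9 * Im w)) ^ m" .
    have "(2 / (9 * Im w)) ^ m < (1 / (4 * Im w)) ^ m"
      using wpos m by (intro power_strict_mono) (auto simp: field_simps)
    then have "h w \<le> 0" using le h0 mult_less_cancel_left_pos[of "h w"] by (meson leD not_le_imp_less)
    then have "h z \<le> 0" using w(2) z by force
    moreover have "Im z ^ m > 0" using z by simp
    ultimately have "(norm (F z))\<^sup>2 \<le> 0" unfolding h_def by (simp only: pos_divide_le_eq mult_zero_left)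
    then show "F z = 0" by simp
  qed
  show "m > 0 \<Longrightarrow> Im z > 0 \<Longrightarrow> F z = 0" by (rule zero)
  show "\<exists>c. \<forall>z. Im z > 0 \<longrightarrow> F z = c"
  proof (cases "m = 0")
    case True
    then have "F z = c" if "Im z > 0" for z using c[OF that] by (simp add: f_def)
    then show ?thesis by blast
  next
    case False
    then show ?thesis using zero by auto
  qed
qed

text \<open>Schwarz's lemma: the modulus of a form \<open>F\<close>, measured invariantly, is maximal in a compact set, where
  the factor \<open>\<bar>(z - \<i>) / (z + \<i>)\<bar>\<^sup>n\<close> gained from a zero of order \<open>n\<close> at \<open>\<i>\<close> is exponentially small; on a
  larger disc the automorphy factor costs at most a factor exponential in the weight.\<close>

lemma vanishing_order_bound:
  obtains C :: nat where
    "\<forall>F k n h. F \<in> mod_forms \<Gamma> k \<longrightarrow> h holomorphic_on uhp \<longrightarrow> (\<forall>z. Im z > 0 \<longrightarrow> F z = (z - \<i>) ^ n * h z) \<longrightarrow>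
       n > C * k \<longrightarrow> F = 0"
proof -
  obtain R where R: "R \<ge> 1" "\<And>z. Im z > 0 \<Longrightarrow> \<exists>A\<in>G. Im (moeb A z) \<ge> 1 / R \<and> norm (moeb A z) \<le> R"
    using cocompact by blast
  define s0 where "s0 = 1 - 4 * (1 / R) / (R + 1)\<^sup>2"
  have Rpos: "1 / R > 0" "(R + 1)\<^sup>2 > 0" using R(1) by auto
  have s0: "0 \<le> s0" "s0 < 1"
  proof -
    have "1 / R \<le> 1" using R(1) by simp
    moreover have "(R + 1)\<^sup>2 \<ge> (1 + 1)\<^sup>2" using R(1) by (intro power_mono) auto
    ultimately have "4 * (1 / R) \<le> (R + 1)\<^sup>2" by simp
    then have "4 * (1 / R) / (R + 1)\<^sup>2 \<le> 1" using Rpos(2) by (simp only: divide_le_eq_1_pos)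
    then show "0 \<le> s0" by (simp add: s0_def)
    show "s0 < 1" unfolding s0_def using Rpos by simp
  qed
  define s1 where "s1 = (1 + s0) / 2"
  have s1: "0 < s1" "s0 < s1" "s1 < 1" using s0 by (auto simp: s1_def)
  define q where "q = s0 / s1"
  have q: "0 \<le> q" "q < 1" using s0 s1 by (auto simp: q_def)
  have B: "1 / (1 - s1) > 0" using s1 by simp
  obtain C where C: "q ^ C < 1 - s1" using real_arch_pow_inv[of "1 - s1" q] s1 q by auto
  have qC: "q ^ C * (1 / (1 - s1)) < 1" using C s1 by (simp add: divide_less_eq)
  have "F = 0" if F: "F \<in> mod_forms \<Gamma> k" and h: "h holomorphic_on uhp" "\<forall>z. Im z > 0 \<longrightarrow> F z = (z - \<i>) ^ n * h z"
    and n: "n > C * k" for F k n h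
  proof -
    have hol: "F holomorphic_on uhp" and tr: "\<And>A z. A \<in> G \<Longrightarrow> Im z > 0 \<Longrightarrow> F (moeb A z) = autj A z ^ k * F z"
      and out: "\<And>z. \<not> Im z > 0 \<Longrightarrow> F z = 0"
      using F by (auto simp: mod_forms_iff)
    define H where "H z = (norm (F z))\<^sup>2 * Im z ^ k" for z
    have "continuous_on uhp H" unfolding H_def
      by (intro continuous_intros holomorphic_on_imp_continuous_on[OF hol])
    moreover have "H (moeb A z) = H z" if A: "A \<in> G" and z: "Im z > 0" for A z
    proof -
      have j: "norm (autj A z) \<noteq> 0" using autj_nonzero G_det A z by simp
      have "(norm (F (moeb A z)))\<^sup>2 = ((norm (autj A z))\<^sup>2) ^ k * (norm (F z))\<^sup>2"
        unfolding tr[OF A z] by (simp add: norm_mult norm_power power_mult_distrib mult.commute flip: power_mult)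
      then show ?thesis unfolding H_def Im_moeb[OF G_det[OF A]] using j by (simp add: power_divide)
    qed
    ultimately obtain w where w: "Im w \<ge> 1 / R" "norm w \<le> R" "\<forall>z. Im z > 0 \<longrightarrow> H z \<le> H w"
      using invariant_attains_sup[OF _ _ R] by metis
    have wpos: "Im w > 0" using w(1) Rpos by linarith
    have pm: "(norm (z + \<i>))\<^sup>2 = (norm (z - \<i>))\<^sup>2 + 4 * Im z" for z
      unfolding cmod_power2 by (simp add: power2_eq_square algebra_simps)
    have np: "norm (z + \<i>) > 0" if "Im z > 0" for z
    proof -
      have "z + \<i> \<noteq> 0" using that by (auto simp: complex_eq_iff)
      then show ?thesis by simp
    qed
    define f where "f z = h z * (z + \<i>) ^ (k + n)" for z
    define S where "S = {z. (norm (z - \<i>))\<^sup>2 \<le> s1 * (norm (z + \<i>))\<^sup>2}"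
    have Su: "Im z > 0" if "z \<in> S" for z
    proof (rule ccontr)
      assume "\<not> Im z > 0"
      then have "(norm (z + \<i>))\<^sup>2 \<le> (norm (z - \<i>))\<^sup>2" using pm[of z] by simp
      also have "\<dots> \<le> s1 * (norm (z + \<i>))\<^sup>2" using that by (simp add: S_def)
      finally have "(1 - s1) * (norm (z + \<i>))\<^sup>2 \<le> 0" by (simp add: algebra_simps)
      then have "(norm (z + \<i>))\<^sup>2 \<le> 0" using s1 by (simp add: mult_le_0_iff)
      then have "z + \<i> = 0" by simp
      then have "z = - \<i>" by (simp add: eq_neg_iff_add_eq_0)
      with that show False by (simp add: S_def)
    qed
    have clS: "closed S" unfolding S_def by (intro closed_Collect_le continuous_intros)
    have bS: "bounded S"
      unfolding bounded_iff
    proof (intro exI ballI)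
      fix z assume z: "z \<in> S"
      define t where "t = sqrt s1"
      have t: "0 < t" "t < 1" "t\<^sup>2 = s1" using s1 by (auto simp: t_def)
      have "(norm (z - \<i>))\<^sup>2 \<le> (t * norm (z + \<i>))\<^sup>2" using z t(3) by (simp add: S_def power_mult_distrib)
      then have "norm (z - \<i>) \<le> t * norm (z + \<i>)" 
        by (rule power2_le_imp_le) (use t(1) in simp)
      moreover have "norm z - 1 \<le> norm (z - \<i>)" using norm_triangle_ineq2[of z \<i>] by simp
      moreover have "t * norm (z + \<i>) \<le> t * (norm z + 1)" using norm_triangle_ineq[of z \<i>] t(1) by (intro mult_left_mono) auto
      ultimately have "norm z * (1 - t) \<le> 1 + t" by (simp add: algebra_simps)
      then show "norm z \<le> (1 + t) / (1 - t)" using t(2) by (simp add: pos_le_divide_eq)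
    qed
    have fr: "frontier S \<subseteq> {z. (norm (z - \<i>))\<^sup>2 = s1 * (norm (z + \<i>))\<^sup>2}"
    proof
      fix z assume z: "z \<in> frontier S"
      then have "z \<in> S" using frontier_subset_closed[OF clS] by auto
      moreover have "\<not> (norm (z - \<i>))\<^sup>2 < s1 * (norm (z + \<i>))\<^sup>2"
      proof
        assume *: "(norm (z - \<i>))\<^sup>2 < s1 * (norm (z + \<i>))\<^sup>2"
        have "open {z. (norm (z - \<i>))\<^sup>2 < s1 * (norm (z + \<i>))\<^sup>2}" by (intro open_Collect_less continuous_intros)
        then have "{z. (norm (z - \<i>))\<^sup>2 < s1 * (norm (z + \<i>))\<^sup>2} \<subseteq> interior S"
          by (intro interior_maximal) (auto simp: S_def)
        then have "z \<in> interior S" using * by auto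
        then show False using z by (simp add: frontier_def)
      qed
      ultimately show "z \<in> {z. (norm (z - \<i>))\<^sup>2 = s1 * (norm (z + \<i>))\<^sup>2}" by (simp add: S_def)
    qed
    define M where "M = H w * (4 / (1 - s1)) ^ k / s1 ^ n"
    have H0: "H w \<ge> 0" using wpos by (simp add: H_def)
    have Fh: "(norm (F z))\<^sup>2 * ((norm (z + \<i>))\<^sup>2) ^ k * ((norm (z + \<i>))\<^sup>2) ^ n = (norm (f z))\<^sup>2 * ((norm (z - \<i>))\<^sup>2) ^ n"
      if "Im z > 0" for z
    proof -
      have "F z * (z + \<i>) ^ k * (z + \<i>) ^ n = f z * (z - \<i>) ^ n"
        using h(2) that by (simp add: f_def power_add)
      then have "(norm (F z * (z + \<i>) ^ k * (z + \<i>) ^ n))\<^sup>2 = (norm (f z * (z - \<i>) ^ n))\<^sup>2" by simp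
      then show ?thesis by (simp add: norm_mult norm_power power_mult_distrib mult.commute flip: power_mult)
    qed
    have HF: "(norm (F z))\<^sup>2 * ((norm (z + \<i>))\<^sup>2) ^ k = H z * ((norm (z + \<i>))\<^sup>2 / Im z) ^ k" if "Im z > 0" for z
      using that by (simp add: H_def power_divide)
    have bd: "norm (f z) \<le> sqrt M" if z: "z \<in> frontier S" for z
    proof -
      have e: "(norm (z - \<i>))\<^sup>2 = s1 * (norm (z + \<i>))\<^sup>2" using fr z by auto
      have zS: "z \<in> S" using z frontier_subset_closed[OF clS] by auto
      have zpos: "Im z > 0" using Su[OF zS] .
      have np2: "(norm (z + \<i>))\<^sup>2 > 0" using np[OF zpos] by simp
      have "4 * Im z = (1 - s1) * (norm (z + \<i>))\<^sup>2" using pm[of z] e by (simp add: algebra_simps)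
      then have r: "(norm (z + \<i>))\<^sup>2 / Im z = 4 / (1 - s1)" using zpos s1 by (simp add: field_simps)
      have "(norm (f z))\<^sup>2 * s1 ^ n * ((norm (z + \<i>))\<^sup>2) ^ n = (norm (F z))\<^sup>2 * ((norm (z + \<i>))\<^sup>2) ^ k * ((norm (z + \<i>))\<^sup>2) ^ n"
        using Fh[OF zpos, symmetric] unfolding e power_mult_distrib by (simp only: mult.assoc)
      then have "(norm (f z))\<^sup>2 * s1 ^ n = (norm (F z))\<^sup>2 * ((norm (z + \<i>))\<^sup>2) ^ k"
        using np2 by (simp only: mult_right_cancel[OF power_not_zero[OF less_imp_neq[OF np2, symmetric]]])
      also have "\<dots> = H z * (4 / (1 - s1)) ^ k" using HF[OF zpos] r by simp
      also have "\<dots> \<le> H w * (4 / (1 - s1)) ^ k" using w(3) zpos s1 by (intro mult_right_mono) auto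
      finally have "(norm (f z))\<^sup>2 \<le> M" using s1 by (simp add: M_def pos_le_divide_eq)
      then show ?thesis by (rule real_le_rsqrt)
    qed
    have wS: "(norm (w - \<i>))\<^sup>2 \<le> s0 * (norm (w + \<i>))\<^sup>2"
    proof -
      have "norm (w + \<i>) \<le> R + 1" using norm_triangle_ineq[of w \<i>] w(2) by simp
      then have "(norm (w + \<i>))\<^sup>2 \<le> (R + 1)\<^sup>2" by (intro power_mono) auto
      then have "4 * (1 / R) / (R + 1)\<^sup>2 * (norm (w + \<i>))\<^sup>2 \<le> 4 * (1 / R) / (R + 1)\<^sup>2 * (R + 1)\<^sup>2"
        using Rpos by (intro mult_left_mono) auto
      also have "\<dots> = 4 * (1 / R)" using Rpos by simp
      also have "\<dots> \<le> 4 * Im w" using w(1) by simp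
      finally have "4 * (1 / R) / (R + 1)\<^sup>2 * (norm (w + \<i>))\<^sup>2 \<le> 4 * Im w" .
      then show ?thesis using pm[of w] unfolding s0_def left_diff_distrib by linarith
    qed
    have "w \<in> S"
    proof -
      have "s0 * (norm (w + \<i>))\<^sup>2 \<le> s1 * (norm (w + \<i>))\<^sup>2" using s1 by (intro mult_right_mono) auto
      then show ?thesis using wS by (simp add: S_def)
    qed
    have holf: "f holomorphic_on uhp" unfolding f_def[abs_def] by (intro holomorphic_intros h)
    have SU: "S \<subseteq> uhp" using Su by auto
    have "norm (f w) \<le> sqrt M"
    proof (rule maximum_modulus_frontier[OF _ _ bS bd \<open>w \<in> S\<close>])
      show "f holomorphic_on interior S" by (rule holomorphic_on_subset[OF holf order_trans[OF interior_subset SU]])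
      show "continuous_on (closure S) f" unfolding closure_closed[OF clS]
        by (rule holomorphic_on_imp_continuous_on[OF holomorphic_on_subset[OF holf SU]])
    qed
    then have "(norm (f w))\<^sup>2 \<le> (sqrt M)\<^sup>2" by (intro power_mono) auto
    moreover have "M \<ge> 0" unfolding M_def using H0 s1 by simp
    ultimately have fw: "(norm (f w))\<^sup>2 \<le> M" by simp
    have nw: "(norm (w + \<i>))\<^sup>2 > 0" using np[OF wpos] by simp
    have "H w * 4 ^ k * ((norm (w + \<i>))\<^sup>2) ^ n \<le> H w * ((norm (w + \<i>))\<^sup>2 / Im w) ^ k * ((norm (w + \<i>))\<^sup>2) ^ n"
    proof -
      have "4 \<le> (norm (w + \<i>))\<^sup>2 / Im w" using pm[of w] wpos by (simp add: pos_le_divide_eq)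
      then show ?thesis using H0 by (intro mult_right_mono mult_left_mono power_mono) auto
    qed
    also have "\<dots> = (norm (f w))\<^sup>2 * ((norm (w - \<i>))\<^sup>2) ^ n" using Fh[OF wpos] HF[OF wpos] by simp
    also have "\<dots> \<le> M * (s0 * (norm (w + \<i>))\<^sup>2) ^ n" using fw wS \<open>M \<ge> 0\<close> by (intro mult_mono power_mono) auto
    also have "\<dots> = H w * 4 ^ k * ((norm (w + \<i>))\<^sup>2) ^ n * (q ^ n * (1 / (1 - s1)) ^ k)"
      by (simp add: M_def q_def power_divide power_mult_distrib mult_ac)
    finally have fin: "H w * 4 ^ k * ((norm (w + \<i>))\<^sup>2) ^ n * 1 \<le> H w * 4 ^ k * ((norm (w + \<i>))\<^sup>2) ^ n * (q ^ n * (1 / (1 - s1)) ^ k)"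
      by simp
    have small: "q ^ n * (1 / (1 - s1)) ^ k < 1"
    proof -
      have "q ^ n = q ^ (C * k) * q ^ (n - C * k)" using n by (simp flip: power_add)
      then have "q ^ n * (1 / (1 - s1)) ^ k = (q ^ C * (1 / (1 - s1))) ^ k * q ^ (n - C * k)"
        unfolding power_mult_distrib power_mult[symmetric] by (simp only: mult.commute mult.left_commute)
      also have "\<dots> \<le> 1 * q ^ (n - C * k)"
        using qC q B by (intro mult_right_mono power_le_one mult_nonneg_nonneg) auto
      also have "\<dots> < 1" using q n by (simp add: power_less_one_iff)
      finally show ?thesis .
    qed
    have "H w = 0"
    proof (rule ccontr)
      assume "H w \<noteq> 0"
      then have "H w * 4 ^ k * ((norm (w + \<i>))\<^sup>2) ^ n > 0" using H0 nw by simp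
      then have "1 \<le> q ^ n * (1 / (1 - s1)) ^ k" using fin by (simp only: mult_le_cancel_left_pos)
      then show False using small by simp
    qed
    have "F z = 0" for z
    proof (cases "Im z > 0")
      case True
      then have "H z \<le> 0" using w(3) \<open>H w = 0\<close> by simp
      moreover have "Im z ^ k > 0" using True by simp
      ultimately have "(norm (F z))\<^sup>2 \<le> 0" 
        using mult_le_cancel_right_pos[of "Im z ^ k" "(norm (F z))\<^sup>2" 0] by (simp add: H_def)
      then show ?thesis by simp
    qed (rule out)
    then show "F = 0" by (simp add: fun_eq_iff)
  qed
  then show thesis by (intro that[of C]) blast
qed

end

section \<open>Existence of modular forms\<close>

definition lin :: "real^2^2 \<Rightarrow> complex \<Rightarrow> complex" where
  "lin A z = (of_real (A$1$1) * z + of_real (A$1$2)) + \<i> * autj A z"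

lemma lin_mult:
  assumes "det B = 1" "Im z > 0"
  shows "lin (A ** B) z = lin A (moeb B z) * autj B z"
proof -
  have nz: "autj B z \<noteq> 0" using autj_nonzero assms by blast
  have "of_real ((A ** B)$1$1) * z + of_real ((A ** B)$1$2)
      = (of_real (A$1$1) * moeb B z + of_real (A$1$2)) * autj B z"
    using nz by (simp add: moeb_def matrix_mult_entries field_simps) (simp add: autj_def algebra_simps)
  then show ?thesis unfolding lin_def autj_mult[OF assms] by (simp add: algebra_simps)
qed

lemma lin_lower:
  assumes d: "det A = 1" and r: "r \<ge> 1" "norm z \<le> r" "Im z \<ge> 1 / r"
  shows "frob A \<le> (2 + (2 * r\<^sup>2 + 1) * r\<^sup>2) * (norm (lin A z))\<^sup>2"
proof -
  define D where "D = 2 + (2 * r\<^sup>2 + 1) * r\<^sup>2"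
  have pos: "Im z > 0" using r by (meson divide_pos_pos less_le_trans zero_less_one)
  have low: "x\<^sup>2 + y\<^sup>2 \<le> D * (norm (of_real x * z + of_real y))\<^sup>2" for x y :: real
  proof -
    let ?n = "(norm (of_real x * z + of_real y))\<^sup>2"
    have n: "?n = (x * Re z + y)\<^sup>2 + (x * Im z)\<^sup>2" unfolding cmod_power2 by simp
    have "1 \<le> r * Im z" using r by (simp add: field_simps)
    then have "1\<^sup>2 \<le> (r * Im z)\<^sup>2" by (intro power_mono) auto
    then have "x\<^sup>2 * 1 \<le> x\<^sup>2 * (r * Im z)\<^sup>2" by (intro mult_left_mono) auto
    then have x: "x\<^sup>2 \<le> r\<^sup>2 * ?n" unfolding n
      by (simp add: power_mult_distrib algebra_simps) (smt (verit) mult_nonneg_nonneg zero_le_power2)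
    have "(Re z)\<^sup>2 \<le> r\<^sup>2"
      using r(2) abs_Re_le_cmod[of z] by (intro abs_le_square_iff[THEN iffD1]) auto
    then have "(x * Re z)\<^sup>2 \<le> x\<^sup>2 * r\<^sup>2" by (simp add: power_mult_distrib mult_left_mono)
    moreover have "y\<^sup>2 \<le> 2 * (x * Re z + y)\<^sup>2 + 2 * (x * Re z)\<^sup>2"
    proof -
      have "0 \<le> (2 * (x * Re z) + y)\<^sup>2" by simp
      then show ?thesis by (simp add: power2_eq_square algebra_simps)
    qed
    moreover have "(x * Re z + y)\<^sup>2 \<le> ?n" unfolding n by simp
    ultimately have "y\<^sup>2 \<le> 2 * ?n + 2 * (x\<^sup>2 * r\<^sup>2)" by linarith
    then have "x\<^sup>2 + y\<^sup>2 \<le> 2 * ?n + (2 * (x\<^sup>2 * r\<^sup>2) + x\<^sup>2)" by linarith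
    moreover have "2 * (x\<^sup>2 * r\<^sup>2) + x\<^sup>2 = (2 * r\<^sup>2 + 1) * x\<^sup>2" by (simp add: algebra_simps)
    ultimately have "x\<^sup>2 + y\<^sup>2 \<le> 2 * ?n + (2 * r\<^sup>2 + 1) * x\<^sup>2" by simp
    also have "\<dots> \<le> 2 * ?n + (2 * r\<^sup>2 + 1) * (r\<^sup>2 * ?n)" using x by (intro add_left_mono mult_left_mono) auto
    finally show ?thesis by (simp add: D_def algebra_simps)
  qed
  let ?u = "of_real (A$1$1) * z + of_real (A$1$2)" and ?v = "of_real (A$2$1) * z + of_real (A$2$2)"
  have "(norm (lin A z))\<^sup>2 = (norm ?u)\<^sup>2 + (norm ?v)\<^sup>2 + 2 * (Im z * (A$1$1 * A$2$2 - A$1$2 * A$2$1))"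
    unfolding lin_def autj_def cmod_power2 by (simp add: power2_eq_square algebra_simps)
  then have "(norm ?u)\<^sup>2 + (norm ?v)\<^sup>2 \<le> (norm (lin A z))\<^sup>2" using d pos by (simp add: det_2)
  then have "D * ((norm ?u)\<^sup>2 + (norm ?v)\<^sup>2) \<le> D * (norm (lin A z))\<^sup>2"
    by (intro mult_left_mono) (auto simp: D_def)
  then show ?thesis using low[of "A$1$1" "A$1$2"] low[of "A$2$1" "A$2$2"]
    unfolding frob_def D_def[symmetric] distrib_left by linarith
qed

context cocompact_group
begin

definition poincare :: "nat \<Rightarrow> complex \<Rightarrow> complex" where
  "poincare l z = (if Im z > 0 then \<Sum>\<^sub>\<infinity>A\<in>G. 1 / lin A z ^ (2 * l) else 0)"

lemma poincare_bound:
  assumes l: "l \<ge> 5" and r: "r \<ge> 1"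
  obtains B where "B > 0"
    "\<forall>A\<in>G. \<forall>z. norm z \<le> r \<longrightarrow> Im z \<ge> 1 / r \<longrightarrow> norm (1 / lin A z ^ (2 * l)) \<le> B * (1 / frob A ^ 5)"
proof -
  define D where "D = 2 + (2 * r\<^sup>2 + 1) * r\<^sup>2"
  have D: "D > 0" unfolding D_def by (intro add_pos_nonneg) auto
  have "norm (1 / lin A z ^ (2 * l)) \<le> D ^ l * (1 / frob A ^ 5)"
    if A: "A \<in> G" and z: "norm z \<le> r" "Im z \<ge> 1 / r" for A z
  proof -
    have d: "det A = 1" using G_det[OF A] .
    have f: "frob A \<ge> 2" by (rule frob_ge_2[OF d])
    have le: "frob A \<le> D * (norm (lin A z))\<^sup>2" unfolding D_def by (rule lin_lower[OF d r z])
    have n0: "(norm (lin A z))\<^sup>2 > 0"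
    proof (rule ccontr)
      assume "\<not> ?thesis"
      then have "(norm (lin A z))\<^sup>2 = 0" by simp
      then show False using le f by simp
    qed
    have "frob A ^ 5 \<le> frob A ^ l" using l f by (intro power_increasing) auto
    also have "\<dots> \<le> (D * (norm (lin A z))\<^sup>2) ^ l" using le f by (intro power_mono) auto
    also have "\<dots> = D ^ l * norm (lin A z) ^ (2 * l)" by (simp add: power_mult_distrib power_mult)
    finally have "frob A ^ 5 \<le> D ^ l * norm (lin A z) ^ (2 * l)" .
    moreover have "norm (lin A z) ^ (2 * l) > 0" using n0 by simp
    moreover have "frob A ^ 5 > 0" using f by simp
    ultimately show ?thesis by (simp add: norm_divide norm_power field_simps)
  qed
  then show thesis using that[of "D ^ l"] D by auto
qed

lemma poincare_summable:
  assumes l: "l \<ge> 5" and z: "Im z > 0"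
  shows "(\<lambda>A. norm (1 / lin A z ^ (2 * l))) summable_on G"
proof -
  define r where "r = norm z + 1 / Im z + 1"
  have r: "r \<ge> 1" "norm z \<le> r" "1 / Im z \<le> r" using z by (auto simp: r_def)
  then have z2: "Im z \<ge> 1 / r" using z by (simp add: field_simps)
  obtain B where B: "B > 0"
    "\<forall>A\<in>G. \<forall>z. norm z \<le> r \<longrightarrow> Im z \<ge> 1 / r \<longrightarrow> norm (1 / lin A z ^ (2 * l)) \<le> B * (1 / frob A ^ 5)"
    by (rule poincare_bound[OF l r(1)])
  show ?thesis
    by (rule Infinite_Sum.abs_summable_on_comparison_test'[OF summable_on_cmult_right[OF summable_frob, of B]])
      (use B(2) r z2 in blast)
qed

lemma poincare_holomorphic:
  assumes l: "l \<ge> 5" shows "poincare l holomorphic_on uhp"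
proof -
  have "poincare l field_differentiable at z" if z: "Im z > 0" for z
  proof -
    define s where "s = Im z / 2"
    have s: "s > 0" using z by (simp add: s_def)
    define r where "r = norm z + s + 1 / s + 1"
    have r: "r \<ge> 1" using s by (simp add: r_def)
    have sub: "norm w \<le> r \<and> Im w \<ge> 1 / r \<and> Im w > 0" if w: "w \<in> cball z s" for w
    proof -
      have d: "norm (z - w) \<le> s" using w by (simp add: dist_norm)
      have "norm w \<le> norm z + norm (z - w)" using norm_triangle_ineq4[of z "z - w"] by simp
      moreover have "1 / s > 0" using s by simp
      ultimately have 1: "norm w \<le> r" using d s unfolding r_def by linarith
      have "\<bar>Im z - Im w\<bar> \<le> s" using abs_Im_le_cmod[of "z - w"] d by simp
      moreover have "Im z = 2 * s" by (simp add: s_def)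
      ultimately have 2: "Im w \<ge> s" by linarith
      have "1 / s \<le> r" using s by (simp add: r_def)
      then have "1 / r \<le> s" using s r by (simp add: field_simps)
      then show ?thesis using 1 2 s by linarith
    qed
    obtain B where B: "B > 0"
      "\<forall>A\<in>G. \<forall>z. norm z \<le> r \<longrightarrow> Im z \<ge> 1 / r \<longrightarrow> norm (1 / lin A z ^ (2 * l)) \<le> B * (1 / frob A ^ 5)"
      by (rule poincare_bound[OF l r])
    have u: "uniform_limit (cball z s) (\<lambda>X w. \<Sum>A\<in>X. 1 / lin A w ^ (2 * l)) (\<lambda>w. \<Sum>\<^sub>\<infinity>A\<in>G. 1 / lin A w ^ (2 * l)) (finite_subsets_at_top G)"
    proof (rule Weierstrass_m_test_general[of _ _ _ "\<lambda>A. B * (1 / frob A ^ 5)"])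
      show "norm (1 / lin A w ^ (2 * l)) \<le> B * (1 / frob A ^ 5)" if "A \<in> G" "w \<in> cball z s" for A w
        using B(2) that(1) sub[OF that(2)] by simp
      show "(\<lambda>A. B * (1 / frob A ^ 5)) summable_on G"
        by (rule summable_on_cmult_right[OF summable_frob])
    qed
    have nz: "lin A w \<noteq> 0" if "A \<in> G" "w \<in> cball z s" for A w
    proof
      assume "lin A w = 0"
      then have "frob A \<le> 0" using lin_lower[OF G_det[OF that(1)] r, of w] sub[OF that(2)] by simp
      then show False using frob_ge_2[OF G_det[OF that(1)]] by simp
    qed
    have h: "(\<lambda>w. \<Sum>A\<in>X. 1 / lin A w ^ (2 * l)) holomorphic_on cball z s" if "X \<subseteq> G" for X
    proof (intro holomorphic_intros)
      fix A w assume "A \<in> X" "w \<in> cball z s"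
      then show "lin A w ^ (2 * l) \<noteq> 0" using nz that by auto
    next
      fix A show "lin A holomorphic_on cball z s" unfolding lin_def[abs_def] by (intro holomorphic_intros)
    qed
    have "\<forall>\<^sub>F X in finite_subsets_at_top G. continuous_on (cball z s) (\<lambda>w. \<Sum>A\<in>X. 1 / lin A w ^ (2 * l))
        \<and> (\<lambda>w. \<Sum>A\<in>X. 1 / lin A w ^ (2 * l)) holomorphic_on ball z s"
      by (rule eventually_finite_subsets_at_top_weakI)
        (use h holomorphic_on_imp_continuous_on holomorphic_on_subset[OF _ ball_subset_cball] in metis)
    then have "(\<lambda>w. \<Sum>\<^sub>\<infinity>A\<in>G. 1 / lin A w ^ (2 * l)) holomorphic_on ball z s"
      using holomorphic_uniform_limit[OF _ u finite_subsets_at_top_neq_bot] by metis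
    then have "poincare l holomorphic_on ball z s"
      by (rule holomorphic_transform) (use sub in \<open>auto simp: poincare_def\<close>)
    then show ?thesis using s by (intro holomorphic_on_imp_differentiable_at[of _ "ball z s"]) auto
  qed
  then show ?thesis by (auto simp: holomorphic_on_def intro: field_differentiable_at_within)
qed

lemma poincare_mod_form:
  assumes l: "l \<ge> 5" shows "poincare l \<in> mod_forms \<Gamma> (2 * l)"
  unfolding mod_forms_iff
proof (intro conjI ballI allI impI)
  show "poincare l holomorphic_on uhp" by (rule poincare_holomorphic[OF l])
next
  fix B z assume B: "B \<in> G" and z: "Im z > 0"
  have j: "autj B z \<noteq> 0" using autj_nonzero G_det B z by blast
  have "(\<Sum>\<^sub>\<infinity>A\<in>G. 1 / lin A (moeb B z) ^ (2 * l)) = (\<Sum>\<^sub>\<infinity>A\<in>G. autj B z ^ (2 * l) * (1 / lin (A ** B) z ^ (2 * l)))"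
    by (intro infsum_cong) (use j in \<open>simp add: lin_mult[OF G_det[OF B] z] power_mult_distrib\<close>)
  also have "\<dots> = autj B z ^ (2 * l) * (\<Sum>\<^sub>\<infinity>A\<in>G. 1 / lin (A ** B) z ^ (2 * l))"
    by (rule infsum_cmult_right')
  also have "(\<Sum>\<^sub>\<infinity>A\<in>G. 1 / lin (A ** B) z ^ (2 * l)) = (\<Sum>\<^sub>\<infinity>A\<in>G. 1 / lin A z ^ (2 * l))"
    by (rule infsum_reindex_bij_betw[OF right_mult_bij[OF B]])
  finally show "poincare l (moeb B z) = autj B z ^ (2 * l) * poincare l z"
    using z moeb_uhp[OF B z] by (simp add: poincare_def)
qed (simp add: poincare_def)

text \<open>At \<open>\<i>\<close> the terms of the stabilizer, a finite group of rotations, have modulus \<open>4\<^sup>-\<^sup>l\<close> and, if \<open>l\<close> is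
  divisible by its order, the same argument; all others are smaller by a factor exponential in \<open>l\<close>.\<close>

lemma exists_mod_form:
  obtains K F where "K > 0" "F \<in> mod_forms \<Gamma> K" "F \<i> \<noteq> 0"
proof -
  define St where "St = {A \<in> G. frob A \<le> 2}"
  define \<zeta> where "\<zeta> A = Complex (A$1$1) (- (A$1$2))" for A :: "real^2^2"
  have finSt: "finite St" unfolding St_def by (rule finite_frob_le)
  have St1: "mat 1 \<in> St" using G_one by (simp add: St_def frob_def mat_1_entries)
  have rot: "A$2$2 = A$1$1" "A$2$1 = - A$1$2" "(A$1$1)\<^sup>2 + (A$1$2)\<^sup>2 = 1" if "A \<in> St" for A
  proof -
    have d: "A$1$1 * A$2$2 - A$1$2 * A$2$1 = 1" and f: "frob A \<le> 2"
      using that G_det by (auto simp: St_def det_2)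
    have "frob A - 2 * 1 = (A$1$1 - A$2$2)\<^sup>2 + (A$1$2 + A$2$1)\<^sup>2"
      unfolding d[symmetric] by (simp add: frob_def power2_eq_square algebra_simps)
    then have "(A$1$1 - A$2$2)\<^sup>2 + (A$1$2 + A$2$1)\<^sup>2 = 0" using f by (smt (verit) zero_le_power2)
    then have e: "A$1$1 - A$2$2 = 0" "A$1$2 + A$2$1 = 0" by (simp_all add: sum_power2_eq_zero_iff)
    then show "A$2$2 = A$1$1" "A$2$1 = - A$1$2" by simp_all
    then show "(A$1$1)\<^sup>2 + (A$1$2)\<^sup>2 = 1" using d by (simp add: power2_eq_square)
  qed
  have St_mult: "A ** B \<in> St \<and> \<zeta> (A ** B) = \<zeta> A * \<zeta> B" if A: "A \<in> St" and B: "B \<in> St" for A B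
  proof
    have "frob (A ** B) = 2 * (((A$1$1)\<^sup>2 + (A$1$2)\<^sup>2) * ((B$1$1)\<^sup>2 + (B$1$2)\<^sup>2))"
      unfolding frob_def matrix_mult_entries rot(1,2)[OF A] rot(1,2)[OF B]
      by (simp add: power2_eq_square algebra_simps)
    then show "A ** B \<in> St" using rot(3)[OF A] rot(3)[OF B] G_mult A B by (simp add: St_def)
    show "\<zeta> (A ** B) = \<zeta> A * \<zeta> B"
      unfolding \<zeta>_def matrix_mult_entries rot(1,2)[OF B] by (simp add: complex_eq_iff)
  qed
  have pow: "\<exists>B\<in>St. \<zeta> B = \<zeta> A ^ n" if A: "A \<in> St" for A n
  proof (induction n)
    case 0
    then show ?case using St1 by (intro bexI[of _ "mat 1"]) (auto simp: \<zeta>_def mat_1_entries complex_eq_iff)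
  next
    case (Suc n)
    then obtain B where "B \<in> St" "\<zeta> B = \<zeta> A ^ n" by auto
    then show ?case using St_mult[OF A] by (intro bexI[of _ "A ** B"]) auto
  qed
  have z0: "\<zeta> A \<noteq> 0" if "A \<in> St" for A using rot(3)[OF that] by (auto simp: \<zeta>_def complex_eq_iff)
  define M where "M = (fact (card St) :: nat)"
  have order: "\<zeta> A ^ M = 1" if A: "A \<in> St" for A
  proof -
    have "(\<lambda>n. \<zeta> A ^ n) ` {0..card St} \<subseteq> \<zeta> ` St"
    proof
      fix y assume "y \<in> (\<lambda>n. \<zeta> A ^ n) ` {0..card St}"
      then obtain n where "y = \<zeta> A ^ n" by auto
      moreover obtain B where "B \<in> St" "\<zeta> B = \<zeta> A ^ n" using pow[OF A, of n] by auto
      ultimately show "y \<in> \<zeta> ` St" by (intro image_eqI[of _ _ B]) auto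
    qed
    then have "card ((\<lambda>n. \<zeta> A ^ n) ` {0..card St}) \<le> card (\<zeta> ` St)"
      by (rule card_mono[OF finite_imageI[OF finSt]])
    also have "\<dots> \<le> card St" by (rule card_image_le[OF finSt])
    finally have "card ((\<lambda>n. \<zeta> A ^ n) ` {0..card St}) \<le> card St" .
    then have "\<not> inj_on (\<lambda>n. \<zeta> A ^ n) {0..card St}"
      using card_image[of "\<lambda>n. \<zeta> A ^ n" "{0..card St}"] by auto
    then obtain m n where mn: "m \<le> card St" "n \<le> card St" "m \<noteq> n" "\<zeta> A ^ m = \<zeta> A ^ n"
      by (auto simp: inj_on_def)
    have *: "\<zeta> A ^ M = 1" if "a < b" "b \<le> card St" "\<zeta> A ^ a = \<zeta> A ^ b" for a b
    proof -
      have "\<zeta> A ^ b = \<zeta> A ^ a * \<zeta> A ^ (b - a)" using that(1) by (simp flip: power_add)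
      then have 1: "\<zeta> A ^ (b - a) = 1" using that(3) z0[OF A] by simp
      have "b - a dvd M" unfolding M_def using that by (intro dvd_fact) auto
      then show ?thesis using 1 by (auto simp: power_mult elim!: dvdE)
    qed
    then show ?thesis using mn by (metis linorder_neqE_nat)
  qed
  have M0: "M \<ge> 1" unfolding M_def by (rule fact_ge_1)
  have lin_i: "(norm (lin A \<i>))\<^sup>2 = frob A + 2" if "A \<in> G" for A
  proof -
    have d: "A$1$1 * A$2$2 - A$1$2 * A$2$1 = 1" using G_det[OF that] by (simp add: det_2)
    have "(norm (lin A \<i>))\<^sup>2 = frob A + 2 * (A$1$1 * A$2$2 - A$1$2 * A$2$1)"
      unfolding lin_def autj_def cmod_power2 frob_def by (simp add: power2_eq_square algebra_simps)
    then show ?thesis using d by simp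
  qed
  \<comment> \<open>the rest of \<open>G\<close> has a gap in \<open>frob\<close>\<close>
  obtain \<mu> where \<mu>: "\<mu> > 2" "\<And>A. A \<in> G \<Longrightarrow> A \<notin> St \<Longrightarrow> frob A \<ge> \<mu>"
  proof -
    define V where "V = insert 3 (frob ` ({A \<in> G. frob A \<le> 3} - St))"
    have fV: "finite V" unfolding V_def using finite_frob_le by simp
    have "Min V > 2" using fV by (subst Min_gr_iff) (auto simp: V_def St_def)
    moreover have "frob A \<ge> Min V" if "A \<in> G" "A \<notin> St" for A
    proof (cases "frob A \<le> 3")
      case True
      then have "frob A \<in> V" using that by (simp add: V_def)
      then show ?thesis using fV by simp
    next
      case False
      moreover have "Min V \<le> 3" using fV by (simp add: V_def)
      ultimately show ?thesis by simp
    qed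
    ultimately show thesis using that by blast
  qed
  define \<theta> where "\<theta> = 4 / (\<mu> + 2)"
  have \<theta>: "0 < \<theta>" "\<theta> < 1" using \<mu>(1) by (auto simp: \<theta>_def)
  define \<Sigma> where "\<Sigma> = (\<Sum>\<^sub>\<infinity>A\<in>G. 1024 * (1 / frob A ^ 5))"
  have sm: "(\<lambda>A. 1024 * (1 / frob A ^ 5)) summable_on G" by (rule summable_on_cmult_right[OF summable_frob])
  have fpos: "frob A > 0" if "A \<in> G" for A using frob_ge_2[OF G_det[OF that]] by simp
  have \<Sigma>0: "\<Sigma> \<ge> 0" unfolding \<Sigma>_def by (rule infsum_nonneg) (use fpos in \<open>simp add: less_imp_le\<close>)
  obtain t where t: "\<theta> ^ t < 1 / (\<Sigma> + 1)"
    using real_arch_pow_inv[of "1 / (\<Sigma> + 1)" \<theta>] \<theta> \<Sigma>0 by auto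
  define l where "l = M * (t + 5)"
  have l: "l \<ge> t + 5" using mult_le_mono1[OF M0, of "t + 5"] unfolding l_def by (simp only: mult_1)
  define T where "T A = (-4) ^ l * (1 / lin A \<i> ^ (2 * l))" for A
  have Ts: "T summable_on G"
    unfolding T_def
    by (rule summable_on_cmult_right[OF abs_summable_summable[OF poincare_summable]]) (use l in auto)
  have TSt: "T A = 1" if A: "A \<in> St" for A
  proof -
    have "lin A \<i> = 2 * \<i> * \<zeta> A"
      using rot(1,2)[OF A] by (simp add: lin_def autj_def \<zeta>_def complex_eq_iff)
    then have sq: "(lin A \<i>)\<^sup>2 = (-4) * (\<zeta> A)\<^sup>2" by (simp add: power2_eq_square algebra_simps)
    have z1: "\<zeta> A ^ l = 1" unfolding l_def power_mult order[OF A] by simp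
    have "lin A \<i> ^ (2 * l) = ((-4) * (\<zeta> A)\<^sup>2) ^ l" unfolding power_mult sq ..
    also have "\<dots> = (-4) ^ l * ((\<zeta> A)\<^sup>2) ^ l" by (rule power_mult_distrib)
    also have "((\<zeta> A)\<^sup>2) ^ l = (\<zeta> A ^ l)\<^sup>2" by (simp only: power_mult[symmetric] mult.commute)
    finally have "lin A \<i> ^ (2 * l) = (-4) ^ l" using z1 by simp
    then show ?thesis by (simp add: T_def)
  qed
  have Tn: "norm (T A) \<le> \<theta> ^ t * (1024 * (1 / frob A ^ 5))" if A: "A \<in> G - St" for A
  proof -
    have f: "frob A \<ge> \<mu>" "A \<in> G" using A \<mu>(2) by auto
    have "norm (T A) = (4 / (norm (lin A \<i>))\<^sup>2) ^ l"
      by (simp add: T_def norm_mult norm_divide norm_power power_divide power_mult)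
    also have "\<dots> = (4 / (frob A + 2)) ^ l" unfolding lin_i[OF f(2)] ..
    also have "\<dots> = (4 / (frob A + 2)) ^ (l - 5) * (4 / (frob A + 2)) ^ 5" using l by (simp flip: power_add)
    also have "\<dots> \<le> \<theta> ^ t * (4 / frob A) ^ 5"
    proof (intro mult_mono)
      have "4 / (frob A + 2) \<le> \<theta>" unfolding \<theta>_def using f \<mu>(1) by (intro divide_left_mono) auto
      then have "(4 / (frob A + 2)) ^ (l - 5) \<le> \<theta> ^ (l - 5)" using fpos[OF f(2)] by (intro power_mono) auto
      also have "\<dots> \<le> \<theta> ^ t" using \<theta> l by (intro power_decreasing) auto
      finally show "(4 / (frob A + 2)) ^ (l - 5) \<le> \<theta> ^ t" .
      show "(4 / (frob A + 2)) ^ 5 \<le> (4 / frob A) ^ 5"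
        using fpos[OF f(2)] by (intro power_mono divide_left_mono) auto
    qed (use \<theta> fpos[OF f(2)] in auto)
    also have "(4 / frob A) ^ 5 = 1024 * (1 / frob A ^ 5)" by (simp add: power_divide)
    finally show ?thesis .
  qed
  have StG: "St \<subseteq> G" by (auto simp: St_def)
  have sm': "(\<lambda>A. \<theta> ^ t * (1024 * (1 / frob A ^ 5))) summable_on (G - St)"
    by (intro summable_on_cmult_right summable_on_subset_banach[OF sm]) auto
  have nT: "(\<lambda>A. norm (T A)) summable_on (G - St)"
    by (rule Infinite_Sum.abs_summable_on_comparison_test'[OF sm' Tn])
  have "norm (infsum T (G - St)) \<le> (\<Sum>\<^sub>\<infinity>A\<in>G - St. norm (T A))" by (rule norm_infsum_bound[OF nT])
  also have "\<dots> \<le> (\<Sum>\<^sub>\<infinity>A\<in>G - St. \<theta> ^ t * (1024 * (1 / frob A ^ 5)))"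
    by (rule infsum_mono[OF nT sm' Tn])
  also have "\<dots> = \<theta> ^ t * (\<Sum>\<^sub>\<infinity>A\<in>G - St. 1024 * (1 / frob A ^ 5))" by (rule infsum_cmult_right')
  also have "\<dots> \<le> \<theta> ^ t * \<Sigma>"
    unfolding \<Sigma>_def by (intro mult_left_mono infsum_mono_neutral summable_on_subset_banach[OF sm] sm)
      (use \<theta> fpos in \<open>auto simp: less_imp_le\<close>)
  also have "\<dots> \<le> 1 / (\<Sigma> + 1) * \<Sigma>" using t \<Sigma>0 by (intro mult_right_mono) auto
  also have "\<dots> < 1" using \<Sigma>0 by simp
  finally have small: "norm (infsum T (G - St)) < 1" .
  have "infsum T G = infsum T (St \<union> (G - St))" using StG by (simp add: Un_absorb1)
  also have "\<dots> = infsum T St + infsum T (G - St)"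
    by (intro infsum_Un_disjoint summable_on_subset_banach[OF Ts]) (use StG in auto)
  also have "infsum T St = of_nat (card St)" using finSt TSt by simp
  finally have split: "infsum T G = of_nat (card St) + infsum T (G - St)" .
  have "card St \<ge> 1" using finSt St1 by (auto simp: Suc_le_eq card_gt_0_iff)
  have "infsum T G \<noteq> 0"
  proof
    assume "infsum T G = 0"
    then have "infsum T (G - St) = - of_nat (card St)"
      using split by (simp add: eq_neg_iff_add_eq_0 add.commute)
    then have "norm (infsum T (G - St)) = real (card St)" by simp
    then show False using small \<open>card St \<ge> 1\<close> by simp
  qed
  have "infsum T G = (-4) ^ l * poincare l \<i>"
    unfolding T_def poincare_def by (subst infsum_cmult_right') simp
  with \<open>infsum T G \<noteq> 0\<close> have "poincare l \<i> \<noteq> 0" by auto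
  then show thesis
    using that[of "2 * l" "poincare l"] poincare_mod_form[of l] l by simp
qed

end

section \<open>The structure of quasimodular forms\<close>

definition uj :: "real^2^2 \<Rightarrow> complex \<Rightarrow> complex" where
  "uj A z = of_real (A$2$1) / autj A z"

lemma coeff_pcompose_linear:
  fixes q :: "complex poly"
  assumes "degree q \<le> p"
  shows "coeff (pcompose q [:b, a:]) n = (\<Sum>i\<le>p. coeff q i * (of_nat (i choose n) * a ^ n * b ^ (i - n)))"
proof -
  have c: "coeff ([:b, a:] ^ i) n = of_nat (i choose n) * a ^ n * b ^ (i - n)" for i
  proof (cases "n \<le> i")
    case True
    then show ?thesis by (rule coeff_linear_poly_power)
  next
    case False
    moreover have "degree ([:b, a:] ^ i) \<le> i" using degree_power_le[of "[:b, a:]" i] by (auto split: if_splits)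
    ultimately show ?thesis by (simp add: coeff_eq_0 binomial_eq_0)
  qed
  have pp: "pcompose (r ^ i) s = pcompose r s ^ i" for r s :: "complex poly" and i
    by (induction i) (simp_all add: pcompose_mult one_pCons)
  have "q = (\<Sum>i\<le>p. monom (coeff q i) i)" using assms by (simp add: poly_as_sum_of_monoms')
  then have "pcompose q [:b, a:] = pcompose (\<Sum>i\<le>p. monom (coeff q i) i) [:b, a:]" by simp
  also have "\<dots> = (\<Sum>i\<le>p. smult (coeff q i) ([:b, a:] ^ i))"
    by (simp add: pcompose_sum monom_altdef pcompose_smult pp pcompose_pCons)
  finally show ?thesis by (simp add: coeff_sum c)
qed

text \<open>The coefficients of a polynomial of bounded degree are Lagrange interpolants of its values, so they are
  holomorphic where values and nodes are.\<close>

lemma holomorphic_coeffs: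
  fixes u :: "nat \<Rightarrow> complex \<Rightarrow> complex" and Q :: "complex \<Rightarrow> complex poly"
  assumes "\<And>i. i \<le> p \<Longrightarrow> u i holomorphic_on S"
    and "\<And>i j z. i \<le> p \<Longrightarrow> j \<le> p \<Longrightarrow> i \<noteq> j \<Longrightarrow> z \<in> S \<Longrightarrow> u i z \<noteq> u j z"
    and "\<And>z. z \<in> S \<Longrightarrow> degree (Q z) \<le> p"
    and "\<And>i. i \<le> p \<Longrightarrow> (\<lambda>z. poly (Q z) (u i z)) holomorphic_on S"
  shows "(\<lambda>z. coeff (Q z) n) holomorphic_on S"
  using assms
proof (induction p arbitrary: Q n)
  case 0
  have c: "coeff (Q z) n = (if n = 0 then poly (Q z) (u 0 z) else 0)" if "z \<in> S" for z
  proof -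
    have "degree (Q z) = 0" using 0(3)[OF that] by simp
    then obtain a where "Q z = [:a:]" by (rule degree_eq_zeroE)
    then show ?thesis by (cases n) auto
  qed
  have "(\<lambda>z. if n = 0 then poly (Q z) (u 0 z) else 0) holomorphic_on S"
    using 0(4)[of 0] by (cases "n = 0") auto
  then show ?case by (rule holomorphic_transform) (simp add: c)
next
  case (Suc p)
  let ?c = "u (Suc p)"
  define Q' where "Q' z = synthetic_div (Q z) (?c z)" for z
  have Q: "Q z = pCons 0 (Q' z) - smult (?c z) (Q' z) + [:poly (Q z) (?c z):]" for z
    using synthetic_div_correct'[of "?c z" "Q z"] by (simp add: Q'_def)
  have hol': "(\<lambda>z. coeff (Q' z) n) holomorphic_on S" for n
  proof (rule Suc.IH)
    show "degree (Q' z) \<le> p" if "z \<in> S" for z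
      using Suc.prems(3)[OF that] by (simp add: Q'_def degree_synthetic_div)
    fix i assume i: "i \<le> p"
    have "(\<lambda>z. (poly (Q z) (u i z) - poly (Q z) (?c z)) / (u i z - ?c z)) holomorphic_on S"
      using i Suc.prems(2)[of i "Suc p"] by (intro holomorphic_intros Suc.prems(1,4)) auto
    then show "(\<lambda>z. poly (Q' z) (u i z)) holomorphic_on S"
    proof (rule holomorphic_transform)
      fix z assume "z \<in> S"
      then have "u i z - ?c z \<noteq> 0" using i Suc.prems(2)[of i "Suc p" z] by simp
      moreover have "poly (Q z) (u i z) - poly (Q z) (?c z) = (u i z - ?c z) * poly (Q' z) (u i z)"
        by (subst (1) Q) (simp add: algebra_simps)
      ultimately show "(poly (Q z) (u i z) - poly (Q z) (?c z)) / (u i z - ?c z) = poly (Q' z) (u i z)" by simp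
    qed
  qed (use Suc.prems in auto)
  have "(\<lambda>z. (if n = 0 then 0 else coeff (Q' z) (n - 1)) - ?c z * coeff (Q' z) n
      + (if n = 0 then poly (Q z) (?c z) else 0)) holomorphic_on S"
    using Suc.prems(4)[of "Suc p"] by (cases n) (auto intro!: holomorphic_intros hol' Suc.prems(1))
  then show ?case
  proof (rule holomorphic_transform)
    fix z
    show "(if n = 0 then 0 else coeff (Q' z) (n - 1)) - ?c z * coeff (Q' z) n + (if n = 0 then poly (Q z) (?c z) else 0) = coeff (Q z) n"
      by (subst (2) Q) (cases n; simp)
  qed
qed

context cocompact_group
begin

definition qrep :: "nat \<Rightarrow> (complex \<Rightarrow> complex) \<Rightarrow> (complex \<Rightarrow> complex poly) \<Rightarrow> bool" where
  "qrep k f Q \<longleftrightarrow> (\<forall>A\<in>G. \<forall>z. Im z > 0 \<longrightarrow> f (moeb A z) = autj A z ^ k * poly (Q z) (uj A z))"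

lemma qrepD: "qrep k f Q \<Longrightarrow> A \<in> G \<Longrightarrow> Im z > 0 \<Longrightarrow> f (moeb A z) = autj A z ^ k * poly (Q z) (uj A z)"
  by (simp add: qrep_def)

lemma infinite_uj: "Im z > 0 \<Longrightarrow> infinite ((\<lambda>A. uj A z) ` G)"
  using infinite_boundary_orbit[of "mat 1" z] by (simp add: uj_def)

lemma poly_unique:
  assumes z: "Im z > 0" and "\<And>A. A \<in> G \<Longrightarrow> poly q (uj A z) = poly r (uj A z)" shows "q = r"
proof (rule ccontr)
  assume "q \<noteq> r"
  then have "finite {x. poly (q - r) x = 0}" by (intro poly_roots_finite) simp
  moreover have "(\<lambda>A. uj A z) ` G \<subseteq> {x. poly (q - r) x = 0}" using assms(2) by auto
  ultimately have "finite ((\<lambda>A. uj A z) ` G)" by (rule finite_subset[rotated])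
  then show False using infinite_uj[OF z] by simp
qed

lemma G_autj: "A \<in> G \<Longrightarrow> Im z > 0 \<Longrightarrow> autj A z \<noteq> 0"
  using autj_nonzero G_det by blast

lemma qrep_0:
  assumes "qrep k f Q" "Im z > 0" shows "f z = coeff (Q z) 0"
  using qrepD[OF assms(1) G_one assms(2)] by (simp add: uj_def mat_1_entries poly_0_coeff_0)

lemma uj_mult:
  assumes "A \<in> G" "B \<in> G" "Im z > 0"
  shows "uj (A ** B) z = uj A (moeb B z) / (autj B z)\<^sup>2 + uj B z"
  unfolding uj_def by (rule autj_cocycle[OF G_det[OF assms(1)] G_det[OF assms(2)] assms(3)])

lemma uj_eq_iff:
  assumes "A \<in> G" "B \<in> G" "Im z > 0"
  shows "uj A z = uj B z \<longleftrightarrow> A$2$1 * B$2$2 = B$2$1 * A$2$2"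
proof -
  have "uj A z = uj B z \<longleftrightarrow> of_real (A$2$1) * autj B z = of_real (B$2$1) * autj A z"
    using G_autj assms by (simp add: uj_def frac_eq_eq)
  also have "\<dots> \<longleftrightarrow> complex_of_real (A$2$1 * B$2$2) = of_real (B$2$1 * A$2$2)"
    by (simp add: autj_def algebra_simps)
  finally show ?thesis by (simp only: of_real_eq_iff)
qed

lemma qrep_cocycle:
  assumes Q: "qrep k f Q" and B: "B \<in> G" and z: "Im z > 0"
  shows "Q (moeb B z) = smult (autj B z ^ k) (pcompose (Q z) [:uj B z, 1 / (autj B z)\<^sup>2:])"
proof (rule poly_unique[OF moeb_uhp[OF B z]])
  fix A assume A: "A \<in> G"
  have w: "Im (moeb B z) > 0" by (rule moeb_uhp[OF B z])
  have m: "moeb (A ** B) z = moeb A (moeb B z)" by (rule moeb_mult[OF G_det[OF A] G_det[OF B] z w])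
  have "autj A (moeb B z) ^ k * poly (Q (moeb B z)) (uj A (moeb B z)) = f (moeb A (moeb B z))"
    using qrepD[OF Q A w] by simp
  also have "\<dots> = autj (A ** B) z ^ k * poly (Q z) (uj (A ** B) z)"
    using qrepD[OF Q G_mult[OF A B] z] m by simp
  also have "\<dots> = autj A (moeb B z) ^ k * (autj B z ^ k * poly (Q z) (uj A (moeb B z) / (autj B z)\<^sup>2 + uj B z))"
    unfolding uj_mult[OF A B z] autj_mult[OF G_det[OF B] z] by (simp add: power_mult_distrib)
  finally show "poly (Q (moeb B z)) (uj A (moeb B z))
      = poly (smult (autj B z ^ k) (pcompose (Q z) [:uj B z, 1 / (autj B z)\<^sup>2:])) (uj A (moeb B z))"
    using G_autj[OF A w] by (simp add: poly_pcompose add.commute)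
qed

lemma qrep_holomorphic:
  assumes Q: "qrep k f Q" and hol: "f holomorphic_on uhp" and deg: "\<And>z. Im z > 0 \<Longrightarrow> degree (Q z) \<le> p"
  shows "(\<lambda>z. coeff (Q z) n) holomorphic_on uhp"
proof -
  obtain U where U: "U \<subseteq> (\<lambda>A. uj A \<i>) ` G" "card U = Suc p" "finite U"
    using infinite_arbitrarily_large[OF infinite_uj[of \<i>], of "Suc p"] by auto
  then obtain e where e: "bij_betw e {..<Suc p} U" using ex_bij_betw_nat_finite[OF U(3)] by (auto simp: atLeast0LessThan)
  have "\<forall>i. \<exists>A. i \<le> p \<longrightarrow> A \<in> G \<and> uj A \<i> = e i"
  proof
    fix i show "\<exists>A. i \<le> p \<longrightarrow> A \<in> G \<and> uj A \<i> = e i"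
    proof (cases "i \<le> p")
      case True
      then have "e i \<in> U" using e by (auto simp: bij_betw_def)
      then have "e i \<in> (\<lambda>A. uj A \<i>) ` G" by (rule subsetD[OF U(1)])
      then show ?thesis by auto
    qed simp
  qed
  from choice[OF this] obtain A where "\<forall>i. i \<le> p \<longrightarrow> A i \<in> G \<and> uj (A i) \<i> = e i" by (rule exE)
  then have A: "A i \<in> G \<and> uj (A i) \<i> = e i" if "i \<le> p" for i using that by simp
  show ?thesis
  proof (rule holomorphic_coeffs[of p "\<lambda>i. uj (A i)"])
    show "uj (A i) holomorphic_on uhp" if "i \<le> p" for i
      unfolding uj_def[abs_def] using A[OF that] G_autj by (intro holomorphic_intros) auto
    show "uj (A i) z \<noteq> uj (A j) z" if ij: "i \<le> p" "j \<le> p" "i \<noteq> j" "z \<in> uhp" for i j z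
    proof -
      have "e i \<noteq> e j" using e ij by (auto simp: bij_betw_def inj_on_def)
      then have "uj (A i) \<i> \<noteq> uj (A j) \<i>" using A ij by simp
      then show ?thesis using uj_eq_iff[of "A i" "A j" z] uj_eq_iff[of "A i" "A j" \<i>] A ij by simp
    qed
    show "degree (Q z) \<le> p" if "z \<in> uhp" for z using deg that by simp
    show "(\<lambda>z. poly (Q z) (uj (A i) z)) holomorphic_on uhp" if i: "i \<le> p" for i
    proof -
      have Ai: "A i \<in> G" using A[OF i] by simp
      have "moeb (A i) ` uhp \<subseteq> uhp" using moeb_uhp[OF Ai] by auto
      then have "(\<lambda>z. f (moeb (A i) z)) holomorphic_on uhp"
        using holomorphic_on_compose_gen[OF holomorphic_moeb[OF G_det[OF Ai]] hol] by (auto simp: o_def)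
      then have "(\<lambda>z. f (moeb (A i) z) / autj (A i) z ^ k) holomorphic_on uhp"
        using G_autj[OF Ai] by (intro holomorphic_intros) auto
      then show ?thesis
        by (rule holomorphic_transform) (use qrepD[OF Q Ai] G_autj[OF Ai] in simp)
    qed
  qed
qed

lemma qrep_coeff_top:
  assumes Q: "qrep k f Q" and deg: "degree (Q z) \<le> p" and B: "B \<in> G" and z: "Im z > 0"
  shows "coeff (Q (moeb B z)) p * autj B z ^ (2 * p) = autj B z ^ k * coeff (Q z) p"
    "p > 0 \<Longrightarrow> coeff (Q (moeb B z)) (p - 1) * autj B z ^ (2 * (p - 1))
       = autj B z ^ k * (coeff (Q z) (p - 1) + of_nat p * coeff (Q z) p * uj B z)"
proof -
  let ?j = "autj B z"
  have j: "?j \<noteq> 0" by (rule G_autj[OF B z])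
  have c: "coeff (Q (moeb B z)) n = ?j ^ k * (\<Sum>i\<le>p. coeff (Q z) i * (of_nat (i choose n) * (1 / ?j\<^sup>2) ^ n * uj B z ^ (i - n)))" for n
    unfolding qrep_cocycle[OF Q B z] by (simp add: coeff_pcompose_linear[OF deg])
  have "(\<Sum>i\<le>p. coeff (Q z) i * (of_nat (i choose p) * (1 / ?j\<^sup>2) ^ p * uj B z ^ (i - p)))
      = (\<Sum>i\<le>p. if i = p then coeff (Q z) p * (1 / ?j\<^sup>2) ^ p else 0)"
    by (intro sum.cong) auto
  then have "coeff (Q (moeb B z)) p = ?j ^ k * (coeff (Q z) p * (1 / ?j\<^sup>2) ^ p)" unfolding c by simp
  then show "coeff (Q (moeb B z)) p * ?j ^ (2 * p) = ?j ^ k * coeff (Q z) p"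
    using j by (simp add: power_mult power_one_over)
  assume "p > 0"
  then obtain p' where p': "p = Suc p'" by (cases p) auto
  have "(\<Sum>i\<le>p. coeff (Q z) i * (of_nat (i choose p') * (1 / ?j\<^sup>2) ^ p' * uj B z ^ (i - p')))
      = (\<Sum>i<p'. coeff (Q z) i * (of_nat (i choose p') * (1 / ?j\<^sup>2) ^ p' * uj B z ^ (i - p')))
        + coeff (Q z) p' * (1 / ?j\<^sup>2) ^ p' + coeff (Q z) p * (of_nat p * (1 / ?j\<^sup>2) ^ p' * uj B z)"
    by (simp add: p' lessThan_Suc_atMost[symmetric])
  also have "(\<Sum>i<p'. coeff (Q z) i * (of_nat (i choose p') * (1 / ?j\<^sup>2) ^ p' * uj B z ^ (i - p'))) = 0"
    by (rule sum.neutral) (simp add: binomial_eq_0)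
  finally have "coeff (Q (moeb B z)) p' = ?j ^ k * ((1 / ?j\<^sup>2) ^ p' * (coeff (Q z) p' + of_nat p * coeff (Q z) p * uj B z))"
    unfolding c by (simp add: algebra_simps)
  then show "coeff (Q (moeb B z)) (p - 1) * ?j ^ (2 * (p - 1))
       = ?j ^ k * (coeff (Q z) (p - 1) + of_nat p * coeff (Q z) p * uj B z)"
    using j by (simp add: p' power_mult power_one_over)
qed

text \<open>The leading coefficient has weight \<open>k - 2 p\<close>, so it vanishes for \<open>2 p > k\<close>.  For \<open>2 p = k\<close> it is a
  constant, and if that constant is nonzero the next coefficient is a multiple of a holomorphic form of weight 2
  with \<open>\<delta> = 1\<close>.\<close>

lemma qrep_degree_step:
  assumes Q: "qrep k f Q" and hol: "f holomorphic_on uhp" and deg: "\<And>z. Im z > 0 \<Longrightarrow> degree (Q z) \<le> p"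
    and p: "p > 0" "k \<le> 2 * p" and z: "Im z > 0"
  shows "degree (Q z) \<le> p - 1"
proof -
  let ?F = "\<lambda>z. coeff (Q z) p"
  have hF: "(\<lambda>z. coeff (Q z) n) holomorphic_on uhp" for n by (rule qrep_holomorphic[OF Q hol deg])
  have tr: "?F (moeb A w) * autj A w ^ (2 * p - k) = ?F w" if "A \<in> G" "Im w > 0" for A w
  proof -
    have "autj A w ^ (2 * p) = autj A w ^ (2 * p - k) * autj A w ^ k" using p(2) by (simp flip: power_add)
    then show ?thesis
      using qrep_coeff_top(1)[OF Q deg[OF that(2)] that] G_autj[OF that] by simp
  qed
  have "?F z = 0"
  proof (cases "k < 2 * p")
    case True
    then show ?thesis using nonpositive_weight(2)[OF hF tr, of z] z by simp
  next
    case False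
    then have k: "k = 2 * p" using p(2) by simp
    obtain c where c: "\<forall>z. Im z > 0 \<longrightarrow> ?F z = c" using nonpositive_weight(1)[OF hF tr] by auto
    have "c = 0"
    proof (rule ccontr)
      assume c0: "c \<noteq> 0"
      let ?\<phi> = "\<lambda>z. coeff (Q z) (p - 1) / (of_nat p * c)"
      show False
      proof (rule no_holomorphic_weight2[of ?\<phi>])
        show "?\<phi> holomorphic_on uhp" using c0 p(1) by (intro holomorphic_intros hF) auto
        fix A w assume A: "A \<in> G" and w: "Im w > 0"
        have j: "autj A w \<noteq> 0" by (rule G_autj[OF A w])
        have "autj A w ^ k = autj A w ^ (2 * (p - 1)) * (autj A w)\<^sup>2"
        proof -
          have "k = 2 * (p - 1) + 2" using p(1) k by simp
          then show ?thesis by (simp only: power_add)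
        qed
        then have "coeff (Q (moeb A w)) (p - 1) * autj A w ^ (2 * (p - 1)) = autj A w ^ (2 * (p - 1)) * ((autj A w)\<^sup>2 * (coeff (Q w) (p - 1) + of_nat p * c * uj A w))"
          using qrep_coeff_top(2)[OF Q deg[OF w] A w p(1)] c w by (simp only: mult.assoc)
        then have "coeff (Q (moeb A w)) (p - 1) = (autj A w)\<^sup>2 * (coeff (Q w) (p - 1) + of_nat p * c * uj A w)"
          using j by simp
        then show "?\<phi> (moeb A w) = autj A w ^ 2 * ?\<phi> w + of_real (A$2$1) * autj A w"
        proof -
          have r: "of_nat p * c \<noteq> 0" using c0 p(1) by simp
          have e: "(x\<^sup>2 * (q + r * y)) / r = x\<^sup>2 * (q / r) + x\<^sup>2 * y" if "r \<noteq> 0" for x q r y :: complex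
            using that by (simp add: distrib_left add_divide_distrib)
          have ju: "(autj A w)\<^sup>2 * uj A w = of_real (A$2$1) * autj A w" using j by (simp add: uj_def power2_eq_square)
          show ?thesis unfolding \<open>coeff (Q (moeb A w)) (p - 1) = _\<close> e[OF r] ju ..
        qed
      qed
    qed
    then show ?thesis using c z by simp
  qed
  then have "coeff (Q z) i = 0" if "i > p - 1" for i
    using that deg[OF z] p(1) by (cases "i = p") (auto intro: coeff_eq_0)
  then show ?thesis by (intro degree_le) auto
qed

lemma qrep_degree_bound:
  assumes Q: "qrep k f Q" and hol: "f holomorphic_on uhp" and deg: "\<forall>z. Im z > 0 \<longrightarrow> degree (Q z) \<le> p"
  shows "\<exists>q. (q = 0 \<or> 2 * q < k) \<and> (\<forall>z. Im z > 0 \<longrightarrow> degree (Q z) \<le> q)"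
  using deg
proof (induction p)
  case 0
  then show ?case by (intro exI[of _ 0]) simp
next
  case (Suc p)
  show ?case
  proof (cases "2 * Suc p < k")
    case True
    then show ?thesis using Suc.prems by (intro exI[of _ "Suc p"]) simp
  next
    case False
    show ?thesis
    proof (rule Suc.IH, intro allI impI)
      fix z assume "Im z > 0"
      then show "degree (Q z) \<le> p"
        using qrep_degree_step[OF Q hol Suc.prems[rule_format], of z] False by simp
    qed
  qed
qed

definition du :: "(complex \<Rightarrow> complex) \<Rightarrow> complex \<Rightarrow> complex" where
  "du f = restr uhp (deriv f)"

lemma du_holomorphic:
  assumes "f holomorphic_on uhp" shows "du f holomorphic_on uhp"
proof -
  have "deriv f holomorphic_on uhp" by (rule holomorphic_deriv[OF assms open_uhp])
  then show ?thesis by (rule holomorphic_transform) (simp add: du_def restr_def)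
qed

text \<open>Differentiation raises the weight by 2 and the degree by 1: with \<open>u = c / (c z + d)\<close> one has \<open>u' = - u\<^sup>2\<close>.\<close>

lemma qrep_du:
  assumes Q: "qrep k f Q" and hol: "f holomorphic_on uhp" and deg: "\<And>z. Im z > 0 \<Longrightarrow> degree (Q z) \<le> p"
  obtains Q' where "qrep (k + 2) (du f) Q'" "\<forall>z. Im z > 0 \<longrightarrow> degree (Q' z) \<le> Suc p"
    "\<forall>z. Im z > 0 \<longrightarrow> coeff (Q' z) (Suc p) = (of_nat k - of_nat p) * coeff (Q z) p"
    "\<forall>n<p. \<forall>z. coeff (Q' z) (Suc n) = (of_nat k - of_nat n) * coeff (Q z) n + deriv (\<lambda>z. coeff (Q z) (Suc n)) z"
proof -
  define Qd where "Qd z = (\<Sum>i\<le>p. monom (deriv (\<lambda>z. coeff (Q z) i) z) i)" for z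
  define Q' where "Q' z = smult (of_nat k) (pCons 0 (Q z)) + Qd z - pCons 0 (pCons 0 (pderiv (Q z)))" for z
  have hF: "(\<lambda>z. coeff (Q z) n) holomorphic_on uhp" for n by (rule qrep_holomorphic[OF Q hol deg])
  show thesis
  proof (rule that[of Q'])
    show "qrep (k + 2) (du f) Q'" unfolding qrep_def
    proof (intro ballI allI impI)
      fix A z assume A: "A \<in> G" and z: "Im z > 0"
      let ?j = "autj A z" and ?u = "uj A z"
      have j: "?j \<noteq> 0" by (rule G_autj[OF A z])
      have Aw: "Im (moeb A z) > 0" by (rule moeb_uhp[OF A z])
      have pa: "poly (Q w) x = (\<Sum>i\<le>p. coeff (Q w) i * x ^ i)" if "Im w > 0" for w x
        by (subst poly_altdef, rule sum.mono_neutral_left) (use deg[OF that] in \<open>auto simp: coeff_eq_0\<close>)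
      have fd: "(f has_field_derivative deriv f (moeb A z)) (at (moeb A z))"
        by (rule holomorphic_derivI[OF hol open_uhp]) (use Aw in simp)
      have d1: "((\<lambda>w. f (moeb A w)) has_field_derivative deriv f (moeb A z) * (1 / ?j\<^sup>2)) (at z)"
        using DERIV_chain2[OF fd moeb_has_deriv[OF G_det[OF A] z]] .
      have "((\<lambda>w. of_real (A$2$1) / autj A w) has_field_derivative (0 * ?j - of_real (A$2$1) * of_real (A$2$1)) / (?j * ?j)) (at z)"
        by (rule DERIV_divide[OF DERIV_const autj_has_deriv j])
      then have ud: "(uj A has_field_derivative - (?u\<^sup>2)) (at z)"
        unfolding uj_def[abs_def] by (simp add: power2_eq_square)
      have Fd: "((\<lambda>w. coeff (Q w) i) has_field_derivative deriv (\<lambda>z. coeff (Q z) i) z) (at z)" for i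
        by (rule holomorphic_derivI[OF hF open_uhp]) (use z in simp)
      let ?S0 = "\<Sum>i\<le>p. coeff (Q z) i * ?u ^ i"
      let ?S1 = "\<Sum>i\<le>p. coeff (Q z) i * (of_nat i * (- (?u\<^sup>2) * ?u ^ (i - Suc 0))) + deriv (\<lambda>z. coeff (Q z) i) z * ?u ^ i"
      have d2: "((\<lambda>w. autj A w ^ k * (\<Sum>i\<le>p. coeff (Q w) i * uj A w ^ i)) has_field_derivative
          ?j ^ k * ?S1 + of_nat k * (of_real (A$2$1) * ?j ^ (k - Suc 0)) * ?S0) (at z)"
        by (intro DERIV_mult' DERIV_sum DERIV_power autj_has_deriv Fd ud)
      have "\<forall>\<^sub>F w in nhds z. f (moeb A w) = autj A w ^ k * (\<Sum>i\<le>p. coeff (Q w) i * uj A w ^ i)"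
        using eventually_nhds_in_open[OF open_uhp, of z] z
        by (auto elim!: eventually_mono simp: qrepD[OF Q A] pa)
      from DERIV_cong_ev[OF refl this refl] d1
      have "((\<lambda>w. autj A w ^ k * (\<Sum>i\<le>p. coeff (Q w) i * uj A w ^ i)) has_field_derivative deriv f (moeb A z) * (1 / ?j\<^sup>2)) (at z)" by simp
      from DERIV_unique[OF this d2]
      have eq1: "deriv f (moeb A z) * (1 / ?j\<^sup>2) = ?j ^ k * ?S1 + of_nat k * (of_real (A$2$1) * ?j ^ (k - Suc 0)) * ?S0" .
      have eq2: "?S0 = poly (Q z) ?u" using pa[OF z] by simp
      have eq3: "of_nat k * (of_real (A$2$1) * ?j ^ (k - Suc 0)) = ?j ^ k * (of_nat k * ?u)"
        using j by (cases k) (simp_all add: uj_def)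
      have eq4: "?S1 = poly (Qd z) ?u - ?u\<^sup>2 * (\<Sum>i\<le>p. of_nat i * coeff (Q z) i * ?u ^ (i - 1))"
        by (simp add: Qd_def poly_sum poly_monom sum.distrib sum_negf sum_subtractf sum_distrib_left mult_ac)
      have eq5: "(\<Sum>i\<le>p. of_nat i * coeff (Q z) i * ?u ^ (i - 1)) = poly (pderiv (Q z)) ?u"
      proof -
        have "((\<lambda>x. \<Sum>i\<le>p. coeff (Q z) i * x ^ i) has_field_derivative
            (\<Sum>i\<le>p. coeff (Q z) i * (of_nat i * (1 * ?u ^ (i - Suc 0))) + 0 * ?u ^ i)) (at ?u)"
          by (intro DERIV_mult' DERIV_sum DERIV_power DERIV_const DERIV_ident)
        then have "(poly (Q z) has_field_derivative
            (\<Sum>i\<le>p. coeff (Q z) i * (of_nat i * (1 * ?u ^ (i - Suc 0))) + 0 * ?u ^ i)) (at ?u)"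
          unfolding pa[OF z, symmetric] .
        from DERIV_unique[OF poly_DERIV this] show ?thesis by (simp add: mult_ac)
      qed
      have "deriv f (moeb A z) * (1 / ?j\<^sup>2)
          = ?j ^ k * (poly (Qd z) ?u - ?u\<^sup>2 * poly (pderiv (Q z)) ?u) + ?j ^ k * (of_nat k * ?u) * poly (Q z) ?u"
        unfolding eq1 eq2 eq3 eq4 eq5 ..
      also have "\<dots> = ?j ^ k * poly (Q' z) ?u" by (simp add: Q'_def power2_eq_square algebra_simps)
      finally have "deriv f (moeb A z) = ?j ^ (k + 2) * poly (Q' z) ?u" using j by (simp add: power_add field_simps power2_eq_square)
      then show "du f (moeb A z) = ?j ^ (k + 2) * poly (Q' z) ?u" using Aw by (simp add: du_def restr_def)
    qed
    have cd: "coeff (Qd z) n = (if n \<le> p then deriv (\<lambda>z. coeff (Q z) n) z else 0)" for z n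
      by (simp add: Qd_def coeff_sum sum.delta)
    have co: "coeff (Q' z) (Suc n) = of_nat k * coeff (Q z) n + coeff (Qd z) (Suc n) - of_nat n * coeff (Q z) n" for z n
      by (cases n) (simp_all add: Q'_def coeff_pderiv)
    show "\<forall>z. Im z > 0 \<longrightarrow> degree (Q' z) \<le> Suc p"
    proof (intro allI impI degree_le)
      fix z i assume z: "Im z > 0" and i: "Suc p < i"
      then obtain n where n: "i = Suc n" "n > p" by (cases i) auto
      then show "coeff (Q' z) i = 0" using deg[OF z] by (simp add: co cd coeff_eq_0)
    qed
    show "\<forall>z. Im z > 0 \<longrightarrow> coeff (Q' z) (Suc p) = (of_nat k - of_nat p) * coeff (Q z) p"
      by (simp add: co cd algebra_simps)
    show "\<forall>n<p. \<forall>z. coeff (Q' z) (Suc n) = (of_nat k - of_nat n) * coeff (Q z) n + deriv (\<lambda>z. coeff (Q z) (Suc n)) z"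
      by (simp add: co cd algebra_simps)
  qed
qed

lemma qrep_mod_form:
  assumes "f \<in> mod_forms \<Gamma> k" shows "qrep k f (\<lambda>z. [:f z:])"
  using assms by (simp add: qrep_def mod_forms_iff)

lemma qrep_iter:
  assumes f: "f \<in> mod_forms \<Gamma> w"
  obtains Q where "qrep (w + 2 * n) ((du ^^ n) f) Q" "\<forall>z. Im z > 0 \<longrightarrow> degree (Q z) \<le> n"
    "\<forall>z. Im z > 0 \<longrightarrow> coeff (Q z) n = pochhammer (of_nat w) n * f z" "(du ^^ n) f holomorphic_on uhp"
proof (induction n arbitrary: thesis)
  case 0
  show ?case by (rule 0[of "\<lambda>z. [:f z:]"]) (use f qrep_mod_form[OF f] in \<open>auto simp: mod_forms_iff\<close>)
next
  case (Suc n)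
  obtain Q where Q: "qrep (w + 2 * n) ((du ^^ n) f) Q" "\<forall>z. Im z > 0 \<longrightarrow> degree (Q z) \<le> n"
    "\<forall>z. Im z > 0 \<longrightarrow> coeff (Q z) n = pochhammer (of_nat w) n * f z" "(du ^^ n) f holomorphic_on uhp"
    by (rule Suc.IH)
  obtain Q' where Q': "qrep (w + 2 * n + 2) (du ((du ^^ n) f)) Q'" "\<forall>z. Im z > 0 \<longrightarrow> degree (Q' z) \<le> Suc n"
    "\<forall>z. Im z > 0 \<longrightarrow> coeff (Q' z) (Suc n) = (of_nat (w + 2 * n) - of_nat n) * coeff (Q z) n"
    by (rule qrep_du[OF Q(1,4), of n]) (use Q(2) in auto)
  show ?case
  proof (rule Suc.prems[of Q'])
    show "qrep (w + 2 * Suc n) ((du ^^ Suc n) f) Q'" using Q'(1) by simp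
    show "(du ^^ Suc n) f holomorphic_on uhp" using du_holomorphic[OF Q(4)] by simp
    show "\<forall>z. Im z > 0 \<longrightarrow> coeff (Q' z) (Suc n) = pochhammer (of_nat w) (Suc n) * f z"
      using Q'(3) Q(3) by (simp add: pochhammer_Suc algebra_simps)
  qed (rule Q'(2))
qed

lemma du_out: "f \<in> mod_forms \<Gamma> w \<Longrightarrow> \<not> Im z > 0 \<Longrightarrow> (du ^^ n) f z = 0"
  by (cases n) (auto simp: du_def restr_def mod_forms_iff)

text \<open>Removing the leading coefficient by a derivative of a modular form lowers the depth; the case
  \<open>2 p \<ge> k\<close>, where no derivative is available, does not occur.\<close>

theorem quasi_form_decomposition:
  assumes "qrep k f Q" "f holomorphic_on uhp" "\<And>z. Im z > 0 \<Longrightarrow> degree (Q z) \<le> p" "\<And>z. \<not> Im z > 0 \<Longrightarrow> f z = 0"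
  shows "f \<in> fvs.span {(du ^^ n) g | n g w. g \<in> mod_forms \<Gamma> w \<and> w + 2 * n = k}" (is "_ \<in> fvs.span ?S")
  using assms
proof (induction p arbitrary: f Q)
  case 0
  have Q: "Q z = [:f z:]" if "Im z > 0" for z
  proof -
    have "degree (Q z) = 0" using 0(3)[OF that] by simp
    then obtain a where "Q z = [:a:]" by (rule degree_eq_zeroE)
    then show ?thesis using qrep_0[OF 0(1) that] by simp
  qed
  have "f \<in> mod_forms \<Gamma> k" using 0 Q by (auto simp: mod_forms_iff qrep_def)
  then have "f \<in> ?S" by (intro CollectI exI[of _ 0] exI[of _ f] exI[of _ k]) simp
  then show ?case by (rule fvs.span_base)
next
  case (Suc p)
  show ?case
  proof (cases "k \<le> 2 * Suc p")
    case True
    have "degree (Q z) \<le> p" if "Im z > 0" for z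
      using qrep_degree_step[OF Suc.prems(1,2,3) _ True that] by simp
    then show ?thesis by (rule Suc.IH[OF Suc.prems(1,2) _ Suc.prems(4)])
  next
    case False
    define w where "w = k - 2 * Suc p"
    have w: "w > 0" "w + 2 * Suc p = k" using False by (auto simp: w_def)
    define g where "g z = (if Im z > 0 then coeff (Q z) (Suc p) else 0)" for z
    have hF: "(\<lambda>z. coeff (Q z) (Suc p)) holomorphic_on uhp" by (rule qrep_holomorphic[OF Suc.prems(1-3)])
    have g: "g \<in> mod_forms \<Gamma> w" unfolding mod_forms_iff
    proof (intro conjI allI impI ballI)
      show "g holomorphic_on uhp" using hF by (rule holomorphic_transform) (simp add: g_def)
      fix A z assume A: "A \<in> G" and z: "Im z > 0"
      have "autj A z ^ k = autj A z ^ w * autj A z ^ (2 * Suc p)" using w(2) by (simp only: power_add[symmetric])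
      then have "coeff (Q (moeb A z)) (Suc p) * autj A z ^ (2 * Suc p) = (autj A z ^ w * coeff (Q z) (Suc p)) * autj A z ^ (2 * Suc p)"
        using qrep_coeff_top(1)[OF Suc.prems(1,3) A z] z by (simp only: mult_ac)
      then have "coeff (Q (moeb A z)) (Suc p) = autj A z ^ w * coeff (Q z) (Suc p)"
        using G_autj[OF A z] by simp
      then show "g (moeb A z) = autj A z ^ w * g z" using z moeb_uhp[OF A z] by (simp add: g_def)
    qed (simp add: g_def)
    obtain P where P: "qrep (w + 2 * Suc p) ((du ^^ Suc p) g) P" "\<forall>z. Im z > 0 \<longrightarrow> degree (P z) \<le> Suc p"
      "\<forall>z. Im z > 0 \<longrightarrow> coeff (P z) (Suc p) = pochhammer (of_nat w) (Suc p) * g z" "(du ^^ Suc p) g holomorphic_on uhp"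
      by (rule qrep_iter[OF g])
    define a where "a = 1 / pochhammer (of_nat w :: complex) (Suc p)"
    have poch: "pochhammer (of_nat w :: complex) (Suc p) \<noteq> 0"
    proof
      assume "pochhammer (of_nat w :: complex) (Suc p) = 0"
      then obtain i where "of_nat w = - (of_nat i :: complex)" by (auto simp: pochhammer_eq_0_iff)
      then have "of_nat (w + i) = (0 :: complex)" by simp
      then show False using w(1) by (simp only: of_nat_eq_0_iff)
    qed
    define h where "h = (\<lambda>z. f z - a * (du ^^ Suc p) g z)"
    have "h \<in> fvs.span ?S"
    proof (rule Suc.IH[of h "\<lambda>z. Q z - smult a (P z)"])
      show "qrep k h (\<lambda>z. Q z - smult a (P z))"
        using Suc.prems(1) P(1) unfolding w(2) qrep_def h_def by (simp add: algebra_simps)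
      show "h holomorphic_on uhp" unfolding h_def by (intro holomorphic_intros Suc.prems(2) P(4))
      show "h z = 0" if "\<not> Im z > 0" for z
        unfolding h_def using Suc.prems(4)[OF that] du_out[OF g that, of "Suc p"] by simp
      show "degree (Q z - smult a (P z)) \<le> p" if z: "Im z > 0" for z
      proof (rule degree_le, intro allI impI)
        fix i assume i: "p < i"
        show "coeff (Q z - smult a (P z)) i = 0"
        proof (cases "i = Suc p")
          case True
          then show ?thesis using P(3) z poch by (simp add: a_def g_def)
        next
          case False
          then have "i > Suc p" using i by simp
          moreover have "degree (Q z) \<le> Suc p" "degree (P z) \<le> Suc p" using Suc.prems(3)[OF z] P(2) z by simp_all
          ultimately show ?thesis by (simp add: coeff_eq_0)
        qed
      qed
    qed
    moreover have "(du ^^ Suc p) g \<in> ?S"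
      by (intro CollectI exI[of _ "Suc p"] exI[of _ g] exI[of _ w] conjI refl g w(2))
    ultimately have "h + fscale a ((du ^^ Suc p) g) \<in> fvs.span ?S"
      by (rule fvs.span_add[OF _ fvs.span_scale[OF fvs.span_base]])
    moreover have "h + fscale a ((du ^^ Suc p) g) = f" by (simp add: h_def fscale_def fun_eq_iff)
    ultimately show ?thesis by simp
  qed
qed

text \<open>A form without zeros would have a logarithmic derivative that contradicts
  \<open>no_holomorphic_weight2\<close>.\<close>

lemma mod_form_has_zero:
  assumes F: "F \<in> mod_forms \<Gamma> K" and K: "K > 0"
  shows "\<exists>z. Im z > 0 \<and> F z = 0"
proof (rule ccontr)
  assume "\<not> ?thesis"
  then have nz: "F z \<noteq> 0" if "Im z > 0" for z using that by blast
  have hol: "F holomorphic_on uhp" using F by (simp add: mod_forms_iff)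
  obtain Q where Q: "qrep (K + 2) (du F) Q" "\<forall>z. Im z > 0 \<longrightarrow> degree (Q z) \<le> Suc 0"
    "\<forall>z. Im z > 0 \<longrightarrow> coeff (Q z) (Suc 0) = (of_nat K - of_nat 0) * coeff [:F z:] 0"
    by (rule qrep_du[OF qrep_mod_form[OF F] hol, of 0]) auto
  show False
  proof (rule no_holomorphic_weight2[of "\<lambda>z. du F z / (of_nat K * F z)"])
    show "(\<lambda>z. du F z / (of_nat K * F z)) holomorphic_on uhp"
      using nz K by (intro holomorphic_intros du_holomorphic hol) auto
    fix A z assume A: "A \<in> G" and z: "Im z > 0"
    have "poly (Q z) (uj A z) = (\<Sum>i\<le>1. coeff (Q z) i * uj A z ^ i)"
      by (subst poly_altdef, rule sum.mono_neutral_left) (use Q(2) z in \<open>auto simp: coeff_eq_0\<close>)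
    also have "\<dots> = du F z + of_nat K * F z * uj A z" using Q(3) z qrep_0[OF Q(1) z] by simp
    finally have "du F (moeb A z) = autj A z ^ (K + 2) * (du F z + of_nat K * F z * uj A z)"
      using qrepD[OF Q(1) A z] by simp
    note t1 = this
    have t2: "F (moeb A z) = autj A z ^ K * F z" using F A z by (simp add: mod_forms_iff)
    show "du F (moeb A z) / (of_nat K * F (moeb A z))
        = autj A z ^ 2 * (du F z / (of_nat K * F z)) + of_real (A$2$1) * autj A z"
    proof -
      let ?j = "autj A z"
      have j: "?j \<noteq> 0" by (rule G_autj[OF A z])
      have e: "(x ^ (K + 2) * (q + r * s * y)) / (r * (x ^ K * s)) = x\<^sup>2 * (q / (r * s)) + x\<^sup>2 * y"
        if "r \<noteq> 0" "x \<noteq> 0" "s \<noteq> 0" for x q r s y :: complex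
        using that by (simp add: power_add power2_eq_square field_simps)
      have ju: "?j\<^sup>2 * uj A z = of_real (A$2$1) * ?j" using j by (simp add: uj_def power2_eq_square)
      show ?thesis unfolding t1 t2 using e[of "of_nat K" ?j "F z" "du F z" "uj A z"] nz[OF z] K j ju by simp
    qed
  qed
qed

end

section \<open>Spans of functions\<close>

lemma fscale_simps:
  "fscale c f + fscale c g = fscale c (f + g)" "fscale c f * g = fscale c (f * g)" "f * fscale c g = fscale c (f * g)"
  by (auto simp: fscale_def fun_eq_iff algebra_simps)

lemma span_times:
  assumes a: "a \<in> fvs.span A" and b: "b \<in> fvs.span B"
    and AB: "\<And>x y. x \<in> A \<Longrightarrow> y \<in> B \<Longrightarrow> x * y \<in> fvs.span C"
  shows "a * b \<in> fvs.span C"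
proof -
  have 1: "x * b \<in> fvs.span C" if x: "x \<in> A" for x
  proof (rule fvs.span_induct[OF b, where P = "\<lambda>b. x * b \<in> fvs.span C"])
    show "fvs.subspace {b. x * b \<in> fvs.span C}"
      by (rule fvs.subspaceI) (auto simp: distrib_left fscale_simps fvs.span_zero fvs.span_add fvs.span_scale)
  qed (use AB x in auto)
  show ?thesis
  proof (rule fvs.span_induct[OF a, where P = "\<lambda>a. a * b \<in> fvs.span C"])
    show "fvs.subspace {a. a * b \<in> fvs.span C}"
      by (rule fvs.subspaceI) (auto simp: distrib_right fscale_simps fvs.span_zero fvs.span_add fvs.span_scale)
  qed (use 1 in auto)
qed

lemma sum_fun_apply: "(\<Sum>i\<in>I. h i) z = (\<Sum>i\<in>I. h i z)" for h :: "'i \<Rightarrow> complex \<Rightarrow> complex"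
  by (induction I rule: infinite_finite_induct) auto

lemma card_le_dim:
  fixes h :: "'i \<Rightarrow> complex \<Rightarrow> complex"
  assumes I: "finite I" and V: "\<And>i. i \<in> I \<Longrightarrow> h i \<in> V" "V \<subseteq> fvs.span B" "finite B"
    and ind: "\<And>x. (\<Sum>i\<in>I. fscale (x i) (h i)) = 0 \<Longrightarrow> \<forall>i\<in>I. x i = 0"
  shows "card I \<le> fvs.dim V"
proof -
  have inj: "inj_on h I"
  proof (rule inj_onI, rule ccontr)
    fix i j assume ij: "i \<in> I" "j \<in> I" "h i = h j" "i \<noteq> j"
    let ?x = "\<lambda>k. if k = i then 1 else if k = j then -1 else (0::complex)"
    have "(\<Sum>k\<in>I. fscale (?x k) (h k)) = (\<Sum>k\<in>{i, j}. fscale (?x k) (h k))"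
      by (rule sum.mono_neutral_right) (use I ij in \<open>auto simp: fscale_def fun_eq_iff\<close>)
    also have "\<dots> = 0" using ij by (simp add: fscale_def fun_eq_iff)
    finally show False using ind[of ?x] ij(1) by auto
  qed
  have indep: "fvs.independent (h ` I)"
  proof
    assume "fvs.dependent (h ` I)"
    then obtain u v where u: "v \<in> h ` I" "u v \<noteq> 0" "(\<Sum>v\<in>h ` I. fscale (u v) v) = 0"
      using fvs.dependent_finite[OF finite_imageI[OF I], of h] by blast
    have "(\<Sum>i\<in>I. fscale (u (h i)) (h i)) = 0" using u(3) by (simp add: sum.reindex[OF inj])
    from ind[OF this] show False using u(1,2) by auto
  qed
  obtain b where b: "b \<subseteq> V" "fvs.independent b" "V \<subseteq> fvs.span b" "card b = fvs.dim V"
    by (rule fvs.basis_exists)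
  have "b \<subseteq> fvs.span B" using b(1) V(2) by (rule order_trans)
  then have "finite b" using fvs.independent_span_bound[OF V(3) b(2)] by blast
  moreover have "h ` I \<subseteq> fvs.span b" using V(1) b(3) by blast
  ultimately have "card (h ` I) \<le> card b" using fvs.independent_span_bound[OF _ indep] by blast
  then show ?thesis using b(4) card_image[OF inj] by simp
qed

section \<open>Quasimodular forms of moderate growth\<close>

definition gwt :: "complex \<Rightarrow> real" where "gwt z = (1 + (norm z)\<^sup>2) / Im z"

lemma gwt_ge: "Im z > 0 \<Longrightarrow> gwt z \<ge> 1" "Im z > 0 \<Longrightarrow> gwt z \<ge> 1 / Im z"
proof -
  assume z: "Im z > 0"
  have "Im z \<le> norm z" using abs_Im_le_cmod[of z] by simp
  moreover have "2 * norm z \<le> 1 + (norm z)\<^sup>2"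
    using zero_le_power2[of "norm z - 1"] by (simp add: power2_eq_square algebra_simps)
  ultimately have "Im z \<le> 1 + (norm z)\<^sup>2" using z by linarith
  then show "gwt z \<ge> 1" using z by (simp add: gwt_def)
  show "gwt z \<ge> 1 / Im z" using z unfolding gwt_def by (intro divide_right_mono) auto
qed

lemma moderate_growth_iff:
  "moderate_growth f \<longleftrightarrow> (\<exists>(N::nat) C. C \<ge> 0 \<and> (\<forall>z. Im z > 0 \<longrightarrow> norm (f z) \<le> C * gwt z ^ N))"
proof
  assume "moderate_growth f"
  then obtain N :: nat and C where C: "\<forall>z\<in>uhp. norm (f z) \<le> C * ((1 + (norm z)\<^sup>2) / Im z) ^ N"
    by (auto simp: moderate_growth_def)
  have "norm (f \<i>) \<le> C * 2 ^ N" using C[rule_format, of \<i>] by simp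
  then have "0 \<le> C * 2 ^ N" by (rule order_trans[OF norm_ge_zero])
  moreover have "(0::real) < 2 ^ N" by simp
  ultimately have "C \<ge> 0" by (simp only: zero_le_mult_iff) linarith
  then show "\<exists>(N::nat) C. C \<ge> 0 \<and> (\<forall>z. Im z > 0 \<longrightarrow> norm (f z) \<le> C * gwt z ^ N)"
    using C by (intro exI[of _ N] exI[of _ C]) (auto simp: gwt_def)
next
  assume "\<exists>(N::nat) C. C \<ge> 0 \<and> (\<forall>z. Im z > 0 \<longrightarrow> norm (f z) \<le> C * gwt z ^ N)"
  then show "moderate_growth f" unfolding moderate_growth_def gwt_def uhp_def mem_Collect_eq Ball_def by meson
qed

lemma moderate_growth_arith:
  assumes "moderate_growth f" "moderate_growth g"
  shows "moderate_growth (f + g)" "moderate_growth (f * g)" "moderate_growth (fscale c f)"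
proof -
  obtain N C where f: "C \<ge> 0" "\<forall>z. Im z > 0 \<longrightarrow> norm (f z) \<le> C * gwt z ^ N"
    using assms(1) unfolding moderate_growth_iff by auto
  obtain M D where g: "D \<ge> 0" "\<forall>z. Im z > 0 \<longrightarrow> norm (g z) \<le> D * gwt z ^ M"
    using assms(2) unfolding moderate_growth_iff by auto
  show "moderate_growth (f + g)" unfolding moderate_growth_iff
  proof (intro exI[of _ "N + M"] exI[of _ "C + D"] conjI allI impI)
    fix z assume z: "Im z > 0"
    have "norm ((f + g) z) \<le> norm (f z) + norm (g z)" by (simp add: norm_triangle_ineq)
    also have "\<dots> \<le> C * gwt z ^ N + D * gwt z ^ M" using f(2) g(2) z by (intro add_mono) auto
    also have "\<dots> \<le> C * gwt z ^ (N + M) + D * gwt z ^ (N + M)"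
      using f(1) g(1) gwt_ge(1)[OF z] by (intro add_mono mult_left_mono power_increasing) auto
    finally show "norm ((f + g) z) \<le> (C + D) * gwt z ^ (N + M)" by (simp add: algebra_simps)
  qed (use f g in auto)
  show "moderate_growth (f * g)" unfolding moderate_growth_iff
  proof (intro exI[of _ "N + M"] exI[of _ "C * D"] conjI allI impI)
    fix z assume z: "Im z > 0"
    have "norm ((f * g) z) = norm (f z) * norm (g z)" by (simp add: norm_mult)
    also have "\<dots> \<le> (C * gwt z ^ N) * (D * gwt z ^ M)" using f g z gwt_ge(1)[OF z] by (intro mult_mono) auto
    finally show "norm ((f * g) z) \<le> C * D * gwt z ^ (N + M)" by (simp add: power_add algebra_simps)
  qed (use f g in auto)
  show "moderate_growth (fscale c f)" unfolding moderate_growth_iff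
  proof (intro exI[of _ N] exI[of _ "norm c * C"] conjI allI impI)
    fix z assume z: "Im z > 0"
    show "norm (fscale c f z) \<le> norm c * C * gwt z ^ N"
      using f(2) z by (simp add: fscale_def norm_mult mult.assoc mult_left_mono)
  qed (use f in auto)
qed

context cocompact_group
begin

lemma moderate_growth_du:
  assumes hol: "f holomorphic_on uhp" and mg: "moderate_growth f"
  shows "moderate_growth (du f)"
proof -
  obtain N C where f: "C \<ge> 0" "\<forall>z. Im z > 0 \<longrightarrow> norm (f z) \<le> C * gwt z ^ N"
    using mg unfolding moderate_growth_iff by auto
  show ?thesis unfolding moderate_growth_iff
  proof (intro exI[of _ "Suc N"] exI[of _ "2 * (C * (9 / 2) ^ N)"] conjI allI impI)
    fix z assume z: "Im z > 0"
    define r where "r = Im z / 2"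
    have r: "r > 0" using z by (simp add: r_def)
    have near: "Im x \<ge> r \<and> gwt x \<le> 9 / 2 * gwt z" if "norm (z - x) \<le> r" for x
    proof
      have "\<bar>Im z - Im x\<bar> \<le> r" using abs_Im_le_cmod[of "z - x"] that by simp
      moreover have "Im z = 2 * r" by (simp add: r_def)
      ultimately show ix: "Im x \<ge> r" by linarith
      have "norm x \<le> norm z + norm (z - x)" using norm_triangle_ineq4[of z "z - x"] by simp
      moreover have "Im z \<le> norm z" using abs_Im_le_cmod[of z] by simp
      ultimately have "norm x \<le> 3 / 2 * norm z" using that by (simp add: r_def)
      then have "(norm x)\<^sup>2 \<le> (3 / 2 * norm z)\<^sup>2" by (intro power_mono) auto
      then have "1 + (norm x)\<^sup>2 \<le> 9 / 4 * (1 + (norm z)\<^sup>2)" by (simp add: power2_eq_square)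
      then have "gwt x \<le> 9 / 4 * (1 + (norm z)\<^sup>2) / r"
        unfolding gwt_def using ix r by (intro frac_le) auto
      moreover have "9 / 4 * (1 + (norm z)\<^sup>2) / r = 9 / 2 * gwt z" using z by (simp add: gwt_def r_def field_simps)
      ultimately show "gwt x \<le> 9 / 2 * gwt z" by (simp only:)
    qed
    have sub: "cball z r \<subseteq> uhp"
    proof
      fix x assume "x \<in> cball z r"
      then have "Im x \<ge> r" using near[of x] by (simp add: dist_norm)
      then have "Im x > 0" using r by linarith
      then show "x \<in> uhp" by simp
    qed
    have "norm ((deriv ^^ 1) f z) \<le> fact 1 * (C * (9 / 2 * gwt z) ^ N) / r ^ 1"
    proof (rule Cauchy_inequality)
      show "f holomorphic_on ball z r" by (rule holomorphic_on_subset[OF hol order_trans[OF ball_subset_cball sub]])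
      show "continuous_on (cball z r) f" by (rule holomorphic_on_imp_continuous_on[OF holomorphic_on_subset[OF hol sub]])
      fix x assume "norm (z - x) = r"
      then have x: "Im x \<ge> r" "gwt x \<le> 9 / 2 * gwt z" using near by auto
      then have xp: "Im x > 0" using r by linarith
      have "norm (f x) \<le> C * gwt x ^ N" using f(2) xp by simp
      also have "\<dots> \<le> C * (9 / 2 * gwt z) ^ N" using x(2) f(1) gwt_ge(1)[OF xp] by (intro mult_left_mono power_mono) auto
      finally show "norm (f x) \<le> C * (9 / 2 * gwt z) ^ N" .
    qed (rule r)
    then have "norm (deriv f z) \<le> 2 * (C * (9 / 2) ^ N) * gwt z ^ N * (1 / Im z)"
      by (simp add: r_def power_mult_distrib power_divide mult_ac)
    also have "\<dots> \<le> 2 * (C * (9 / 2) ^ N) * gwt z ^ N * gwt z"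
      using f(1) gwt_ge[OF z] by (intro mult_left_mono) auto
    finally show "norm (du f z) \<le> 2 * (C * (9 / 2) ^ N) * gwt z ^ Suc N" using z by (simp add: du_def restr_def mult_ac)
  qed (use f in auto)
qed

lemma moderate_growth_mod_form:
  assumes F: "F \<in> mod_forms \<Gamma> k" shows "moderate_growth F"
proof -
  obtain R where R: "R \<ge> 1" "\<And>z. Im z > 0 \<Longrightarrow> \<exists>A\<in>G. Im (moeb A z) \<ge> 1 / R \<and> norm (moeb A z) \<le> R"
    using cocompact by blast
  have hol: "F holomorphic_on uhp" and tr: "\<And>A z. A \<in> G \<Longrightarrow> Im z > 0 \<Longrightarrow> F (moeb A z) = autj A z ^ k * F z"
    using F by (auto simp: mod_forms_iff)
  define H where "H z = (norm (F z))\<^sup>2 * Im z ^ k" for z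
  have "continuous_on uhp H" unfolding H_def
    by (intro continuous_intros holomorphic_on_imp_continuous_on[OF hol])
  moreover have "H (moeb A z) = H z" if A: "A \<in> G" and z: "Im z > 0" for A z
  proof -
    have j: "norm (autj A z) \<noteq> 0" using autj_nonzero G_det A z by simp
    have "(norm (F (moeb A z)))\<^sup>2 = ((norm (autj A z))\<^sup>2) ^ k * (norm (F z))\<^sup>2"
      unfolding tr[OF A z] by (simp add: norm_mult norm_power power_mult_distrib mult.commute flip: power_mult)
    then show ?thesis unfolding H_def Im_moeb[OF G_det[OF A]] using j by (simp add: power_divide)
  qed
  ultimately obtain w where w: "Im w \<ge> 1 / R" "\<forall>z. Im z > 0 \<longrightarrow> H z \<le> H w"
    using invariant_attains_sup[OF _ _ R] by metis
  have "1 / R > 0" using R(1) by simp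
  then have "Im w > 0" using w(1) by linarith
  then have H0: "H w \<ge> 0" by (simp add: H_def)
  show ?thesis unfolding moderate_growth_iff
  proof (intro exI[of _ k] exI[of _ "1 + H w"] conjI allI impI)
    fix z assume z: "Im z > 0"
    have "(norm (F z))\<^sup>2 \<le> H w * (1 / Im z) ^ k"
      using w(2) z by (simp add: H_def power_one_over pos_le_divide_eq)
    also have "\<dots> \<le> H w * gwt z ^ k" using H0 gwt_ge(2)[OF z] z by (intro mult_left_mono power_mono) auto
    finally have 1: "(norm (F z))\<^sup>2 \<le> H w * gwt z ^ k" .
    have "2 * norm (F z) \<le> 1 + (norm (F z))\<^sup>2"
      using zero_le_power2[of "norm (F z) - 1"] by (simp add: power2_eq_square algebra_simps)
    then have "norm (F z) \<le> 1 + (norm (F z))\<^sup>2" using norm_ge_zero[of "F z"] by linarith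
    also have "\<dots> \<le> gwt z ^ k + H w * gwt z ^ k" using 1 gwt_ge(1)[OF z] by (intro add_mono one_le_power)
    finally show "norm (F z) \<le> (1 + H w) * gwt z ^ k" by (simp add: algebra_simps)
  qed (use H0 in simp)
qed

lemma quasi_forms_depth_iff:
  "f \<in> quasi_forms_depth \<Gamma> k p \<longleftrightarrow> (\<forall>z. \<not> Im z > 0 \<longrightarrow> f z = 0) \<and> f holomorphic_on uhp \<and> moderate_growth f \<and>
     (\<exists>Q. qrep k f Q \<and> (\<forall>z. Im z > 0 \<longrightarrow> degree (Q z) \<le> p))"
proof -
  have eq: "f (moeb A z) / autj A z ^ k = x \<longleftrightarrow> f (moeb A z) = autj A z ^ k * x" if "A \<in> G" "z \<in> uhp" for A z x
    using G_autj that by (auto simp: field_simps)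
  have "(\<exists>F :: nat \<Rightarrow> complex \<Rightarrow> complex. \<forall>A\<in>\<Union>\<Gamma>. \<forall>z\<in>uhp.
           f (moeb A z) / autj A z ^ k = (\<Sum>j\<le>p. F j z * (of_real (A$2$1) / autj A z) ^ j)) \<longleftrightarrow>
        (\<exists>Q. qrep k f Q \<and> (\<forall>z. Im z > 0 \<longrightarrow> degree (Q z) \<le> p))" (is "?l \<longleftrightarrow> ?r")
  proof
    assume ?l
    then obtain F where F: "\<And>A z. A \<in> G \<Longrightarrow> z \<in> uhp \<Longrightarrow> f (moeb A z) / autj A z ^ k = (\<Sum>j\<le>p. F j z * uj A z ^ j)"
      unfolding G_def[symmetric] uj_def[symmetric] by metis
    have "qrep k f (\<lambda>z. \<Sum>j\<le>p. monom (F j z) j)"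
      unfolding qrep_def using F eq by (simp add: poly_sum poly_monom)
    moreover have "degree (\<Sum>j\<le>p. monom (F j z) j) \<le> p" for z
      by (intro degree_sum_le) (auto intro: order_trans[OF degree_monom_le])
    ultimately show ?r by blast
  next
    assume ?r
    then obtain Q where Q: "qrep k f Q" "\<forall>z. Im z > 0 \<longrightarrow> degree (Q z) \<le> p" by blast
    have "f (moeb A z) / autj A z ^ k = (\<Sum>j\<le>p. coeff (Q z) j * uj A z ^ j)" if "A \<in> G" "z \<in> uhp" for A z
    proof -
      have "poly (Q z) (uj A z) = (\<Sum>j\<le>p. coeff (Q z) j * uj A z ^ j)"
        by (subst poly_altdef, rule sum.mono_neutral_left) (use Q(2) that in \<open>auto simp: coeff_eq_0\<close>)
      then show ?thesis using qrepD[OF Q(1) that(1)] that(2) G_autj[OF that(1)] by simp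
    qed
    then show ?l unfolding G_def[symmetric] uj_def[symmetric]
      by (intro exI[of _ "\<lambda>j z. coeff (Q z) j"]) simp
  qed
  then show ?thesis unfolding quasi_forms_depth_def fun_ring_def by simp
qed

lemma quasi_forms_iff:
  "f \<in> quasi_forms \<Gamma> k \<longleftrightarrow> (\<forall>z. \<not> Im z > 0 \<longrightarrow> f z = 0) \<and> f holomorphic_on uhp \<and> moderate_growth f \<and>
     (\<exists>Q p. qrep k f Q \<and> (\<forall>z. Im z > 0 \<longrightarrow> degree (Q z) \<le> p))"
  unfolding quasi_forms_def by (auto simp: quasi_forms_depth_iff)

lemma qrep_arith:
  assumes "qrep k f Q" "qrep l g R"
  shows "qrep (k + l) (f * g) (\<lambda>z. Q z * R z)" "k = l \<Longrightarrow> qrep k (f + g) (\<lambda>z. Q z + R z)"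
    "qrep k (fscale c f) (\<lambda>z. smult c (Q z))"
  using assms by (simp_all add: qrep_def power_add algebra_simps fscale_def)

lemma quasi_depth_mult:
  assumes f: "f \<in> quasi_forms_depth \<Gamma> k p" and g: "g \<in> quasi_forms_depth \<Gamma> l q"
  shows "f * g \<in> quasi_forms_depth \<Gamma> (k + l) (p + q)"
proof -
  obtain Q where Q: "qrep k f Q" "\<forall>z. Im z > 0 \<longrightarrow> degree (Q z) \<le> p" using f by (auto simp: quasi_forms_depth_iff)
  obtain R where R: "qrep l g R" "\<forall>z. Im z > 0 \<longrightarrow> degree (R z) \<le> q" using g by (auto simp: quasi_forms_depth_iff)
  have "degree (Q z * R z) \<le> p + q" if "Im z > 0" for z
    using degree_mult_le[of "Q z" "R z"] Q(2) R(2) that by (meson add_mono order_trans)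
  moreover have "(\<lambda>z. f z * g z) holomorphic_on uhp" using f g by (intro holomorphic_intros) (auto simp: quasi_forms_depth_iff)
  ultimately show ?thesis unfolding quasi_forms_depth_iff
    using f g moderate_growth_arith(2)[of f g] qrep_arith(1)[OF Q(1) R(1)]
    by (auto simp: quasi_forms_depth_iff times_fun_def intro!: exI[of _ "\<lambda>z. Q z * R z"])
qed

lemma quasi_one: "restr uhp (\<lambda>_. c) \<in> quasi_forms_depth \<Gamma> 0 0"
  unfolding quasi_forms_depth_iff
proof (intro conjI)
  show "restr uhp (\<lambda>_. c) holomorphic_on uhp"
    by (rule holomorphic_transform[of "\<lambda>_. c"]) (auto simp: restr_def intro!: holomorphic_intros)
  show "moderate_growth (restr uhp (\<lambda>_. c))" unfolding moderate_growth_iff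
    by (intro exI[of _ 0] exI[of _ "norm c"]) (simp add: restr_def)
  show "\<exists>Q. qrep 0 (restr uhp (\<lambda>_. c)) Q \<and> (\<forall>z. Im z > 0 \<longrightarrow> degree (Q z) \<le> 0)"
    by (intro exI[of _ "\<lambda>_. [:c:]"]) (auto simp: qrep_def restr_def moeb_uhp)
qed (simp add: restr_def)

lemma quasi_forms_subspace: "fvs.subspace (quasi_forms \<Gamma> k)"
proof (rule fvs.subspaceI)
  have "0 \<in> quasi_forms_depth \<Gamma> k 0" unfolding quasi_forms_depth_iff
    by (auto simp: qrep_def zero_fun_def moderate_growth_iff intro!: exI[of _ "\<lambda>_. 0"] exI[of _ 0])
  then show "0 \<in> quasi_forms \<Gamma> k" by (auto simp: quasi_forms_def)
next
  fix f g assume f: "f \<in> quasi_forms \<Gamma> k" and g: "g \<in> quasi_forms \<Gamma> k"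
  obtain Q p where Q: "qrep k f Q" "\<forall>z. Im z > 0 \<longrightarrow> degree (Q z) \<le> p" using f by (auto simp: quasi_forms_iff)
  obtain R q where R: "qrep k g R" "\<forall>z. Im z > 0 \<longrightarrow> degree (R z) \<le> q" using g by (auto simp: quasi_forms_iff)
  have "degree (Q z + R z) \<le> p + q" if "Im z > 0" for z
    using Q(2) R(2) that by (intro degree_add_le) (auto intro: trans_le_add1 trans_le_add2)
  moreover have "(\<lambda>z. f z + g z) holomorphic_on uhp" using f g by (intro holomorphic_intros) (auto simp: quasi_forms_iff)
  ultimately show "f + g \<in> quasi_forms \<Gamma> k" unfolding quasi_forms_iff
    using f g moderate_growth_arith(1)[of f g] qrep_arith(2)[OF Q(1) R(1)]
    by (auto simp: quasi_forms_iff plus_fun_def intro!: exI[of _ "\<lambda>z. Q z + R z"] exI[of _ "p + q"])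
next
  fix c f assume f: "f \<in> quasi_forms \<Gamma> k"
  obtain Q p where Q: "qrep k f Q" "\<forall>z. Im z > 0 \<longrightarrow> degree (Q z) \<le> p" using f by (auto simp: quasi_forms_iff)
  have "(\<lambda>z. c * f z) holomorphic_on uhp" using f by (intro holomorphic_intros) (auto simp: quasi_forms_iff)
  moreover have "degree (smult c (Q z)) \<le> p" if "Im z > 0" for z
    using Q(2) that degree_smult_le[of c "Q z"] by (meson order_trans)
  ultimately show "fscale c f \<in> quasi_forms \<Gamma> k" unfolding quasi_forms_iff
    using f moderate_growth_arith(3)[of f f c] qrep_arith(3)[OF Q(1) Q(1), of c]
    by (auto simp: quasi_forms_iff fscale_def intro!: exI[of _ "\<lambda>z. smult c (Q z)"] exI[of _ p])
qed

lemma quasi_iter: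
  assumes f: "f \<in> mod_forms \<Gamma> w" shows "(du ^^ n) f \<in> quasi_forms_depth \<Gamma> (w + 2 * n) n"
proof -
  have "moderate_growth ((du ^^ n) f)"
  proof (induction n)
    case 0
    then show ?case using moderate_growth_mod_form[OF f] by simp
  next
    case (Suc n)
    obtain Q where "(du ^^ n) f holomorphic_on uhp" by (rule qrep_iter[OF f, of n])
    then show ?case using moderate_growth_du Suc by simp
  qed
  moreover obtain Q where "qrep (w + 2 * n) ((du ^^ n) f) Q" "\<forall>z. Im z > 0 \<longrightarrow> degree (Q z) \<le> n"
    "(du ^^ n) f holomorphic_on uhp"
    by (rule qrep_iter[OF f, of n])
  ultimately show ?thesis unfolding quasi_forms_depth_iff using du_out[OF f] by blast
qed

lemma mod_forms_mult: "f \<in> mod_forms \<Gamma> k \<Longrightarrow> g \<in> mod_forms \<Gamma> l \<Longrightarrow> f * g \<in> mod_forms \<Gamma> (k + l)"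
  by (auto simp: mod_forms_iff power_add times_fun_def intro!: holomorphic_intros)

lemma mod_forms_power:
  assumes "f \<in> mod_forms \<Gamma> k" "n > 0" shows "f ^ n \<in> mod_forms \<Gamma> (n * k)"
  using assms(2)
proof (induction n)
  case (Suc n)
  show ?case
  proof (cases "n = 0")
    case False
    then show ?thesis using mod_forms_mult[OF assms(1) Suc.IH] by (simp only: power_Suc mult_Suc)
  qed (use assms(1) in simp)
qed simp

lemma fun_power: "(f ^ n) z = f z ^ n" for f :: "complex \<Rightarrow> complex"
  by (induction n) auto

text \<open>Compare \<open>F\<close> with the Rankin-Cohen bracket \<open>W = K F F'' - (K + 1) F'\<^sup>2\<close>.  At a zero of \<open>F\<close> of order \<open>n\<close>
  the bracket vanishes to order \<open>2 n - 2\<close>, less than the order \<open>(2 K + 4) n / K\<close> that proportional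
  powers of equal weight would need.\<close>

lemma independent_forms:
  obtains l P Q S where "l > (0::nat)" "P \<in> mod_forms \<Gamma> (2 * l)" "Q \<in> mod_forms \<Gamma> (2 * l)"
    "\<forall>z\<in>S. Im z > 0 \<and> P z \<noteq> 0 \<and> Q z \<noteq> 0" "infinite ((\<lambda>z. P z / Q z) ` S)"
proof -
  obtain K F where K: "K > 0" and F: "F \<in> mod_forms \<Gamma> K" and F0: "F \<i> \<noteq> 0" by (rule exists_mod_form)
  obtain z0 where z0: "Im z0 > 0" "F z0 = 0" using mod_form_has_zero[OF F K] by auto
  have hol: "F holomorphic_on uhp" using F by (simp add: mod_forms_iff)
  define W where "W z = of_nat K * F z * du (du F) z - (of_nat K + 1) * (du F z)\<^sup>2" for z
  have WM: "W \<in> mod_forms \<Gamma> (2 * K + 4)"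
  proof -
    obtain Q1 where Q1: "qrep (K + 2) (du F) Q1" "\<forall>z. Im z > 0 \<longrightarrow> degree (Q1 z) \<le> Suc 0"
      "\<forall>z. Im z > 0 \<longrightarrow> coeff (Q1 z) (Suc 0) = (of_nat K - of_nat 0) * coeff [:F z:] 0"
      by (rule qrep_du[OF qrep_mod_form[OF F] hol, of 0]) auto
    obtain Q2 where Q2: "qrep (K + 2 + 2) (du (du F)) Q2" "\<forall>z. Im z > 0 \<longrightarrow> degree (Q2 z) \<le> Suc (Suc 0)"
      "\<forall>z. Im z > 0 \<longrightarrow> coeff (Q2 z) (Suc (Suc 0)) = (of_nat (K + 2) - of_nat (Suc 0)) * coeff (Q1 z) (Suc 0)"
      "\<forall>n<Suc 0. \<forall>z. coeff (Q2 z) (Suc n) = (of_nat (K + 2) - of_nat n) * coeff (Q1 z) n + deriv (\<lambda>z. coeff (Q1 z) (Suc n)) z"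
      by (rule qrep_du[OF Q1(1) du_holomorphic[OF hol], of "Suc 0"]) (use Q1(2) in auto)
    have p1: "poly (Q1 z) x = du F z + of_nat K * F z * x" if z: "Im z > 0" for z x
    proof -
      have "poly (Q1 z) x = (\<Sum>i\<le>Suc 0. coeff (Q1 z) i * x ^ i)"
        by (subst poly_altdef, rule sum.mono_neutral_left) (use Q1(2) z in \<open>auto simp: coeff_eq_0\<close>)
      then show ?thesis using Q1(3) z qrep_0[OF Q1(1) z] by simp
    qed
    have dF: "deriv (\<lambda>z. coeff (Q1 z) (Suc 0)) z = of_nat K * du F z" if z: "Im z > 0" for z
    proof -
      have "\<forall>\<^sub>F w in nhds z. coeff (Q1 w) (Suc 0) = of_nat K * F w"
        using eventually_nhds_in_open[OF open_uhp, of z] z Q1(3) by (auto elim!: eventually_mono)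
      then have "deriv (\<lambda>z. coeff (Q1 z) (Suc 0)) z = deriv (\<lambda>w. of_nat K * F w) z" by (rule deriv_cong_ev) simp
      also have "\<dots> = of_nat K * deriv F z"
        by (rule deriv_cmult) (use holomorphic_on_imp_differentiable_at[OF hol open_uhp, of z] z in simp)
      finally show ?thesis using z by (simp add: du_def restr_def)
    qed
    have p2: "poly (Q2 z) x = du (du F) z + 2 * (of_nat K + 1) * du F z * x + of_nat K * (of_nat K + 1) * F z * x\<^sup>2"
      if z: "Im z > 0" for z x
    proof -
      have "poly (Q2 z) x = (\<Sum>i\<le>Suc (Suc 0). coeff (Q2 z) i * x ^ i)"
        by (subst poly_altdef, rule sum.mono_neutral_left) (use Q2(2) z in \<open>auto simp: coeff_eq_0\<close>)
      also have "\<dots> = coeff (Q2 z) 0 + coeff (Q2 z) (Suc 0) * x + coeff (Q2 z) (Suc (Suc 0)) * x\<^sup>2"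
        by (simp add: power2_eq_square)
      also have "coeff (Q2 z) (Suc 0) = 2 * (of_nat K + 1) * du F z"
        using Q2(4) dF[OF z] qrep_0[OF Q1(1) z] by (simp add: algebra_simps)
      also have "coeff (Q2 z) (Suc (Suc 0)) = of_nat K * (of_nat K + 1) * F z"
        using Q2(3) Q1(3) z by (simp add: algebra_simps)
      also have "coeff (Q2 z) 0 = du (du F) z" using qrep_0[OF Q2(1) z] by simp
      finally show ?thesis by (simp add: algebra_simps)
    qed
    show ?thesis unfolding mod_forms_iff
    proof (intro conjI allI impI ballI)
      show "W holomorphic_on uhp" unfolding W_def[abs_def] by (intro holomorphic_intros du_holomorphic hol)
      show "W z = 0" if "\<not> Im z > 0" for z using that F by (simp add: W_def du_def restr_def mod_forms_iff)
      fix A z assume A: "A \<in> G" and z: "Im z > 0"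
      have f: "F (moeb A z) = autj A z ^ K * F z" using F A z by (simp add: mod_forms_iff)
      have e: "j ^ (K + 2 + 2) = j ^ K * j ^ 2 * j ^ 2" "j ^ (K + 2) = j ^ K * j ^ 2" "j ^ (2 * K + 4) = j ^ K * j ^ K * j ^ 4" for j :: complex
        by (simp_all only: power_add mult_2)
      have alg: "k * (X * p) * (X * (j * j) * (j * j) * (r + 2 * (k + 1) * q * u + k * (k + 1) * p * (u * u))) -
          (k + 1) * (X * (j * j) * (q + k * p * u) * (X * (j * j) * (q + k * p * u))) =
          X * X * (j * j * j * j) * (k * p * r - (k + 1) * (q * q))" for k p q r u X j :: complex
        by (simp add: algebra_simps)
      show "W (moeb A z) = autj A z ^ (2 * K + 4) * W z"
        unfolding W_def f qrepD[OF Q1(1) A z] qrepD[OF Q2(1) A z] p1[OF z] p2[OF z] e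
        unfolding power2_eq_square power4_eq_xxxx by (rule alg)
    qed
  qed
  have "\<not> F constant_on uhp"
  proof
    assume "F constant_on uhp"
    then have "F \<i> = F z0" using z0(1) by (auto simp: constant_on_def)
    then show False using F0 z0(2) by simp
  qed
  moreover have "z0 \<in> uhp" using z0(1) by simp
  ultimately obtain g r n where n: "n > 0" and r: "r > 0" "ball z0 r \<subseteq> uhp" and g: "g holomorphic_on ball z0 r"
    and Fg: "\<And>w. w \<in> ball z0 r \<Longrightarrow> F w = (w - z0) ^ n * g w" and g0: "\<And>w. w \<in> ball z0 r \<Longrightarrow> g w \<noteq> 0"
    using holomorphic_factor_zero_nonconstant[OF hol open_uhp connected_uhp _ z0(2)] by metis
  obtain m where m: "n = Suc m" using n by (cases n) auto
  define a where "a w = of_nat n * g w + (w - z0) * deriv g w" for w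
  have hdg: "deriv g holomorphic_on ball z0 r" by (rule holomorphic_deriv[OF g open_ball])
  have ha: "a holomorphic_on ball z0 r" unfolding a_def[abs_def] by (intro holomorphic_intros g hdg)
  have dF: "du F w = (w - z0) ^ m * a w" if w: "w \<in> ball z0 r" for w
  proof -
    have gd: "(g has_field_derivative deriv g w) (at w)" by (rule holomorphic_derivI[OF g open_ball w])
    have "((\<lambda>w. (w - z0) ^ Suc m * g w) has_field_derivative (w - z0) ^ Suc m * deriv g w + (1 + of_nat m) * (1 - 0) * (w - z0) ^ m * g w) (at w)"
      using DERIV_mult'[OF DERIV_power_Suc[OF DERIV_diff[OF DERIV_ident DERIV_const]] gd, of z0 m] by simp
    moreover have "\<forall>\<^sub>F v in nhds w. F v = (v - z0) ^ Suc m * g v"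
      using eventually_nhds_in_open[OF open_ball w] Fg m by (auto elim!: eventually_mono)
    ultimately have "(F has_field_derivative (w - z0) ^ Suc m * deriv g w + (1 + of_nat m) * (1 - 0) * (w - z0) ^ m * g w) (at w)"
      by (simp only: DERIV_cong_ev[OF refl _ refl])
    then have "deriv F w = (w - z0) ^ m * a w" by (simp add: DERIV_imp_deriv a_def m algebra_simps)
    then show ?thesis using w r(2) by (auto simp: du_def restr_def)
  qed
  have ddF: "(w - z0) * du (du F) w = (w - z0) ^ m * (of_nat m * a w + (w - z0) * deriv a w)" if w: "w \<in> ball z0 r" for w
  proof -
    have ad: "(a has_field_derivative deriv a w) (at w)" by (rule holomorphic_derivI[OF ha open_ball w])
    have "((\<lambda>w. (w - z0) ^ m * a w) has_field_derivative (w - z0) ^ m * deriv a w + of_nat m * ((1 - 0) * (w - z0) ^ (m - Suc 0)) * a w) (at w)"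
      using DERIV_mult'[OF DERIV_power[OF DERIV_diff[OF DERIV_ident DERIV_const]] ad, of z0 m] by simp
    moreover have "\<forall>\<^sub>F v in nhds w. du F v = (v - z0) ^ m * a v"
      using eventually_nhds_in_open[OF open_ball w] dF by (auto elim!: eventually_mono)
    ultimately have "(du F has_field_derivative (w - z0) ^ m * deriv a w + of_nat m * ((1 - 0) * (w - z0) ^ (m - Suc 0)) * a w) (at w)"
      by (simp only: DERIV_cong_ev[OF refl _ refl])
    then have "deriv (du F) w = (w - z0) ^ m * deriv a w + of_nat m * (w - z0) ^ (m - Suc 0) * a w" by (simp add: DERIV_imp_deriv)
    then have "du (du F) w = (w - z0) ^ m * deriv a w + of_nat m * (w - z0) ^ (m - Suc 0) * a w"
      using w r(2) by (auto simp: du_def[of "du F"] restr_def)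
    moreover have "x * (x ^ m * b + of_nat m * x ^ (m - Suc 0) * y) = x ^ m * (of_nat m * y + x * b)" for x y b :: complex
      by (cases m) (simp_all add: algebra_simps)
    ultimately show ?thesis by (simp only:)
  qed
  define c where "c w = of_nat K * g w * (of_nat m * a w + (w - z0) * deriv a w) - (of_nat K + 1) * (a w)\<^sup>2" for w
  have Wc: "W w = (w - z0) ^ (2 * m) * c w" if w: "w \<in> ball z0 r" for w
  proof -
    have "of_nat K * F w * du (du F) w = of_nat K * ((w - z0) ^ m * g w) * ((w - z0) * du (du F) w)"
      unfolding Fg[OF w] m power_Suc by (simp only: mult_ac)
    also have "\<dots> = (w - z0) ^ (2 * m) * (of_nat K * g w * (of_nat m * a w + (w - z0) * deriv a w))"
      unfolding ddF[OF w] mult_2 power_add by (simp only: mult_ac)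
    finally show ?thesis unfolding W_def c_def dF[OF w] mult_2 power_add power2_eq_square right_diff_distrib
      by (simp only: mult_ac)
  qed
  have z0b: "z0 \<in> ball z0 r" using r by simp
  have c0: "c z0 \<noteq> 0"
  proof -
    have "c z0 = - ((g z0)\<^sup>2 * (of_nat n * of_nat (K + n)))"
      unfolding c_def a_def m power2_eq_square by (simp add: algebra_simps)
    moreover have "of_nat (K + n) \<noteq> (0::complex)" using n by (simp only: of_nat_eq_0_iff)
    ultimately show ?thesis using g0[OF z0b] n by (simp del: of_nat_add)
  qed
  have "continuous_on (ball z0 r) c"
    unfolding c_def[abs_def]
    by (intro continuous_intros holomorphic_on_imp_continuous_on g ha holomorphic_deriv[OF ha open_ball])
  then have cont_c: "isCont c z0" using z0b by (simp add: continuous_on_eq_continuous_at)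
  then have "\<forall>\<^sub>F w in at z0. c w \<noteq> 0" using c0 unfolding isCont_def by (rule tendsto_imp_eventually_ne)
  moreover have "\<forall>\<^sub>F w in at z0. w \<in> ball z0 r - {z0}"
    using eventually_at_in_open[OF open_ball z0b] by simp
  ultimately have ev: "\<forall>\<^sub>F w in at z0. w \<in> ball z0 r - {z0} \<and> c w \<noteq> 0" by eventually_elim simp
  define S where "S = {w \<in> ball z0 r - {z0}. c w \<noteq> 0}"
  define P where "P = F ^ (2 * K + 4)"
  define Q where "Q = W ^ K"
  have PQ: "P w / Q w = (w - z0) ^ (4 * n + 2 * K) * (g w ^ (2 * K + 4) / c w ^ K)" if w: "w \<in> S" for w
  proof -
    have wb: "w \<in> ball z0 r" "w - z0 \<noteq> 0" "c w \<noteq> 0" using w by (auto simp: S_def)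
    have "n * (2 * K + 4) = (4 * n + 2 * K) + 2 * m * K" by (simp add: m algebra_simps)
    then have "(w - z0) ^ (n * (2 * K + 4)) = (w - z0) ^ (4 * n + 2 * K) * (w - z0) ^ (2 * m * K)"
      by (simp only: power_add)
    then show ?thesis using wb
      by (simp add: P_def Q_def fun_power Fg[OF wb(1)] Wc[OF wb(1)] power_mult_distrib flip: power_mult)
  qed
  have lim: "((\<lambda>w. (w - z0) ^ (4 * n + 2 * K) * (g w ^ (2 * K + 4) / c w ^ K)) \<longlongrightarrow> 0) (at z0)"
  proof -
    have "isCont g z0"
      using holomorphic_on_imp_continuous_on[OF g] z0b by (simp add: continuous_on_eq_continuous_at)
    with cont_c have "((\<lambda>w. (w - z0) ^ (4 * n + 2 * K) * (g w ^ (2 * K + 4) / c w ^ K)) \<longlongrightarrow>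
        (z0 - z0) ^ (4 * n + 2 * K) * (g z0 ^ (2 * K + 4) / c z0 ^ K)) (at z0)"
      unfolding isCont_def using c0 by (intro tendsto_intros) auto
    then show ?thesis using n by (simp add: power_0_left)
  qed
  have Spos: "\<forall>z\<in>S. Im z > 0 \<and> P z \<noteq> 0 \<and> Q z \<noteq> 0"
  proof
    fix w assume "w \<in> S"
    then have wb: "w \<in> ball z0 r" "w - z0 \<noteq> 0" "c w \<noteq> 0" by (auto simp: S_def)
    have "w \<in> uhp" by (rule subsetD[OF r(2) wb(1)])
    then show "Im w > 0 \<and> P w \<noteq> 0 \<and> Q w \<noteq> 0"
      using wb g0[OF wb(1)] by (simp add: P_def Q_def fun_power Fg[OF wb(1)] Wc[OF wb(1)])
  qed
  have inf: "infinite ((\<lambda>z. P z / Q z) ` S)"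
  proof
    assume fin: "finite ((\<lambda>z. P z / Q z) ` S)"
    have "\<forall>\<^sub>F w in at z0. w \<in> S" using ev by eventually_elim (simp add: S_def)
    then have ev2: "\<forall>\<^sub>F w in at z0. P w / Q w = (w - z0) ^ (4 * n + 2 * K) * (g w ^ (2 * K + 4) / c w ^ K)"
      by eventually_elim (rule PQ)
    have l: "((\<lambda>w. P w / Q w) \<longlongrightarrow> 0) (at z0)" by (rule iffD2[OF tendsto_cong[OF ev2] lim])
    have "open (- ((\<lambda>z. P z / Q z) ` S))" using fin by (intro open_Compl finite_imp_closed)
    moreover have "0 \<in> - ((\<lambda>z. P z / Q z) ` S)" using Spos by auto
    ultimately have "\<forall>\<^sub>F w in at z0. P w / Q w \<in> - ((\<lambda>z. P z / Q z) ` S)" using topological_tendstoD[OF l] by blast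
    then have "\<forall>\<^sub>F w in at z0. False" using \<open>\<forall>\<^sub>F w in at z0. w \<in> S\<close> by eventually_elim auto
    then show False by (simp add: eventually_False)
  qed
  show thesis
  proof (rule that[of "K * (K + 2)" P Q S])
    show "P \<in> mod_forms \<Gamma> (2 * (K * (K + 2)))"
      using mod_forms_power[OF F, of "2 * K + 4"] by (simp add: P_def algebra_simps)
    show "Q \<in> mod_forms \<Gamma> (2 * (K * (K + 2)))"
      using mod_forms_power[OF WM K] by (simp add: Q_def algebra_simps)
  qed (use K Spos inf in auto)
qed

end

section \<open>Generated algebras as spans\<close>

lemma ring_fun_ring: "ring (fun_ring \<Omega>)"
  using cring_fun_ring by (rule cring.axioms)

lemma fun_ring_simps:
  "carrier (fun_ring \<Omega>) = {f. \<forall>z. z \<notin> \<Omega> \<longrightarrow> f z = 0}" "x \<otimes>\<^bsub>fun_ring \<Omega>\<^esub> y = x * y" "x \<oplus>\<^bsub>fun_ring \<Omega>\<^esub> y = x + y"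
  "\<one>\<^bsub>fun_ring \<Omega>\<^esub> = restr \<Omega> (\<lambda>_. 1)" "\<zero>\<^bsub>fun_ring \<Omega>\<^esub> = 0"
  by (simp_all add: fun_ring_def restr_def)

lemma a_inv_fun_ring:
  assumes "x \<in> carrier (fun_ring \<Omega>)" shows "\<ominus>\<^bsub>fun_ring \<Omega>\<^esub> x = - x"
proof -
  interpret cring "fun_ring \<Omega>" by (rule cring_fun_ring)
  show ?thesis by (rule minus_equality) (use assms in \<open>auto simp: fun_ring_simps\<close>)
qed

lemma gens_carrier:
  "S \<subseteq> carrier (fun_ring \<Omega>) \<Longrightarrow> range (\<lambda>c. restr \<Omega> (\<lambda>_. c)) \<union> S \<subseteq> carrier (fun_ring \<Omega>)"
  by (auto simp: fun_ring_simps restr_def)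

lemma gen_alg_subset:
  assumes S: "S \<subseteq> carrier (fun_ring \<Omega>)" "S \<subseteq> V" and V: "fvs.subspace V" "\<And>c. restr \<Omega> (\<lambda>_. c) \<in> V"
    "\<And>x y. x \<in> V \<Longrightarrow> y \<in> V \<Longrightarrow> x * y \<in> V"
  shows "gen_alg \<Omega> S \<subseteq> V"
proof
  fix x assume "x \<in> gen_alg \<Omega> S"
  then have "x \<in> V \<and> x \<in> carrier (fun_ring \<Omega>)" unfolding gen_alg_def
  proof (induction rule: generate_ring.induct)
    case (incl h)
    then show ?case using gens_carrier[OF S(1)] S(2) V(2) by auto
  next
    case (a_inv h)
    then have "\<ominus>\<^bsub>fun_ring \<Omega>\<^esub> h = fscale (-1) h" by (auto simp: a_inv_fun_ring fscale_def fun_eq_iff)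
    moreover have "fscale (-1) h \<in> V" using a_inv by (intro fvs.subspace_scale[OF V(1)]) simp
    moreover have "fscale (-1) h \<in> carrier (fun_ring \<Omega>)" using a_inv by (auto simp: fun_ring_simps fscale_def)
    ultimately show ?case by (simp only:)
  next
    case (eng_add h1 h2)
    have "h1 + h2 \<in> V" by (rule fvs.subspace_add[OF V(1)]) (use eng_add in blast)+
    moreover have "h1 + h2 \<in> carrier (fun_ring \<Omega>)" using eng_add by (auto simp: fun_ring_simps)
    ultimately show ?case by (simp only: fun_ring_simps(3) simp_thms)
  next
    case (eng_mult h1 h2)
    have "h1 * h2 \<in> V" by (rule V(3)) (use eng_mult in blast)+
    moreover have "h1 * h2 \<in> carrier (fun_ring \<Omega>)" using eng_mult by (auto simp: fun_ring_simps)
    ultimately show ?case by (simp only: fun_ring_simps(2) simp_thms)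
  qed (use V(2) in \<open>auto simp: fun_ring_simps restr_def\<close>)
  then show "x \<in> V" by simp
qed

lemma gen_alg_closed:
  assumes S: "S \<subseteq> carrier (fun_ring \<Omega>)"
  shows "fvs.subspace (gen_alg \<Omega> S)" "x \<in> gen_alg \<Omega> S \<Longrightarrow> y \<in> gen_alg \<Omega> S \<Longrightarrow> x * y \<in> gen_alg \<Omega> S"
    "restr \<Omega> (\<lambda>_. c) \<in> gen_alg \<Omega> S" "S \<subseteq> gen_alg \<Omega> S" "gen_alg \<Omega> S \<subseteq> carrier (fun_ring \<Omega>)"
proof -
  interpret ring "fun_ring \<Omega>" by (rule ring_fun_ring)
  show carr: "gen_alg \<Omega> S \<subseteq> carrier (fun_ring \<Omega>)"
    unfolding gen_alg_def by (rule generate_ring_incl[OF gens_carrier[OF S]])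
  show mult: "x * y \<in> gen_alg \<Omega> S" if "x \<in> gen_alg \<Omega> S" "y \<in> gen_alg \<Omega> S" for x y
    using generate_ring.eng_mult[OF that[unfolded gen_alg_def]] by (simp add: gen_alg_def fun_ring_simps)
  show const: "restr \<Omega> (\<lambda>_. c) \<in> gen_alg \<Omega> S" for c
    unfolding gen_alg_def by (rule generate_ring.incl) auto
  show "S \<subseteq> gen_alg \<Omega> S"
    unfolding gen_alg_def by (rule subsetI, rule generate_ring.incl) auto
  show "fvs.subspace (gen_alg \<Omega> S)"
  proof (rule fvs.subspaceI)
    show "0 \<in> gen_alg \<Omega> S" using zero_in_generate by (simp add: gen_alg_def fun_ring_simps)
    show "x + y \<in> gen_alg \<Omega> S" if "x \<in> gen_alg \<Omega> S" "y \<in> gen_alg \<Omega> S" for x y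
      using generate_ring.eng_add[OF that[unfolded gen_alg_def]] by (simp add: gen_alg_def fun_ring_simps)
    fix c x assume x: "x \<in> gen_alg \<Omega> S"
    then have "fscale c x = restr \<Omega> (\<lambda>_. c) * x" using carr by (auto simp: fun_ring_simps restr_def fscale_def fun_eq_iff)
    then show "fscale c x \<in> gen_alg \<Omega> S" using mult[OF const x] by simp
  qed
qed

lemma wt_monom_carrier:
  assumes "snd ` S \<subseteq> carrier (fun_ring \<Omega>)" "(k, g) \<in> wt_monom \<Omega> S" shows "g \<in> carrier (fun_ring \<Omega>)"
  using assms(2,1) by (induction rule: wt_monom.induct) (auto simp: fun_ring_simps restr_def)

lemma wt_monom_mult:
  assumes "(k, g) \<in> wt_monom \<Omega> S" "(l, h) \<in> wt_monom \<Omega> S" "snd ` S \<subseteq> carrier (fun_ring \<Omega>)"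
  shows "(k + l, g * h) \<in> wt_monom \<Omega> S"
  using assms(1)
proof (induction rule: wt_monom.induct)
  case one
  have "restr \<Omega> (\<lambda>_. 1) * h = h" using wt_monom_carrier[OF assms(3,2)] by (auto simp: fun_ring_simps restr_def fun_eq_iff)
  then show ?case using assms(2) by (simp add: fun_ring_simps)
next
  case (mult w g k m)
  then show ?case using wt_monom.mult[OF mult(1) mult(3)] by (simp only: fun_ring_simps mult.assoc add.assoc)
qed

lemma wt_monom_incl:
  assumes "(k, g) \<in> S" "snd ` S \<subseteq> carrier (fun_ring \<Omega>)" shows "(k, g) \<in> wt_monom \<Omega> S"
proof -
  have "g * restr \<Omega> (\<lambda>_. 1) = g" using assms by (force simp: fun_ring_simps restr_def fun_eq_iff)
  then show ?thesis using wt_monom.mult[OF assms(1) wt_monom.one, of \<Omega>] by (simp add: fun_ring_simps)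
qed

lemma wt_monom_mono:
  assumes "(k, g) \<in> wt_monom \<Omega> S" "S \<subseteq> T" shows "(k, g) \<in> wt_monom \<Omega> T"
  using assms by (induction rule: wt_monom.induct) (auto intro: wt_monom.intros)

lemma gen_alg_span:
  assumes S: "snd ` S \<subseteq> carrier (fun_ring \<Omega>)"
  shows "gen_alg \<Omega> (snd ` S) \<subseteq> fvs.span (snd ` wt_monom \<Omega> S)"
proof (rule gen_alg_subset[OF S])
  show "snd ` S \<subseteq> fvs.span (snd ` wt_monom \<Omega> S)"
  proof
    fix g assume "g \<in> snd ` S"
    then obtain k where "(k, g) \<in> S" by force
    then have "(k, g) \<in> wt_monom \<Omega> S" by (rule wt_monom_incl[OF _ S])
    then show "g \<in> fvs.span (snd ` wt_monom \<Omega> S)" by (intro fvs.span_base) force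
  qed
  show "restr \<Omega> (\<lambda>_. c) \<in> fvs.span (snd ` wt_monom \<Omega> S)" for c
  proof -
    have "restr \<Omega> (\<lambda>_. 1) \<in> snd ` wt_monom \<Omega> S" using wt_monom.one[of \<Omega> S] by (force simp: fun_ring_simps)
    then have "fscale c (restr \<Omega> (\<lambda>_. 1)) \<in> fvs.span (snd ` wt_monom \<Omega> S)" by (intro fvs.span_scale fvs.span_base)
    moreover have "fscale c (restr \<Omega> (\<lambda>_. 1)) = restr \<Omega> (\<lambda>_. c)" by (auto simp: fscale_def restr_def)
    ultimately show ?thesis by simp
  qed
  fix x y assume "x \<in> fvs.span (snd ` wt_monom \<Omega> S)" "y \<in> fvs.span (snd ` wt_monom \<Omega> S)"
  then show "x * y \<in> fvs.span (snd ` wt_monom \<Omega> S)"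
  proof (rule span_times)
    fix a b assume "a \<in> snd ` wt_monom \<Omega> S" "b \<in> snd ` wt_monom \<Omega> S"
    then obtain k l where "(k, a) \<in> wt_monom \<Omega> S" "(l, b) \<in> wt_monom \<Omega> S" by auto
    then have "(k + l, a * b) \<in> wt_monom \<Omega> S" by (rule wt_monom_mult[OF _ _ S])
    then show "a * b \<in> fvs.span (snd ` wt_monom \<Omega> S)" by (intro fvs.span_base) force
  qed
qed (rule fvs.subspace_span)

context cocompact_group
begin

text \<open>Functions of different weights cannot cancel: this is the independence of the automorphy factors,
  applied to the values on one orbit.\<close>

lemma weight_component:
  fixes Q :: "(complex \<Rightarrow> complex) \<Rightarrow> complex poly" and k :: "(complex \<Rightarrow> complex) \<Rightarrow> nat"
  assumes t: "finite t" and z: "Im z > 0"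
    and f: "\<And>A. A \<in> G \<Longrightarrow> f (moeb A z) = autj A z ^ w * poly q (uj A z)"
    and b: "\<And>b A. b \<in> t \<Longrightarrow> A \<in> G \<Longrightarrow> b (moeb A z) = autj A z ^ k b * poly (Q b) (uj A z)"
    and fb: "\<And>A. A \<in> G \<Longrightarrow> f (moeb A z) = (\<Sum>b\<in>t. r b * b (moeb A z))"
  shows "q = (\<Sum>b\<in>{b \<in> t. k b = w}. smult (r b) (Q b))"
proof -
  define K where "K x = (case x of None \<Rightarrow> w | Some b \<Rightarrow> k b)" for x
  define P where "P x = (case x of None \<Rightarrow> - q | Some b \<Rightarrow> smult (r b) (Q b))" for x
  have "(\<Sum>i\<in>{i \<in> insert None (Some ` t). K i = w}. P i) = 0"
  proof (rule automorphy_unique[OF _ z])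
    fix A assume A: "A \<in> G"
    have "(\<Sum>i\<in>insert None (Some ` t). autj A z ^ K i * poly (P i) (of_real (A$2$1) / autj A z))
        = (\<Sum>b\<in>t. autj A z ^ k b * (r b * poly (Q b) (uj A z))) - autj A z ^ w * poly q (uj A z)"
      using t by (simp add: sum.reindex K_def P_def uj_def)
    also have "\<dots> = (\<Sum>b\<in>t. r b * b (moeb A z)) - f (moeb A z)"
      unfolding f[OF A] by (intro arg_cong2[of _ _ _ _ "(-)"] sum.cong refl) (simp add: b[OF _ A] mult_ac)
    finally show "(\<Sum>i\<in>insert None (Some ` t). autj A z ^ K i * poly (P i) (of_real (A$2$1) / autj A z)) = 0"
      using fb[OF A] by simp
  qed (use t in simp)
  moreover have "{i \<in> insert None (Some ` t). K i = w} = insert None (Some ` {b \<in> t. k b = w})"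
    by (auto simp: K_def)
  ultimately show ?thesis using t by (simp add: sum.reindex P_def)
qed

section \<open>The ring of quasimodular forms is not finitely generated\<close>

text \<open>A form of weight \<open>k\<close> and depth \<open>p > 0\<close> has \<open>2 p < k\<close>.  Finitely many generators therefore satisfy
  \<open>2 p \<le> (1 - \<epsilon>) k\<close> with a common \<open>\<epsilon> > 0\<close>, and so do all their products.  The derivatives of one modular
  form of weight \<open>K\<close> have weight \<open>K + 2 n\<close> and exact depth \<open>n\<close>, so their ratio \<open>2 p / k\<close> tends to 1.\<close>

lemma quasi_ring_not_fin_gen: "\<not> fin_gen_alg uhp (quasi_ring \<Gamma>)"
proof
  assume "fin_gen_alg uhp (quasi_ring \<Gamma>)"
  then obtain S where S: "finite S" "S \<subseteq> carrier (fun_ring uhp)" "quasi_ring \<Gamma> = gen_alg uhp S"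
    by (auto simp: fin_gen_alg_def)
  define B where "B m = {g. \<exists>k p. g \<in> quasi_forms_depth \<Gamma> k p \<and> 2 * (m + 1) * p \<le> m * k}" for m :: nat
  have mono: "B m \<subseteq> B m'" if "m \<le> m'" for m m'
  proof -
    have "2 * (m' + 1) * p \<le> m' * k" if h: "2 * (m + 1) * p \<le> m * k" for k p :: nat
    proof -
      have "(m + 1) * (2 * p) \<le> (m + 1) * k" using h by simp
      then have le: "2 * p \<le> k" by (simp only: mult_le_cancel1)
      obtain d where d: "m' = m + d" using le_Suc_ex[OF \<open>m \<le> m'\<close>] by auto
      have "d * (2 * p) \<le> d * k" using le by (rule mult_le_mono2)
      from add_mono[OF this h] show ?thesis unfolding d by (simp only: algebra_simps)
    qed
    then show ?thesis unfolding B_def by blast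
  qed
  have smono: "fvs.span (B m) \<subseteq> fvs.span (B m')" if "m \<le> m'" for m m'
    by (rule fvs.span_mono[OF mono[OF that]])
  have ex: "\<exists>m. s \<in> fvs.span (B m)" if s: "s \<in> quasi_ring \<Gamma>" for s
    using s unfolding quasi_ring_def
  proof (induction rule: fvs.span_induct_alt)
    case base
    show ?case by (intro exI[of _ 0] fvs.span_zero)
  next
    case (step c x y)
    then obtain k m where x: "x \<in> quasi_forms \<Gamma> k" and y: "y \<in> fvs.span (B m)" by auto
    obtain Q p where Q: "qrep k x Q" "\<forall>z. Im z > 0 \<longrightarrow> degree (Q z) \<le> p" using x by (auto simp: quasi_forms_iff)
    have hol: "x holomorphic_on uhp" using x by (simp add: quasi_forms_iff)
    obtain q where q: "q = 0 \<or> 2 * q < k" "\<forall>z. Im z > 0 \<longrightarrow> degree (Q z) \<le> q"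
      using qrep_degree_bound[OF Q(1) hol Q(2)] by auto
    have "x \<in> quasi_forms_depth \<Gamma> k q" unfolding quasi_forms_depth_iff
      using x Q(1) q(2) by (auto simp: quasi_forms_iff)
    moreover have "2 * (2 * q + 1) * q \<le> 2 * q * k"
      using q(1) mult_le_mono2[of "2 * q + 1" k "2 * q"] by (auto simp: mult_ac)
    ultimately have xB: "x \<in> B (2 * q)" unfolding B_def by blast
    have "2 * q \<le> 2 * q + m" "m \<le> 2 * q + m" by simp_all
    note le = this
    have "x \<in> fvs.span (B (2 * q + m))" by (rule fvs.span_base[OF subsetD[OF mono[OF le(1)] xB]])
    moreover have "y \<in> fvs.span (B (2 * q + m))" by (rule subsetD[OF smono[OF le(2)] y])
    ultimately show ?case by (intro exI[of _ "2 * q + m"] fvs.span_add fvs.span_scale)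
  qed
  have "S \<subseteq> quasi_ring \<Gamma>" unfolding S(3) by (rule gen_alg_closed(4)[OF S(2)])
  then have "\<forall>s\<in>S. \<exists>m. s \<in> fvs.span (B m)" using ex by auto
  from bchoice[OF this] obtain \<mu> where \<mu>: "\<forall>s\<in>S. s \<in> fvs.span (B (\<mu> s))" by auto
  define m where "m = (\<Sum>s\<in>S. \<mu> s)"
  have "S \<subseteq> fvs.span (B m)"
  proof
    fix s assume s: "s \<in> S"
    then have "\<mu> s \<le> m" unfolding m_def by (intro member_le_sum) (use S(1) in auto)
    then show "s \<in> fvs.span (B m)" by (rule subsetD[OF smono]) (use \<mu> s in auto)
  qed
  then have "quasi_ring \<Gamma> \<subseteq> fvs.span (B m)" unfolding S(3)
  proof (rule gen_alg_subset[OF S(2)])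
    show "restr uhp (\<lambda>_. c) \<in> fvs.span (B m)" for c
      by (rule fvs.span_base) (use quasi_one[of c] in \<open>auto simp: B_def intro!: exI[of _ 0]\<close>)
    fix x y assume "x \<in> fvs.span (B m)" "y \<in> fvs.span (B m)"
    then show "x * y \<in> fvs.span (B m)"
    proof (rule span_times)
      fix a b assume "a \<in> B m" "b \<in> B m"
      then obtain k p l q where a: "a \<in> quasi_forms_depth \<Gamma> k p" "2 * (m + 1) * p \<le> m * k"
        and b: "b \<in> quasi_forms_depth \<Gamma> l q" "2 * (m + 1) * q \<le> m * l" by (auto simp: B_def)
      have "2 * (m + 1) * (p + q) \<le> m * (k + l)" using a(2) b(2) by (simp add: algebra_simps)
      then have "a * b \<in> B m" using quasi_depth_mult[OF a(1) b(1)] unfolding B_def by blast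
      then show "a * b \<in> fvs.span (B m)" by (rule fvs.span_base)
    qed
  qed (rule fvs.subspace_span)
  moreover obtain K F where K: "K > 0" and F: "F \<in> mod_forms \<Gamma> K" and F0: "F \<i> \<noteq> 0" by (rule exists_mod_form)
  define n where "n = (m + 1) * K"
  have "(du ^^ n) F \<in> quasi_forms_depth \<Gamma> (K + 2 * n) n" by (rule quasi_iter[OF F])
  then have "(du ^^ n) F \<in> quasi_ring \<Gamma>"
    unfolding quasi_ring_def quasi_forms_def by (intro fvs.span_base) blast
  ultimately have "(du ^^ n) F \<in> fvs.span (B m)" by blast
  then obtain t r where t: "finite t" "t \<subseteq> B m" "(du ^^ n) F = (\<Sum>b\<in>t. fscale (r b) b)"
    by (auto simp: fvs.span_explicit)
  have "\<forall>b\<in>t. \<exists>x. b \<in> quasi_forms_depth \<Gamma> (fst x) (snd x) \<and> 2 * (m + 1) * snd x \<le> m * fst x"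
    using t(2) by (fastforce simp: B_def)
  from bchoice[OF this] obtain kp where kp: "\<forall>b\<in>t. b \<in> quasi_forms_depth \<Gamma> (fst (kp b)) (snd (kp b)) \<and> 2 * (m + 1) * snd (kp b) \<le> m * fst (kp b)"
    by auto
  have "\<forall>b\<in>t. \<exists>Q. qrep (fst (kp b)) b Q \<and> (\<forall>z. Im z > 0 \<longrightarrow> degree (Q z) \<le> snd (kp b))"
    using kp by (auto simp: quasi_forms_depth_iff)
  from bchoice[OF this] obtain Q where Q: "\<forall>b\<in>t. qrep (fst (kp b)) b (Q b) \<and> (\<forall>z. Im z > 0 \<longrightarrow> degree (Q b z) \<le> snd (kp b))"
    by auto
  obtain QF where QF: "qrep (K + 2 * n) ((du ^^ n) F) QF" "\<forall>z. Im z > 0 \<longrightarrow> coeff (QF z) n = pochhammer (of_nat K) n * F z"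
    by (rule qrep_iter[OF F, of n])
  have i: "Im \<i> > 0" by simp
  have "QF \<i> = (\<Sum>b\<in>{b \<in> t. fst (kp b) = K + 2 * n}. smult (r b) (Q b \<i>))"
  proof (rule weight_component[OF t(1) i])
    show "(du ^^ n) F (moeb A \<i>) = autj A \<i> ^ (K + 2 * n) * poly (QF \<i>) (uj A \<i>)" if "A \<in> G" for A
      by (rule qrepD[OF QF(1) that i])
    show "b (moeb A \<i>) = autj A \<i> ^ fst (kp b) * poly (Q b \<i>) (uj A \<i>)" if "b \<in> t" "A \<in> G" for b A
      using Q that by (intro qrepD[OF _ _ i]) auto
    show "(du ^^ n) F (moeb A \<i>) = (\<Sum>b\<in>t. r b * b (moeb A \<i>))" for A
      unfolding t(3) by (simp add: sum_fun_apply fscale_def)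
  qed
  then have "coeff (QF \<i>) n = (\<Sum>b\<in>{b \<in> t. fst (kp b) = K + 2 * n}. r b * coeff (Q b \<i>) n)"
    by (simp add: coeff_sum)
  also have "\<dots> = 0"
  proof (rule sum.neutral, rule ballI)
    fix b assume b: "b \<in> {b \<in> t. fst (kp b) = K + 2 * n}"
    have "2 * (m + 1) * snd (kp b) \<le> m * (K + 2 * n)" using kp b by fastforce
    also have "\<dots> < 2 * (m + 1) * n" using K by (simp add: n_def algebra_simps)
    finally have "2 * (m + 1) * snd (kp b) < 2 * (m + 1) * n" .
    then have "snd (kp b) < n" by (rule mult_less_cancel1[THEN iffD1, THEN conjunct2])
    moreover have "degree (Q b \<i>) \<le> snd (kp b)" using Q b i by blast
    ultimately show "r b * coeff (Q b \<i>) n = 0" by (simp add: coeff_eq_0)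
  qed
  finally have "pochhammer (of_nat K) n * F \<i> = 0" using QF(2) i by simp
  moreover have "pochhammer (of_nat K :: complex) n \<noteq> 0"
  proof
    assume "pochhammer (of_nat K :: complex) n = 0"
    then obtain j where "(of_nat K :: complex) = - of_nat j" by (auto simp: pochhammer_eq_0_iff)
    then have "(of_nat (K + j) :: complex) = 0" by simp
    then show False using K by (simp only: of_nat_eq_0_iff)
  qed
  ultimately show False using F0 by simp
qed

section \<open>Quasimodular forms grow at least quadratically\<close>

lemma quasi_depth_power:
  assumes "g \<in> quasi_forms_depth \<Gamma> k p" "f \<in> quasi_forms_depth \<Gamma> l q"
  shows "g * f ^ n \<in> quasi_forms_depth \<Gamma> (k + n * l) (p + n * q)"
proof (induction n)
  case 0
  have "g * f ^ 0 = g" by (simp add: fun_eq_iff)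
  then show ?case using assms(1) by simp
next
  case (Suc n)
  have "g * f ^ Suc n = (g * f ^ n) * f" by (simp only: power_Suc mult_ac)
  moreover have "k + Suc n * l = k + n * l + l" "p + Suc n * q = p + n * q + q" by simp_all
  ultimately show ?case using quasi_depth_mult[OF Suc assms(2)] by (simp only:)
qed

text \<open>If \<open>P\<close> and \<open>Q\<close> are algebraically independent forms of the same weight, the products
  \<open>P\<^sup>a Q\<^sup>b (P')\<^sup>c\<close> of a given weight are linearly independent: on an orbit \<open>P'\<close> becomes a nonconstant
  affine function of \<open>c / (c z + d)\<close>, which separates the exponents \<open>c\<close>, and \<open>P / Q\<close> takes infinitely many
  values.  The exponents range over a two-dimensional set.\<close>

lemma quasi_dim_lower:
  obtains c :: real and \<kappa>0 :: nat where "c > 0"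
    "\<forall>\<kappa>\<ge>\<kappa>0. \<forall>B. finite B \<longrightarrow> quasi_forms \<Gamma> (2 * \<kappa>) \<subseteq> fvs.span B \<longrightarrow> c * real \<kappa> ^ 2 \<le> real (fvs.dim (quasi_forms \<Gamma> (2 * \<kappa>)))"
proof -
  obtain l P Q S where l: "l > (0::nat)" and P: "P \<in> mod_forms \<Gamma> (2 * l)" and Q: "Q \<in> mod_forms \<Gamma> (2 * l)"
    and S: "\<forall>z\<in>S. Im z > 0 \<and> P z \<noteq> 0 \<and> Q z \<noteq> 0" "infinite ((\<lambda>z. P z / Q z) ` S)"
    by (rule independent_forms)
  have Phol: "P holomorphic_on uhp" using P by (simp add: mod_forms_iff)
  define E where "E = du P"
  have E: "E \<in> quasi_forms_depth \<Gamma> (2 * l + 2) 1" using quasi_iter[OF P, of 1] by (simp add: E_def)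
  have Pd: "P \<in> quasi_forms_depth \<Gamma> (2 * l) 0" using quasi_iter[OF P, of 0] by simp
  have Qd: "Q \<in> quasi_forms_depth \<Gamma> (2 * l) 0" using quasi_iter[OF Q, of 0] by simp
  obtain R where R: "qrep (2 * l + 2) (du P) R" "\<forall>z. Im z > 0 \<longrightarrow> degree (R z) \<le> Suc 0"
    "\<forall>z. Im z > 0 \<longrightarrow> coeff (R z) (Suc 0) = (of_nat (2 * l) - of_nat 0) * coeff [:P z:] 0"
    by (rule qrep_du[OF qrep_mod_form[OF P] Phol, of 0]) auto
  have ER: "E (moeb A z) = autj A z ^ (2 * l + 2) * (E z + of_nat (2 * l) * P z * uj A z)" if A: "A \<in> G" and z: "Im z > 0" for A z
  proof -
    have "poly (R z) (uj A z) = (\<Sum>i\<le>Suc 0. coeff (R z) i * uj A z ^ i)"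
      by (subst poly_altdef, rule sum.mono_neutral_left) (use R(2) z in \<open>auto simp: coeff_eq_0\<close>)
    then show ?thesis using R(3) z qrep_0[OF R(1) z] qrepD[OF R(1) A z] by (simp add: E_def)
  qed
  define e where "e \<kappa> t = \<kappa> mod l + l * t" for \<kappa> t
  define s where "s \<kappa> t = (\<kappa> - (l + 1) * e \<kappa> t) div l" for \<kappa> t
  define T where "T \<kappa> = \<kappa> div (4 * l * (l + 1))" for \<kappa>
  define M where "M \<kappa> = \<kappa> div (4 * l)" for \<kappa>
  have arith: "l * s \<kappa> t + (l + 1) * e \<kappa> t = \<kappa> \<and> M \<kappa> \<le> s \<kappa> t" if t: "t < T \<kappa>" for \<kappa> t
  proof -
    have "e \<kappa> t < l * (t + 1)" using l by (simp add: e_def)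
    also have "\<dots> \<le> l * T \<kappa>" using t by (intro mult_le_mono2) simp
    finally have "4 * ((l + 1) * e \<kappa> t) \<le> 4 * ((l + 1) * (l * T \<kappa>))" by (intro mult_le_mono2) simp
    also have "\<dots> = 4 * l * (l + 1) * T \<kappa>" by (simp only: mult_ac)
    also have "\<dots> \<le> \<kappa>" unfolding T_def by (rule times_div_less_eq_dividend)
    finally have le: "4 * ((l + 1) * e \<kappa> t) \<le> \<kappa>" .
    have eq: "(l + 1) * e \<kappa> t = l * (t + e \<kappa> t) + \<kappa> mod l" by (simp add: e_def algebra_simps)
    have "\<kappa> - (l + 1) * e \<kappa> t = (l * (\<kappa> div l) + \<kappa> mod l) - (l * (t + e \<kappa> t) + \<kappa> mod l)"
      unfolding eq by simp
    also have "\<dots> = l * (\<kappa> div l - (t + e \<kappa> t))" by (simp only: diff_cancel2 diff_mult_distrib2)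
    finally have "l dvd \<kappa> - (l + 1) * e \<kappa> t" by (rule dvdI)
    then have ls: "l * s \<kappa> t = \<kappa> - (l + 1) * e \<kappa> t" by (simp add: s_def)
    have "4 * l * M \<kappa> \<le> \<kappa>" unfolding M_def by (rule times_div_less_eq_dividend)
    then have "l * M \<kappa> \<le> l * s \<kappa> t" unfolding ls using le by simp
    then have "M \<kappa> \<le> s \<kappa> t" using l by (simp only: mult_le_cancel1 simp_thms)
    moreover have "(l + 1) * e \<kappa> t \<le> \<kappa>" using le by linarith
    then have "l * s \<kappa> t + (l + 1) * e \<kappa> t = \<kappa>" unfolding ls by (rule le_add_diff_inverse2)
    ultimately show ?thesis by (intro conjI)
  qed
  define h where "h \<kappa> x = restr uhp (\<lambda>_. 1) * P ^ snd x * Q ^ (s \<kappa> (fst x) - snd x) * E ^ e \<kappa> (fst x)" for \<kappa> x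
  have lower: "T \<kappa> * (M \<kappa> + 1) \<le> fvs.dim (quasi_forms \<Gamma> (2 * \<kappa>))" if B: "finite B" "quasi_forms \<Gamma> (2 * \<kappa>) \<subseteq> fvs.span B" for \<kappa> B
  proof -
    let ?I = "{..<T \<kappa>} \<times> {..M \<kappa>}"
    have "card ?I \<le> fvs.dim (quasi_forms \<Gamma> (2 * \<kappa>))"
    proof (rule card_le_dim[of ?I "h \<kappa>", OF _ _ B(2,1)])
      fix x assume x: "x \<in> ?I"
      have hq: "h \<kappa> x \<in> quasi_forms_depth \<Gamma> (0 + snd x * (2 * l) + (s \<kappa> (fst x) - snd x) * (2 * l) + e \<kappa> (fst x) * (2 * l + 2))
          (0 + snd x * 0 + (s \<kappa> (fst x) - snd x) * 0 + e \<kappa> (fst x) * 1)"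
        unfolding h_def by (intro quasi_depth_power quasi_one Pd Qd E)
      have eq: "0 + snd x * (2 * l) + (s \<kappa> (fst x) - snd x) * (2 * l) + e \<kappa> (fst x) * (2 * l + 2) = 2 * \<kappa>"
      proof -
        have a: "l * s \<kappa> (fst x) + (l + 1) * e \<kappa> (fst x) = \<kappa>" "snd x \<le> s \<kappa> (fst x)"
          using arith[of "fst x" \<kappa>] x by auto
        have "snd x * (2 * l) + (s \<kappa> (fst x) - snd x) * (2 * l) = s \<kappa> (fst x) * (2 * l)"
          using a(2) by (simp only: add_mult_distrib[symmetric] le_add_diff_inverse)
        then show ?thesis using a(1) by (simp add: algebra_simps)
      qed
      show "h \<kappa> x \<in> quasi_forms \<Gamma> (2 * \<kappa>)"
        unfolding quasi_forms_def by (rule UN_I[where B = "quasi_forms_depth \<Gamma> (2 * \<kappa>)", OF UNIV_I hq[unfolded eq]])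
    next
      fix y :: "nat \<times> nat \<Rightarrow> complex" assume y: "(\<Sum>x\<in>?I. fscale (y x) (h \<kappa> x)) = 0"
      have key: "(\<Sum>x\<in>?I. y x * (P z ^ snd x * Q z ^ (s \<kappa> (fst x) - snd x)) * (E z + of_nat (2 * l) * P z * uj A z) ^ e \<kappa> (fst x)) = 0"
        if A: "A \<in> G" and z: "Im z > 0" for A z
      proof -
        let ?j = "autj A z" and ?X = "E z + of_nat (2 * l) * P z * uj A z"
        have "0 = (\<Sum>x\<in>?I. y x * h \<kappa> x (moeb A z))"
          using fun_cong[OF y, of "moeb A z"] by (simp add: sum_fun_apply fscale_def)
        also have "\<dots> = (\<Sum>x\<in>?I. ?j ^ (2 * \<kappa>) * (y x * (P z ^ snd x * Q z ^ (s \<kappa> (fst x) - snd x)) * ?X ^ e \<kappa> (fst x)))"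
        proof (intro sum.cong refl)
          fix x assume x: "x \<in> ?I"
          have a: "l * s \<kappa> (fst x) + (l + 1) * e \<kappa> (fst x) = \<kappa>" "snd x \<le> s \<kappa> (fst x)"
            using arith[of "fst x" \<kappa>] x by auto
          have pq: "P (moeb A z) = ?j ^ (2 * l) * P z" "Q (moeb A z) = ?j ^ (2 * l) * Q z"
            using P Q A z by (simp_all add: mod_forms_iff)
          have "(2 * l) * snd x + (2 * l) * (s \<kappa> (fst x) - snd x) + (2 * l + 2) * e \<kappa> (fst x) = 2 * \<kappa>"
          proof -
            have "(2 * l) * snd x + (2 * l) * (s \<kappa> (fst x) - snd x) = 2 * l * s \<kappa> (fst x)"
              using a(2) by (simp only: add_mult_distrib2[symmetric] le_add_diff_inverse)
            then show ?thesis using a(1) by (simp add: algebra_simps)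
          qed
          then have jj: "?j ^ (2 * \<kappa>) = (?j ^ (2 * l)) ^ snd x * (?j ^ (2 * l)) ^ (s \<kappa> (fst x) - snd x) * (?j ^ (2 * l + 2)) ^ e \<kappa> (fst x)"
            by (simp only: power_mult[symmetric] power_add[symmetric])
          have alg: "v * ((a1 * p) ^ i * (a2 * q) ^ j * (a3 * r) ^ k) = a1 ^ i * a2 ^ j * a3 ^ k * (v * (p ^ i * q ^ j) * r ^ k)"
            for v a1 a2 a3 p q r :: complex and i j k :: nat
            by (simp add: power_mult_distrib)
          have hx: "h \<kappa> x (moeb A z) = P (moeb A z) ^ snd x * Q (moeb A z) ^ (s \<kappa> (fst x) - snd x) * E (moeb A z) ^ e \<kappa> (fst x)"
            using moeb_uhp[OF A z] by (simp add: h_def fun_power restr_def)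
          show "y x * h \<kappa> x (moeb A z) = ?j ^ (2 * \<kappa>) * (y x * (P z ^ snd x * Q z ^ (s \<kappa> (fst x) - snd x)) * ?X ^ e \<kappa> (fst x))"
            unfolding jj hx pq ER[OF A z] by (rule alg)
        qed
        finally show ?thesis using G_autj[OF A z] by (simp add: sum_distrib_left[symmetric])
      qed
      have key2: "(\<Sum>a\<le>M \<kappa>. y (t, a) * (P z ^ a * Q z ^ (s \<kappa> t - a))) = 0" if z: "z \<in> S" and t: "t < T \<kappa>" for z t
      proof -
        have z': "Im z > 0" "P z \<noteq> 0" using S(1) z by auto
        define p where "p = (\<Sum>x\<in>?I. monom (y x * (P z ^ snd x * Q z ^ (s \<kappa> (fst x) - snd x))) (e \<kappa> (fst x)))"
        have "p = 0"
        proof (rule ccontr)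
          assume "p \<noteq> 0"
          then have fin: "finite {x. poly p x = 0}" by (rule poly_roots_finite)
          have sub: "(\<lambda>u. E z + of_nat (2 * l) * P z * u) ` ((\<lambda>A. uj A z) ` G) \<subseteq> {x. poly p x = 0}"
          proof (intro image_subsetI CollectI)
            fix u assume "u \<in> (\<lambda>A. uj A z) ` G"
            then obtain A where u: "u = uj A z" and A: "A \<in> G" by (rule imageE)
            show "poly p (E z + of_nat (2 * l) * P z * u) = 0"
              unfolding u p_def poly_sum poly_monom by (rule key[OF A z'(1)])
          qed
          have inj: "inj_on (\<lambda>u. E z + of_nat (2 * l) * P z * u) ((\<lambda>A. uj A z) ` G)"
            by (rule inj_onI) (use z'(2) l in simp)
          have "finite ((\<lambda>A. uj A z) ` G)" by (rule finite_imageD[OF finite_subset[OF sub fin] inj])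
          then show False using infinite_uj[OF z'(1)] by simp
        qed
        then have "0 = coeff p (e \<kappa> t)" by simp
        also have "\<dots> = (\<Sum>x\<in>?I. if fst x = t then y x * (P z ^ snd x * Q z ^ (s \<kappa> (fst x) - snd x)) else 0)"
          unfolding p_def coeff_sum coeff_monom using l by (intro sum.cong refl) (auto simp: e_def)
        also have "\<dots> = (\<Sum>t'<T \<kappa>. \<Sum>a\<le>M \<kappa>. if t' = t then y (t', a) * (P z ^ a * Q z ^ (s \<kappa> t' - a)) else 0)"
          by (subst sum.cartesian_product) (intro sum.cong refl, auto)
        also have "\<dots> = (\<Sum>t'<T \<kappa>. if t' = t then (\<Sum>a\<le>M \<kappa>. y (t', a) * (P z ^ a * Q z ^ (s \<kappa> t' - a))) else 0)"
          by (intro sum.cong refl) auto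
        also have "\<dots> = (\<Sum>a\<le>M \<kappa>. y (t, a) * (P z ^ a * Q z ^ (s \<kappa> t - a)))" using t by simp
        finally show ?thesis by simp
      qed
      show "\<forall>x\<in>?I. y x = 0"
      proof
        fix x assume x: "x \<in> ?I"
        obtain t a where xt: "x = (t, a)" "t < T \<kappa>" "a \<le> M \<kappa>" using x by auto
        define p where "p = (\<Sum>a\<le>M \<kappa>. monom (y (t, a)) a)"
        have "p = 0"
        proof (rule ccontr)
          assume "p \<noteq> 0"
          then have "finite {x. poly p x = 0}" by (rule poly_roots_finite)
          moreover have "(\<lambda>z. P z / Q z) ` S \<subseteq> {x. poly p x = 0}"
          proof clarify
            fix z assume z: "z \<in> S"
            then have q: "Q z \<noteq> 0" using S(1) by simp
            have "0 = (\<Sum>a\<le>M \<kappa>. y (t, a) * (P z ^ a * Q z ^ (s \<kappa> t - a)))" using key2[OF z xt(2)] by simp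
            also have "\<dots> = (\<Sum>a\<le>M \<kappa>. Q z ^ s \<kappa> t * (y (t, a) * (P z / Q z) ^ a))"
            proof (intro sum.cong refl)
              fix a assume "a \<in> {..M \<kappa>}"
              then have "a \<le> s \<kappa> t" using arith[OF xt(2)] by simp
              then have "Q z ^ s \<kappa> t = Q z ^ (s \<kappa> t - a) * Q z ^ a" by (simp flip: power_add)
              then show "y (t, a) * (P z ^ a * Q z ^ (s \<kappa> t - a)) = Q z ^ s \<kappa> t * (y (t, a) * (P z / Q z) ^ a)"
                using q by (simp add: power_divide)
            qed
            finally have "Q z ^ s \<kappa> t * (\<Sum>a\<le>M \<kappa>. y (t, a) * (P z / Q z) ^ a) = 0" by (simp only: sum_distrib_left)
            then show "poly p (P z / Q z) = 0" using q by (simp add: p_def poly_sum poly_monom)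
          qed
          ultimately have "finite ((\<lambda>z. P z / Q z) ` S)" by (rule rev_finite_subset)
          then show False using S(2) by (rule notE[rotated])
        qed
        then have "0 = coeff p a" by (simp only: coeff_0)
        also have "\<dots> = y x" using xt by (simp add: p_def coeff_sum)
        finally show "y x = 0" by simp
      qed
    qed simp
    then show ?thesis by simp
  qed
  show thesis
  proof (rule that[of "1 / (32 * real l ^ 2 * (real l + 1))" "8 * l * (l + 1)"])
    show "1 / (32 * real l ^ 2 * (real l + 1)) > 0" using l by simp
    show "\<forall>\<kappa>\<ge>8 * l * (l + 1). \<forall>B. finite B \<longrightarrow> quasi_forms \<Gamma> (2 * \<kappa>) \<subseteq> fvs.span B \<longrightarrow>
        1 / (32 * real l ^ 2 * (real l + 1)) * real \<kappa> ^ 2 \<le> real (fvs.dim (quasi_forms \<Gamma> (2 * \<kappa>)))"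
    proof (intro allI impI)
      fix \<kappa> B assume \<kappa>: "\<kappa> \<ge> 8 * l * (l + 1)" and B: "finite B" "quasi_forms \<Gamma> (2 * \<kappa>) \<subseteq> fvs.span B"
      have dv: "real \<kappa> / real n - 1 \<le> real (\<kappa> div n)" if n: "n > 0" for n
      proof -
        have "n * (\<kappa> div n) + \<kappa> mod n = \<kappa>" by (rule mult_div_mod_eq)
        moreover have "\<kappa> mod n < n" using n by (rule mod_less_divisor)
        ultimately have "\<kappa> \<le> n * (\<kappa> div n) + n" by linarith
        then have "\<kappa> \<le> (\<kappa> div n + 1) * n" by (simp add: algebra_simps)
        then have "real \<kappa> \<le> real ((\<kappa> div n + 1) * n)" by (rule of_nat_mono)
        then have "real \<kappa> \<le> (real (\<kappa> div n) + 1) * real n" by (simp only: of_nat_mult of_nat_add of_nat_1)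
        then have "real \<kappa> / real n \<le> real (\<kappa> div n) + 1" by (rule mult_imp_div_pos_le[rotated]) (use n in simp)
        then show ?thesis by linarith
      qed
      define q where "q = 4 * l * (l + 1)"
      define X where "X = real \<kappa> / real (2 * q)"
      have q: "q > 0" using l by (simp add: q_def)
      have "2 * q \<le> \<kappa>" using \<kappa> by (simp add: q_def)
      then have "real (2 * q) \<le> real \<kappa>" by (rule of_nat_mono)
      moreover have "0 < real (2 * q)" using q by simp
      ultimately have X1: "1 \<le> X" unfolding X_def by (simp only: le_divide_eq_1_pos)
      have "real \<kappa> / real q = 2 * X" by (simp add: X_def)
      then have "2 * X - 1 \<le> real (T \<kappa>)" using dv[OF q] unfolding T_def q_def[symmetric] by (simp only:)
      then have t: "X \<le> real (T \<kappa>)" using X1 by linarith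
      have "real \<kappa> / real (4 * l) - 1 \<le> real (\<kappa> div (4 * l))" by (rule dv) (use l in simp)
      then have m: "real \<kappa> / real (4 * l) \<le> real (M \<kappa> + 1)" unfolding M_def of_nat_add of_nat_1 by linarith
      have alg: "1 / (32 * a\<^sup>2 * (a + 1)) * b\<^sup>2 = b / (2 * (4 * a * (a + 1))) * (b / (4 * a))" for a b :: real
        by (simp add: power2_eq_square)
      have "1 / (32 * real l ^ 2 * (real l + 1)) * real \<kappa> ^ 2 = X * (real \<kappa> / real (4 * l))"
        unfolding X_def q_def of_nat_mult of_nat_add of_nat_numeral of_nat_1 by (rule alg)
      also have "\<dots> \<le> real (T \<kappa>) * real (M \<kappa> + 1)" using t m X1 by (intro mult_mono) auto
      also have "\<dots> = real (T \<kappa> * (M \<kappa> + 1))" by (simp only: of_nat_mult)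
      also have "\<dots> \<le> real (fvs.dim (quasi_forms \<Gamma> (2 * \<kappa>)))" using lower[OF B] by (intro of_nat_mono)
      finally show "1 / (32 * real l ^ 2 * (real l + 1)) * real \<kappa> ^ 2 \<le> real (fvs.dim (quasi_forms \<Gamma> (2 * \<kappa>)))" .
    qed
  qed
qed

end

section \<open>Meromorphic modular forms with poles on the orbit of \<open>\<i>\<close>\<close>

context cocompact_group
begin

lemma Om_pos: "z \<in> Om \<Gamma> \<Longrightarrow> Im z > 0"
  using Om_subset uhp_iff by blast

lemma i_notin_Om: "\<i> \<notin> Om \<Gamma>"
  using orbit_self[of \<i>] by (simp add: Om_def)

lemma mero_iI:
  assumes "h meromorphic_on uhp" "h holomorphic_on Om \<Gamma>" shows "restr (Om \<Gamma>) h \<in> mero_i \<Gamma>"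
proof -
  have "\<forall>\<^sub>F w in at z. restr (Om \<Gamma>) h w = h w" if z: "z \<in> uhp" for z
  proof -
    have "Im z > 0" using z by simp
    then obtain e where e: "e > 0" "ball z e - {z} \<subseteq> Om \<Gamma>" by (rule punctured_nbhd)
    have "\<forall>\<^sub>F w in at z. w \<in> ball z e - {z}" by (rule eventually_at_in_open) (use e in auto)
    then show ?thesis by (rule eventually_mono) (use e(2) in \<open>auto simp: restr_def\<close>)
  qed
  then have "restr (Om \<Gamma>) h meromorphic_on uhp \<longleftrightarrow> h meromorphic_on uhp" by (intro meromorphic_on_cong) auto
  moreover have "restr (Om \<Gamma>) h holomorphic_on Om \<Gamma>"
    by (rule holomorphic_transform[OF assms(2)]) (simp add: restr_def)
  ultimately show ?thesis using assms(1) by (simp add: mero_i_def fun_ring_simps restr_def)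
qed

lemma mod_forms_i_iff:
  "f \<in> mod_forms_i \<Gamma> k \<longleftrightarrow> (\<forall>z. z \<notin> Om \<Gamma> \<longrightarrow> f z = 0) \<and> f meromorphic_on uhp \<and> f holomorphic_on Om \<Gamma> \<and>
     (\<forall>A\<in>G. \<forall>z\<in>Om \<Gamma>. f (moeb A z) = autj A z powi k * f z)"
  by (auto simp: mod_forms_i_def mero_i_def fun_ring_simps G_def)

lemma mod_forms_i_trans: "f \<in> mod_forms_i \<Gamma> (int k) \<Longrightarrow> A \<in> G \<Longrightarrow> z \<in> Om \<Gamma> \<Longrightarrow> f (moeb A z) = autj A z ^ k * f z"
  by (simp add: mod_forms_i_iff)

lemma mod_forms_i_mult:
  assumes f: "f \<in> mod_forms_i \<Gamma> (int k)" and g: "g \<in> mod_forms_i \<Gamma> (int l)"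
  shows "f * g \<in> mod_forms_i \<Gamma> (int (k + l))"
proof -
  have "(\<lambda>z. f z * g z) meromorphic_on uhp"
    by (rule meromorphic_on_mult) (use f g in \<open>auto simp: mod_forms_i_iff\<close>)
  moreover have "(\<lambda>z. f z * g z) holomorphic_on Om \<Gamma>"
    by (rule holomorphic_on_mult) (use f g in \<open>auto simp: mod_forms_i_iff\<close>)
  moreover have "f (moeb A z) * g (moeb A z) = autj A z ^ (k + l) * (f z * g z)" if "A \<in> G" "z \<in> Om \<Gamma>" for A z
    using mod_forms_i_trans[OF f that] mod_forms_i_trans[OF g that] by (simp add: power_add)
  ultimately show ?thesis using f unfolding mod_forms_i_iff times_fun_def by (simp only: power_int_of_nat) auto
qed

lemma restr_mod_form:
  assumes f: "f \<in> mod_forms \<Gamma> k" shows "restr (Om \<Gamma>) f \<in> mod_forms_i \<Gamma> (int k)"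
proof -
  have hol: "f holomorphic_on uhp" using f by (simp add: mod_forms_iff)
  then have "f meromorphic_on uhp" by (intro analytic_on_imp_meromorphic_on) (simp add: analytic_on_open open_uhp)
  then have "restr (Om \<Gamma>) f \<in> mero_i \<Gamma>" by (rule mero_iI) (rule holomorphic_on_subset[OF hol Om_subset])
  moreover have "restr (Om \<Gamma>) f (moeb A z) = autj A z powi int k * restr (Om \<Gamma>) f z" if "A \<in> G" "z \<in> Om \<Gamma>" for A z
    using moeb_Om[OF that] that f Om_pos[OF that(2)] by (simp add: restr_def mod_forms_iff)
  ultimately show ?thesis by (simp add: mod_forms_i_def flip: G_def)
qed

lemma transform_deriv:
  assumes f: "f holomorphic_on Om \<Gamma>" and z: "z \<in> Om \<Gamma>" and A: "A \<in> G"
    and fg: "\<And>w. w \<in> Om \<Gamma> \<Longrightarrow> f (moeb A w) = g w" and g: "(g has_field_derivative g') (at z)"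
  shows "deriv f (moeb A z) = (autj A z)\<^sup>2 * g'"
proof -
  have "(f has_field_derivative deriv f (moeb A z)) (at (moeb A z))"
    by (rule holomorphic_derivI[OF f open_Om moeb_Om[OF A z]])
  then have "((\<lambda>w. f (moeb A w)) has_field_derivative deriv f (moeb A z) * (1 / (autj A z)\<^sup>2)) (at z)"
    by (rule DERIV_chain2[OF _ moeb_has_deriv[OF G_det[OF A] Om_pos[OF z]]])
  moreover have "((\<lambda>w. f (moeb A w)) has_field_derivative g') (at z)"
    by (rule has_field_derivative_transform_within_open[OF g open_Om z]) (simp add: fg)
  ultimately have "deriv f (moeb A z) * (1 / (autj A z)\<^sup>2) = g'" by (rule DERIV_unique)
  then show ?thesis using G_autj[OF A Om_pos[OF z]] by (simp add: field_simps)
qed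

lemma odd_weight_zero:
  assumes g: "g \<in> mod_forms_i \<Gamma> (int k)" and k: "odd k" shows "g = 0"
proof
  fix z
  show "g z = 0 z"
  proof (cases "z \<in> Om \<Gamma>")
    case True
    have "g z = - g z" using mod_forms_i_trans[OF g G_neg1 True] k by (simp add: autj_neg1 moeb_neg1)
    then show ?thesis by simp
  qed (use g in \<open>simp add: mod_forms_i_iff\<close>)
qed

lemma Dphi_mod_form:
  assumes \<phi>: "\<phi> \<in> quasi_forms2_i_delta1 \<Gamma>" and f: "f \<in> mod_forms_i \<Gamma> k"
  shows "Dphi \<Gamma> \<phi> k f \<in> mod_forms_i \<Gamma> (k + 2)"
proof -
  have p: "\<phi> meromorphic_on uhp" "\<phi> holomorphic_on Om \<Gamma>"
    "\<And>A z. A \<in> G \<Longrightarrow> z \<in> Om \<Gamma> \<Longrightarrow> \<phi> (moeb A z) = autj A z ^ 2 * \<phi> z + of_real (A$2$1) * autj A z"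
    using \<phi> by (auto simp: quasi_forms2_i_delta1_def mero_i_def G_def)
  have h: "f meromorphic_on uhp" "f holomorphic_on Om \<Gamma>" "\<And>A z. A \<in> G \<Longrightarrow> z \<in> Om \<Gamma> \<Longrightarrow> f (moeb A z) = autj A z powi k * f z"
    using f by (auto simp: mod_forms_i_iff)
  have "Dphi \<Gamma> \<phi> k f \<in> mero_i \<Gamma>" unfolding Dphi_def
  proof (rule mero_iI)
    show "(\<lambda>z. deriv f z - of_int k * \<phi> z * f z) meromorphic_on uhp" by (intro meromorphic_intros p h)
    show "(\<lambda>z. deriv f z - of_int k * \<phi> z * f z) holomorphic_on Om \<Gamma>"
      by (intro holomorphic_intros holomorphic_deriv[OF h(2) open_Om] p h)
  qed
  moreover have "Dphi \<Gamma> \<phi> k f (moeb A z) = autj A z powi (k + 2) * Dphi \<Gamma> \<phi> k f z" if A: "A \<in> G" and z: "z \<in> Om \<Gamma>" for A z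
  proof -
    let ?j = "autj A z"
    have j: "?j \<noteq> 0" by (rule G_autj[OF A Om_pos[OF z]])
    have fd: "(f has_field_derivative deriv f z) (at z)" by (rule holomorphic_derivI[OF h(2) open_Om z])
    have "deriv f (moeb A z) = ?j\<^sup>2 * (?j powi k * deriv f z + of_int k * ?j powi (k - 1) * of_real (A$2$1) * f z)"
      by (rule transform_deriv[OF h(2) z A h(3)[OF A]])
        (assumption, rule DERIV_mult'[OF DERIV_power_int[OF autj_has_deriv] fd], use j in simp)
    moreover have "?j powi (k - 1) = ?j powi k / ?j" "?j powi (k + 2) = ?j powi k * ?j\<^sup>2"
      using j by (simp_all add: power_int_diff power_int_add)
    moreover have "x\<^sup>2 * (J * d + a * (J / x) * c * y) - a * (x\<^sup>2 * p + c * x) * (J * y) = J * x\<^sup>2 * (d - a * p * y)"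
      if "x \<noteq> 0" for x J d a c y p :: complex
      using that by (simp add: power2_eq_square field_simps)
    ultimately show ?thesis using moeb_Om[OF A z] z j by (simp add: Dphi_def restr_def h(3)[OF A z] p(3)[OF A z])
  qed
  ultimately show ?thesis by (simp add: mod_forms_i_def flip: G_def)
qed

lemma omega_mod_form:
  assumes \<phi>: "\<phi> \<in> quasi_forms2_i_delta1 \<Gamma>" shows "omega \<Gamma> \<phi> \<in> mod_forms_i \<Gamma> 4"
proof -
  have p: "\<phi> meromorphic_on uhp" "\<phi> holomorphic_on Om \<Gamma>"
    "\<And>A z. A \<in> G \<Longrightarrow> z \<in> Om \<Gamma> \<Longrightarrow> \<phi> (moeb A z) = autj A z ^ 2 * \<phi> z + of_real (A$2$1) * autj A z"
    using \<phi> by (auto simp: quasi_forms2_i_delta1_def mero_i_def G_def)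
  have "omega \<Gamma> \<phi> \<in> mero_i \<Gamma>" unfolding omega_def
  proof (rule mero_iI)
    show "(\<lambda>z. deriv \<phi> z - (\<phi> z)\<^sup>2) meromorphic_on uhp" by (intro meromorphic_intros p)
    show "(\<lambda>z. deriv \<phi> z - (\<phi> z)\<^sup>2) holomorphic_on Om \<Gamma>"
      by (intro holomorphic_intros holomorphic_deriv[OF p(2) open_Om] p)
  qed
  moreover have "omega \<Gamma> \<phi> (moeb A z) = autj A z powi 4 * omega \<Gamma> \<phi> z" if A: "A \<in> G" and z: "z \<in> Om \<Gamma>" for A z
  proof -
    let ?j = "autj A z" and ?c = "of_real (A$2$1) :: complex"
    have fd: "(\<phi> has_field_derivative deriv \<phi> z) (at z)" by (rule holomorphic_derivI[OF p(2) open_Om z])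
    have "((\<lambda>z. autj A z ^ 2 * \<phi> z + ?c * autj A z) has_field_derivative
        (?j ^ 2 * deriv \<phi> z + of_nat 2 * (?c * ?j ^ (2 - Suc 0)) * \<phi> z) + ?c * ?c) (at z)"
      by (rule DERIV_add[OF DERIV_mult'[OF DERIV_power[OF autj_has_deriv] fd] DERIV_cmult[OF autj_has_deriv]])
    from transform_deriv[OF p(2) z A p(3)[OF A] this]
    have "deriv \<phi> (moeb A z) = ?j\<^sup>2 * (?j\<^sup>2 * deriv \<phi> z + 2 * (?c * ?j) * \<phi> z + ?c * ?c)" by simp
    moreover have "x\<^sup>2 * (x\<^sup>2 * d + 2 * (c * x) * y + c * c) - (x\<^sup>2 * y + c * x)\<^sup>2 = x ^ 4 * (d - y\<^sup>2)" for x d c y :: complex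
      by (simp add: power2_eq_square power4_eq_xxxx algebra_simps)
    ultimately show ?thesis using moeb_Om[OF A z] z by (simp add: omega_def restr_def p(3)[OF A z])
  qed
  ultimately show ?thesis by (simp add: mod_forms_i_def flip: G_def)
qed

section \<open>Bounded poles\<close>

definition rad :: real where
  "rad = (SOME e. e > 0 \<and> ball \<i> e - {\<i>} \<subseteq> Om \<Gamma> \<and> ball \<i> e \<subseteq> uhp)"

lemma rad: "rad > 0" "ball \<i> rad - {\<i>} \<subseteq> Om \<Gamma>" "ball \<i> rad \<subseteq> uhp"
proof -
  have i: "Im \<i> > 0" by simp
  obtain e where "e > 0" "ball \<i> e - {\<i>} \<subseteq> Om \<Gamma>" "ball \<i> e \<subseteq> uhp" by (rule punctured_nbhd[OF i])
  then have "\<exists>e. e > 0 \<and> ball \<i> e - {\<i>} \<subseteq> Om \<Gamma> \<and> ball \<i> e \<subseteq> uhp" by blast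
  from someI_ex[OF this] show "rad > 0" "ball \<i> rad - {\<i>} \<subseteq> Om \<Gamma>" "ball \<i> rad \<subseteq> uhp"
    unfolding rad_def[symmetric] by simp_all
qed

definition pole_le :: "nat \<Rightarrow> (complex \<Rightarrow> complex) \<Rightarrow> bool" where
  "pole_le n g \<longleftrightarrow> (\<exists>h. h holomorphic_on ball \<i> rad \<and> (\<forall>z\<in>ball \<i> rad - {\<i>}. (z - \<i>) ^ n * g z = h z))"

lemma pole_le_limit:
  assumes g: "g holomorphic_on Om \<Gamma>" and l: "((\<lambda>z. (z - \<i>) ^ n * g z) \<longlongrightarrow> l) (at \<i>)"
  shows "pole_le n g"
proof -
  define h where "h z = (if z = \<i> then l else (z - \<i>) ^ n * g z)" for z
  have "h holomorphic_on ball \<i> rad"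
  proof (rule no_isolated_singularity'[of "{\<i>}"])
    fix z assume "z \<in> {\<i>}"
    then have z: "z = \<i>" by simp
    have "(h \<longlongrightarrow> l) (at \<i>)"
      by (rule Lim_transform_eventually[OF l]) (auto simp: h_def eventually_at_filter)
    then show "(h \<longlongrightarrow> h z) (at z within ball \<i> rad)" unfolding z h_def[of \<i>] by (simp add: Lim_at_imp_Lim_at_within)
  next
    have "(\<lambda>z. (z - \<i>) ^ n * g z) holomorphic_on ball \<i> rad - {\<i>}"
      by (intro holomorphic_intros holomorphic_on_subset[OF g rad(2)])
    then show "h holomorphic_on ball \<i> rad - {\<i>}" by (rule holomorphic_transform) (simp add: h_def)
  qed auto
  then show ?thesis unfolding pole_le_def by (intro exI[of _ h]) (simp add: h_def)
qed

lemma pole_le_exists: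
  assumes g: "g \<in> mod_forms_i \<Gamma> k" shows "\<exists>n. pole_le n g"
proof -
  have hol: "g holomorphic_on Om \<Gamma>" and mer: "g meromorphic_on uhp" using g by (auto simp: mod_forms_i_iff)
  have "g meromorphic_on {\<i>}" by (rule meromorphic_on_subset[OF mer]) simp
  then have "not_essential g \<i>" by (rule meromorphic_on_not_essential)
  then consider l where "(g \<longlongrightarrow> l) (at \<i>)" | "is_pole g \<i>" by (auto simp: not_essential_def)
  then show ?thesis
  proof cases
    case 1
    then show ?thesis by (intro exI[of _ 0] pole_le_limit[OF hol]) simp
  next
    case 2
    let ?h = "zor_poly g \<i>" and ?n = "nat (- zorder g \<i>)"
    have gh: "g holomorphic_on ball \<i> rad - {\<i>}" by (rule holomorphic_on_subset[OF hol rad(2)])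
    have ib: "\<i> \<in> ball \<i> rad" using rad(1) by simp
    obtain r where r: "r > 0" "?h holomorphic_on cball \<i> r" "\<forall>w\<in>cball \<i> r - {\<i>}. g w = ?h w / (w - \<i>) ^ ?n \<and> ?h w \<noteq> 0"
      using zorder_exist_pole[OF gh open_ball ib 2] by auto
    have "continuous_on (ball \<i> r) ?h"
      by (rule holomorphic_on_imp_continuous_on[OF holomorphic_on_subset[OF r(2) ball_subset_cball]])
    then have "isCont ?h \<i>" using r(1) by (simp add: continuous_on_eq_continuous_at)
    then have lim: "(?h \<longlongrightarrow> ?h \<i>) (at \<i>)" by (simp add: isCont_def)
    have "\<forall>\<^sub>F w in at \<i>. w \<in> ball \<i> r - {\<i>}" by (rule eventually_at_in_open) (use r in auto)
    then have "\<forall>\<^sub>F w in at \<i>. ?h w = (w - \<i>) ^ ?n * g w" by (rule eventually_mono) (use r(3) in auto)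
    then have "((\<lambda>w. (w - \<i>) ^ ?n * g w) \<longlongrightarrow> ?h \<i>) (at \<i>)" by (rule Lim_transform_eventually[OF lim])
    then show ?thesis by (intro exI pole_le_limit[OF hol])
  qed
qed

lemma pole_le_mult:
  assumes "pole_le n f" "pole_le m g" shows "pole_le (n + m) (f * g)"
proof -
  obtain h where h: "h holomorphic_on ball \<i> rad" "\<forall>z\<in>ball \<i> rad - {\<i>}. (z - \<i>) ^ n * f z = h z"
    using assms(1) by (auto simp: pole_le_def)
  obtain k where k: "k holomorphic_on ball \<i> rad" "\<forall>z\<in>ball \<i> rad - {\<i>}. (z - \<i>) ^ m * g z = k z"
    using assms(2) by (auto simp: pole_le_def)
  have "(z - \<i>) ^ (n + m) * (f * g) z = h z * k z" if "z \<in> ball \<i> rad - {\<i>}" for z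
  proof -
    have "(z - \<i>) ^ (n + m) * (f * g) z = ((z - \<i>) ^ n * f z) * ((z - \<i>) ^ m * g z)"
      by (simp add: power_add)
    then show ?thesis using h(2) k(2) that by (simp only:)
  qed
  moreover have "(\<lambda>z. h z * k z) holomorphic_on ball \<i> rad" by (intro holomorphic_intros h k)
  ultimately show ?thesis unfolding pole_le_def by (intro exI[of _ "\<lambda>z. h z * k z"]) blast
qed

lemma pole_le_mono:
  assumes "pole_le n g" "n \<le> m" shows "pole_le m g"
proof -
  obtain h where h: "h holomorphic_on ball \<i> rad" "\<forall>z\<in>ball \<i> rad - {\<i>}. (z - \<i>) ^ n * g z = h z"
    using assms(1) by (auto simp: pole_le_def)
  have "(z - \<i>) ^ m * g z = (z - \<i>) ^ (m - n) * h z" if "z \<in> ball \<i> rad - {\<i>}" for z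
  proof -
    have "(z - \<i>) ^ m = (z - \<i>) ^ (m - n) * (z - \<i>) ^ n" using assms(2) by (simp flip: power_add)
    then show ?thesis using h(2) that by (simp only: mult.assoc)
  qed
  moreover have "(\<lambda>z. (z - \<i>) ^ (m - n) * h z) holomorphic_on ball \<i> rad" by (intro holomorphic_intros h)
  ultimately show ?thesis unfolding pole_le_def by (intro exI[of _ "\<lambda>z. (z - \<i>) ^ (m - n) * h z"]) blast
qed

text \<open>A form that tends to 0 at \<open>\<i>\<close> tends to 0 on the whole orbit, so its singularities are removable and
  the values 0 given to it there are the right ones.\<close>

lemma mod_form_i_extends:
  assumes g: "g \<in> mod_forms_i \<Gamma> (int k)" and lim: "(g \<longlongrightarrow> 0) (at \<i>)"
  shows "g \<in> mod_forms \<Gamma> k"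
proof -
  have hol: "g holomorphic_on Om \<Gamma>" and out: "\<And>z. z \<notin> Om \<Gamma> \<Longrightarrow> g z = 0" using g by (auto simp: mod_forms_i_iff)
  have lim0: "(g \<longlongrightarrow> 0) (at w0)" if w0: "Im w0 > 0" "w0 \<notin> Om \<Gamma>" for w0
  proof -
    have "w0 \<in> orbit_of \<Gamma> \<i>" using w0 by (simp add: Om_def)
    then obtain A where A: "A \<in> G" "w0 = moeb A \<i>" by (auto simp: orbit_of_eq)
    obtain B where B: "B \<in> G" "A ** B = mat 1" "B ** A = mat 1" using A(1) by (rule G_inv)
    have "moeb (B ** A) \<i> = moeb B (moeb A \<i>)"
      by (rule moeb_mult) (use A B G_det moeb_uhp in auto)
    then have Bw: "moeb B w0 = \<i>" by (simp add: A(2) B(3))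
    have "isCont (moeb B) w0" by (rule DERIV_isCont[OF moeb_has_deriv[OF G_det[OF B(1)] w0(1)]])
    then have tB: "(moeb B \<longlongrightarrow> \<i>) (at w0)" by (simp add: isCont_def Bw)
    obtain e where e: "e > 0" "ball w0 e - {w0} \<subseteq> Om \<Gamma>" by (rule punctured_nbhd[OF w0(1)])
    have "\<forall>\<^sub>F w in at w0. w \<in> ball w0 e - {w0}" by (rule eventually_at_in_open) (use e in auto)
    then have ev: "\<forall>\<^sub>F w in at w0. w \<in> Om \<Gamma>" by (rule eventually_mono) (use e in auto)
    have "\<forall>\<^sub>F w in at w0. moeb B w \<noteq> \<i>"
      using ev by (rule eventually_mono) (use moeb_Om[OF B(1)] i_notin_Om in metis)
    then have fB: "filterlim (moeb B) (at \<i>) (at w0)" using tB by (simp add: filterlim_at)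
    have "((\<lambda>w. g (moeb B w)) \<longlongrightarrow> 0) (at w0)" by (rule filterlim_compose[OF lim fB])
    moreover have "((\<lambda>w. autj A (moeb B w) ^ k) \<longlongrightarrow> autj A \<i> ^ k) (at w0)"
      unfolding autj_def by (intro tendsto_intros tB)
    ultimately have "((\<lambda>w. autj A (moeb B w) ^ k * g (moeb B w)) \<longlongrightarrow> autj A \<i> ^ k * 0) (at w0)" by (intro tendsto_mult)
    then have l: "((\<lambda>w. autj A (moeb B w) ^ k * g (moeb B w)) \<longlongrightarrow> 0) (at w0)" by simp
    have "\<forall>\<^sub>F w in at w0. autj A (moeb B w) ^ k * g (moeb B w) = g w"
      using ev
    proof (rule eventually_mono)
      fix w assume w: "w \<in> Om \<Gamma>"
      have "moeb (A ** B) w = moeb A (moeb B w)"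
        by (rule moeb_mult) (use A B G_det moeb_uhp Om_pos[OF w] in auto)
      then show "autj A (moeb B w) ^ k * g (moeb B w) = g w"
        using mod_forms_i_trans[OF g A(1) moeb_Om[OF B(1) w]] by (simp add: B(2))
    qed
    then show ?thesis by (rule Lim_transform_eventually[OF l])
  qed
  have diff: "g field_differentiable (at w)" if w: "Im w > 0" for w
  proof (cases "w \<in> Om \<Gamma>")
    case True
    then show ?thesis by (rule holomorphic_on_imp_differentiable_at[OF hol open_Om])
  next
    case False
    obtain e where e: "e > 0" "ball w e - {w} \<subseteq> Om \<Gamma>" by (rule punctured_nbhd[OF w])
    have "g holomorphic_on ball w e"
    proof (rule no_isolated_singularity'[of "{w}"])
      show "(g \<longlongrightarrow> g z) (at z within ball w e)" if "z \<in> {w}" for z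
        using that lim0[OF w False] out[OF False] by (auto intro: Lim_at_imp_Lim_at_within)
    qed (use holomorphic_on_subset[OF hol e(2)] in auto)
    then show ?thesis by (rule holomorphic_on_imp_differentiable_at) (use e in auto)
  qed
  show ?thesis unfolding mod_forms_iff
  proof (intro conjI allI impI ballI)
    show "g z = 0" if "\<not> Im z > 0" for z using that out[of z] Om_pos[of z] by auto
    show "g holomorphic_on uhp"
      unfolding holomorphic_on_def using diff by (auto intro: field_differentiable_at_within)
    fix A z assume A: "A \<in> G" and z: "Im z > 0"
    show "g (moeb A z) = autj A z ^ k * g z"
    proof (cases "z \<in> Om \<Gamma>")
      case False
      have "moeb A z \<notin> Om \<Gamma>"
      proof
        assume Az: "moeb A z \<in> Om \<Gamma>"
        obtain B where B: "B \<in> G" "A ** B = mat 1" "B ** A = mat 1" using A by (rule G_inv)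
        have "moeb (B ** A) z = moeb B (moeb A z)"
          by (rule moeb_mult) (use A B G_det moeb_uhp z in auto)
        then show False using moeb_Om[OF B(1) Az] False by (simp add: B(3))
      qed
      then show ?thesis using out False by simp
    qed (use mod_forms_i_trans[OF g A] in simp)
  qed
qed

text \<open>Raising the vanishing order at \<open>\<i>\<close> by one costs one linear condition, and forms that vanish
  to an order larger than a multiple of the weight are zero.\<close>

lemma mod_forms_i_dim:
  obtains C :: nat where
    "\<forall>k n. \<exists>B. finite B \<and> card B \<le> n + C * k + 1 \<and> {g \<in> mod_forms_i \<Gamma> (int k). pole_le n g} \<subseteq> fvs.span B"
proof -
  obtain C :: nat where C: "\<forall>F k n h. F \<in> mod_forms \<Gamma> k \<longrightarrow> h holomorphic_on uhp \<longrightarrow>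
      (\<forall>z. Im z > 0 \<longrightarrow> F z = (z - \<i>) ^ n * h z) \<longrightarrow> n > C * k \<longrightarrow> F = 0"
    by (rule vanishing_order_bound)
  have "\<exists>B. finite B \<and> card B \<le> n + C * k + 1 \<and> {g \<in> mod_forms_i \<Gamma> (int k). pole_le n g} \<subseteq> fvs.span B" for k n
  proof -
    define U where "U m = {g \<in> mod_forms_i \<Gamma> (int k). \<exists>h. h holomorphic_on ball \<i> rad \<and>
        (\<forall>z\<in>ball \<i> rad - {\<i>}. (z - \<i>) ^ n * g z = (z - \<i>) ^ m * h z)}" for m
    define r where "r = C * k + 1"
    have top: "g = 0" if gU: "g \<in> U (n + r)" for g
    proof -
      obtain h where g: "g \<in> mod_forms_i \<Gamma> (int k)" and h: "h holomorphic_on ball \<i> rad"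
        and gh: "\<forall>z\<in>ball \<i> rad - {\<i>}. (z - \<i>) ^ n * g z = (z - \<i>) ^ (n + r) * h z"
        using gU by (auto simp: U_def)
      have gr: "g z = (z - \<i>) ^ r * h z" if "z \<in> ball \<i> rad - {\<i>}" for z
      proof -
        have "(z - \<i>) ^ n * g z = (z - \<i>) ^ n * ((z - \<i>) ^ r * h z)"
          using gh that by (simp only: power_add mult.assoc)
        then show ?thesis using that by simp
      qed
      have ib: "\<i> \<in> ball \<i> rad" using rad(1) by simp
      have "isCont h \<i>" using holomorphic_on_imp_continuous_on[OF h] ib by (simp only: continuous_on_eq_continuous_at open_ball)
      then have "((\<lambda>z. (z - \<i>) ^ r * h z) \<longlongrightarrow> (\<i> - \<i>) ^ r * h \<i>) (at \<i>)" unfolding isCont_def by (intro tendsto_intros)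
      then have l: "((\<lambda>z. (z - \<i>) ^ r * h z) \<longlongrightarrow> 0) (at \<i>)" by (simp add: r_def)
      have "\<forall>\<^sub>F z in at \<i>. z \<in> ball \<i> rad - {\<i>}" by (rule eventually_at_in_open) (use ib in auto)
      then have "\<forall>\<^sub>F z in at \<i>. (z - \<i>) ^ r * h z = g z" by (rule eventually_mono) (simp add: gr)
      then have "(g \<longlongrightarrow> 0) (at \<i>)" by (rule Lim_transform_eventually[OF l])
      then have gM: "g \<in> mod_forms \<Gamma> k" by (rule mod_form_i_extends[OF g])
      define H where "H z = (if z \<in> ball \<i> rad then h z else g z / (z - \<i>) ^ r)" for z
      have "H holomorphic_on ball \<i> rad" by (rule holomorphic_transform[OF h]) (simp add: H_def)
      moreover have "(\<lambda>z. g z / (z - \<i>) ^ r) holomorphic_on uhp - {\<i>}"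
        using gM by (intro holomorphic_intros) (auto simp: mod_forms_iff intro: holomorphic_on_subset)
      then have "H holomorphic_on uhp - {\<i>}" by (rule holomorphic_transform) (use gr in \<open>auto simp: H_def\<close>)
      moreover have "open (uhp - {\<i>})" by (intro open_Diff open_uhp) simp
      ultimately have "H holomorphic_on ball \<i> rad \<union> (uhp - {\<i>})" by (intro holomorphic_on_Un) auto
      then have Hh: "H holomorphic_on uhp" by (rule holomorphic_on_subset) (use ib in auto)
      have HF: "\<forall>z. Im z > 0 \<longrightarrow> g z = (z - \<i>) ^ r * H z"
      proof (intro allI impI)
        fix z
        have "g \<i> = 0" using g i_notin_Om by (simp add: mod_forms_i_iff)
        then show "g z = (z - \<i>) ^ r * H z" using gr[of z] by (cases "z = \<i>") (auto simp: H_def r_def)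
      qed
      have "r > C * k" by (simp add: r_def)
      then show ?thesis using C[rule_format, OF gM Hh] HF by blast
    qed
    have step: "\<exists>B. finite B \<and> card B \<le> e \<and> U (n + r - e) \<subseteq> fvs.span B" if "e \<le> n + r" for e
      using that
    proof (induction e)
      case 0
      then show ?case by (intro exI[of _ "{}"]) (use top in \<open>auto simp: fvs.span_zero\<close>)
    next
      case (Suc e)
      then obtain B where B: "finite B" "card B \<le> e" "U (n + r - e) \<subseteq> fvs.span B" by auto
      define m where "m = n + r - Suc e"
      have m: "n + r - e = Suc m" using Suc.prems by (simp add: m_def)
      have drop: "g \<in> U (Suc m)" if g: "g \<in> mod_forms_i \<Gamma> (int k)" and h: "h holomorphic_on ball \<i> rad"
        "\<forall>z\<in>ball \<i> rad - {\<i>}. (z - \<i>) ^ n * g z = (z - \<i>) ^ m * h z" "h \<i> = 0" for g h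
      proof -
        have "(\<lambda>z. if z = \<i> then deriv h \<i> else h z / (z - \<i>) - h \<i> / (z - \<i>)) holomorphic_on ball \<i> rad"
          by (rule pole_theorem_open[OF h(1) open_ball]) simp
        then show ?thesis unfolding U_def using g h
          by (intro CollectI conjI exI[of _ "\<lambda>z. if z = \<i> then deriv h \<i> else h z / (z - \<i>) - h \<i> / (z - \<i>)"]) auto
      qed
      show ?case
      proof (cases "U m \<subseteq> U (Suc m)")
        case True
        then show ?thesis using B unfolding m m_def[symmetric] by (intro exI[of _ B]) auto
      next
        case False
        then obtain v where v: "v \<in> U m" "v \<notin> U (Suc m)" by blast
        obtain hv where vM: "v \<in> mod_forms_i \<Gamma> (int k)" and hv: "hv holomorphic_on ball \<i> rad"
          "\<forall>z\<in>ball \<i> rad - {\<i>}. (z - \<i>) ^ n * v z = (z - \<i>) ^ m * hv z" using v(1) by (auto simp: U_def)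
        have hv0: "hv \<i> \<noteq> 0" using drop[OF vM hv] v(2) by blast
        have "U m \<subseteq> fvs.span (insert v B)"
        proof
          fix g assume "g \<in> U m"
          then obtain h where gM: "g \<in> mod_forms_i \<Gamma> (int k)" and h: "h holomorphic_on ball \<i> rad"
            "\<forall>z\<in>ball \<i> rad - {\<i>}. (z - \<i>) ^ n * g z = (z - \<i>) ^ m * h z" by (auto simp: U_def)
          define c where "c = h \<i> / hv \<i>"
          have "(\<lambda>z. g z - c * v z) \<in> mod_forms_i \<Gamma> (int k)"
            using gM vM unfolding mod_forms_i_iff
            by (auto intro!: meromorphic_intros holomorphic_intros simp: algebra_simps)
          moreover have "(\<lambda>z. h z - c * hv z) holomorphic_on ball \<i> rad" by (intro holomorphic_intros h hv)
          moreover have "\<forall>z\<in>ball \<i> rad - {\<i>}. (z - \<i>) ^ n * (g z - c * v z) = (z - \<i>) ^ m * (h z - c * hv z)"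
          proof
            fix z assume z: "z \<in> ball \<i> rad - {\<i>}"
            have "(z - \<i>) ^ n * (g z - c * v z) = (z - \<i>) ^ n * g z - c * ((z - \<i>) ^ n * v z)" by (simp add: algebra_simps)
            also have "\<dots> = (z - \<i>) ^ m * h z - c * ((z - \<i>) ^ m * hv z)" using h(2) hv(2) z by (simp only:)
            finally show "(z - \<i>) ^ n * (g z - c * v z) = (z - \<i>) ^ m * (h z - c * hv z)" by (simp add: algebra_simps)
          qed
          moreover have "h \<i> - c * hv \<i> = 0" using hv0 by (simp add: c_def)
          ultimately have "(\<lambda>z. g z - c * v z) \<in> U (Suc m)" by (rule drop)
          then have "(\<lambda>z. g z - c * v z) \<in> fvs.span (insert v B)"
            using B(3) fvs.span_mono[of B "insert v B"] unfolding m by blast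
          moreover have "fscale c v \<in> fvs.span (insert v B)" by (intro fvs.span_scale fvs.span_base) simp
          ultimately have "(\<lambda>z. g z - c * v z) + fscale c v \<in> fvs.span (insert v B)" by (rule fvs.span_add)
          moreover have "(\<lambda>z. g z - c * v z) + fscale c v = g" by (simp add: fscale_def fun_eq_iff)
          ultimately show "g \<in> fvs.span (insert v B)" by simp
        qed
        moreover have "card (insert v B) \<le> Suc e" using B by (simp add: card_insert_if)
        ultimately show ?thesis using B(1) unfolding m_def[symmetric] by (intro exI[of _ "insert v B"]) auto
      qed
    qed
    obtain B where B: "finite B" "card B \<le> n + r" "U (n + r - (n + r)) \<subseteq> fvs.span B" using step[of "n + r"] by auto
    have "{g \<in> mod_forms_i \<Gamma> (int k). pole_le n g} \<subseteq> U (n + r - (n + r))" by (auto simp: U_def pole_le_def)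
    then show ?thesis using B by (intro exI[of _ B]) (auto simp: r_def)
  qed
  then show thesis by (intro that) blast
qed

end

section \<open>The graded ring generated by \<open>\<phi>\<close>\<close>

lemma fin_dim_span:
  assumes "X \<subseteq> fvs.span B" "finite B" shows "fin_dim (fvs.span X)"
proof -
  obtain b where b: "b \<subseteq> X" "fvs.independent b" "X \<subseteq> fvs.span b" by (rule fvs.maximal_independent_subset)
  have "b \<subseteq> fvs.span B" using b(1) assms(1) by (rule order_trans)
  then have "finite b" using fvs.independent_span_bound[OF assms(2) b(2)] by simp
  moreover have "fvs.span b = fvs.span X"
    by (rule antisym[OF fvs.span_mono[OF b(1)] fvs.span_minimal[OF b(3) fvs.subspace_span]])
  ultimately show ?thesis unfolding fin_dim_def by (intro exI[of _ b] conjI)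
qed

lemma restr_span:
  assumes Y: "\<And>y. y \<in> Y \<Longrightarrow> restr D y \<in> W" and W: "fvs.subspace W" and F: "F \<in> fvs.span Y"
  shows "restr D F \<in> W"
  using F
proof (induction rule: fvs.span_induct_alt)
  case base
  have "restr D 0 = 0" by (simp add: restr_def fun_eq_iff)
  then show ?case using fvs.subspace_0[OF W] by (simp only:)
next
  case (step c x y)
  have "restr D (fscale c x + y) = fscale c (restr D x) + restr D y" by (simp add: restr_def fscale_def fun_eq_iff)
  moreover have "fscale c (restr D x) + restr D y \<in> W"
    by (rule fvs.subspace_add[OF W fvs.subspace_scale[OF W Y[OF step(1)]] step(2)])
  ultimately show ?case by (simp only:)
qed

lemma restr_times: "restr D (a * b) = restr D a * restr D b"
  by (simp add: restr_def fun_eq_iff)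

context cocompact_group
begin

lemma span_weight:
  assumes Y: "\<forall>k. \<forall>b\<in>Y k. (\<forall>z. z \<notin> D \<longrightarrow> b z = 0) \<and> (\<forall>A\<in>G. \<forall>z\<in>D. b (moeb A z) = autj A z ^ k * b z)"
    and D: "D \<subseteq> uhp" and F: "\<forall>z. z \<notin> D \<longrightarrow> F z = 0" "\<forall>A\<in>G. \<forall>z\<in>D. F (moeb A z) = autj A z ^ w * F z"
    and FY: "F \<in> fvs.span (\<Union>k. Y k)"
  shows "F \<in> fvs.span (Y w)"
proof -
  obtain t r where t: "finite t" "t \<subseteq> (\<Union>k. Y k)" "F = (\<Sum>b\<in>t. fscale (r b) b)"
    using FY by (auto simp: fvs.span_explicit)
  have "\<forall>b\<in>t. \<exists>k. b \<in> Y k" using t(2) by blast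
  from bchoice[OF this] obtain k where k: "\<forall>b\<in>t. b \<in> Y (k b)" by auto
  have "F z = (\<Sum>b\<in>{b \<in> t. k b = w}. fscale (r b) b) z" for z
  proof (cases "z \<in> D")
    case True
    then have z: "Im z > 0" using D uhp_iff by blast
    have "[:F z:] = (\<Sum>b\<in>{b \<in> t. k b = w}. smult (r b) [:b z:])"
    proof (rule weight_component[OF t(1) z])
      show "F (moeb A z) = autj A z ^ w * poly [:F z:] (uj A z)" if "A \<in> G" for A
        using F(2) that True by simp
      show "b (moeb A z) = autj A z ^ k b * poly [:b z:] (uj A z)" if "b \<in> t" "A \<in> G" for b A
      proof -
        have "b \<in> Y (k b)" using k that(1) by (rule bspec)
        then show ?thesis using Y that(2) True by simp
      qed
      show "F (moeb A z) = (\<Sum>b\<in>t. r b * b (moeb A z))" for A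
        unfolding t(3) by (simp add: sum_fun_apply fscale_def)
    qed
    then have "coeff [:F z:] 0 = coeff (\<Sum>b\<in>{b \<in> t. k b = w}. smult (r b) [:b z:]) 0" by (rule arg_cong)
    then show ?thesis by (simp add: coeff_sum sum_fun_apply fscale_def)
  next
    case False
    have "b z = 0" if "b \<in> t" for b
    proof -
      have "b \<in> Y (k b)" using k that by (rule bspec)
      then show ?thesis using Y False by blast
    qed
    then show ?thesis using F(1) False by (auto simp: sum_fun_apply fscale_def intro!: sum.neutral)
  qed
  then have "F = (\<Sum>b\<in>{b \<in> t. k b = w}. fscale (r b) b)" by (rule ext)
  moreover have "(\<Sum>b\<in>{b \<in> t. k b = w}. fscale (r b) b) \<in> fvs.span (Y w)"
    by (intro fvs.span_sum fvs.span_scale fvs.span_base) (use k in auto)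
  ultimately show ?thesis by (simp only:)
qed

lemma deriv_restr:
  assumes z: "z \<in> Om \<Gamma>" shows "deriv (restr (Om \<Gamma>) g) z = deriv g z"
proof (rule deriv_cong_ev)
  have "\<forall>\<^sub>F w in nhds z. w \<in> Om \<Gamma>" by (rule eventually_nhds_in_open[OF open_Om z])
  then show "\<forall>\<^sub>F w in nhds z. restr (Om \<Gamma>) g w = g w" by (rule eventually_mono) (simp add: restr_def)
qed simp

lemma restr_inj:
  assumes x: "x holomorphic_on uhp" "\<And>z. \<not> Im z > 0 \<Longrightarrow> x z = 0" and 0: "restr (Om \<Gamma>) x = 0"
  shows "x = 0"
proof -
  have on: "x z = 0" if "z \<in> Om \<Gamma>" for z using fun_cong[OF 0, of z] that by (simp add: restr_def)
  have "x z = 0" for z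
  proof (cases "Im z > 0")
    case True
    then obtain e where e: "e > 0" "ball z e - {z} \<subseteq> Om \<Gamma>" by (rule punctured_nbhd)
    have "isCont x z" using holomorphic_on_imp_continuous_on[OF x(1)] True open_uhp by (simp add: continuous_on_eq_continuous_at)
    then have l: "(x \<longlongrightarrow> x z) (at z)" by (simp add: isCont_def)
    have "\<forall>\<^sub>F w in at z. w \<in> ball z e - {z}" by (rule eventually_at_in_open) (use e in auto)
    then have "\<forall>\<^sub>F w in at z. x w = 0" by (rule eventually_mono) (use on e(2) in auto)
    then have "(x \<longlongrightarrow> 0) (at z)" by (rule tendsto_eventually)
    then show ?thesis using l by (intro tendsto_unique[OF at_neq_bot])
  qed (rule x(2))
  then show ?thesis by (simp add: fun_eq_iff)
qed

end

locale phi_ring = cocompact_group +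
  fixes \<phi> :: "complex \<Rightarrow> complex" and d N :: nat and wt :: "nat \<Rightarrow> nat" and f :: "nat \<Rightarrow> complex \<Rightarrow> complex"
  assumes phi: "\<phi> \<in> quasi_forms2_i_delta1 \<Gamma>"
    and forms: "\<And>m. m \<in> {1..d} \<Longrightarrow> wt m > 0 \<and> f m \<in> mod_forms \<Gamma> (wt m)"
    and basis: "quotient_basis (pos_ideal \<Gamma>) (ideal_prod (fun_ring uhp) (pos_ideal \<Gamma>) (pos_ideal \<Gamma>)) d f"
    and closed: "closed_Dphi \<Gamma> \<phi> (R_ring \<Gamma> \<phi> N d wt f)"
begin

abbreviation Rg :: "(nat \<times> (complex \<Rightarrow> complex)) set" where "Rg \<equiv> R_gens \<Gamma> \<phi> N d wt f"
abbreviation gens :: "(nat \<times> (complex \<Rightarrow> complex)) set" where "gens \<equiv> insert (2, \<phi>) Rg"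
abbreviation Rt :: "nat \<Rightarrow> (complex \<Rightarrow> complex) set" where "Rt \<equiv> Rt_wt \<Gamma> \<phi> N d wt f"

lemma phi_props: "z \<notin> Om \<Gamma> \<Longrightarrow> \<phi> z = 0" "\<phi> holomorphic_on Om \<Gamma>"
  using phi by (auto simp: quasi_forms2_i_delta1_def mero_i_def fun_ring_simps)

lemma iter_mod_form:
  assumes "h \<in> mod_forms_i \<Gamma> (int w)" shows "Dphi_iter \<Gamma> \<phi> w j h \<in> mod_forms_i \<Gamma> (int (w + 2 * j))"
proof (induction j)
  case (Suc j)
  have "int (w + 2 * Suc j) = int (w + 2 * j) + 2" by simp
  then show ?case using Dphi_mod_form[OF phi Suc] by (simp only: Dphi_iter.simps)
qed (use assms in simp)

lemma omega_form: "omega \<Gamma> \<phi> \<in> mod_forms_i \<Gamma> (int 4)"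
  using omega_mod_form[OF phi] by simp

lemma form_i: "m \<in> {1..d} \<Longrightarrow> restr (Om \<Gamma>) (f m) \<in> mod_forms_i \<Gamma> (int (wt m))"
  using forms restr_mod_form by blast

lemma Rg_f: "j \<le> N \<Longrightarrow> m \<in> {1..d} \<Longrightarrow> (wt m + 2 * j, Dphi_iter \<Gamma> \<phi> (wt m) j (restr (Om \<Gamma>) (f m))) \<in> Rg"
  unfolding R_gens_def by (rule UnI1) blast

lemma Rg_omega: "l \<le> N \<Longrightarrow> (4 + 2 * l, Dphi_iter \<Gamma> \<phi> 4 l (omega \<Gamma> \<phi>)) \<in> Rg"
  unfolding R_gens_def by (rule UnI2) blast

lemma Rg_cases:
  assumes "(w, g) \<in> Rg"
  obtains (f) j m where "j \<le> N" "m \<in> {1..d}" "w = wt m + 2 * j" "g = Dphi_iter \<Gamma> \<phi> (wt m) j (restr (Om \<Gamma>) (f m))"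
  | (omega) l where "l \<le> N" "w = 4 + 2 * l" "g = Dphi_iter \<Gamma> \<phi> 4 l (omega \<Gamma> \<phi>)"
proof -
  have "(\<exists>j m. j \<le> N \<and> m \<in> {1..d} \<and> w = wt m + 2 * j \<and> g = Dphi_iter \<Gamma> \<phi> (wt m) j (restr (Om \<Gamma>) (f m))) \<or>
      (\<exists>l. l \<le> N \<and> w = 4 + 2 * l \<and> g = Dphi_iter \<Gamma> \<phi> 4 l (omega \<Gamma> \<phi>))"
    using assms unfolding R_gens_def by blast
  then show thesis using f omega by blast
qed

lemma Rg_mod_form:
  assumes "(w, g) \<in> Rg" shows "w > 0" "g \<in> mod_forms_i \<Gamma> (int w)"
proof -
  have "w > 0 \<and> g \<in> mod_forms_i \<Gamma> (int w)"
    using assms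
  proof (cases rule: Rg_cases)
    case (f j m)
    have "w > 0" using forms[OF f(2)] f(3) by simp
    moreover have "g \<in> mod_forms_i \<Gamma> (int w)" unfolding f(3,4) by (rule iter_mod_form[OF form_i[OF f(2)]])
    ultimately show ?thesis by (rule conjI)
  next
    case (omega l)
    have "w > 0" using omega(2) by simp
    moreover have "g \<in> mod_forms_i \<Gamma> (int w)" unfolding omega(2,3) by (rule iter_mod_form[OF omega_form])
    ultimately show ?thesis by (rule conjI)
  qed
  then show "w > 0" "g \<in> mod_forms_i \<Gamma> (int w)" by simp_all
qed

lemma finite_Rg: "finite Rg"
  unfolding R_gens_def by (intro finite_UnI finite_image_set2 finite_image_set) simp_all

lemma Rg_carrier: "snd ` Rg \<subseteq> carrier (fun_ring (Om \<Gamma>))"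
proof
  fix g assume "g \<in> snd ` Rg"
  then obtain w where "(w, g) \<in> Rg" by force
  then show "g \<in> carrier (fun_ring (Om \<Gamma>))" using Rg_mod_form(2) by (simp add: fun_ring_simps mod_forms_i_iff)
qed

lemma gens_carrier_Om: "snd ` gens \<subseteq> carrier (fun_ring (Om \<Gamma>))"
  using Rg_carrier phi_props(1) by (auto simp: fun_ring_simps)

lemma one_mod_form: "restr (Om \<Gamma>) (\<lambda>_. 1) \<in> mod_forms_i \<Gamma> (int 0)"
proof -
  have "restr (Om \<Gamma>) (\<lambda>_. 1) \<in> mero_i \<Gamma>" by (rule mero_iI) auto
  moreover have "restr (Om \<Gamma>) (\<lambda>_. 1) (moeb A z) = restr (Om \<Gamma>) (\<lambda>_. 1) z" if "A \<in> G" "z \<in> Om \<Gamma>" for A z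
    using moeb_Om[OF that] that by (simp add: restr_def)
  ultimately show ?thesis by (simp add: mod_forms_i_def flip: G_def)
qed

lemma monom_mod_form: "(k, m) \<in> wt_monom (Om \<Gamma>) Rg \<Longrightarrow> m \<in> mod_forms_i \<Gamma> (int k)"
proof (induction rule: wt_monom.induct)
  case one
  then show ?case unfolding fun_ring_simps by (rule one_mod_form)
next
  case (mult w g k m)
  show ?case unfolding fun_ring_simps by (rule mod_forms_i_mult[OF Rg_mod_form(2)[OF mult(1)] mult(3)])
qed

lemma monom_pole:
  obtains C :: nat where "\<forall>k m. (k, m) \<in> wt_monom (Om \<Gamma>) Rg \<longrightarrow> pole_le (C * k) m"
proof -
  have "\<forall>x\<in>Rg. \<exists>n. pole_le n (snd x)"
  proof
    fix x assume "x \<in> Rg"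
    then have "(fst x, snd x) \<in> Rg" by simp
    then show "\<exists>n. pole_le n (snd x)" by (rule pole_le_exists[OF Rg_mod_form(2)])
  qed
  from bchoice[OF this] obtain \<nu> where \<nu>: "\<forall>x\<in>Rg. pole_le (\<nu> x) (snd x)" by auto
  define C where "C = (\<Sum>x\<in>Rg. \<nu> x)"
  have gen: "pole_le (C * w) g" if wg: "(w, g) \<in> Rg" for w g
  proof -
    have "\<nu> (w, g) \<le> C" unfolding C_def using wg finite_Rg by (intro member_le_sum) auto
    also have "C \<le> C * w" using Rg_mod_form(1)[OF wg] by simp
    finally have "\<nu> (w, g) \<le> C * w" .
    moreover have "pole_le (\<nu> (w, g)) g" using bspec[OF \<nu> wg] by simp
    ultimately show ?thesis by (rule pole_le_mono[rotated])
  qed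
  have "pole_le (C * k) m" if "(k, m) \<in> wt_monom (Om \<Gamma>) Rg" for k m
    using that
  proof (induction rule: wt_monom.induct)
    case one
    show ?case unfolding fun_ring_simps pole_le_def
      by (rule exI[of _ "\<lambda>_. 1"]) (use rad(2) in \<open>auto simp: restr_def\<close>)
  next
    case (mult w g k m)
    show ?case unfolding fun_ring_simps add_mult_distrib2 by (rule pole_le_mult[OF gen[OF mult(1)] mult(3)])
  qed
  then show thesis by (intro that) blast
qed

lemma monom_split:
  assumes "(k, g) \<in> wt_monom (Om \<Gamma>) gens"
  shows "\<exists>j l m. (l, m) \<in> wt_monom (Om \<Gamma>) Rg \<and> k = 2 * j + l \<and> g = \<phi> ^ j * m"
  using assms
proof (induction rule: wt_monom.induct)
  case one
  have "restr (Om \<Gamma>) (\<lambda>_. 1) = \<phi> ^ 0 * restr (Om \<Gamma>) (\<lambda>_. 1)" by (simp only: power_0 mult_1_left)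
  then show ?case using wt_monom.one[of "Om \<Gamma>" Rg] unfolding fun_ring_simps by (metis add_0 mult_0_right)
next
  case (mult w g k m)
  obtain j l m' where IH: "(l, m') \<in> wt_monom (Om \<Gamma>) Rg" "k = 2 * j + l" "m = \<phi> ^ j * m'" using mult(3) by blast
  show ?case
  proof (cases "(w, g) \<in> Rg")
    case True
    have "g * m = \<phi> ^ j * (g * m')" unfolding IH(3) by (rule mult.left_commute)
    moreover have "(w + l, g * m') \<in> wt_monom (Om \<Gamma>) Rg" using wt_monom.mult[OF True IH(1)] by (simp only: fun_ring_simps)
    moreover have "w + k = 2 * j + (w + l)" using IH(2) by simp
    ultimately show ?thesis unfolding fun_ring_simps by blast
  next
    case False
    then have wg: "w = 2" "g = \<phi>" using mult(1) by auto
    have "g * m = \<phi> ^ Suc j * m'" unfolding IH(3) wg(2) by (simp only: power_Suc mult.assoc)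
    moreover have "w + k = 2 * Suc j + l" using IH(2) wg by simp
    ultimately show ?thesis using IH(1) unfolding fun_ring_simps by blast
  qed
qed

text \<open>A monomial is a power \<open>\<phi>\<^sup>j\<close> times a monomial in the generators of \<open>R\<close>.  The latter are modular
  forms whose pole order at \<open>\<i>\<close> is at most a multiple of their weight, because all generators have positive
  weight; for each of the \<open>O(k)\<close> values of \<open>j\<close> they span a space of dimension \<open>O(k)\<close>.\<close>

lemma Rt_bound:
  obtains C :: nat where "\<forall>k. \<exists>B. finite B \<and> card B \<le> C * (k + 1)\<^sup>2 \<and> Rt k \<subseteq> fvs.span B"
proof -
  obtain C1 :: nat where C1: "\<forall>k m. (k, m) \<in> wt_monom (Om \<Gamma>) Rg \<longrightarrow> pole_le (C1 * k) m" by (rule monom_pole)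
  obtain C2 :: nat where C2: "\<forall>k n. \<exists>B. finite B \<and> card B \<le> n + C2 * k + 1 \<and> {g \<in> mod_forms_i \<Gamma> (int k). pole_le n g} \<subseteq> fvs.span B"
    by (rule mod_forms_i_dim)
  define C where "C = C1 + C2 + 1"
  have main: "\<exists>B. finite B \<and> card B \<le> C * (k + 1)\<^sup>2 \<and> Rt k \<subseteq> fvs.span B" for k
  proof -
    have "\<forall>l. \<exists>B. finite B \<and> card B \<le> C1 * l + C2 * l + 1 \<and> {g \<in> mod_forms_i \<Gamma> (int l). pole_le (C1 * l) g} \<subseteq> fvs.span B"
      using C2 by blast
    then obtain b where b: "\<forall>l. finite (b l) \<and> card (b l) \<le> C1 * l + C2 * l + 1 \<and>
        {g \<in> mod_forms_i \<Gamma> (int l). pole_le (C1 * l) g} \<subseteq> fvs.span (b l)"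
      unfolding choice_iff ..
    define B where "B = (\<Union>j\<in>{..k}. (\<lambda>x. \<phi> ^ j * x) ` b (k - 2 * j))"
    have "finite B" unfolding B_def using b by auto
    moreover have "card B \<le> C * (k + 1)\<^sup>2"
    proof -
      have "card B \<le> (\<Sum>j\<in>{..k}. card ((\<lambda>x. \<phi> ^ j * x) ` b (k - 2 * j)))" unfolding B_def by (rule card_UN_le) simp
      also have "\<dots> \<le> (\<Sum>j\<in>{..k}. C * (k + 1))"
      proof (rule sum_mono)
        fix j
        have "card ((\<lambda>x. \<phi> ^ j * x) ` b (k - 2 * j)) \<le> card (b (k - 2 * j))" by (rule card_image_le) (use b in simp)
        also have "\<dots> \<le> C1 * (k - 2 * j) + C2 * (k - 2 * j) + 1" using b by simp
        also have "\<dots> \<le> C1 * (k + 1) + C2 * (k + 1) + (k + 1)" by (intro add_mono mult_le_mono2) auto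
        also have "\<dots> = C * (k + 1)" by (simp add: C_def algebra_simps)
        finally show "card ((\<lambda>x. \<phi> ^ j * x) ` b (k - 2 * j)) \<le> C * (k + 1)" .
      qed
      also have "\<dots> = C * (k + 1)\<^sup>2" by (simp add: power2_eq_square algebra_simps)
      finally show ?thesis .
    qed
    moreover have "Rt k \<subseteq> fvs.span B" unfolding Rt_wt_def
    proof (rule fvs.span_minimal[OF _ fvs.subspace_span], rule subsetI)
      fix g assume "g \<in> {g. (k, g) \<in> wt_monom (Om \<Gamma>) gens}"
      then obtain j l m where m: "(l, m) \<in> wt_monom (Om \<Gamma>) Rg" "k = 2 * j + l" "g = \<phi> ^ j * m"
        using monom_split by blast
      have "m \<in> {g \<in> mod_forms_i \<Gamma> (int l). pole_le (C1 * l) g}" using monom_mod_form[OF m(1)] C1 m(1) by simp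
      then have mb: "m \<in> fvs.span (b l)" by (rule subsetD[OF b[rule_format, THEN conjunct2, THEN conjunct2]])
      have pj: "\<phi> ^ j \<in> fvs.span {\<phi> ^ j}" by (rule fvs.span_base) simp
      have "\<phi> ^ j * m \<in> fvs.span B"
      proof (rule span_times[OF pj mb])
        fix x y assume x: "x \<in> {\<phi> ^ j}" and y: "y \<in> b l"
        have l: "l = k - 2 * j" and "j \<in> {..k}" using m(2) by simp_all
        then have "\<phi> ^ j * y \<in> B" unfolding B_def by (intro UN_I[of j] imageI) (use y l in \<open>simp_all only:\<close>)
        then show "x * y \<in> fvs.span B" using x by (intro fvs.span_base) (simp only: singleton_iff)
      qed
      then show "g \<in> fvs.span B" unfolding m(3) .
    qed
    ultimately show ?thesis by (intro exI[of _ B] conjI)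
  qed
  show thesis by (rule that, rule allI, rule main)
qed

lemma Rt_odd:
  assumes k: "odd k" shows "Rt k \<subseteq> fvs.span {}"
  unfolding Rt_wt_def
proof (rule fvs.span_minimal[OF _ fvs.subspace_span], rule subsetI)
  fix g assume "g \<in> {g. (k, g) \<in> wt_monom (Om \<Gamma>) gens}"
  then obtain j l m where m: "(l, m) \<in> wt_monom (Om \<Gamma>) Rg" "k = 2 * j + l" "g = \<phi> ^ j * m"
    using monom_split by blast
  have "odd l" using k m(2) by simp
  then have "m = 0" by (rule odd_weight_zero[OF monom_mod_form[OF m(1)]])
  then have "g = 0" unfolding m(3) by (simp only: mult_zero_right)
  then show "g \<in> fvs.span {}" by (simp only: fvs.span_zero)
qed

section \<open>The ring contains the quasimodular forms\<close>

lemma Rt_subspace: "fvs.subspace (Rt k)"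
  unfolding Rt_wt_def by (rule fvs.subspace_span)

lemma Rt_monom: "(k, g) \<in> wt_monom (Om \<Gamma>) gens \<Longrightarrow> g \<in> Rt k"
  unfolding Rt_wt_def by (rule fvs.span_base) simp

lemma Rt_gen: "(k, g) \<in> gens \<Longrightarrow> g \<in> Rt k"
  by (rule Rt_monom[OF wt_monom_incl[OF _ gens_carrier_Om]])

lemma Rt_mult:
  assumes "a \<in> Rt k" "b \<in> Rt l" shows "a * b \<in> Rt (k + l)"
  using assms unfolding Rt_wt_def
proof (rule span_times)
  fix x y assume "x \<in> {g. (k, g) \<in> wt_monom (Om \<Gamma>) gens}" "y \<in> {g. (l, g) \<in> wt_monom (Om \<Gamma>) gens}"
  then have "(k + l, x * y) \<in> wt_monom (Om \<Gamma>) gens" using wt_monom_mult[OF _ _ gens_carrier_Om] by simp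
  then show "x * y \<in> fvs.span {g. (k + l, g) \<in> wt_monom (Om \<Gamma>) gens}" by (intro fvs.span_base) (rule CollectI)
qed

lemma Rt_one: "restr (Om \<Gamma>) (\<lambda>_. 1) \<in> Rt 0"
  using Rt_monom[OF wt_monom.one] by (simp only: fun_ring_simps)

text \<open>Modulo \<open>I\<^sup>2\<close> every modular form is a combination of the \<open>f m\<close>, and the elements of \<open>I\<^sup>2\<close> are
  combinations of products of forms of smaller weight.  The components of the wrong weight drop out.\<close>

lemma mod_forms_Rt: "F \<in> mod_forms \<Gamma> w \<Longrightarrow> restr (Om \<Gamma>) F \<in> Rt w"
proof (induction w arbitrary: F rule: less_induct)
  case (less w)
  note F = less.prems
  show ?case
  proof (cases "w = 0")
    case True
    have "\<exists>c. \<forall>z. Im z > 0 \<longrightarrow> F z = c"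
      by (rule nonpositive_weight(1)[of F 0]) (use F True in \<open>auto simp: mod_forms_iff\<close>)
    then obtain c where c: "\<forall>z. Im z > 0 \<longrightarrow> F z = c" by auto
    have "restr (Om \<Gamma>) F = fscale c (restr (Om \<Gamma>) (\<lambda>_. 1))" using c Om_pos by (auto simp: restr_def fscale_def fun_eq_iff)
    then show ?thesis using fvs.subspace_scale[OF Rt_subspace Rt_one] True by (simp only:)
  next
    case False
    let ?I = "pos_ideal \<Gamma>"
    define Y where "Y k = {f m | m. m \<in> {1..d} \<and> wt m = k} \<union>
      {a * b | a b p q. p > 0 \<and> q > 0 \<and> p + q = k \<and> a \<in> mod_forms \<Gamma> p \<and> b \<in> mod_forms \<Gamma> q}" for k
    have Yf: "f m \<in> Y (wt m)" if "m \<in> {1..d}" for m unfolding Y_def using that by blast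
    have Yab: "a * b \<in> Y (p + q)" if "p > 0" "q > 0" "a \<in> mod_forms \<Gamma> p" "b \<in> mod_forms \<Gamma> q" for a b p q
      unfolding Y_def using that by blast
    have YM: "y \<in> mod_forms \<Gamma> k" if "y \<in> Y k" for y k
      using that unfolding Y_def
    proof
      assume "y \<in> {f m | m. m \<in> {1..d} \<and> wt m = k}"
      then show ?thesis using forms by blast
    next
      assume "y \<in> {a * b | a b p q. p > 0 \<and> q > 0 \<and> p + q = k \<and> a \<in> mod_forms \<Gamma> p \<and> b \<in> mod_forms \<Gamma> q}"
      then show ?thesis using mod_forms_mult by blast
    qed
    have prods: "s \<in> fvs.span (\<Union>k. Y k)" if "s \<in> ideal_prod (fun_ring uhp) ?I ?I" for s
      using that
    proof (induction rule: ideal_prod.induct)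
      case (prod i j)
      have "i * j \<in> fvs.span (\<Union>k. Y k)"
      proof (rule span_times[OF prod[unfolded pos_ideal_def]])
        fix x y assume "x \<in> (\<Union>k\<in>{1..}. mod_forms \<Gamma> k)" "y \<in> (\<Union>k\<in>{1..}. mod_forms \<Gamma> k)"
        then obtain p q where "1 \<le> p" "x \<in> mod_forms \<Gamma> p" "1 \<le> q" "y \<in> mod_forms \<Gamma> q" by auto
        then have "x * y \<in> Y (p + q)" by (intro Yab) auto
        then show "x * y \<in> fvs.span (\<Union>k. Y k)" by (intro fvs.span_base UN_I[OF UNIV_I])
      qed
      then show ?case by (simp only: fun_ring_simps)
    next
      case (sum s1 s2)
      have "s1 + s2 \<in> fvs.span (\<Union>k. Y k)" by (rule fvs.span_add[OF sum(3,4)])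
      then show ?case by (simp only: fun_ring_simps)
    qed
    have "F \<in> ?I" unfolding pos_ideal_def
      by (rule fvs.span_base, rule UN_I[of w]) (use F False in auto)
    then obtain c where c: "F - (\<Sum>m=1..d. fscale (c m) (f m)) \<in> ideal_prod (fun_ring uhp) ?I ?I"
      using basis unfolding quotient_basis_def by blast
    have "(\<Sum>m=1..d. fscale (c m) (f m)) \<in> fvs.span (\<Union>k. Y k)"
      by (rule fvs.span_sum, rule fvs.span_scale, rule fvs.span_base, rule UN_I[where B = Y, OF UNIV_I Yf])
    from fvs.span_add[OF prods[OF c] this] have "F \<in> fvs.span (\<Union>k. Y k)" by (simp only: diff_add_cancel)
    then have FY: "F \<in> fvs.span (Y w)"
    proof (rule span_weight[rotated -1])
      show "\<forall>k. \<forall>b\<in>Y k. (\<forall>z. z \<notin> uhp \<longrightarrow> b z = 0) \<and> (\<forall>A\<in>G. \<forall>z\<in>uhp. b (moeb A z) = autj A z ^ k * b z)"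
        using YM by (simp add: mod_forms_iff)
    qed (use F in \<open>simp_all add: mod_forms_iff\<close>)
    show ?thesis
    proof (rule restr_span[OF _ Rt_subspace FY])
      fix y assume "y \<in> Y w"
      then consider m where "m \<in> {1..d}" "wt m = w" "y = f m"
        | a b p q where "p > 0" "q > 0" "p + q = w" "a \<in> mod_forms \<Gamma> p" "b \<in> mod_forms \<Gamma> q" "y = a * b"
        unfolding Y_def by blast
      then show "restr (Om \<Gamma>) y \<in> Rt w"
      proof cases
        case (1 m)
        have "(w, restr (Om \<Gamma>) y) \<in> gens" using Rg_f[OF _ 1(1), of 0] 1(2,3) by simp
        then show ?thesis by (rule Rt_gen)
      next
        case (2 a b p q)
        have "restr (Om \<Gamma>) a \<in> Rt p" "restr (Om \<Gamma>) b \<in> Rt q" by (rule less.IH; use 2 in simp)+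
        then have "restr (Om \<Gamma>) a * restr (Om \<Gamma>) b \<in> Rt (p + q)" by (rule Rt_mult)
        then show ?thesis unfolding 2(6) 2(3) restr_times .
      qed
    qed
  qed
qed

definition dO :: "(complex \<Rightarrow> complex) \<Rightarrow> complex \<Rightarrow> complex" where "dO g = restr (Om \<Gamma>) (deriv g)"

text \<open>By definition of \<open>D\<^sub>\<phi>\<close> the derivative of the \<open>j\<close>-th iterate is the next iterate plus a multiple of
  \<open>\<phi>\<close> times the iterate.  For \<open>j = N\<close> the next iterate is no generator, but lies in \<open>R\<close>, which is
  closed under \<open>D\<^sub>\<phi>\<close>, and in its graded piece of the right weight.\<close>

lemma dO_iter:
  assumes h: "h \<in> mod_forms_i \<Gamma> (int w)" and mem: "\<And>j. j \<le> N \<Longrightarrow> (w + 2 * j, Dphi_iter \<Gamma> \<phi> w j h) \<in> Rg" and j: "j \<le> N"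
  shows "dO (Dphi_iter \<Gamma> \<phi> w j h) \<in> Rt (w + 2 * j + 2)"
proof -
  let ?x = "Dphi_iter \<Gamma> \<phi> w j h" and ?y = "Dphi_iter \<Gamma> \<phi> w (Suc j) h"
  have y: "?y \<in> Rt (w + 2 * Suc j)"
  proof (cases "j < N")
    case True
    then have "(w + 2 * Suc j, ?y) \<in> Rg" by (intro mem) simp
    then show ?thesis by (intro Rt_gen insertI2)
  next
    case False
    let ?Y = "\<lambda>k. {g. (k, g) \<in> wt_monom (Om \<Gamma>) Rg}"
    have x: "?x \<in> mod_forms_i \<Gamma> (int (w + 2 * j))" by (rule iter_mod_form[OF h])
    have "?x \<in> snd ` Rg" using imageI[OF mem[OF j], of snd] by (simp only: snd_conv)
    then have "?x \<in> R_ring \<Gamma> \<phi> N d wt f" unfolding R_ring_def by (rule subsetD[OF gen_alg_closed(4)[OF Rg_carrier]])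
    then have "Dphi \<Gamma> \<phi> (int (w + 2 * j)) ?x \<in> R_ring \<Gamma> \<phi> N d wt f"
      using closed[unfolded closed_Dphi_def, rule_format, of "{int (w + 2 * j)}" "\<lambda>_. ?x"] x by simp
    then have "?y \<in> fvs.span (snd ` wt_monom (Om \<Gamma>) Rg)"
      unfolding R_ring_def Dphi_iter.simps by (rule subsetD[OF gen_alg_span[OF Rg_carrier]])
    moreover have "snd ` wt_monom (Om \<Gamma>) Rg = (\<Union>k. ?Y k)" by force
    ultimately have "?y \<in> fvs.span (\<Union>k. ?Y k)" by (simp only:)
    then have "?y \<in> fvs.span (?Y (w + 2 * Suc j))"
    proof (rule span_weight[rotated -1])
      show "\<forall>k. \<forall>b\<in>?Y k. (\<forall>z. z \<notin> Om \<Gamma> \<longrightarrow> b z = 0) \<and> (\<forall>A\<in>G. \<forall>z\<in>Om \<Gamma>. b (moeb A z) = autj A z ^ k * b z)"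
      proof (intro allI ballI)
        fix k b assume "b \<in> ?Y k"
        then have "b \<in> mod_forms_i \<Gamma> (int k)" using monom_mod_form by simp
        then show "(\<forall>z. z \<notin> Om \<Gamma> \<longrightarrow> b z = 0) \<and> (\<forall>A\<in>G. \<forall>z\<in>Om \<Gamma>. b (moeb A z) = autj A z ^ k * b z)"
          by (simp add: mod_forms_i_iff)
      qed
      have y: "?y \<in> mod_forms_i \<Gamma> (int (w + 2 * Suc j))" by (rule iter_mod_form[OF h])
      show "\<forall>z. z \<notin> Om \<Gamma> \<longrightarrow> ?y z = 0" using y unfolding mod_forms_i_iff by blast
      show "\<forall>A\<in>G. \<forall>z\<in>Om \<Gamma>. ?y (moeb A z) = autj A z ^ (w + 2 * Suc j) * ?y z" using mod_forms_i_trans[OF y] by blast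
    qed (rule Om_subset)
    moreover have "fvs.span (?Y (w + 2 * Suc j)) \<subseteq> Rt (w + 2 * Suc j)"
      unfolding Rt_wt_def by (rule fvs.span_mono) (use wt_monom_mono in blast)
    ultimately show ?thesis by blast
  qed
  have "(2 + (w + 2 * j)) = w + 2 * Suc j" by simp
  moreover have "\<phi> * ?x \<in> Rt (2 + (w + 2 * j))"
    by (intro Rt_mult Rt_gen insertI1 insertI2 mem[OF j])
  ultimately have px: "\<phi> * ?x \<in> Rt (w + 2 * Suc j)" by (simp only:)
  have "dO ?x = ?y + fscale (of_int (int (w + 2 * j))) (\<phi> * ?x)"
  proof
    fix z show "dO ?x z = (?y + fscale (of_int (int (w + 2 * j))) (\<phi> * ?x)) z"
      using phi_props(1)[of z] by (cases "z \<in> Om \<Gamma>") (simp_all add: dO_def Dphi_def restr_def fscale_def)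
  qed
  moreover have "?y + fscale (of_int (int (w + 2 * j))) (\<phi> * ?x) \<in> Rt (w + 2 * Suc j)"
    by (rule fvs.subspace_add[OF Rt_subspace y fvs.subspace_scale[OF Rt_subspace px]])
  moreover have "w + 2 * Suc j = w + 2 * j + 2" by simp
  ultimately show ?thesis by (simp only:)
qed

lemma dO_gen:
  assumes "(w, g) \<in> gens" shows "dO g \<in> Rt (w + 2)"
proof (cases "(w, g) \<in> Rg")
  case True
  then show ?thesis
  proof (cases rule: Rg_cases)
    case (f j m)
    show ?thesis unfolding f(3,4) by (rule dO_iter[OF form_i[OF f(2)] Rg_f[OF _ f(2)] f(1)])
  next
    case (omega l)
    show ?thesis unfolding omega(2,3) by (rule dO_iter[OF omega_form Rg_omega omega(1)])
  qed
next
  case False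
  then have wg: "w = 2" "g = \<phi>" using assms by auto
  have "omega \<Gamma> \<phi> \<in> Rt 4" using Rt_gen[OF insertI2[OF Rg_omega[of 0]]] by simp
  moreover have "\<phi> * \<phi> \<in> Rt (2 + 2)" by (intro Rt_mult Rt_gen insertI1)
  then have "\<phi> * \<phi> \<in> Rt 4" by (simp only: numeral_plus_numeral add_num_simps)
  ultimately have "omega \<Gamma> \<phi> + \<phi> * \<phi> \<in> Rt 4" by (rule fvs.subspace_add[OF Rt_subspace])
  moreover have "dO \<phi> = omega \<Gamma> \<phi> + \<phi> * \<phi>"
    using phi_props(1) by (auto simp: dO_def omega_def restr_def fun_eq_iff power2_eq_square)
  moreover have "(2::nat) + 2 = 4" by simp
  ultimately show ?thesis unfolding wg by (simp only:)
qed

lemma gens_holomorphic: "(w, g) \<in> gens \<Longrightarrow> g holomorphic_on Om \<Gamma>"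
  using phi_props(2) Rg_mod_form(2) by (auto simp: mod_forms_i_iff)

lemma dO_monom: "(k, g) \<in> wt_monom (Om \<Gamma>) gens \<Longrightarrow> g holomorphic_on Om \<Gamma> \<and> dO g \<in> Rt (k + 2)"
proof (induction rule: wt_monom.induct)
  case one
  have "dO (restr (Om \<Gamma>) (\<lambda>_. 1)) = 0" by (auto simp: dO_def restr_def[of _ "deriv _"] fun_eq_iff deriv_restr)
  then have "dO (restr (Om \<Gamma>) (\<lambda>_. 1)) \<in> Rt (0 + 2)" using fvs.subspace_0[OF Rt_subspace] by (simp only:)
  moreover have "restr (Om \<Gamma>) (\<lambda>_. 1) holomorphic_on Om \<Gamma>" using one_mod_form by (simp add: mod_forms_i_iff)
  ultimately show ?case unfolding fun_ring_simps by (intro conjI)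
next
  case (mult w g k m)
  have g: "g holomorphic_on Om \<Gamma>" by (rule gens_holomorphic[OF mult(1)])
  have m: "m holomorphic_on Om \<Gamma>" "dO m \<in> Rt (k + 2)" using mult(3) by simp_all
  have "(g * m) holomorphic_on Om \<Gamma>" unfolding times_fun_def by (intro holomorphic_intros g m)
  moreover have "dO (g * m) = dO g * m + g * dO m"
  proof
    fix z
    show "dO (g * m) z = (dO g * m + g * dO m) z"
    proof (cases "z \<in> Om \<Gamma>")
      case True
      have "g field_differentiable at z" "m field_differentiable at z"
        using holomorphic_on_imp_differentiable_at[OF _ open_Om True] g m by auto
      then have "deriv (\<lambda>w. g w * m w) z = g z * deriv m z + deriv g z * m z" by (rule deriv_mult)
      then show ?thesis using True by (simp add: dO_def restr_def times_fun_def)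
    qed (simp add: dO_def restr_def)
  qed
  moreover have "dO g * m + g * dO m \<in> Rt (w + k + 2)"
  proof (rule fvs.subspace_add[OF Rt_subspace])
    have "w + 2 + k = w + k + 2" "w + (k + 2) = w + k + 2" by simp_all
    moreover have "dO g * m \<in> Rt (w + 2 + k)" by (rule Rt_mult[OF dO_gen[OF mult(1)] Rt_monom[OF mult(2)]])
    moreover have "g * dO m \<in> Rt (w + (k + 2))" by (rule Rt_mult[OF Rt_gen[OF mult(1)] m(2)])
    ultimately show "dO g * m \<in> Rt (w + k + 2)" "g * dO m \<in> Rt (w + k + 2)" by (simp_all only:)
  qed
  ultimately show ?case unfolding fun_ring_simps by (simp only: simp_thms)
qed

lemma dO_Rt:
  assumes "g \<in> Rt k" shows "g holomorphic_on Om \<Gamma> \<and> dO g \<in> Rt (k + 2)"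
  using assms unfolding Rt_wt_def[of _ _ _ _ _ _ k]
proof (induction rule: fvs.span_induct_alt)
  case base
  have "dO 0 = 0" by (simp add: dO_def restr_def fun_eq_iff zero_fun_def)
  then have "dO 0 \<in> Rt (k + 2)" using fvs.subspace_0[OF Rt_subspace] by (simp only:)
  moreover have "(0 :: complex \<Rightarrow> complex) holomorphic_on Om \<Gamma>" unfolding zero_fun_def by (rule holomorphic_on_const)
  ultimately show ?case by (intro conjI)
next
  case (step c x y)
  have x: "x holomorphic_on Om \<Gamma>" "dO x \<in> Rt (k + 2)" using dO_monom step(1) by simp_all
  have y: "y holomorphic_on Om \<Gamma>" "dO y \<in> Rt (k + 2)" using step(2) by simp_all
  have "(\<lambda>z. c * x z + y z) holomorphic_on Om \<Gamma>" by (intro holomorphic_intros x y)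
  then have "(fscale c x + y) holomorphic_on Om \<Gamma>" by (simp add: fscale_def plus_fun_def)
  moreover have "dO (fscale c x + y) = fscale c (dO x) + dO y"
  proof
    fix z
    show "dO (fscale c x + y) z = (fscale c (dO x) + dO y) z"
    proof (cases "z \<in> Om \<Gamma>")
      case True
      have "(x has_field_derivative deriv x z) (at z)" "(y has_field_derivative deriv y z) (at z)"
        using holomorphic_derivI[OF _ open_Om True] x y by auto
      then have "((\<lambda>z. c * x z + y z) has_field_derivative c * deriv x z + deriv y z) (at z)"
        by (intro DERIV_add DERIV_cmult)
      then have "deriv (\<lambda>z. c * x z + y z) z = c * deriv x z + deriv y z" by (rule DERIV_imp_deriv)
      then show ?thesis using True by (simp add: dO_def restr_def fscale_def plus_fun_def)
    qed (simp add: dO_def restr_def fscale_def)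
  qed
  moreover have "fscale c (dO x) + dO y \<in> Rt (k + 2)"
    by (rule fvs.subspace_add[OF Rt_subspace fvs.subspace_scale[OF Rt_subspace x(2)] y(2)])
  ultimately show ?case by (simp only: simp_thms)
qed

lemma iter_Rt:
  assumes g: "g \<in> mod_forms \<Gamma> w" shows "restr (Om \<Gamma>) ((du ^^ n) g) \<in> Rt (w + 2 * n)"
proof (induction n)
  case (Suc n)
  have "restr (Om \<Gamma>) ((du ^^ Suc n) g) = dO (restr (Om \<Gamma>) ((du ^^ n) g))"
  proof
    fix z
    show "restr (Om \<Gamma>) ((du ^^ Suc n) g) z = dO (restr (Om \<Gamma>) ((du ^^ n) g)) z"
    proof (cases "z \<in> Om \<Gamma>")
      case True
      have "restr (Om \<Gamma>) ((du ^^ Suc n) g) z = du ((du ^^ n) g) z" using True by (simp add: restr_def)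
      also have "\<dots> = deriv ((du ^^ n) g) z" using Om_pos[OF True] by (simp add: du_def restr_def)
      also have "\<dots> = deriv (restr (Om \<Gamma>) ((du ^^ n) g)) z" by (rule deriv_restr[OF True, symmetric])
      also have "\<dots> = dO (restr (Om \<Gamma>) ((du ^^ n) g)) z"
        using True unfolding dO_def restr_def[of "Om \<Gamma>" "deriv (restr (Om \<Gamma>) ((du ^^ n) g))"] by simp
      finally show ?thesis .
    qed (simp add: dO_def restr_def)
  qed
  moreover have "dO (restr (Om \<Gamma>) ((du ^^ n) g)) \<in> Rt (w + 2 * n + 2)" using dO_Rt[OF Suc] by (rule conjunct2)
  moreover have "w + 2 * n + 2 = w + 2 * Suc n" by simp
  ultimately show ?case by (simp only:)
qed (use mod_forms_Rt[OF g] in simp)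

lemma quasi_forms_Rt:
  assumes x: "x \<in> quasi_forms \<Gamma> k" shows "restr (Om \<Gamma>) x \<in> Rt k"
proof -
  obtain Q p where Q: "qrep k x Q" "\<forall>z. Im z > 0 \<longrightarrow> degree (Q z) \<le> p" using x by (auto simp: quasi_forms_iff)
  have x': "x holomorphic_on uhp" "\<forall>z. \<not> Im z > 0 \<longrightarrow> x z = 0" using x by (simp_all add: quasi_forms_iff)
  have xs: "x \<in> fvs.span {(du ^^ n) g | n g w. g \<in> mod_forms \<Gamma> w \<and> w + 2 * n = k}"
    by (rule quasi_form_decomposition[OF Q(1) x'(1), of p]) (use Q(2) x'(2) in simp_all)
  show ?thesis
  proof (rule restr_span[OF _ Rt_subspace xs])
    fix y assume "y \<in> {(du ^^ n) g | n g w. g \<in> mod_forms \<Gamma> w \<and> w + 2 * n = k}"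
    then obtain n g w where "y = (du ^^ n) g" "g \<in> mod_forms \<Gamma> w" "w + 2 * n = k" by auto
    then show "restr (Om \<Gamma>) y \<in> Rt k" using iter_Rt[of g w n] by simp
  qed
qed

section \<open>The three rings\<close>

lemma R_ring_carrier: "R_ring \<Gamma> \<phi> N d wt f \<subseteq> carrier (fun_ring (Om \<Gamma>))"
  unfolding R_ring_def by (rule gen_alg_closed(5)[OF Rg_carrier])

lemma Rt_ring_eq: "Rt_ring \<Gamma> \<phi> N d wt f = gen_alg (Om \<Gamma>) (snd ` gens)"
proof
  interpret ring "fun_ring (Om \<Gamma>)" by (rule ring_fun_ring)
  let ?E = "gen_alg (Om \<Gamma>) (snd ` gens)" and ?R = "R_ring \<Gamma> \<phi> N d wt f"
  note E = gen_alg_closed[OF gens_carrier_Om]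
  have H: "?R \<union> {\<phi>} \<subseteq> carrier (fun_ring (Om \<Gamma>))" using R_ring_carrier gens_carrier_Om by auto
  show "Rt_ring \<Gamma> \<phi> N d wt f \<subseteq> ?E"
    unfolding Rt_ring_def
  proof (rule generate_ring_min_subring1[OF H])
    show "subring ?E (fun_ring (Om \<Gamma>))"
      unfolding gen_alg_def by (rule generate_ring_is_subring[OF gens_carrier[OF gens_carrier_Om]])
    have "snd ` Rg \<subseteq> ?E" by (rule order_trans[OF _ E(4)]) auto
    then have "?R \<subseteq> ?E" unfolding R_ring_def
      by (rule gen_alg_subset[OF Rg_carrier _ E(1) E(3) E(2)])
    moreover have "\<phi> \<in> ?E" by (rule subsetD[OF E(4)]) simp
    ultimately show "?R \<union> {\<phi>} \<subseteq> ?E" by simp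
  qed
  show "?E \<subseteq> Rt_ring \<Gamma> \<phi> N d wt f"
    unfolding gen_alg_def
  proof (rule generate_ring_min_subring1[OF gens_carrier[OF gens_carrier_Om]])
    show "subring (Rt_ring \<Gamma> \<phi> N d wt f) (fun_ring (Om \<Gamma>))"
      unfolding Rt_ring_def by (rule generate_ring_is_subring[OF H])
    have inc: "?R \<union> {\<phi>} \<subseteq> Rt_ring \<Gamma> \<phi> N d wt f" unfolding Rt_ring_def by (rule subsetI, rule generate_ring.incl)
    have "restr (Om \<Gamma>) (\<lambda>_. c) \<in> ?R" for c unfolding R_ring_def by (rule gen_alg_closed(3)[OF Rg_carrier])
    moreover have "snd ` Rg \<subseteq> ?R" unfolding R_ring_def by (rule gen_alg_closed(4)[OF Rg_carrier])
    ultimately have "range (\<lambda>c. restr (Om \<Gamma>) (\<lambda>_. c)) \<union> snd ` gens \<subseteq> ?R \<union> {\<phi>}" by auto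
    then show "range (\<lambda>c. restr (Om \<Gamma>) (\<lambda>_. c)) \<union> snd ` gens \<subseteq> Rt_ring \<Gamma> \<phi> N d wt f"
      using inc by (rule order_trans)
  qed
qed

lemma Rt_ring_fin_gen: "fin_gen_alg (Om \<Gamma>) (Rt_ring \<Gamma> \<phi> N d wt f)"
  unfolding fin_gen_alg_def Rt_ring_eq
  by (intro exI[of _ "snd ` gens"] conjI gens_carrier_Om refl finite_imageI) (simp add: finite_Rg)

lemma Rt_sub_ring: "Rt k \<subseteq> Rt_ring \<Gamma> \<phi> N d wt f"
  unfolding Rt_ring_eq Rt_wt_def
proof (rule fvs.span_minimal[OF _ gen_alg_closed(1)[OF gens_carrier_Om]], rule subsetI)
  note E = gen_alg_closed[OF gens_carrier_Om]
  fix g assume "g \<in> {g. (k, g) \<in> wt_monom (Om \<Gamma>) gens}"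
  then have "(k, g) \<in> wt_monom (Om \<Gamma>) gens" by simp
  then show "g \<in> gen_alg (Om \<Gamma>) (snd ` gens)"
  proof (induction rule: wt_monom.induct)
    case one
    then show ?case unfolding fun_ring_simps by (rule E(3))
  next
    case (mult w g k m)
    have "g \<in> snd ` gens" using imageI[OF mult(1), of snd] by (simp only: snd_conv)
    then show ?case unfolding fun_ring_simps by (intro E(2) subsetD[OF E(4)] mult(3))
  qed
qed

lemma quasi_ring_subring:
  "subring (restr (Om \<Gamma>) ` quasi_ring \<Gamma>) ((fun_ring (Om \<Gamma>))\<lparr>carrier := Rt_ring \<Gamma> \<phi> N d wt f\<rparr>)" (is "subring ?Q ?R")
proof -
  let ?E = "Rt_ring \<Gamma> \<phi> N d wt f"
  note E = gen_alg_closed[OF gens_carrier_Om, folded Rt_ring_eq]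
  interpret F: ring "fun_ring (Om \<Gamma>)" by (rule ring_fun_ring)
  have "ring ?R"
    unfolding Rt_ring_eq gen_alg_def by (rule F.generate_ring_is_ring[OF gens_carrier[OF gens_carrier_Om]])
  then interpret R: ring ?R .
  have ops: "carrier ?R = ?E" "\<And>x y. x \<otimes>\<^bsub>?R\<^esub> y = x * y" "\<And>x y. x \<oplus>\<^bsub>?R\<^esub> y = x + y"
    "\<one>\<^bsub>?R\<^esub> = restr (Om \<Gamma>) (\<lambda>_. 1)" "\<zero>\<^bsub>?R\<^esub> = 0"
    by (simp_all add: fun_ring_def restr_def)
  have QE: "restr (Om \<Gamma>) x \<in> ?E" if "x \<in> quasi_ring \<Gamma>" for x
  proof (rule restr_span[OF _ E(1) that[unfolded quasi_ring_def]])
    fix y assume "y \<in> (\<Union>k. quasi_forms \<Gamma> k)"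
    then obtain k where "y \<in> quasi_forms \<Gamma> k" by auto
    then show "restr (Om \<Gamma>) y \<in> ?E" by (rule subsetD[OF Rt_sub_ring quasi_forms_Rt])
  qed
  have sub: "fvs.subspace (quasi_ring \<Gamma>)" unfolding quasi_ring_def by (rule fvs.subspace_span)
  have mult: "x * y \<in> quasi_ring \<Gamma>" if "x \<in> quasi_ring \<Gamma>" "y \<in> quasi_ring \<Gamma>" for x y
    using that unfolding quasi_ring_def
  proof (rule span_times)
    fix a b assume "a \<in> (\<Union>k. quasi_forms \<Gamma> k)" "b \<in> (\<Union>k. quasi_forms \<Gamma> k)"
    then obtain k p l q where "a \<in> quasi_forms_depth \<Gamma> k p" "b \<in> quasi_forms_depth \<Gamma> l q"
      by (auto simp: quasi_forms_def)
    then have "a * b \<in> quasi_forms_depth \<Gamma> (k + l) (p + q)" by (rule quasi_depth_mult)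
    then have "a * b \<in> (\<Union>k. quasi_forms \<Gamma> k)" unfolding quasi_forms_def by (intro UN_I[OF UNIV_I])
    then show "a * b \<in> fvs.span (\<Union>k. quasi_forms \<Gamma> k)" by (rule fvs.span_base)
  qed
  have scale: "fscale c (restr (Om \<Gamma>) x) = restr (Om \<Gamma>) (fscale c x)" for c x
    by (simp add: fscale_def restr_def fun_eq_iff)
  show ?thesis
  proof (rule R.subringI)
    show "?Q \<subseteq> carrier ?R" unfolding ops by (rule image_subsetI, rule QE)
    have q1: "restr uhp (\<lambda>_. 1) \<in> quasi_ring \<Gamma>"
      unfolding quasi_ring_def quasi_forms_def
      by (rule fvs.span_base, rule UN_I[OF UNIV_I], rule UN_I[OF UNIV_I], rule quasi_one)
    have eq: "restr (Om \<Gamma>) (restr uhp (\<lambda>_. 1)) = restr (Om \<Gamma>) (\<lambda>_. 1)"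
      using Om_pos by (auto simp: restr_def fun_eq_iff)
    show "\<one>\<^bsub>?R\<^esub> \<in> ?Q" using imageI[OF q1, of "restr (Om \<Gamma>)"] unfolding ops eq .
    show "\<ominus>\<^bsub>?R\<^esub> h \<in> ?Q" if h: "h \<in> ?Q" for h
    proof -
      obtain x where x2: "h = restr (Om \<Gamma>) x" and x1: "x \<in> quasi_ring \<Gamma>" using h by (rule imageE)
      note x = x1 x2
      have hE: "h \<in> ?E" unfolding x(2) by (rule QE[OF x(1)])
      have "\<ominus>\<^bsub>?R\<^esub> h = fscale (-1) h"
      proof (rule R.minus_equality)
        show "fscale (-1) h \<oplus>\<^bsub>?R\<^esub> h = \<zero>\<^bsub>?R\<^esub>" unfolding ops by (simp add: fscale_def fun_eq_iff)
        show "h \<in> carrier ?R" unfolding ops by (rule hE)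
        show "fscale (-1) h \<in> carrier ?R" unfolding ops by (rule fvs.subspace_scale[OF E(1) hE])
      qed
      then show ?thesis unfolding x(2) scale using fvs.subspace_scale[OF sub x(1)] by (simp only: imageI)
    qed
    fix h1 h2 assume "h1 \<in> ?Q" "h2 \<in> ?Q"
    note h12 = this
    obtain x where x2: "h1 = restr (Om \<Gamma>) x" and x1: "x \<in> quasi_ring \<Gamma>" using h12(1) by (rule imageE)
    obtain y where y2: "h2 = restr (Om \<Gamma>) y" and y1: "y \<in> quasi_ring \<Gamma>" using h12(2) by (rule imageE)
    note x = x1 x2 and y = y1 y2
    have "restr (Om \<Gamma>) x + restr (Om \<Gamma>) y = restr (Om \<Gamma>) (x + y)" by (simp add: restr_def fun_eq_iff)
    then show "h1 \<oplus>\<^bsub>?R\<^esub> h2 \<in> ?Q" unfolding ops x(2) y(2) using fvs.subspace_add[OF sub x(1) y(1)] by (simp only: imageI)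
    show "h1 \<otimes>\<^bsub>?R\<^esub> h2 \<in> ?Q" unfolding ops x(2) y(2) restr_times[symmetric] using mult[OF x(1) y(1)] by (rule imageI)
  qed
qed

text \<open>Restriction to the complement of the orbit of \<open>\<i>\<close> is injective on holomorphic functions.\<close>

lemma quasi_dim_le:
  shows "\<exists>B. finite B \<and> quasi_forms \<Gamma> k \<subseteq> fvs.span B" "fvs.dim (quasi_forms \<Gamma> k) \<le> fvs.dim (Rt k)"
proof -
  obtain C :: nat where C: "\<forall>k. \<exists>B. finite B \<and> card B \<le> C * (k + 1)\<^sup>2 \<and> Rt k \<subseteq> fvs.span B" by (rule Rt_bound)
  obtain B where B: "finite B" "Rt k \<subseteq> fvs.span B" using C by blast
  obtain b where b: "b \<subseteq> quasi_forms \<Gamma> k" "fvs.independent b" "quasi_forms \<Gamma> k \<subseteq> fvs.span b"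
    "card b = fvs.dim (quasi_forms \<Gamma> k)"
    by (rule fvs.basis_exists)
  have le: "card I \<le> fvs.dim (Rt k)" if I: "finite I" "I \<subseteq> b" for I
  proof (rule card_le_dim[OF I(1) _ B(2,1), of "restr (Om \<Gamma>)"])
    show "restr (Om \<Gamma>) i \<in> Rt k" if "i \<in> I" for i by (rule quasi_forms_Rt) (use that I(2) b(1) in blast)
    fix x assume 0: "(\<Sum>i\<in>I. fscale (x i) (restr (Om \<Gamma>) i)) = 0"
    have "(\<Sum>i\<in>I. fscale (x i) i) \<in> quasi_forms \<Gamma> k"
      by (intro fvs.subspace_sum[OF quasi_forms_subspace] fvs.subspace_scale[OF quasi_forms_subspace]) (use I(2) b(1) in blast)
    then have s: "(\<Sum>i\<in>I. fscale (x i) i) holomorphic_on uhp" "\<forall>z. \<not> Im z > 0 \<longrightarrow> (\<Sum>i\<in>I. fscale (x i) i) z = 0"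
      unfolding quasi_forms_iff by blast+
    have "restr (Om \<Gamma>) (\<Sum>i\<in>I. fscale (x i) i) = (\<Sum>i\<in>I. fscale (x i) (restr (Om \<Gamma>) i))"
      by (rule ext) (simp add: restr_def sum_fun_apply fscale_def)
    then have r0: "restr (Om \<Gamma>) (\<Sum>i\<in>I. fscale (x i) i) = 0" using 0 by (simp only:)
    have z: "(\<Sum>i\<in>I. fscale (x i) i) = 0"
    proof (rule restr_inj[OF s(1) _ r0])
      show "(\<Sum>i\<in>I. fscale (x i) i) z = 0" if "\<not> Im z > 0" for z
        by (rule s(2)[rule_format, OF that])
    qed
    show "\<forall>i\<in>I. x i = 0"
    proof
      fix i assume "i \<in> I"
      then show "x i = 0" using fvs.independentD[OF b(2) I z] by simp
    qed
  qed
  have "finite b"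
  proof (rule ccontr)
    assume "infinite b"
    from infinite_arbitrarily_large[OF this, of "Suc (fvs.dim (Rt k))"]
    obtain I where I: "finite I \<and> card I = Suc (fvs.dim (Rt k)) \<and> I \<subseteq> b" ..
    have "card I \<le> fvs.dim (Rt k)" by (rule le) (use I in simp_all)
    then show False using I by simp
  qed
  then show "\<exists>B. finite B \<and> quasi_forms \<Gamma> k \<subseteq> fvs.span B" using b(3) by blast
  show "fvs.dim (quasi_forms \<Gamma> k) \<le> fvs.dim (Rt k)" using le[OF \<open>finite b\<close> order_refl] b(4) by simp
qed

lemma dim_growth:
  shows "(\<lambda>k. real (fvs.dim (Rt k))) \<in> O(\<lambda>k. real k ^ 2)"
    "(\<lambda>k. real (fvs.dim (Rt k))) \<in> \<Theta>(\<lambda>k. real (fvs.dim (quasi_forms \<Gamma> k)))"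
proof -
  obtain C :: nat where C: "\<forall>k. \<exists>B. finite B \<and> card B \<le> C * (k + 1)\<^sup>2 \<and> Rt k \<subseteq> fvs.span B" by (rule Rt_bound)
  obtain c :: real and \<kappa>0 :: nat where c: "c > 0" and low: "\<forall>\<kappa>\<ge>\<kappa>0. \<forall>B. finite B \<longrightarrow> quasi_forms \<Gamma> (2 * \<kappa>) \<subseteq> fvs.span B \<longrightarrow>
      c * real \<kappa> ^ 2 \<le> real (fvs.dim (quasi_forms \<Gamma> (2 * \<kappa>)))"
    by (rule quasi_dim_lower)
  have up: "real (fvs.dim (Rt k)) \<le> 4 * real C * real k ^ 2" if k: "k \<ge> 1" for k
  proof -
    obtain B where B: "finite B" "card B \<le> C * (k + 1)\<^sup>2" "Rt k \<subseteq> fvs.span B" using C by blast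
    have "fvs.dim (Rt k) \<le> C * (k + 1)\<^sup>2" using fvs.dim_le_card[OF B(3,1)] B(2) by (rule order_trans)
    also have "\<dots> \<le> C * (2 * k)\<^sup>2" using k by (intro mult_le_mono2 power_mono) auto
    finally have "real (fvs.dim (Rt k)) \<le> real (C * (2 * k)\<^sup>2)" by (rule of_nat_mono)
    also have "real (C * (2 * k)\<^sup>2) = 4 * real C * real k ^ 2" by (simp add: power_mult_distrib)
    finally show ?thesis .
  qed
  show "(\<lambda>k. real (fvs.dim (Rt k))) \<in> O(\<lambda>k. real k ^ 2)"
  proof (rule bigoI[of _ "4 * real C"])
    show "\<forall>\<^sub>F k in at_top. norm (real (fvs.dim (Rt k))) \<le> 4 * real C * norm (real k ^ 2)"
      using eventually_ge_at_top[of 1] by (rule eventually_mono) (use up in simp)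
  qed
  show "(\<lambda>k. real (fvs.dim (Rt k))) \<in> \<Theta>(\<lambda>k. real (fvs.dim (quasi_forms \<Gamma> k)))"
  proof (rule bigthetaI'[of 1 "16 * real C / c + 1"])
    show "16 * real C / c + 1 > 0" using c by (intro add_nonneg_pos divide_nonneg_pos) auto
    show "\<forall>\<^sub>F k in at_top. 1 * norm (real (fvs.dim (quasi_forms \<Gamma> k))) \<le> norm (real (fvs.dim (Rt k))) \<and>
        norm (real (fvs.dim (Rt k))) \<le> (16 * real C / c + 1) * norm (real (fvs.dim (quasi_forms \<Gamma> k)))"
      using eventually_ge_at_top[of "2 * \<kappa>0 + 1"]
    proof (rule eventually_mono)
      fix k :: nat assume k: "k \<ge> 2 * \<kappa>0 + 1"
      have "real (fvs.dim (Rt k)) \<le> (16 * real C / c + 1) * real (fvs.dim (quasi_forms \<Gamma> k))"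
      proof (cases "even k")
        case True
        then obtain \<kappa> where \<kappa>: "k = 2 * \<kappa>" by (rule evenE)
        obtain B where B: "finite B" "quasi_forms \<Gamma> k \<subseteq> fvs.span B" using quasi_dim_le(1) by blast
        have "\<kappa>0 \<le> \<kappa>" using k \<kappa> by simp
        then have l: "c * real \<kappa> ^ 2 \<le> real (fvs.dim (quasi_forms \<Gamma> k))" using low B unfolding \<kappa> by blast
        have "real (fvs.dim (Rt k)) \<le> 4 * real C * real k ^ 2" using up k by simp
        also have "\<dots> = 16 * real C / c * (c * real \<kappa> ^ 2)" using c by (simp add: \<kappa> power_mult_distrib)
        also have "\<dots> \<le> 16 * real C / c * real (fvs.dim (quasi_forms \<Gamma> k))" using l c by (intro mult_left_mono) auto
        also have "\<dots> \<le> (16 * real C / c + 1) * real (fvs.dim (quasi_forms \<Gamma> k))" by (intro mult_right_mono) auto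
        finally show ?thesis .
      next
        case False
        have "fvs.dim (Rt k) \<le> card ({} :: (complex \<Rightarrow> complex) set)" by (rule fvs.dim_le_card[OF Rt_odd[OF False]]) simp
        then have "fvs.dim (Rt k) = 0" by simp
        moreover have "0 \<le> (16 * real C / c + 1) * real (fvs.dim (quasi_forms \<Gamma> k))"
          using c by (intro mult_nonneg_nonneg add_nonneg_nonneg divide_nonneg_pos) auto
        ultimately show ?thesis by simp
      qed
      then show "1 * norm (real (fvs.dim (quasi_forms \<Gamma> k))) \<le> norm (real (fvs.dim (Rt k))) \<and>
          norm (real (fvs.dim (Rt k))) \<le> (16 * real C / c + 1) * norm (real (fvs.dim (quasi_forms \<Gamma> k)))"
        using quasi_dim_le(2)[of k] by simp
    qed
  qed simp
qed

lemma Rt_fin_dim: "fin_dim (Rt k)"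
proof -
  obtain C :: nat where C: "\<forall>k. \<exists>B. finite B \<and> card B \<le> C * (k + 1)\<^sup>2 \<and> Rt k \<subseteq> fvs.span B" by (rule Rt_bound)
  obtain B where B: "finite B" "Rt k \<subseteq> fvs.span B" using C by blast
  have "{g. (k, g) \<in> wt_monom (Om \<Gamma>) gens} \<subseteq> fvs.span B" using Rt_monom B(2) by blast
  then show ?thesis unfolding Rt_wt_def using B(1) by (rule fin_dim_span)
qed

end

theorem mainTheorem11:
  fixes \<Gamma> :: "(real^2^2) set set"
    and \<phi> :: "complex \<Rightarrow> complex"
    and d N :: nat
    and wt :: "nat \<Rightarrow> nat"
    and f :: "nat \<Rightarrow> complex \<Rightarrow> complex"
  assumes "discrete_cocompact \<Gamma>"
    and "\<phi> \<in> quasi_forms2_i_delta1 \<Gamma>"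
    and "\<And>m. m \<in> {1..d} \<Longrightarrow> wt m > 0 \<and> f m \<in> mod_forms \<Gamma> (wt m)"
    and "quotient_basis (pos_ideal \<Gamma>) (ideal_prod (fun_ring uhp) (pos_ideal \<Gamma>) (pos_ideal \<Gamma>)) d f"
    and "N \<ge> 1"
    and "closed_Dphi \<Gamma> \<phi> (R_ring \<Gamma> \<phi> N d wt f)"
  shows "(\<forall>k. fin_dim (Rt_wt \<Gamma> \<phi> N d wt f k)) \<and>
    (\<lambda>k. real (fvs.dim (Rt_wt \<Gamma> \<phi> N d wt f k))) \<in> O(\<lambda>k. real k ^ 2) \<and>
    fin_gen_alg (Om \<Gamma>) (Rt_ring \<Gamma> \<phi> N d wt f) \<and>
    subring (restr (Om \<Gamma>) ` quasi_ring \<Gamma>) ((fun_ring (Om \<Gamma>))\<lparr>carrier := Rt_ring \<Gamma> \<phi> N d wt f\<rparr>) \<and>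
    (\<forall>k. restr (Om \<Gamma>) ` quasi_forms \<Gamma> k \<subseteq> Rt_wt \<Gamma> \<phi> N d wt f k) \<and>
    \<not> fin_gen_alg uhp (quasi_ring \<Gamma>) \<and>
    (\<lambda>k. real (fvs.dim (Rt_wt \<Gamma> \<phi> N d wt f k))) \<in> \<Theta>(\<lambda>k. real (fvs.dim (quasi_forms \<Gamma> k)))"
proof -
  interpret phi_ring \<Gamma> \<phi> d N wt f
    by (intro phi_ring.intro cocompact_group.intro phi_ring_axioms.intro) (use assms in blast)+
  show ?thesis
  proof (intro conjI allI)
    show "fin_dim (Rt_wt \<Gamma> \<phi> N d wt f k)" for k by (rule Rt_fin_dim)
    show "restr (Om \<Gamma>) ` quasi_forms \<Gamma> k \<subseteq> Rt_wt \<Gamma> \<phi> N d wt f k" for k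
      by (rule image_subsetI) (rule quasi_forms_Rt)
  qed (rule dim_growth Rt_ring_fin_gen quasi_ring_subring quasi_ring_not_fin_gen)+
qed

end
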